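(* There exists a randomized algorithm with the following guarantee. Let $\beta>0$, $\alpha>0$, and let $\pi_1,\ldots,\pi_r$ be rankings of $n$ elements generated independently from Mallows' model with parameter $\beta$ and (unknown) center $\pi^*$. Given $\pi_1,\ldots,\pi_r$, the algorithm computes a maximum probability order $\pi^m$, i.e. a permutation minimizing $\sum_{k=1}^r d_K(\pi_k,\pi^m)$, in time $$T(n)=O\left(n^{1+O\left(\frac{\alpha}{\beta r}\right)}\cdot 2^{O\left(\frac{\alpha}{\beta}+\frac{1}{\beta^2}\right)}\cdot \log^2 n\right),$$ with error probability $<n^{-\alpha}$. In particular, the running time tends to almost linear as $r$ grows.
   Context: For permutations $\pi,\sigma$ of $n$ elements, the Kemeny distance is $d_K(\pi,\sigma)=\#\{(i,j): \sigma(i)<\sigma(j)\text{ and }\pi(i)>\pi(j)\}$. In Mallows' model with parameter $\beta>0$ and center $\pi^*$, a random permutation $\pi$ has probability $\P[\pi\mid\pi^*]=\frac{1}{Z(\beta)}e^{-\beta d_K(\pi,\pi^* )}$, where $Z(\beta)$ is a normalizing constant. A maximum probability (maximum likelihood) order given independent samples $\pi_1,\dots,\pi_r$ is a permutation $\pi^m$ maximizing $\prod_{k=1}^r \P[\pi_k\mid \pi^m]$, equivalently minimizing $\sum_{k=1}^r d_K(\pi_k,\pi^m)$. *)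

theory Defs
  imports "HOL-Probability.Probability" "HOL-Library.Landau_Symbols"
begin

section \<open>Mallows' model\<close>

text \<open>
  The elements are \<open>0, \<dots>, n - 1\<close>, and a ranking is a function \<open>p\<close> with \<open>p permutes {..<n}\<close>,
  where \<open>p i\<close> is the position of element \<open>i\<close>.
\<close>

definition kemeny_dist :: "nat \<Rightarrow> (nat \<Rightarrow> nat) \<Rightarrow> (nat \<Rightarrow> nat) \<Rightarrow> nat" where
  "kemeny_dist n p q = card {(i, j). i < n \<and> j < n \<and> q i < q j \<and> p i > p j}"

definition mallows_Z :: "nat \<Rightarrow> real \<Rightarrow> (nat \<Rightarrow> nat) \<Rightarrow> real" where
  "mallows_Z n \<beta> c = (\<Sum>p | p permutes {..<n}. exp (- \<beta> * real (kemeny_dist n p c)))"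

definition mallows :: "nat \<Rightarrow> real \<Rightarrow> (nat \<Rightarrow> nat) \<Rightarrow> (nat \<Rightarrow> nat) pmf" where
  "mallows n \<beta> c = embed_pmf (\<lambda>p. if p permutes {..<n}
     then exp (- \<beta> * real (kemeny_dist n p c)) / mallows_Z n \<beta> c else 0)"

definition is_max_prob_order ::
  "nat \<Rightarrow> real \<Rightarrow> (nat \<Rightarrow> nat) list \<Rightarrow> (nat \<Rightarrow> nat) \<Rightarrow> bool" where
  "is_max_prob_order n \<beta> ps m \<longleftrightarrow> m permutes {..<n} \<and>
     (\<forall>q. q permutes {..<n} \<longrightarrow>
        (\<Prod>p\<leftarrow>ps. pmf (mallows n \<beta> q) p) \<le> (\<Prod>p\<leftarrow>ps. pmf (mallows n \<beta> m) p))"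

text \<open>
  The normalizing constant does not depend on the centre, and maximizing the likelihood is the
  same as minimizing the total Kemeny distance.
\<close>

lemma mallows_Z_pos: "mallows_Z n \<beta> c > 0"
proof -
  have "(0::real) < exp (- \<beta> * real (kemeny_dist n id c))" by simp
  also have "\<dots> \<le> mallows_Z n \<beta> c"
    unfolding mallows_Z_def
    by (rule member_le_sum[of id]) (simp_all add: permutes_id finite_permutations del: id_apply)
  finally show ?thesis .
qed

lemma pmf_mallows:
  "pmf (mallows n \<beta> c) p = (if p permutes {..<n}
     then exp (- \<beta> * real (kemeny_dist n p c)) / mallows_Z n \<beta> c else 0)"
proof -
  define f where "f = (\<lambda>p. if p permutes {..<n}
     then exp (- \<beta> * real (kemeny_dist n p c)) / mallows_Z n \<beta> c else 0)"
  have nonneg: "f p \<ge> 0" for p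
    using mallows_Z_pos[of n \<beta> c] by (simp add: f_def less_imp_le)
  have fin: "finite {p. p permutes {..<n}}" by (simp add: finite_permutations)
  have "(\<Sum>p | p permutes {..<n}. f p) = (\<Sum>p | p permutes {..<n}.
      exp (- \<beta> * real (kemeny_dist n p c)) / mallows_Z n \<beta> c)"
    by (rule sum.cong) (auto simp: f_def)
  also have "\<dots> = mallows_Z n \<beta> c / mallows_Z n \<beta> c"
    by (simp add: sum_divide_distrib[symmetric] mallows_Z_def)
  also have "\<dots> = 1" using mallows_Z_pos[of n \<beta> c] by simp
  finally have s1: "(\<Sum>p | p permutes {..<n}. f p) = 1" .
  have "(\<integral>\<^sup>+ p. ennreal (f p) \<partial>count_space UNIV) =
      (\<integral>\<^sup>+ p. ennreal (f p) \<partial>count_space {p. p permutes {..<n}})"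
    by (subst nn_integral_count_space_indicator)
       (auto intro!: nn_integral_cong simp: f_def indicator_def)
  also have "\<dots> = (\<Sum>p | p permutes {..<n}. ennreal (f p))"
    by (rule nn_integral_count_space_finite[OF fin])
  also have "\<dots> = 1" using nonneg s1 by (simp add: sum_ennreal)
  finally have "pmf (embed_pmf f) p = f p" using nonneg by (intro pmf_embed_pmf) auto
  then show ?thesis by (simp add: f_def mallows_def)
qed

lemma kemeny_dist_comp:
  assumes s: "s permutes {..<n}"
  shows "kemeny_dist n (p \<circ> s) (q \<circ> s) = kemeny_dist n p q"
proof -
  let ?A = "{(i, j). i < n \<and> j < n \<and> q (s i) < q (s j) \<and> p (s i) > p (s j)}"
  let ?B = "{(i, j). i < n \<and> j < n \<and> q i < q j \<and> p i > p j}"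
  have lt: "s i < n \<longleftrightarrow> i < n" for i using permutes_in_image[OF s, of i] by simp
  have "bij_betw (map_prod s s) ?A ?B"
  proof (rule bij_betw_imageI)
    show "inj_on (map_prod s s) ?A"
      using permutes_inj[OF s] by (auto simp: inj_on_def)
    show "map_prod s s ` ?A = ?B"
    proof (intro equalityI subsetI)
      fix x assume "x \<in> ?B"
      then obtain i j where x: "x = (i, j)" "i < n" "j < n" "q i < q j" "p i > p j" by auto
      obtain i' j' where "i = s i'" "j = s j'" using permutes_surj[OF s] by (meson surjD)
      with x lt show "x \<in> map_prod s s ` ?A"
        by (intro image_eqI[of _ _ "(i', j')"]) auto
    qed (use lt in auto)
  qed
  then show ?thesis unfolding kemeny_dist_def comp_def by (rule bij_betw_same_card)
qed

lemma mallows_Z_center: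
  assumes c: "c permutes {..<n}"
  shows "mallows_Z n \<beta> c = mallows_Z n \<beta> id"
proof -
  have "mallows_Z n \<beta> c =
      (\<Sum>p | p permutes {..<n}. exp (- \<beta> * real (kemeny_dist n (p \<circ> c) c)))"
    unfolding mallows_Z_def by (rule sum_permutations_compose_right[OF c])
  also have "\<dots> = (\<Sum>p | p permutes {..<n}. exp (- \<beta> * real (kemeny_dist n p id)))"
  proof (rule sum.cong)
    fix p
    show "exp (- \<beta> * real (kemeny_dist n (p \<circ> c) c)) = exp (- \<beta> * real (kemeny_dist n p id))"
      using kemeny_dist_comp[OF c, of p id] by simp
  qed simp
  finally show ?thesis by (simp add: mallows_Z_def)
qed

lemma is_max_prob_order_iff:
  assumes \<beta>: "\<beta> > 0" and ps: "\<And>p. p \<in> set ps \<Longrightarrow> p permutes {..<n}"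
  shows "is_max_prob_order n \<beta> ps m \<longleftrightarrow> m permutes {..<n} \<and>
     (\<forall>q. q permutes {..<n} \<longrightarrow>
        (\<Sum>p\<leftarrow>ps. kemeny_dist n p m) \<le> (\<Sum>p\<leftarrow>ps. kemeny_dist n p q))"
proof -
  define Z where "Z = mallows_Z n \<beta> id"
  have Z: "Z > 0" unfolding Z_def by (rule mallows_Z_pos)
  have lik: "(\<Prod>p\<leftarrow>ps. pmf (mallows n \<beta> q) p) =
      exp (- \<beta> * real (\<Sum>p\<leftarrow>ps. kemeny_dist n p q)) / Z ^ length ps"
    if q: "q permutes {..<n}" for q
    using ps
  proof (induction ps)
    case Nil
    then show ?case by simp
  next
    case (Cons p ps)
    have "pmf (mallows n \<beta> q) p = exp (- \<beta> * real (kemeny_dist n p q)) / Z"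
      using Cons.prems by (simp add: pmf_mallows mallows_Z_center[OF q] Z_def)
    moreover have "(\<Prod>p\<leftarrow>ps. pmf (mallows n \<beta> q) p) =
        exp (- \<beta> * real (\<Sum>p\<leftarrow>ps. kemeny_dist n p q)) / Z ^ length ps"
      using Cons by simp
    ultimately show ?case
      by (simp add: ring_distribs exp_diff exp_minus field_class.field_divide_inverse)
  qed
  have "(\<Prod>p\<leftarrow>ps. pmf (mallows n \<beta> q) p) \<le> (\<Prod>p\<leftarrow>ps. pmf (mallows n \<beta> m) p) \<longleftrightarrow>
      (\<Sum>p\<leftarrow>ps. kemeny_dist n p m) \<le> (\<Sum>p\<leftarrow>ps. kemeny_dist n p q)"
    if "q permutes {..<n}" "m permutes {..<n}" for q
    unfolding lik[OF that(1)] lik[OF that(2)]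
    using Z \<beta> by (simp add: divide_le_cancel)
  then show ?thesis unfolding is_max_prob_order_def by blast
qed


section \<open>Randomized random access machines\<close>

text \<open>
  The machine is the uniform-cost random access machine of Cook and Reckhow, with addition and
  truncated subtraction as its only arithmetic operations, extended by fair coin flips. Its memory
  is a map from addresses to natural numbers; the operands of an instruction are addresses.
  The input lies in a separate read-only store, which is read one word per step, so that an
  algorithm need not look at the whole input.
\<close>

datatype input_source = Num_Elements | Num_Samples | Ranking | Alpha | Beta

type_synonym input = "input_source \<Rightarrow> nat \<Rightarrow> nat \<Rightarrow> nat"

datatype instr =
    Const nat nat  \<comment> \<open>\<open>M[d] := k\<close>\<close>
  | Add nat nat nat  \<comment> \<open>\<open>M[d] := M[a] + M[b]\<close>\<close>
  | Sub nat nat nat  \<comment> \<open>\<open>M[d] := M[a] - M[b]\<close>\<close>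
  | Load nat nat  \<comment> \<open>\<open>M[d] := M[M[a]]\<close>\<close>
  | Store nat nat  \<comment> \<open>\<open>M[M[a]] := M[b]\<close>\<close>
  | Read nat input_source nat nat  \<comment> \<open>\<open>M[d] := src(M[a], M[b])\<close>\<close>
  | Flip nat  \<comment> \<open>\<open>M[d] := 0\<close> or \<open>1\<close>, each with probability \<open>1/2\<close>\<close>
  | Jump_If_Zero nat nat  \<comment> \<open>goto \<open>l\<close> if \<open>M[a] = 0\<close>\<close>

type_synonym program = "instr list"

type_synonym config = "nat \<times> (nat \<Rightarrow> nat)"

definition halted :: "program \<Rightarrow> config \<Rightarrow> bool" where
  "halted P c \<longleftrightarrow> fst c \<ge> length P"

fun exec_instr :: "input \<Rightarrow> instr \<Rightarrow> config \<Rightarrow> config pmf" where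
  "exec_instr inp (Const d k) (pc, M) = return_pmf (Suc pc, M(d := k))"
| "exec_instr inp (Add d a b) (pc, M) = return_pmf (Suc pc, M(d := M a + M b))"
| "exec_instr inp (Sub d a b) (pc, M) = return_pmf (Suc pc, M(d := M a - M b))"
| "exec_instr inp (Load d a) (pc, M) = return_pmf (Suc pc, M(d := M (M a)))"
| "exec_instr inp (Store a b) (pc, M) = return_pmf (Suc pc, M(M a := M b))"
| "exec_instr inp (Read d src a b) (pc, M) = return_pmf (Suc pc, M(d := inp src (M a) (M b)))"
| "exec_instr inp (Flip d) (pc, M) =
     map_pmf (\<lambda>b. (Suc pc, M(d := of_bool b))) (bernoulli_pmf (1 / 2))"
| "exec_instr inp (Jump_If_Zero a l) (pc, M) = return_pmf (if M a = 0 then l else Suc pc, M)"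

definition step :: "program \<Rightarrow> input \<Rightarrow> config \<Rightarrow> config pmf" where
  "step P inp c = (if halted P c then return_pmf c else exec_instr inp (P ! fst c) c)"

primrec run_from :: "program \<Rightarrow> input \<Rightarrow> nat \<Rightarrow> config \<Rightarrow> config pmf" where
  "run_from P inp 0 c = return_pmf c"
| "run_from P inp (Suc t) c = step P inp c \<bind> run_from P inp t"

definition run :: "program \<Rightarrow> input \<Rightarrow> nat \<Rightarrow> config pmf" where
  "run P inp t = run_from P inp t (0, \<lambda>_. 0)"

definition halts_within :: "program \<Rightarrow> input \<Rightarrow> nat \<Rightarrow> bool" where
  "halts_within P inp t \<longleftrightarrow> (\<forall>c \<in> set_pmf (run P inp t). halted P c)"


section \<open>Input, output and error probability\<close>

text \<open>
  A real parameter is given as an infinite sequence of words: its integer part, followed by the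
  binary digits of its fractional part.
\<close>

definition real_word :: "real \<Rightarrow> nat \<Rightarrow> nat" where
  "real_word x i = (if i = 0 then nat \<lfloor>x\<rfloor> else nat \<lfloor>2 ^ i * x\<rfloor> mod 2)"

definition problem_input ::
  "real \<Rightarrow> real \<Rightarrow> nat \<Rightarrow> (nat \<Rightarrow> nat) list \<Rightarrow> input" where
  "problem_input \<alpha> \<beta> n ps src i j = (case src of
      Num_Elements \<Rightarrow> n
    | Num_Samples \<Rightarrow> length ps
    | Ranking \<Rightarrow> (if i < length ps \<and> j < n then (ps ! i) j else 0)
    | Alpha \<Rightarrow> real_word \<alpha> i
    | Beta \<Rightarrow> real_word \<beta> i)"

definition output_order :: "nat \<Rightarrow> config \<Rightarrow> nat \<Rightarrow> nat" where
  "output_order n c i = (if i < n then snd c i else i)"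

text \<open>The probability below is over both the samples and the coin flips of the algorithm.\<close>

definition error_prob ::
  "program \<Rightarrow> real \<Rightarrow> real \<Rightarrow> nat \<Rightarrow> nat \<Rightarrow> (nat \<Rightarrow> nat) \<Rightarrow> nat \<Rightarrow> real" where
  "error_prob P \<alpha> \<beta> n r center t = measure_pmf.prob
     (do {ps \<leftarrow> replicate_pmf r (mallows n \<beta> center);
          c \<leftarrow> run P (problem_input \<alpha> \<beta> n ps) t;
          return_pmf (ps, c)})
     {(ps, c). \<not> (halted P c \<and> is_max_prob_order n \<beta> ps (output_order n c))}"

end

theory Submission
  imports Defs
begin

text \<open>
  Sort the elements by the sum of their positions in the samples (the Borda order), and for the cut
  before rank \<open>q\<close> let \<open>X q\<close> be twice the number of votes against this order across the cut. By an
  exchange argument, the first \<open>p\<close> elements of an optimal order contain all Borda ranks below a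
  number \<open>lo p\<close>, none from a number \<open>up p\<close> on, and miss at most \<open>sqrt (X p / r)\<close> of the first \<open>p\<close>
  ranks. A dynamic program over such prefixes, aborted when its fuel is used up, finds an optimal
  order, and small excesses \<open>X q\<close> keep both the windows and the number of prefixes small.

  Under Mallows' model the number of inversions across a cut has the exponential moment
  \<open>exp (2 / \<beta>)\<close> at \<open>\<beta> / 2\<close>, by the generating function of shuffles. Therefore the \<open>s\<close>-th moment of the
  work per level, where \<open>s\<close> is about \<open>\<beta> r\<close>, is \<open>exp (O (s / \<beta>\<^sup>2))\<close>, and by Markov's inequality fuel
  \<open>n * 2 ^ (Q + O (1 / \<beta>\<^sup>2))\<close> with \<open>Q\<close> about \<open>\<alpha> log n / (\<beta> r)\<close> fails to suffice with probability
  less than \<open>n powr - \<alpha>\<close>. If \<open>r\<close> is large, it is enough to read about \<open>(\<alpha> / \<beta> + 1) log n / \<beta>\<^sup>2\<close> samples: both in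
  them and in the whole sample, each pair is then ordered by a strict majority as in the centre,
  which is the unique optimum for both.
\<close>

section \<open>Compiling first-order list functions into flip-free machine code\<close>

section \<open>Straight-line code and relocatable programs\<close>

text \<open>The exponent of n in the time bound is 1 plus a multiple of \<alpha> / (\<beta> r), with
  nothing that survives \<alpha> -> 0. A union bound over the n cuts would leave \<alpha> + 1 in
  place of \<alpha>. Therefore only the sum of the level costs is controlled: by the power mean
  inequality the s-th power of their average is at most the average of the s-th powers, the number
  of cuts cancels, and Markov's inequality has to beat n^\<alpha> alone.

  The center is unknown, yet the fuel bound requires no closeness of the Borda order to it. Among
  all sets of q elements the first q Borda ranks have the fewest votes against them, so
  \<open>X q\<close> is at most twice the number of inversions across the q-th cut of the center.

  Fuel also turns a typical running time into one valid for every input, as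
  \<open>halts_within\<close> demands. The program never flips a coin; all error comes from the
  samples. Since the bound has no factor r, not even the whole input may be read when r is large.
  The parameter \<beta> is used through its leading nonzero word only, as b / g with b / g <=
  \<beta> < 2 b / g and b = 1 or g = 1.\<close>

fun mem_exec :: "input \<Rightarrow> instr \<Rightarrow> (nat \<Rightarrow> nat) \<Rightarrow> nat \<Rightarrow> nat" where
  "mem_exec inp (Const d k) M = M(d := k)"
| "mem_exec inp (Add d a b) M = M(d := M a + M b)"
| "mem_exec inp (Sub d a b) M = M(d := M a - M b)"
| "mem_exec inp (Load d a) M = M(d := M (M a))"
| "mem_exec inp (Store a b) M = M(M a := M b)"
| "mem_exec inp (Read d src a b) M = M(d := inp src (M a) (M b))"
| "mem_exec inp (Flip d) M = M"
| "mem_exec inp (Jump_If_Zero a l) M = M"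

fun is_jump :: "instr \<Rightarrow> bool" where
  "is_jump (Jump_If_Zero a l) = True"
| "is_jump _ = False"

fun is_flip :: "instr \<Rightarrow> bool" where
  "is_flip (Flip d) = True"
| "is_flip _ = False"

text \<open>A flip falls under the default branch and acts as a no-op, so this function describes
  \<open>step\<close> only for programs without flips.\<close>

definition det_step :: "program \<Rightarrow> input \<Rightarrow> config \<Rightarrow> config" where
  "det_step P inp c = (if halted P c then c else
     (case P ! fst c of
        Jump_If_Zero a l \<Rightarrow> (if snd c a = 0 then l else Suc (fst c), snd c)
      | i \<Rightarrow> (Suc (fst c), mem_exec inp i (snd c))))"

lemma step_det:
  assumes "\<forall>i \<in> set P. \<not> is_flip i"
  shows "step P inp c = return_pmf (det_step P inp c)"
proof (cases "halted P c")
  case True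
  then show ?thesis by (simp add: step_def det_step_def)
next
  case False
  then have "\<not> is_flip (P ! fst c)" using assms by (simp add: halted_def)
  then show ?thesis using False
    by (cases c; cases "P ! fst c") (auto simp: step_def det_step_def)
qed

lemma run_from_det:
  assumes "\<forall>i \<in> set P. \<not> is_flip i"
  shows "run_from P inp t c = return_pmf ((det_step P inp ^^ t) c)"
  by (induction t arbitrary: c)
     (auto simp: step_det[OF assms] bind_return_pmf funpow_swap1)

lemma det_step_halted: "halted P c \<Longrightarrow> (det_step P inp ^^ t) c = c"
  by (induction t) (auto simp: det_step_def)

primrec placed :: "program \<Rightarrow> nat \<Rightarrow> instr list \<Rightarrow> bool" where
  "placed P k [] = True"
| "placed P k (i # is) = (k < length P \<and> P ! k = i \<and> placed P (Suc k) is)"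

lemma placed_append:
  "placed P k (xs @ ys) \<longleftrightarrow> placed P k xs \<and> placed P (k + length xs) ys"
  by (induction xs arbitrary: k) auto

lemma placed_middle: "placed (xs @ ys @ zs) (length xs) ys"
proof (induction ys arbitrary: xs)
  case (Cons a ys)
  from Cons[of "xs @ [a]"] show ?case by (simp add: nth_append)
qed simp

definition runs :: "program \<Rightarrow> input \<Rightarrow> nat \<Rightarrow> config \<Rightarrow> config \<Rightarrow> bool" where
  "runs P inp t c c' \<longleftrightarrow> (det_step P inp ^^ t) c = c'"

lemma runs_0: "runs P inp 0 c c"
  by (simp add: runs_def)

lemma runs_trans:
  assumes "runs P inp s a b" "runs P inp t b c"
  shows "runs P inp (s + t) a c"
proof -
  have "(det_step P inp ^^ (t + s)) a = (det_step P inp ^^ t) ((det_step P inp ^^ s) a)"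
    by (simp add: funpow_add)
  then show ?thesis using assms by (simp add: runs_def add.commute)
qed

lemma runs_straight:
  assumes "placed P k is" "\<forall>i \<in> set is. \<not> is_jump i"
  shows "runs P inp (length is) (k, M) (k + length is, foldl (\<lambda>M i. mem_exec inp i M) M is)"
  using assms
proof (induction "is" arbitrary: k M)
  case Nil
  then show ?case by (simp add: runs_0)
next
  case (Cons i "is")
  have "det_step P inp (k, M) = (Suc k, mem_exec inp i M)"
    using Cons.prems by (cases i) (auto simp: det_step_def halted_def)
  then have "runs P inp 1 (k, M) (Suc k, mem_exec inp i M)" by (simp add: runs_def)
  from runs_trans[OF this Cons.IH] show ?case using Cons.prems by simp
qed

lemma runs_jump:
  assumes "placed P k [Jump_If_Zero a l]"
  shows "runs P inp 1 (k, M) (if M a = 0 then l else Suc k, M)"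
  using assms by (simp add: runs_def det_step_def halted_def)

lemma runs_jump_zero:
  "placed P k [Jump_If_Zero a l] \<Longrightarrow> M a = 0 \<Longrightarrow> runs P inp 1 (k, M) (l, M)"
  using runs_jump[of P k a l inp M] by simp

lemma runs_jump_nonzero:
  "placed P k [Jump_If_Zero a l] \<Longrightarrow> M a \<noteq> 0 \<Longrightarrow> k' = Suc k \<Longrightarrow> runs P inp 1 (k, M) (k', M)"
  using runs_jump[of P k a l inp M] by simp


section \<open>Representation of values in an immutable heap\<close>

text \<open>\<open>w\<close> is the word that stands for \<open>x\<close>, with all cells of
  \<open>x\<close> between \<open>lo\<close> and \<open>hi\<close>. The axiom expresses persistence:
  cells once allocated are never written again, so a value survives every later allocation.\<close>

class rep =
  fixes rep :: "(nat \<Rightarrow> nat) \<Rightarrow> nat \<Rightarrow> nat \<Rightarrow> nat \<Rightarrow> 'a \<Rightarrow> bool"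
  assumes rep_mono: "\<lbrakk>rep M lo hi w x; \<forall>a. lo \<le> a \<and> a < hi \<longrightarrow> M' a = M a; hi \<le> hi'\<rbrakk>
    \<Longrightarrow> rep M' lo hi' w x"

instantiation nat :: rep
begin
definition "rep_nat (M :: nat \<Rightarrow> nat) (lo :: nat) (hi :: nat) (w :: nat) (x :: nat) = (w = x)"
instance by standard (simp add: rep_nat_def)
end

instantiation bool :: rep
begin
definition "rep_bool (M :: nat \<Rightarrow> nat) (lo :: nat) (hi :: nat) (w :: nat) x = ((w \<noteq> 0) = x)"
instance by standard (simp add: rep_bool_def)
end

instantiation prod :: (rep, rep) rep
begin
definition "rep_prod M lo hi w x =
  (lo \<le> w \<and> Suc w < hi \<and> rep M lo hi (M w) (fst x) \<and> rep M lo hi (M (Suc w)) (snd x))"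
instance
proof
  fix M M' :: "nat \<Rightarrow> nat" and lo hi hi' w and x :: "'a \<times> 'b"
  assume "rep M lo hi w x" "\<forall>a. lo \<le> a \<and> a < hi \<longrightarrow> M' a = M a" "hi \<le> hi'"
  then show "rep M' lo hi' w x"
    using rep_mono[of M lo hi "M w" "fst x" M' hi'] rep_mono[of M lo hi "M (Suc w)" "snd x" M' hi']
    by (auto simp: rep_prod_def)
qed
end

text \<open>The empty list is the null word. This is unambiguous because \<open>heap_ok\<close>
  keeps all cells at address 8 or above. A nonempty list has the layout of a pair of head and
  tail.\<close>

instantiation list :: (rep) rep
begin
primrec rep_list where
  "rep_list M lo hi w [] = (w = 0)"
| "rep_list M lo hi w (x # xs) =
    (lo \<le> w \<and> Suc w < hi \<and> rep M lo hi (M w) x \<and> rep_list M lo hi (M (Suc w)) xs)"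
instance
proof
  fix M M' :: "nat \<Rightarrow> nat" and lo hi hi' w and x :: "'a list"
  assume "rep M lo hi w x" "\<forall>a. lo \<le> a \<and> a < hi \<longrightarrow> M' a = M a" "hi \<le> hi'"
  then show "rep M' lo hi' w x"
    by (induction x arbitrary: w) (auto intro: rep_mono)
qed
end

text \<open>
  Registers: 0 holds the argument and the result, 1 the constant one, 2 the heap pointer,
  3 the stack (a list in the heap), 4 to 6 are temporary.
\<close>

definition heap_ok :: "nat \<Rightarrow> (nat \<Rightarrow> nat) \<Rightarrow> bool" where
  "heap_ok lo M \<longleftrightarrow> M 1 = 1 \<and> lo \<le> M 2 \<and> 8 \<le> lo"

definition heap_ext :: "nat \<Rightarrow> (nat \<Rightarrow> nat) \<Rightarrow> (nat \<Rightarrow> nat) \<Rightarrow> bool" where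
  "heap_ext lo M M' \<longleftrightarrow> heap_ok lo M' \<and> M 2 \<le> M' 2 \<and> M' 3 = M 3 \<and>
     (\<forall>a. lo \<le> a \<and> a < M 2 \<longrightarrow> M' a = M a)"

text \<open>Without a nonzero word of \<beta> the search for its leading digit would run
  forever.\<close>

definition valid_input :: "input \<Rightarrow> bool" where
  "valid_input inp \<longleftrightarrow> (\<exists>k. inp Beta k 0 \<noteq> 0)"

text \<open>Jumps are absolute, so code is a function of its start address. A length independent of
  that address lets jump targets be computed before the parts are laid out.\<close>

definition wf_code :: "(nat \<Rightarrow> instr list) \<Rightarrow> bool" where
  "wf_code code \<longleftrightarrow> (\<forall>k. length (code k) = length (code 0) \<and> (\<forall>i \<in> set (code k). \<not> is_flip i))"

definition computes ::
  "(nat \<Rightarrow> instr list) \<Rightarrow> (input \<Rightarrow> 'a::rep \<Rightarrow> 'b::rep) \<Rightarrow> (input \<Rightarrow> 'a \<Rightarrow> nat) \<Rightarrow> bool" where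
  "computes code F c \<longleftrightarrow> (\<forall>P inp k lo M x.
     valid_input inp \<and> placed P k (code k) \<and> heap_ok lo M \<and> rep M lo (M 2) (M 0) x \<longrightarrow>
     (\<exists>t M'. t \<le> c inp x \<and> runs P inp t (k, M) (k + length (code k), M') \<and>
        heap_ext lo M M' \<and> rep M' lo (M' 2) (M' 0) (F inp x)))"

lemma computesD:
  assumes "computes code F c" "valid_input inp" "placed P k (code k)" "heap_ok lo M"
    "rep M lo (M 2) (M 0) x" "length (code k) = m"
  obtains t M' where "t \<le> c inp x" "runs P inp t (k, M) (k + m, M')"
    "heap_ext lo M M'" "rep M' lo (M' 2) (M' 0) (F inp x)"
  using assms unfolding computes_def by blast

text \<open>The constant \<open>K\<close> swallows the instruction counts of all glue code, so
  \<open>c\<close> records only work that depends on the data, and costs compose by plain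
  addition.\<close>

definition tm :: "(input \<Rightarrow> 'a::rep \<Rightarrow> 'b::rep) \<Rightarrow> (input \<Rightarrow> 'a \<Rightarrow> nat) \<Rightarrow> bool" where
  "tm F c \<longleftrightarrow> (\<exists>code K. wf_code code \<and> computes code F (\<lambda>inp x. K * (1 + c inp x)))"

lemma tmE:
  assumes "tm F c"
  obtains f n K where "\<And>k. length (f k) = n" "\<And>k. \<forall>i \<in> set (f k). \<not> is_flip i"
    "computes f F (\<lambda>inp x. K * (1 + c inp x))"
  using assms unfolding tm_def wf_code_def by metis

lemma tmI:
  assumes "\<And>k. length (f k) = n" "\<And>k. \<forall>i \<in> set (f k). \<not> is_flip i"
    "\<And>P inp k lo M x. \<lbrakk>valid_input inp; placed P k (f k); heap_ok lo M; rep M lo (M 2) (M 0) x\<rbrakk> \<Longrightarrow>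
       \<exists>t M'. t \<le> K * (1 + c inp x) \<and> runs P inp t (k, M) (k + n, M') \<and>
        heap_ext lo M M' \<and> rep M' lo (M' 2) (M' 0) (F inp x)"
  shows "tm F c"
  unfolding tm_def wf_code_def computes_def using assms by (intro exI[of _ f] exI[of _ K]) simp

lemma heap_ext_refl: "heap_ok lo M \<Longrightarrow> heap_ext lo M M"
  by (simp add: heap_ext_def)

lemma heap_ext_trans: "heap_ext lo M M' \<Longrightarrow> heap_ext lo M' M'' \<Longrightarrow> heap_ext lo M M''"
  by (auto simp: heap_ext_def)

lemma rep_ext: "heap_ext lo M M' \<Longrightarrow> rep M lo (M 2) w x \<Longrightarrow> rep M' lo (M' 2) w x"
  by (rule rep_mono[of M]) (auto simp: heap_ext_def)

lemma tm_straight: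
  fixes F :: "input \<Rightarrow> 'a::rep \<Rightarrow> 'b::rep"
  assumes jf: "\<forall>i \<in> set is. \<not> is_jump i \<and> \<not> is_flip i"
    and sem: "\<And>inp lo M x. valid_input inp \<Longrightarrow> heap_ok lo M \<Longrightarrow> rep M lo (M 2) (M 0) x \<Longrightarrow>
      heap_ext lo M (foldl (\<lambda>M i. mem_exec inp i M) M is) \<and>
      rep (foldl (\<lambda>M i. mem_exec inp i M) M is) lo ((foldl (\<lambda>M i. mem_exec inp i M) M is) 2)
        ((foldl (\<lambda>M i. mem_exec inp i M) M is) 0) (F inp x)"
  shows "tm F (\<lambda>_ _. 0)"
proof -
  show ?thesis
  proof (rule tmI[where f = "\<lambda>_. is" and n = "length is" and K = "length is"])
    fix P inp k lo M and x :: 'a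
    assume *: "valid_input inp" "placed P k is" "heap_ok lo M" "rep M lo (M 2) (M 0) x"
    show "\<exists>t M'. t \<le> length is * (1 + 0) \<and> runs P inp t (k, M) (k + length is, M') \<and>
        heap_ext lo M M' \<and> rep M' lo (M' 2) (M' 0) (F inp x)"
      using sem[OF *(1,3,4)] runs_straight[OF *(2), of inp M] jf
      by (intro exI[of _ "length is"] exI[of _ "foldl (\<lambda>M i. mem_exec inp i M) M is"]) simp
  qed (use jf in auto)
qed

lemma tm_weaken:
  assumes "tm F c" "\<And>inp x. valid_input inp \<Longrightarrow> c inp x \<le> k * (1 + d inp x)"
  shows "tm F d"
proof -
  obtain code K where 1: "wf_code code" "computes code F (\<lambda>inp x. K * (1 + c inp x))"
    using assms(1) unfolding tm_def by blast
  have "K * (1 + c inp x) \<le> (K * (1 + k)) * (1 + d inp x)" if "valid_input inp" for inp x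
  proof -
    have "1 + c inp x \<le> (1 + k) * (1 + d inp x)" using assms(2)[OF that, of x] by simp
    then show ?thesis by (metis mult.assoc mult_le_mono2)
  qed
  then have "computes code F (\<lambda>inp x. (K * (1 + k)) * (1 + d inp x))"
    using 1(2) unfolding computes_def by (meson order_trans)
  then show ?thesis using 1(1) unfolding tm_def by blast
qed

lemma tm_le: "tm F c \<Longrightarrow> (\<And>inp x. valid_input inp \<Longrightarrow> c inp x \<le> d inp x) \<Longrightarrow> tm F d"
  by (rule tm_weaken[where k = 1]) (auto intro: le_SucI)

lemma tm_cong:
  assumes "tm F c" "\<And>inp x. valid_input inp \<Longrightarrow> F inp x = G inp x"
  shows "tm G c"
  using assms unfolding tm_def computes_def by metis

lemma tm_id: "tm (\<lambda>inp x. x) (\<lambda>_ _. 0)"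
  by (rule tm_straight[of "[]"]) (auto simp: heap_ext_refl)

definition push_code :: "instr list" where
  "push_code = [Store 2 0, Add 4 2 1, Store 4 3, Const 5 0, Add 3 2 5, Add 2 4 1]"

text \<open>Exchanges the saved argument on top of the stack for the result just computed. A fresh
  stack cell is allocated instead of overwriting the old one, since heap cells are
  immutable.\<close>

definition swap_code :: "instr list" where
  "swap_code = [Load 4 3, Add 5 3 1, Load 5 5, Store 2 0, Add 6 2 1, Store 6 5, Const 5 0,
     Add 3 2 5, Add 2 6 1, Add 0 4 5]"

definition pack_code :: "instr list" where
  "pack_code = [Load 4 3, Add 5 3 1, Load 3 5, Store 2 4, Add 5 2 1, Store 5 0, Const 6 0,
     Add 0 2 6, Add 2 5 1]"

definition pop_code :: "instr list" where
  "pop_code = [Const 4 0, Add 4 4 0, Load 0 3, Add 5 3 1, Load 3 5]"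

abbreviation "exec_all inp is M \<equiv> foldl (\<lambda>M i. mem_exec inp i M) M is"

lemma length_codes [simp]:
  "length push_code = 6" "length swap_code = 10" "length pack_code = 9" "length pop_code = 5"
  by (simp_all add: push_code_def swap_code_def pack_code_def pop_code_def)

lemma no_jump_codes [simp]:
  "\<forall>i \<in> set push_code. \<not> is_jump i" "\<forall>i \<in> set swap_code. \<not> is_jump i"
  "\<forall>i \<in> set pack_code. \<not> is_jump i" "\<forall>i \<in> set pop_code. \<not> is_jump i"
  by (simp_all add: push_code_def swap_code_def pack_code_def pop_code_def)

lemma no_flip_codes [simp]:
  "\<forall>i \<in> set push_code. \<not> is_flip i" "\<forall>i \<in> set swap_code. \<not> is_flip i"
  "\<forall>i \<in> set pack_code. \<not> is_flip i" "\<forall>i \<in> set pop_code. \<not> is_flip i"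
  by (simp_all add: push_code_def swap_code_def pack_code_def pop_code_def)

lemma push:
  fixes inp :: input
  assumes "heap_ok lo M" "rep M lo (M 2) (M 0) x"
  defines "M' \<equiv> exec_all inp push_code M"
  shows "heap_ok lo M'" "rep M' lo (M' 2) (M' 0) x" "M' 3 = M 2" "M' (M 2) = M 0"
    "M' (Suc (M 2)) = M 3" "M' 2 = M 2 + 2" "\<forall>a. lo \<le> a \<and> a < M 2 \<longrightarrow> M' a = M a"
    "M' 0 = M 0"
proof -
  have a: "M 1 = 1" "lo \<le> M 2" "8 \<le> lo" using assms(1) by (auto simp: heap_ok_def)
  have M': "M' = M(M 2 := M 0, 4 := Suc (M 2), Suc (M 2) := M 3, 5 := 0, 3 := M 2, 2 := M 2 + 2)"
    using a unfolding M'_def push_code_def by (auto simp: fun_eq_iff)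
  show b: "heap_ok lo M'" "M' 3 = M 2" "M' (M 2) = M 0" "M' (Suc (M 2)) = M 3" "M' 2 = M 2 + 2"
    "\<forall>a. lo \<le> a \<and> a < M 2 \<longrightarrow> M' a = M a" "M' 0 = M 0"
    using a unfolding M' by (auto simp: heap_ok_def)
  show "rep M' lo (M' 2) (M' 0) x"
    using assms(2) rep_mono[of M lo "M 2" "M 0" x M' "M' 2"] b by auto
qed

lemma runs_code:
  assumes "placed P k is" "\<forall>i \<in> set is. \<not> is_jump i" "l = k + length is"
  shows "runs P inp (length is) (k, M) (l, exec_all inp is M)"
  using runs_straight[OF assms(1,2)] assms(3) by simp

lemma tm_comp:
  fixes F :: "input \<Rightarrow> 'a::rep \<Rightarrow> 'b::rep"
  assumes "tm F c" "tm G d"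
  shows "tm (\<lambda>inp x. G inp (F inp x)) (\<lambda>inp x. c inp x + d inp (F inp x))"
proof -
  obtain f nf K where lf: "\<And>k. length (f k) = nf" and uf: "\<And>k. \<forall>i \<in> set (f k). \<not> is_flip i"
    and f: "computes f F (\<lambda>inp x. K * (1 + c inp x))"
    by (rule tmE[OF assms(1)]) (blast intro: that)
  obtain g ng L where lg: "\<And>k. length (g k) = ng" and ug: "\<And>k. \<forall>i \<in> set (g k). \<not> is_flip i"
    and g: "computes g G (\<lambda>inp x. L * (1 + d inp x))"
    by (rule tmE[OF assms(2)]) (blast intro: that)
  define code where "code k = f k @ g (k + nf)" for k
  show ?thesis
  proof (rule tmI[where f = code and n = "nf + ng" and K = "K + L"])
    show "length (code k) = nf + ng" for k by (simp add: code_def lf lg)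
    show "\<forall>i \<in> set (code k). \<not> is_flip i" for k using uf ug by (auto simp: code_def)
    fix P inp k lo M and x :: 'a
    assume v: "valid_input inp" and pl: "placed P k (code k)" and ok: "heap_ok lo M"
      and rp: "rep M lo (M 2) (M 0) x"
    have pl': "placed P k (f k)" "placed P (k + nf) (g (k + nf))"
      using pl by (auto simp: code_def placed_append lf)
    obtain t M' where 1: "t \<le> K * (1 + c inp x)" "runs P inp t (k, M) (k + nf, M')"
      "heap_ext lo M M'" "rep M' lo (M' 2) (M' 0) (F inp x)"
      by (rule computesD[OF f v pl'(1) ok rp lf])
    have ok': "heap_ok lo M'" using 1(3) by (simp add: heap_ext_def)
    obtain u M'' where 2: "u \<le> L * (1 + d inp (F inp x))"
      "runs P inp u (k + nf, M') (k + nf + ng, M'')"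
      "heap_ext lo M' M''" "rep M'' lo (M'' 2) (M'' 0) (G inp (F inp x))"
      by (rule computesD[OF g v pl'(2) ok' 1(4) lg])
    have "t + u \<le> (K + L) * (1 + (c inp x + d inp (F inp x)))"
      using 1(1) 2(1) by (simp add: algebra_simps)
    moreover have "runs P inp (t + u) (k, M) (k + (nf + ng), M'')"
      using runs_trans[OF 1(2) 2(2)] by (simp add: add.assoc)
    ultimately show "\<exists>t M'. t \<le> (K + L) * (1 + (c inp x + d inp (F inp x))) \<and>
        runs P inp t (k, M) (k + (nf + ng), M') \<and>
        heap_ext lo M M' \<and> rep M' lo (M' 2) (M' 0) (G inp (F inp x))"
      using heap_ext_trans[OF 1(3) 2(3)] 2(4) by blast
  qed
qed

text \<open>Both components start from the same argument, but a call preserves only the stack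
  register, the constant one and the heap allocated so far; so the argument is saved on the
  stack.\<close>

lemma tm_pair:
  fixes F :: "input \<Rightarrow> 'a::rep \<Rightarrow> 'b::rep"
  assumes "tm F c" "tm G d"
  shows "tm (\<lambda>inp x. (F inp x, G inp x)) (\<lambda>inp x. c inp x + d inp x)"
proof -
  obtain f nf K where lf: "\<And>k. length (f k) = nf" and uf: "\<And>k. \<forall>i \<in> set (f k). \<not> is_flip i"
    and f: "computes f F (\<lambda>inp x. K * (1 + c inp x))"
    by (rule tmE[OF assms(1)]) (blast intro: that)
  obtain g ng L where lg: "\<And>k. length (g k) = ng" and ug: "\<And>k. \<forall>i \<in> set (g k). \<not> is_flip i"
    and g: "computes g G (\<lambda>inp x. L * (1 + d inp x))"
    by (rule tmE[OF assms(2)]) (blast intro: that)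
  define code where "code k = push_code @ f (k + 6) @ swap_code @ g (k + 16 + nf) @ pack_code" for k
  show ?thesis
  proof (rule tmI[where f = code and n = "25 + nf + ng" and K = "25 + K + L"])
    show "length (code k) = 25 + nf + ng" for k by (simp add: code_def lf lg)
    show "\<forall>i \<in> set (code k). \<not> is_flip i" for k
      using uf ug no_flip_codes by (auto simp: code_def)
    fix P inp k lo M and x :: 'a
    assume v: "valid_input inp" and pl: "placed P k (code k)" and ok: "heap_ok lo M"
      and rp: "rep M lo (M 2) (M 0) x"
    let ?k1 = "k + 6" let ?k2 = "k + 6 + nf" let ?k3 = "k + 16 + nf"
    let ?k4 = "k + 16 + nf + ng" let ?k5 = "k + 25 + nf + ng"
    have pl': "placed P k push_code" "placed P ?k1 (f ?k1)" "placed P ?k2 swap_code"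
       "placed P ?k3 (g ?k3)" "placed P ?k4 pack_code"
      using pl by (simp_all add: code_def placed_append lf lg add_ac)
    define M1 where "M1 = exec_all inp push_code M"
    note p = push[OF ok rp, of inp, folded M1_def]
    have lo: "M 1 = 1" "lo \<le> M 2" "8 \<le> lo" using ok by (auto simp: heap_ok_def)
    have r1: "runs P inp 6 (k, M) (?k1, M1)"
      using runs_code[OF pl'(1), of ?k1] by (simp add: M1_def)
    obtain t2 M2 where 2: "t2 \<le> K * (1 + c inp x)" "runs P inp t2 (?k1, M1) (?k1 + nf, M2)"
      "heap_ext lo M1 M2" "rep M2 lo (M2 2) (M2 0) (F inp x)"
      by (rule computesD[OF f v pl'(2) p(1,2) lf])
    have x2: "rep M2 lo (M2 2) (M 0) x"
      using rep_ext[OF 2(3) p(2)] p(8) by simp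
    have a2: "M2 1 = 1" "lo \<le> M2 2" "M 2 + 2 \<le> M2 2" "M2 3 = M 2" "M2 (M 2) = M 0"
       "M2 (Suc (M 2)) = M 3" "\<forall>a. lo \<le> a \<and> a < M 2 \<longrightarrow> M2 a = M a"
      using 2(3) p lo by (auto simp: heap_ext_def heap_ok_def)
    define M3 where "M3 = exec_all inp swap_code M2"
    have M3: "M3 = M2(4 := M 0, M2 2 := M2 0, 6 := Suc (M2 2), Suc (M2 2) := M 3,
        5 := 0, 3 := M2 2, 2 := M2 2 + 2, 0 := M 0)"
      using a2 lo unfolding M3_def swap_code_def by (auto simp: fun_eq_iff)
    have r3: "runs P inp 10 (?k2, M2) (?k3, M3)"
      using runs_code[OF pl'(3), of ?k3 inp M2] by (simp add: M3_def)
    have a3: "heap_ok lo M3" "M3 2 = M2 2 + 2" "M3 3 = M2 2" "M3 (M2 2) = M2 0"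
       "M3 (Suc (M2 2)) = M 3" "\<forall>a. lo \<le> a \<and> a < M2 2 \<longrightarrow> M3 a = M2 a" "M3 0 = M 0"
      using a2 lo unfolding M3 by (auto simp: heap_ok_def)
    have x3: "rep M3 lo (M3 2) (M3 0) x"
      using rep_mono[OF x2 a3(6), of "M3 2"] a3 by simp
    have y3: "rep M3 lo (M3 2) (M2 0) (F inp x)"
      using rep_mono[OF 2(4) a3(6), of "M3 2"] a3 by simp
    obtain t4 M4 where 4: "t4 \<le> L * (1 + d inp x)"
      "runs P inp t4 (?k3, M3) (?k3 + ng, M4)"
      "heap_ext lo M3 M4" "rep M4 lo (M4 2) (M4 0) (G inp x)"
      by (rule computesD[OF g v pl'(4) a3(1) x3 lg])
    have y4: "rep M4 lo (M4 2) (M2 0) (F inp x)" by (rule rep_ext[OF 4(3) y3])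
    have a4: "M4 1 = 1" "lo \<le> M4 2" "M2 2 + 2 \<le> M4 2" "M4 3 = M2 2" "M4 (M2 2) = M2 0"
       "M4 (Suc (M2 2)) = M 3" "\<forall>a. lo \<le> a \<and> a < M 2 \<longrightarrow> M4 a = M a"
      using 4(3) a3 a2 lo by (auto simp: heap_ext_def heap_ok_def)
    define M5 where "M5 = exec_all inp pack_code M4"
    have M5: "M5 = M4(4 := M2 0, 3 := M 3, M4 2 := M2 0, 5 := Suc (M4 2),
        Suc (M4 2) := M4 0, 6 := 0, 0 := M4 2, 2 := M4 2 + 2)"
      using a4 a2(2) lo unfolding M5_def pack_code_def by (auto simp: fun_eq_iff)
    have r5: "runs P inp 9 (?k4, M4) (?k5, M5)"
      using runs_code[OF pl'(5), of ?k5 inp M4] by (simp add: M5_def)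
    have a5: "heap_ext lo M M5" "M5 0 = M4 2" "M5 2 = M4 2 + 2" "M5 (M4 2) = M2 0"
       "M5 (Suc (M4 2)) = M4 0" "\<forall>a. lo \<le> a \<and> a < M4 2 \<longrightarrow> M5 a = M4 a"
      using a4 a2 lo unfolding M5 by (auto simp: heap_ok_def heap_ext_def)
    have res: "rep M5 lo (M5 2) (M5 0) (F inp x, G inp x)"
      using rep_mono[OF y4 a5(6), of "M5 2"] rep_mono[OF 4(4) a5(6), of "M5 2"] a5 a4
      by (simp add: rep_prod_def)
    have "runs P inp (6 + t2 + 10 + t4 + 9) (k, M) (k + (25 + nf + ng), M5)"
      using runs_trans[OF runs_trans[OF runs_trans[OF runs_trans[OF r1 2(2)] r3] 4(2)] r5]
      by (simp only: add_ac)
    moreover have "6 + t2 + 10 + t4 + 9 \<le> (25 + K + L) * (1 + (c inp x + d inp x))"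
      using 2(1) 4(1) by (simp add: algebra_simps)
    ultimately show "\<exists>t M'. t \<le> (25 + K + L) * (1 + (c inp x + d inp x)) \<and>
        runs P inp t (k, M) (k + (25 + nf + ng), M') \<and>
        heap_ext lo M M' \<and> rep M' lo (M' 2) (M' 0) (F inp x, G inp x)"
      using a5(1) res by blast
  qed
qed

text \<open>Evaluating a test leaves the argument in register 0 and the truth value in register 4.\<close>

definition branch_code :: "(nat \<Rightarrow> instr list) \<Rightarrow> nat \<Rightarrow> instr list" where
  "branch_code f k = push_code @ f (k + 6) @ pop_code"

lemma test_run:
  assumes f: "computes f (F :: input \<Rightarrow> 'a::rep \<Rightarrow> bool) C" and v: "valid_input inp"
    and lf: "\<And>k. length (f k) = nf"
    and pl: "placed P k (branch_code f k)"
    and ok: "heap_ok lo M" and rp: "rep M lo (M 2) (M 0) x"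
  obtains t M' where "t \<le> 11 + C inp x"
    "runs P inp t (k, M) (k + 11 + nf, M')" "heap_ext lo M M'"
    "rep M' lo (M' 2) (M' 0) x" "(M' 4 \<noteq> 0) = F inp x"
proof -
  let ?k1 = "k + 6" let ?k2 = "k + 6 + nf" let ?k3 = "k + 11 + nf"
  have pl': "placed P k push_code" "placed P ?k1 (f ?k1)" "placed P ?k2 pop_code"
    using pl by (simp_all add: branch_code_def placed_append lf add_ac)
  define M1 where "M1 = exec_all inp push_code M"
  note p = push[OF ok rp, of inp, folded M1_def]
  have lo: "M 1 = 1" "lo \<le> M 2" "8 \<le> lo" using ok by (auto simp: heap_ok_def)
  have r1: "runs P inp 6 (k, M) (?k1, M1)"
    using runs_code[OF pl'(1), of ?k1] by (simp add: M1_def)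
  obtain t2 M2 where 2: "t2 \<le> C inp x" "runs P inp t2 (?k1, M1) (?k1 + nf, M2)"
    "heap_ext lo M1 M2" "rep M2 lo (M2 2) (M2 0) (F inp x)"
    by (rule computesD[OF f v pl'(2) p(1,2) lf])
  have x2: "rep M2 lo (M2 2) (M 0) x"
    using rep_ext[OF 2(3) p(2)] p(8) by simp
  have a2: "M2 1 = 1" "lo \<le> M2 2" "M 2 + 2 \<le> M2 2" "M2 3 = M 2" "M2 (M 2) = M 0"
     "M2 (Suc (M 2)) = M 3" "\<forall>a. lo \<le> a \<and> a < M 2 \<longrightarrow> M2 a = M a"
    using 2(3) p lo by (auto simp: heap_ext_def heap_ok_def)
  define M3 where "M3 = exec_all inp pop_code M2"
  have M3: "M3 = M2(4 := M2 0, 0 := M 0, 5 := Suc (M 2), 3 := M 3)"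
    using a2 lo unfolding M3_def pop_code_def by (auto simp: fun_eq_iff)
  have r3: "runs P inp 5 (?k2, M2) (?k3, M3)"
    using runs_code[OF pl'(3), of ?k3 inp M2] by (simp add: M3_def)
  have a3: "heap_ext lo M M3" "M3 2 = M2 2" "M3 0 = M 0" "M3 4 = M2 0"
      "\<forall>a. lo \<le> a \<and> a < M2 2 \<longrightarrow> M3 a = M2 a"
    using a2 lo unfolding M3 by (auto simp: heap_ok_def heap_ext_def)
  have "rep M3 lo (M3 2) (M3 0) x" using rep_mono[OF x2 a3(5), of "M3 2"] a3 by simp
  moreover have "(M3 4 \<noteq> 0) = F inp x" using 2(4) a3(4) by (simp add: rep_bool_def)
  moreover have "runs P inp (6 + t2 + 5) (k, M) (?k3, M3)"
    using runs_trans[OF runs_trans[OF r1 2(2)] r3] .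
  moreover have "6 + t2 + 5 \<le> 11 + C inp x" using 2(1) by simp
  ultimately show thesis using a3(1) that by blast
qed

lemma jump_succ: "k + 12 + n = Suc (k + 11 + n)" for k n :: nat
  by simp

lemma tm_if:
  fixes F :: "input \<Rightarrow> 'a::rep \<Rightarrow> 'b::rep"
  assumes "tm B b" "tm F c" "tm G d"
  shows "tm (\<lambda>inp x. if B inp x then F inp x else G inp x)
    (\<lambda>inp x. b inp x + (if B inp x then c inp x else d inp x))"
proof -
  obtain h nh J where lh: "\<And>k. length (h k) = nh" and uh: "\<And>k. \<forall>i \<in> set (h k). \<not> is_flip i"
    and h: "computes h B (\<lambda>inp x. J * (1 + b inp x))"
    by (rule tmE[OF assms(1)]) (blast intro: that)
  have lt: "length (branch_code h k) = 11 + nh" for k by (simp add: branch_code_def lh)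
  obtain f nf K where lf: "\<And>k. length (f k) = nf" and uf: "\<And>k. \<forall>i \<in> set (f k). \<not> is_flip i"
    and f: "computes f F (\<lambda>inp x. K * (1 + c inp x))"
    by (rule tmE[OF assms(2)]) (blast intro: that)
  obtain g ng L where lg: "\<And>k. length (g k) = ng" and ug: "\<And>k. \<forall>i \<in> set (g k). \<not> is_flip i"
    and g: "computes g G (\<lambda>inp x. L * (1 + d inp x))"
    by (rule tmE[OF assms(3)]) (blast intro: that)
  define code where "code k = branch_code h k @
    [Jump_If_Zero 4 (k + 14 + nh + nf)] @ f (k + 12 + nh) @
    [Const 4 0] @ [Jump_If_Zero 4 (k + 14 + nh + nf + ng)] @ g (k + 14 + nh + nf)" for k
  show ?thesis
  proof (rule tmI[where f = code and n = "14 + nh + nf + ng" and K = "14 + J + K + L"])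
    show "length (code k) = 14 + nh + nf + ng" for k by (simp add: code_def branch_code_def lf lg lh)
    show "\<forall>i \<in> set (code k). \<not> is_flip i" for k
      using uf ug uh no_flip_codes by (auto simp: code_def branch_code_def)
    fix P inp k lo M and x :: 'a
    assume v: "valid_input inp" and pl: "placed P k (code k)" and ok: "heap_ok lo M"
      and rp: "rep M lo (M 2) (M 0) x"
    have pl': "placed P k (branch_code h k)"
      "placed P (k + 11 + nh) [Jump_If_Zero 4 (k + 14 + nh + nf)]"
      "placed P (k + 12 + nh) (f (k + 12 + nh))"
      "placed P (k + 12 + nh + nf) [Const 4 0]"
      "placed P (k + 13 + nh + nf) [Jump_If_Zero 4 (k + 14 + nh + nf + ng)]"
      "placed P (k + 14 + nh + nf) (g (k + 14 + nh + nf))"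
      using pl by (simp_all add: code_def placed_append lf lg lt add_ac)
    obtain t M1 where 1: "t \<le> 11 + J * (1 + b inp x)"
      "runs P inp t (k, M) (k + 11 + nh, M1)" "heap_ext lo M M1"
      "rep M1 lo (M1 2) (M1 0) x" "(M1 4 \<noteq> 0) = B inp x"
      by (rule test_run[OF h v lh pl'(1) ok rp])
    have ok1: "heap_ok lo M1" using 1(3) by (simp add: heap_ext_def)
    show "\<exists>t M'. t \<le> (14 + J + K + L) * (1 + (b inp x + (if B inp x then c inp x else d inp x))) \<and>
        runs P inp t (k, M) (k + (14 + nh + nf + ng), M') \<and>
        heap_ext lo M M' \<and> rep M' lo (M' 2) (M' 0) (if B inp x then F inp x else G inp x)"
    proof (cases "B inp x")
      case True
      have r1: "runs P inp (t + 1) (k, M) (k + 12 + nh, M1)"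
        using runs_trans[OF 1(2) runs_jump_nonzero[OF pl'(2)]] 1(5) True 
        by (metis jump_succ)
      obtain t2 M2 where 2: "t2 \<le> K * (1 + c inp x)"
        "runs P inp t2 (k + 12 + nh, M1) (k + 12 + nh + nf, M2)"
        "heap_ext lo M1 M2" "rep M2 lo (M2 2) (M2 0) (F inp x)"
        by (rule computesD[OF f v pl'(3) ok1 1(4) lf])
      let ?M3 = "M2(4 := 0)"
      have r3: "runs P inp 1 (k + 12 + nh + nf, M2) (k + 13 + nh + nf, ?M3)"
        using runs_code[OF pl'(4), of "k + 13 + nh + nf" inp M2] by (simp del: add_Suc)
      have r4: "runs P inp 1 (k + 13 + nh + nf, ?M3) (k + 14 + nh + nf + ng, ?M3)"
        by (rule runs_jump_zero[OF pl'(5)]) simp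
      have e: "heap_ext lo M2 ?M3" using 2(3) by (auto simp: heap_ext_def heap_ok_def)
      have "rep ?M3 lo (?M3 2) (?M3 0) (F inp x)" using rep_ext[OF e 2(4)] by simp
      moreover have "runs P inp (t + 1 + t2 + 1 + 1) (k, M) (k + (14 + nh + nf + ng), ?M3)"
        using runs_trans[OF runs_trans[OF runs_trans[OF r1 2(2)] r3] r4] by (simp only: add_ac)
      moreover have "heap_ext lo M ?M3" using 1(3) 2(3) e by (metis heap_ext_trans)
      moreover have "t + 1 + t2 + 1 + 1 \<le> (14 + J + K + L) * (1 + (b inp x + c inp x))"
        using 1(1) 2(1) by (simp add: algebra_simps)
      ultimately show ?thesis unfolding if_P[OF True] by blast
    next
      case False
      have r1: "runs P inp (t + 1) (k, M) (k + 14 + nh + nf, M1)"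
        using runs_trans[OF 1(2) runs_jump_zero[OF pl'(2)]] 1(5) False by blast
      obtain t2 M2 where 2: "t2 \<le> L * (1 + d inp x)"
        "runs P inp t2 (k + 14 + nh + nf, M1) (k + 14 + nh + nf + ng, M2)"
        "heap_ext lo M1 M2" "rep M2 lo (M2 2) (M2 0) (G inp x)"
        by (rule computesD[OF g v pl'(6) ok1 1(4) lg])
      have "runs P inp (t + 1 + t2) (k, M) (k + (14 + nh + nf + ng), M2)"
        using runs_trans[OF r1 2(2)] by (simp only: add_ac)
      moreover have "t + 1 + t2 \<le> (14 + J + K + L) * (1 + (b inp x + d inp x))"
        using 1(1) 2(1) by (simp add: algebra_simps)
      ultimately show ?thesis unfolding if_not_P[OF False] using 2(4) heap_ext_trans[OF 1(3) 2(3)] by blast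
    qed
  qed
qed

text \<open>\<open>c\<close> bounds the remaining cost and strictly decreases in every round, so one
  induction on it yields both termination and running time. \<open>F\<close> maps a state to the
  final one; it is characterized by its invariance under \<open>S\<close> and by
  \<open>F inp x = x\<close> at exit, which spares a recursive definition of the loop. The
  initialization \<open>A\<close> belongs to the rule because it establishes
  \<open>I\<close>.\<close>

lemma tm_while:
  fixes F :: "input \<Rightarrow> 'b::rep \<Rightarrow> 'b" and A :: "input \<Rightarrow> 'a::rep \<Rightarrow> 'b"
  assumes "tm B b" "tm S s" "tm A a"
    and init: "\<And>inp x. valid_input inp \<Longrightarrow> I inp (A inp x)"
    and loop: "\<And>inp x. valid_input inp \<Longrightarrow> I inp x \<Longrightarrow> B inp x \<Longrightarrow>
       I inp (S inp x) \<and> F inp x = F inp (S inp x) \<and>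
       b inp x + s inp x + 1 + c inp (S inp x) \<le> c inp x"
    and stop: "\<And>inp x. valid_input inp \<Longrightarrow> I inp x \<Longrightarrow> \<not> B inp x \<Longrightarrow>
       F inp x = x \<and> b inp x \<le> c inp x"
  shows "tm (\<lambda>inp x. F inp (A inp x)) (\<lambda>inp x. a inp x + c inp (A inp x))"
proof -
  obtain h nh J where lh: "\<And>k. length (h k) = nh" and uh: "\<And>k. \<forall>i \<in> set (h k). \<not> is_flip i"
    and h: "computes h B (\<lambda>inp x. J * (1 + b inp x))"
    by (rule tmE[OF assms(1)]) (blast intro: that)
  have lt: "length (branch_code h k) = 11 + nh" for k by (simp add: branch_code_def lh)
  obtain f nf K where lf: "\<And>k. length (f k) = nf" and uf: "\<And>k. \<forall>i \<in> set (f k). \<not> is_flip i"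
    and f: "computes f S (\<lambda>inp x. K * (1 + s inp x))"
    by (rule tmE[OF assms(2)]) (blast intro: that)
  obtain g ng L where lg: "\<And>k. length (g k) = ng" and ug: "\<And>k. \<forall>i \<in> set (g k). \<not> is_flip i"
    and g: "computes g A (\<lambda>inp x. L * (1 + a inp x))"
    by (rule tmE[OF assms(3)]) (blast intro: that)
  define loop_code where "loop_code k = branch_code h k @
    [Jump_If_Zero 4 (k + 14 + nh + nf)] @ f (k + 12 + nh) @
    [Const 4 0] @ [Jump_If_Zero 4 k]" for k
  define code where "code k = g k @ loop_code (k + ng)" for k
  define N where "N = 14 + J + K"
  have main: "\<exists>t M'. t \<le> N * (1 + c inp x) \<and>
      runs P inp t (k, M) (k + 14 + nh + nf, M') \<and>
      heap_ext lo M M' \<and> rep M' lo (M' 2) (M' 0) (F inp x)"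
    if v: "valid_input inp" and pl: "placed P k (loop_code k)" and ok: "heap_ok lo M"
      and rp: "rep M lo (M 2) (M 0) x" and I: "I inp x" for P inp k lo M x
    using ok rp I
  proof (induction "c inp x" arbitrary: x M rule: less_induct)
    case less
    have pl': "placed P k (branch_code h k)"
      "placed P (k + 11 + nh) [Jump_If_Zero 4 (k + 14 + nh + nf)]"
      "placed P (k + 12 + nh) (f (k + 12 + nh))"
      "placed P (k + 12 + nh + nf) [Const 4 0]"
      "placed P (k + 13 + nh + nf) [Jump_If_Zero 4 k]"
      using pl by (simp_all add: loop_code_def placed_append lf lg lt add_ac)
    obtain t M1 where 1: "t \<le> 11 + J * (1 + b inp x)"
      "runs P inp t (k, M) (k + 11 + nh, M1)" "heap_ext lo M M1"
      "rep M1 lo (M1 2) (M1 0) x" "(M1 4 \<noteq> 0) = B inp x"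
      by (rule test_run[OF h v lh pl'(1) less.prems(1,2)])
    have ok1: "heap_ok lo M1" using 1(3) by (simp add: heap_ext_def)
    show ?case
    proof (cases "B inp x")
      case True
      note lp = loop[OF v less.prems(3) True]
      have r1: "runs P inp (t + 1) (k, M) (k + 12 + nh, M1)"
        using runs_trans[OF 1(2) runs_jump_nonzero[OF pl'(2)]] 1(5) True 
        by (metis jump_succ)
      obtain t2 M2 where 2: "t2 \<le> K * (1 + s inp x)"
        "runs P inp t2 (k + 12 + nh, M1) (k + 12 + nh + nf, M2)"
        "heap_ext lo M1 M2" "rep M2 lo (M2 2) (M2 0) (S inp x)"
        by (rule computesD[OF f v pl'(3) ok1 1(4) lf])
      let ?M3 = "M2(4 := 0)"
      have r3: "runs P inp 1 (k + 12 + nh + nf, M2) (k + 13 + nh + nf, ?M3)"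
        using runs_code[OF pl'(4), of "k + 13 + nh + nf" inp M2] by (simp del: add_Suc)
      have r4: "runs P inp 1 (k + 13 + nh + nf, ?M3) (k, ?M3)"
        by (rule runs_jump_zero[OF pl'(5)]) simp
      have e: "heap_ext lo M2 ?M3" using 2(3) by (auto simp: heap_ext_def heap_ok_def)
      have rp3: "rep ?M3 lo (?M3 2) (?M3 0) (S inp x)" using rep_ext[OF e 2(4)] by simp
      have ok3: "heap_ok lo ?M3" using e by (simp add: heap_ext_def)
      have lt: "c inp (S inp x) < c inp x" using lp by linarith
      obtain t5 M5 where 5: "t5 \<le> N * (1 + c inp (S inp x))"
         "runs P inp t5 (k, ?M3) (k + 14 + nh + nf, M5)" "heap_ext lo ?M3 M5"
         "rep M5 lo (M5 2) (M5 0) (F inp (S inp x))"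
        using less.hyps[OF lt ok3 rp3] lp by blast
      have "runs P inp (t + 1 + t2 + 1 + 1 + t5) (k, M) (k + 14 + nh + nf, M5)"
        using runs_trans[OF runs_trans[OF runs_trans[OF runs_trans[OF r1 2(2)] r3] r4] 5(2)] .
      moreover have "heap_ext lo M M5" using 1(3) 2(3) e 5(3) by (metis heap_ext_trans)
      moreover have "t + 1 + t2 + 1 + 1 + t5 \<le> N * (1 + c inp x)"
      proof -
        have "t + 1 + t2 + 1 + 1 + t5 \<le> N * (1 + b inp x + s inp x) + N * (1 + c inp (S inp x))"
          using 1(1) 2(1) 5(1) by (simp add: N_def algebra_simps)
        also have "\<dots> = N * (1 + (b inp x + s inp x + 1 + c inp (S inp x)))"
          by (simp add: algebra_simps)
        also have "\<dots> \<le> N * (1 + c inp x)" using lp by (intro mult_le_mono) auto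
        finally show ?thesis .
      qed
      ultimately show ?thesis using 5(4) lp by metis
    next
      case False
      note st = stop[OF v less.prems(3) False]
      have r1: "runs P inp (t + 1) (k, M) (k + 14 + nh + nf, M1)"
        using runs_trans[OF 1(2) runs_jump_zero[OF pl'(2)]] 1(5) False by blast
      have "t + 1 \<le> N * (1 + b inp x)" using 1(1) by (simp add: N_def algebra_simps)
      also have "\<dots> \<le> N * (1 + c inp x)" using st by (intro mult_le_mono) auto
      finally show ?thesis using r1 1(3,4) st by metis
    qed
  qed
  show ?thesis
  proof (rule tmI[where f = code and n = "14 + nh + nf + ng" and K = "N + L"])
    show "length (code k) = 14 + nh + nf + ng" for k by (simp add: code_def loop_code_def branch_code_def lf lg lh)
    show "\<forall>i \<in> set (code k). \<not> is_flip i" for k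
      using uf ug uh no_flip_codes by (auto simp: code_def branch_code_def loop_code_def)
    fix P inp k lo M and x :: 'a
    assume v: "valid_input inp" and pl: "placed P k (code k)" and ok: "heap_ok lo M"
      and rp: "rep M lo (M 2) (M 0) x"
    have pl': "placed P k (g k)" "placed P (k + ng) (loop_code (k + ng))"
      using pl by (auto simp: code_def placed_append lg)
    obtain t M1 where 1: "t \<le> L * (1 + a inp x)" "runs P inp t (k, M) (k + ng, M1)"
      "heap_ext lo M M1" "rep M1 lo (M1 2) (M1 0) (A inp x)"
      by (rule computesD[OF g v pl'(1) ok rp lg])
    have ok1: "heap_ok lo M1" using 1(3) by (simp add: heap_ext_def)
    obtain u M2 where 2: "u \<le> N * (1 + c inp (A inp x))"
      "runs P inp u (k + ng, M1) (k + ng + 14 + nh + nf, M2)"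
      "heap_ext lo M1 M2" "rep M2 lo (M2 2) (M2 0) (F inp (A inp x))"
      using main[OF v pl'(2) ok1 1(4) init[OF v]] by blast
    have "runs P inp (t + u) (k, M) (k + (14 + nh + nf + ng), M2)"
      using runs_trans[OF 1(2) 2(2)] by (simp only: add_ac)
    moreover have "t + u \<le> (N + L) * (1 + (a inp x + c inp (A inp x)))"
      using 1(1) 2(1) by (simp add: algebra_simps)
    ultimately show "\<exists>t M'. t \<le> (N + L) * (1 + (a inp x + c inp (A inp x))) \<and>
        runs P inp t (k, M) (k + (14 + nh + nf + ng), M') \<and>
        heap_ext lo M M' \<and> rep M' lo (M' 2) (M' 0) (F inp (A inp x))"
      using heap_ext_trans[OF 1(3) 2(3)] 2(4) by blast
  qed
qed

lemma runs_block:
  assumes "placed P k is" "\<forall>i \<in> set is. \<not> is_jump i" "exec_all inp is M = M'"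
    "t = length is" "l = k + length is"
  shows "runs P inp t (k, M) (l, M')"
  unfolding assms(4,5) assms(3)[symmetric] by (rule runs_straight[OF assms(1,2)])

section \<open>Basic operations\<close>

text \<open>Applied repeatedly, these rules follow the syntax of a function and synthesize a cost
  for it; \<open>tm_le\<close> or \<open>tm_weaken\<close> then compares that cost with the stated
  one.\<close>

named_theorems tm_rules

lemma tm_lift1:
  assumes "tm (\<lambda>i z. g i z) (\<lambda>_ _. 0)" "tm F c"
  shows "tm (\<lambda>i x. g i (F i x)) c"
  using tm_comp[OF assms(2,1)] by simp

lemmas [tm_rules] = tm_id tm_pair tm_if

lemma tm_const_nat [tm_rules]: "tm (\<lambda>i x. k :: nat) (\<lambda>_ _. 0)"
  by (rule tm_straight[of "[Const 0 k]"]) (auto simp: heap_ext_def heap_ok_def rep_nat_def)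

lemma tm_const_bool [tm_rules]: "tm (\<lambda>i x. b :: bool) (\<lambda>_ _. 0)"
  by (rule tm_straight[of "[Const 0 (if b then 1 else 0)]"])
     (auto simp: heap_ext_def heap_ok_def rep_bool_def)

lemma tm_nil [tm_rules]: "tm (\<lambda>i x. [] :: 'b::rep list) (\<lambda>_ _. 0)"
  by (rule tm_straight[of "[Const 0 0]"]) (auto simp: heap_ext_def heap_ok_def)

lemma rep_upd_low:
  fixes x :: "'a::rep"
  assumes "rep M lo hi w x" "\<forall>a. lo \<le> a \<and> a < hi \<longrightarrow> M' a = M a"
  shows "rep M' lo hi w x"
  using rep_mono[OF assms] by simp

lemma tm_fst0: "tm (\<lambda>i z. fst z) (\<lambda>_ (_ :: 'a::rep \<times> 'b::rep). 0)"
  by (rule tm_straight[of "[Load 0 0]"])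
     (auto simp: heap_ext_def heap_ok_def rep_prod_def elim!: rep_upd_low)

lemma tm_snd0: "tm (\<lambda>i z. snd z) (\<lambda>_ (_ :: 'a::rep \<times> 'b::rep). 0)"
  by (rule tm_straight[of "[Add 0 0 1, Load 0 0]"])
     (auto simp: heap_ext_def heap_ok_def rep_prod_def elim!: rep_upd_low)

lemmas tm_fst [tm_rules] = tm_lift1[OF tm_fst0] and tm_snd [tm_rules] = tm_lift1[OF tm_snd0]

text \<open>A pair of head and tail occupies two adjacent cells exactly as a list cell does, so the
  empty program conses.\<close>

lemma tm_cons0: "tm (\<lambda>i z. fst z # snd z) (\<lambda>_ (_ :: 'a::rep \<times> 'a list). 0)"
  by (rule tm_straight[of "[]"]) (auto simp: heap_ext_refl rep_prod_def)

lemma tm_cons [tm_rules]: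
  "tm F c \<Longrightarrow> tm G d \<Longrightarrow> tm (\<lambda>i x. F i x # G i x) (\<lambda>i x. c i x + d i x)"
  using tm_lift1[OF tm_cons0 tm_pair] by fastforce

lemma tm_add0: "tm (\<lambda>i z. fst z + snd z) (\<lambda>_ (_ :: nat \<times> nat). 0)"
  by (rule tm_straight[of "[Load 4 0, Add 5 0 1, Load 5 5, Add 0 4 5]"])
     (auto simp: heap_ext_def heap_ok_def rep_prod_def rep_nat_def)

lemma tm_sub0: "tm (\<lambda>i z. fst z - snd z) (\<lambda>_ (_ :: nat \<times> nat). 0)"
  by (rule tm_straight[of "[Load 4 0, Add 5 0 1, Load 5 5, Sub 0 4 5]"])
     (auto simp: heap_ext_def heap_ok_def rep_prod_def rep_nat_def)

lemma tm_read0: "tm (\<lambda>i z. i src (fst z) (snd z)) (\<lambda>_ (_ :: nat \<times> nat). 0)"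
  by (rule tm_straight[of "[Load 4 0, Add 5 0 1, Load 5 5, Read 0 src 4 5]"])
     (auto simp: heap_ext_def heap_ok_def rep_prod_def rep_nat_def)

lemma tm_less0: "tm (\<lambda>i z. fst z < snd z) (\<lambda>_ (_ :: nat \<times> nat). 0)"
  by (rule tm_straight[of "[Load 4 0, Add 5 0 1, Load 5 5, Sub 0 5 4]"])
     (auto simp: heap_ext_def heap_ok_def rep_prod_def rep_nat_def rep_bool_def)

lemma tm_not0: "tm (\<lambda>i z. \<not> z) (\<lambda>_ (_ :: bool). 0)"
  by (rule tm_straight[of "[Sub 0 1 0]"])
     (auto simp: heap_ext_def heap_ok_def rep_bool_def)

lemma tm_add [tm_rules]:
  "tm F c \<Longrightarrow> tm G d \<Longrightarrow> tm (\<lambda>i x. F i x + G i x :: nat) (\<lambda>i x. c i x + d i x)"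
  using tm_lift1[OF tm_add0 tm_pair] by fastforce

lemma tm_sub [tm_rules]:
  "tm F c \<Longrightarrow> tm G d \<Longrightarrow> tm (\<lambda>i x. F i x - G i x :: nat) (\<lambda>i x. c i x + d i x)"
  using tm_lift1[OF tm_sub0 tm_pair] by fastforce

lemma tm_read [tm_rules]:
  "tm F c \<Longrightarrow> tm G d \<Longrightarrow> tm (\<lambda>i x. i src (F i x) (G i x)) (\<lambda>i x. c i x + d i x)"
  using tm_lift1[OF tm_read0 tm_pair] by fastforce

lemma tm_Suc [tm_rules]: "tm F c \<Longrightarrow> tm (\<lambda>i x. Suc (F i x)) c"
  using tm_add[OF _ tm_const_nat, of F c 1] by simp

lemma tm_less [tm_rules]:
  "tm F c \<Longrightarrow> tm G d \<Longrightarrow> tm (\<lambda>i x. (F i x :: nat) < G i x) (\<lambda>i x. c i x + d i x)"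
  using tm_lift1[OF tm_less0 tm_pair] by fastforce

lemma tm_not [tm_rules]: "tm F c \<Longrightarrow> tm (\<lambda>i x. \<not> F i x) c"
  by (rule tm_lift1[OF tm_not0])

lemma tm_le_nat [tm_rules]:
  "tm F c \<Longrightarrow> tm G d \<Longrightarrow> tm (\<lambda>i x. (F i x :: nat) \<le> G i x) (\<lambda>i x. d i x + c i x)"
  unfolding not_less[symmetric] by (intro tm_not tm_less)

lemma tm_conj [tm_rules]:
  assumes "tm F c" "tm G d"
  shows "tm (\<lambda>i x. F i x \<and> G i x) (\<lambda>i x. c i x + d i x)"
proof -
  have "tm (\<lambda>i x. if F i x then G i x else False) (\<lambda>i x. c i x + d i x)"
    by (rule tm_le[OF tm_if[OF assms tm_const_bool]]) auto
  then show ?thesis by (rule tm_cong) auto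
qed

lemma tm_eq_nat [tm_rules]:
  assumes "tm F c" "tm G d"
  shows "tm (\<lambda>i x. (F i x :: nat) = G i x) (\<lambda>i x. c i x + d i x)"
proof -
  have "tm (\<lambda>i x. F i x \<le> G i x \<and> G i x \<le> F i x) (\<lambda>i x. c i x + d i x)"
    by (rule tm_weaken[OF tm_conj[OF tm_le_nat[OF assms] tm_le_nat[OF assms(2,1)]], where k = 2]) auto
  then show ?thesis by (rule tm_cong) auto
qed

lemma tm_let [tm_rules]:
  fixes F :: "input \<Rightarrow> 'a::rep \<Rightarrow> 'b::rep"
  assumes "tm F c" "tm (\<lambda>i z. G i (fst z) (snd z)) d"
  shows "tm (\<lambda>i x. Let (F i x) (G i x)) (\<lambda>i x. c i x + d i (x, F i x))"
  using tm_comp[OF tm_pair[OF tm_id assms(1)] assms(2)] by simp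

text \<open>The calling convention: several arguments travel as nested pairs, and the cost of the
  callee is evaluated at the values of the arguments.\<close>

lemma tm_fun2:
  assumes "tm (\<lambda>i z. g i (fst z) (snd z)) d" "tm F c1" "tm G c2"
  shows "tm (\<lambda>i x. g i (F i x) (G i x)) (\<lambda>i x. c1 i x + c2 i x + d i (F i x, G i x))"
  using tm_comp[OF tm_pair[OF assms(2,3)] assms(1)] by simp

lemma tm_fun3:
  assumes "tm (\<lambda>i z. g i (fst z) (fst (snd z)) (snd (snd z))) d" "tm F c1" "tm G c2" "tm H c3"
  shows "tm (\<lambda>i x. g i (F i x) (G i x) (H i x))
    (\<lambda>i x. c1 i x + c2 i x + c3 i x + d i (F i x, G i x, H i x))"
  using tm_comp[OF tm_pair[OF assms(2) tm_pair[OF assms(3,4)]] assms(1)] by (simp add: add.assoc)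

lemma tm_fun4:
  assumes "tm (\<lambda>i z. g i (fst z) (fst (snd z)) (fst (snd (snd z))) (snd (snd (snd z)))) d"
    "tm F c1" "tm G c2" "tm H c3" "tm J c4"
  shows "tm (\<lambda>i x. g i (F i x) (G i x) (H i x) (J i x))
    (\<lambda>i x. c1 i x + c2 i x + c3 i x + c4 i x + d i (F i x, G i x, H i x, J i x))"
  using tm_comp[OF tm_pair[OF assms(2) tm_pair[OF assms(3) tm_pair[OF assms(4,5)]]] assms(1)]
  by (simp add: add.assoc)

lemma tm_fun1:
  assumes "tm (\<lambda>i z. g i z) d" "tm F c"
  shows "tm (\<lambda>i x. g i (F i x)) (\<lambda>i x. c i x + d i (F i x))"
  using tm_comp[OF assms(2,1)] by simp


subsection \<open>Lists\<close>

lemma tm_case0: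
  fixes A :: "input \<Rightarrow> 'a::rep \<Rightarrow> 'b::rep" and B :: "input \<Rightarrow> 'a \<times> 'e::rep \<times> 'e list \<Rightarrow> 'b"
  assumes "tm A c" "tm B d"
  shows "tm (\<lambda>i z. case snd z of [] \<Rightarrow> A i (fst z) | h # t \<Rightarrow> B i (fst z, h, t))
    (\<lambda>i z. case snd z of [] \<Rightarrow> c i (fst z) | h # t \<Rightarrow> d i (fst z, h, t))"
    (is "tm ?F ?c")
proof -
  obtain f nf K where lf: "\<And>k. length (f k) = nf" and uf: "\<And>k. \<forall>i \<in> set (f k). \<not> is_flip i"
    and f: "computes f A (\<lambda>inp x. K * (1 + c inp x))"
    by (rule tmE[OF assms(1)]) (blast intro: that)
  obtain g ng L where lg: "\<And>k. length (g k) = ng" and ug: "\<And>k. \<forall>i \<in> set (g k). \<not> is_flip i"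
    and g: "computes g B (\<lambda>inp x. L * (1 + d inp x))"
    by (rule tmE[OF assms(2)]) (blast intro: that)
  define code where "code k = [Add 4 0 1, Load 4 4] @ [Jump_If_Zero 4 (k + 5 + ng)] @ g (k + 3) @
    [Const 4 0] @ [Jump_If_Zero 4 (k + 6 + ng + nf)] @ [Load 0 0] @ f (k + 6 + ng)" for k
  show ?thesis
  proof (rule tmI[where f = code and n = "6 + ng + nf" and K = "6 + K + L"])
    show "length (code k) = 6 + ng + nf" for k by (simp add: code_def lf lg)
    show "\<forall>i \<in> set (code k). \<not> is_flip i" for k using uf ug by (auto simp: code_def)
    fix P inp k lo M and z :: "'a \<times> 'e list"
    assume v: "valid_input inp" and pl: "placed P k (code k)" and ok: "heap_ok lo M"
      and rp: "rep M lo (M 2) (M 0) z"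
    obtain x l where z: "z = (x, l)" by (cases z)
    have pl': "placed P k [Add 4 0 1, Load 4 4]" "placed P (k + 2) [Jump_If_Zero 4 (k + 5 + ng)]"
      "placed P (k + 3) (g (k + 3))" "placed P (k + 3 + ng) [Const 4 0]"
      "placed P (k + 4 + ng) [Jump_If_Zero 4 (k + 6 + ng + nf)]"
      "placed P (k + 5 + ng) [Load 0 0]" "placed P (k + 6 + ng) (f (k + 6 + ng))"
      using pl by (simp_all add: code_def placed_append lf lg add_ac numeral_eq_Suc)
    have r: "lo \<le> M 0" "Suc (M 0) < M 2" "rep M lo (M 2) (M (M 0)) x"
      "rep M lo (M 2) (M (Suc (M 0))) l" and M1: "M 1 = 1" "lo \<le> M 2" "8 \<le> lo"
      using rp ok by (auto simp: z rep_prod_def heap_ok_def)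
    let ?M1 = "M(4 := M (Suc (M 0)))"
    have r1: "runs P inp 2 (k, M) (k + 2, ?M1)"
      by (rule runs_block[OF pl'(1)]) (use M1 r(1) in \<open>auto simp: fun_eq_iff\<close>)
    have e1: "heap_ext lo M ?M1" "heap_ok lo ?M1" using M1 by (auto simp: heap_ext_def heap_ok_def)
    have x1: "rep ?M1 lo (?M1 2) (M (M 0)) x" "rep ?M1 lo (?M1 2) (M (Suc (M 0))) l"
      using rep_ext[OF e1(1)] r by auto
    show "\<exists>t M'. t \<le> (6 + K + L) * (1 + ?c inp z) \<and> runs P inp t (k, M) (k + (6 + ng + nf), M') \<and>
        heap_ext lo M M' \<and> rep M' lo (M' 2) (M' 0) (?F inp z)"
    proof (cases l)
      case Nil
      have r2: "runs P inp 1 (k + 2, ?M1) (k + 5 + ng, ?M1)"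
        by (rule runs_jump_zero[OF pl'(2)]) (use r(4) Nil in simp)
      let ?M2 = "?M1(0 := M (M 0))"
      have r3: "runs P inp 1 (k + 5 + ng, ?M1) (k + 6 + ng, ?M2)"
        using runs_code[OF pl'(6), of "k + 6 + ng" inp ?M1] M1 r by (simp add: fun_upd_def)
      have e2: "heap_ext lo ?M1 ?M2" "heap_ok lo ?M2" using M1 by (auto simp: heap_ext_def heap_ok_def)
      have x2: "rep ?M2 lo (?M2 2) (?M2 0) x" using rep_ext[OF e2(1) x1(1)] by simp
      obtain t M3 where 3: "t \<le> K * (1 + c inp x)" "runs P inp t (k + 6 + ng, ?M2) (k + 6 + ng + nf, M3)"
        "heap_ext lo ?M2 M3" "rep M3 lo (M3 2) (M3 0) (A inp x)"
        by (rule computesD[OF f v pl'(7) e2(2) x2 lf])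
      have "runs P inp (2 + 1 + 1 + t) (k, M) (k + (6 + ng + nf), M3)"
        using runs_trans[OF runs_trans[OF runs_trans[OF r1 r2] r3] 3(2)] by (simp only: add_ac)
      moreover have "2 + 1 + 1 + t \<le> (6 + K + L) * (1 + ?c inp z)"
        using 3(1) by (simp add: z Nil algebra_simps)
      moreover have "heap_ext lo M M3" using e1(1) e2(1) 3(3) by (metis heap_ext_trans)
      moreover have "?F inp z = A inp x" by (simp add: z Nil)
      ultimately show ?thesis using 3(4) by metis
    next
      case (Cons h tl)
      have r2: "runs P inp 1 (k + 2, ?M1) (k + 3, ?M1)"
        by (rule runs_jump_nonzero[OF pl'(2)]) (use r(4) Cons M1 in auto)
      \<comment> \<open>A list cell is laid out as a pair, so the pair \<open>(x, h # tl)\<close>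
        already represents the triple \<open>(x, h, tl)\<close>; nothing is copied.\<close>
      have x1': "rep ?M1 lo (?M1 2) (?M1 0) (x, h, tl)"
      proof -
        have "8 \<le> M (Suc (M 0))" using r(4) M1 Cons by simp
        then show ?thesis using x1 r(1,2) M1 Cons by (auto simp: rep_prod_def)
      qed
      obtain t M3 where 3: "t \<le> L * (1 + d inp (x, h, tl))"
        "runs P inp t (k + 3, ?M1) (k + 3 + ng, M3)"
        "heap_ext lo ?M1 M3" "rep M3 lo (M3 2) (M3 0) (B inp (x, h, tl))"
        by (rule computesD[OF g v pl'(3) e1(2) x1' lg])
      let ?M4 = "M3(4 := 0)"
      have r4: "runs P inp 1 (k + 3 + ng, M3) (k + 4 + ng, ?M4)"
        using runs_code[OF pl'(4), of "k + 4 + ng" inp M3] by (simp del: add_Suc)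
      have r5: "runs P inp 1 (k + 4 + ng, ?M4) (k + 6 + ng + nf, ?M4)"
        by (rule runs_jump_zero[OF pl'(5)]) simp
      have e4: "heap_ext lo M3 ?M4" using 3(3) by (auto simp: heap_ext_def heap_ok_def)
      have "rep ?M4 lo (?M4 2) (?M4 0) (B inp (x, h, tl))" using rep_ext[OF e4 3(4)] by simp
      moreover have "runs P inp (2 + 1 + t + 1 + 1) (k, M) (k + (6 + ng + nf), ?M4)"
        using runs_trans[OF runs_trans[OF runs_trans[OF runs_trans[OF r1 r2] 3(2)] r4] r5]
        by (simp only: add_ac)
      moreover have "2 + 1 + t + 1 + 1 \<le> (6 + K + L) * (1 + ?c inp z)"
        using 3(1) by (simp add: z Cons algebra_simps)
      moreover have "heap_ext lo M ?M4" using e1(1) e4 3(3) by (metis heap_ext_trans)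
      moreover have "?F inp z = B inp (x, h, tl)" by (simp add: z Cons)
      ultimately show ?thesis by metis
    qed
  qed
qed

lemma tm_case [tm_rules]:
  fixes A :: "input \<Rightarrow> 'a::rep \<Rightarrow> 'b::rep" and B :: "input \<Rightarrow> 'a \<Rightarrow> 'e::rep \<Rightarrow> 'e list \<Rightarrow> 'b"
  assumes "tm L b" "tm A c" "tm (\<lambda>i z. B i (fst z) (fst (snd z)) (snd (snd z))) d"
  shows "tm (\<lambda>i x. case L i x of [] \<Rightarrow> A i x | h # t \<Rightarrow> B i x h t)
    (\<lambda>i x. b i x + (case L i x of [] \<Rightarrow> c i x | h # t \<Rightarrow> d i (x, h, t)))"
  using tm_comp[OF tm_pair[OF tm_id assms(1)] tm_case0[OF assms(2,3)]]
  by (simp only: fst_conv snd_conv add_0)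

text \<open>The cost of a step may depend on the accumulator, so it is summed along the actual run
  of the fold. The extra 1 per element covers the loop overhead.\<close>

primrec fold_cost :: "('a \<Rightarrow> 'e \<Rightarrow> nat) \<Rightarrow> ('a \<Rightarrow> 'e \<Rightarrow> 'a) \<Rightarrow> 'a \<Rightarrow> 'e list \<Rightarrow> nat" where
  "fold_cost c g a [] = 0"
| "fold_cost c g a (e # es) = c a e + 1 + fold_cost c g (g a e) es"

lemma tm_foldl [tm_rules]:
  fixes g :: "input \<Rightarrow> 'a::rep \<Rightarrow> 'b::rep \<Rightarrow> 'e::rep \<Rightarrow> 'b"
  assumes g: "tm (\<lambda>i z. g i (fst z) (fst (snd z)) (snd (snd z))) c" and "tm A d" "tm L e"
  shows "tm (\<lambda>i x. foldl (g i x) (A i x) (L i x))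
    (\<lambda>i x. d i x + e i x + fold_cost (\<lambda>a h. c i (x, a, h)) (g i x) (A i x) (L i x))"
proof -
  have test: "tm (\<lambda>i (z :: 'a \<times> 'b \<times> 'e list). case snd (snd z) of [] \<Rightarrow> False | h # t \<Rightarrow> True) (\<lambda>_ _. 0)"
    by (rule tm_le, (rule tm_rules)+) (auto split: list.splits)
  have body: "tm (\<lambda>i (z :: 'a \<times> 'b \<times> 'e list). case snd (snd z) of [] \<Rightarrow> z
      | h # t \<Rightarrow> (fst z, g i (fst z) (fst (snd z)) h, t))
    (\<lambda>i z. case snd (snd z) of [] \<Rightarrow> 0 | h # t \<Rightarrow> c i (fst z, fst (snd z), h))"
    by (rule tm_le, (rule tm_rules tm_fun3[OF g])+) (auto split: list.splits)
  have start: "tm (\<lambda>i x. (x, A i x, L i x)) (\<lambda>i x. d i x + e i x)"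
    by (rule tm_le, (rule tm_rules assms)+) auto
  have "tm (\<lambda>i x. (\<lambda>i z. (fst z, foldl (g i (fst z)) (fst (snd z)) (snd (snd z)), [] :: 'e list))
         i ((\<lambda>i x. (x, A i x, L i x)) i x))
    (\<lambda>i x. d i x + e i x + (\<lambda>i z. fold_cost (\<lambda>a h. c i (fst z, a, h)) (g i (fst z)) (fst (snd z)) (snd (snd z)))
       i ((\<lambda>i x. (x, A i x, L i x)) i x))"
    by (rule tm_while[OF test body start, of "\<lambda>_ _. True"]) (auto split: list.splits)
  then have "tm (\<lambda>i x. (x, foldl (g i x) (A i x) (L i x), [] :: 'e list))
    (\<lambda>i x. d i x + e i x + fold_cost (\<lambda>a h. c i (x, a, h)) (g i x) (A i x) (L i x))" by simp
  from tm_fst[OF tm_snd[OF this]] show ?thesis by simp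
qed

lemma fold_cost_le:
  assumes "\<And>a e. e \<in> set es \<Longrightarrow> c a e \<le> k e"
  shows "fold_cost c g a es \<le> (\<Sum>e\<leftarrow>es. k e + 1)"
  using assms
proof (induction es arbitrary: a)
  case (Cons e es)
  have "c a e \<le> k e" "fold_cost c g (g a e) es \<le> (\<Sum>e\<leftarrow>es. k e + 1)"
    using Cons.prems Cons.IH by auto
  then show ?case by simp
qed simp

lemma fold_cost_const_le:
  assumes "\<And>a e. e \<in> set es \<Longrightarrow> c a e \<le> k"
  shows "fold_cost c g a es \<le> length es * (k + 1)"
  using fold_cost_le[of es c "\<lambda>_. k" g a] assms by (simp add: sum_list_triv)

lemma fold_cost_0 [simp]: "fold_cost (\<lambda>_ _. 0) g a es = length es"
  by (induction es arbitrary: a) auto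

text \<open>Amortized analysis: a step may cost more than its share \<open>k e\<close> if it
  releases the difference from the potential \<Phi>.\<close>

lemma fold_cost_pot:
  assumes "I a" "\<And>a e. I a \<Longrightarrow> e \<in> set es \<Longrightarrow> I (g a e) \<and> c a e + \<Phi> (g a e) \<le> \<Phi> a + k e"
  shows "fold_cost c g a es + \<Phi> (foldl g a es) \<le> \<Phi> a + (\<Sum>e\<leftarrow>es. k e + 1)"
  using assms
proof (induction es arbitrary: a)
  case (Cons e es)
  have 1: "I (g a e)" "c a e + \<Phi> (g a e) \<le> \<Phi> a + k e" using Cons.prems by auto
  have "fold_cost c g (g a e) es + \<Phi> (foldl g (g a e) es) \<le> \<Phi> (g a e) + (\<Sum>e\<leftarrow>es. k e + 1)"
    using Cons.IH[OF 1(1)] Cons.prems by auto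
  then show ?case using 1(2) by simp
qed simp

lemma case_list_same [simp]: "(case xs of [] \<Rightarrow> k | x # y \<Rightarrow> k) = k"
  by (simp split: list.splits)

lemma tm_length [tm_rules]:
  assumes "tm F c"
  shows "tm (\<lambda>i x. length (F i x :: 'e::rep list)) (\<lambda>i x. c i x + length (F i x))"
proof -
  have "foldl (\<lambda>a (_ :: 'e). Suc a) n xs = length xs + n" for n xs
    by (induction xs arbitrary: n) auto
  then have *: "length xs = foldl (\<lambda>a (_ :: 'e). Suc a) 0 xs" for xs by simp
  show ?thesis unfolding *
    by (rule tm_le, (rule tm_rules assms)+) (simp add: *[symmetric])
qed

definition rev_append :: "'e list \<Rightarrow> 'e list \<Rightarrow> 'e list" where
  "rev_append xs ys = foldl (\<lambda>a x. x # a) ys xs"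

lemma rev_append: "rev_append xs ys = rev xs @ ys"
  unfolding rev_append_def by (induction xs arbitrary: ys) auto

lemma tm_rev_append [tm_rules]:
  assumes "tm F c" "tm G d"
  shows "tm (\<lambda>i x. rev_append (F i x :: 'e::rep list) (G i x)) (\<lambda>i x. c i x + d i x + length (F i x))"
  unfolding rev_append_def by (rule tm_le, (rule tm_rules assms)+) simp

lemma tm_rev [tm_rules]:
  assumes "tm F c"
  shows "tm (\<lambda>i x. rev (F i x :: 'e::rep list)) (\<lambda>i x. c i x + length (F i x))"
proof -
  have "tm (\<lambda>i x. rev_append (F i x) []) (\<lambda>i x. c i x + length (F i x))"
    by (rule tm_le, (rule tm_rules assms)+) simp
  then show ?thesis by (simp add: rev_append)
qed

lemma tm_append [tm_rules]:
  assumes "tm F c" "tm G d"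
  shows "tm (\<lambda>i x. (F i x :: 'e::rep list) @ G i x) (\<lambda>i x. c i x + d i x + length (F i x))"
proof -
  have "tm (\<lambda>i x. rev_append (rev (F i x)) (G i x)) (\<lambda>i x. c i x + d i x + length (F i x))"
    by (rule tm_weaken[where k = 2], (rule tm_rules assms)+) simp
  then show ?thesis by (simp add: rev_append)
qed

lemma tm_map [tm_rules]:
  fixes g :: "input \<Rightarrow> 'a::rep \<Rightarrow> 'e::rep \<Rightarrow> 'b::rep"
  assumes "tm (\<lambda>i z. g i (fst z) (snd z)) c" "tm L d"
  shows "tm (\<lambda>i x. map (g i x) (L i x))
    (\<lambda>i x. d i x + (\<Sum>e\<leftarrow>L i x. c i (x, e) + 1))"
proof -
  have *: "map f xs = rev (foldl (\<lambda>a e. f e # a) [] xs)" for f :: "'e \<Rightarrow> 'b" and xs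
  proof -
    have "foldl (\<lambda>a e. f e # a) ys xs = rev (map f xs) @ ys" for ys
      by (induction xs arbitrary: ys) auto
    then show ?thesis by simp
  qed
  show ?thesis unfolding *
  proof (rule tm_weaken[where k = 2], (rule tm_rules tm_fun2[OF assms(1)] assms(2))+)
    fix i x
    have "length xs \<le> (\<Sum>e\<leftarrow>xs. c i (x, e) + 1)" for xs by (induction xs) auto
    then have "length (L i x) \<le> (\<Sum>e\<leftarrow>L i x. c i (x, e) + 1)" .
    moreover have "fold_cost (\<lambda>a e. c i (x, e)) (\<lambda>a e. g i x e # a) [] (L i x) \<le> (\<Sum>e\<leftarrow>L i x. c i (x, e) + 1)"
      by (rule fold_cost_le) simp
    ultimately show "0 + d i x + fold_cost
          (\<lambda>a h. 0 + (0 :: nat) + c i (fst (x, a, h), snd (snd (x, a, h))) + 0)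
          (\<lambda>a e. g i x e # a) [] (L i x) + length (foldl (\<lambda>a e. g i x e # a) [] (L i x))
        \<le> 2 * (1 + (d i x + (\<Sum>e\<leftarrow>L i x. c i (x, e) + 1)))"
      by (simp add: *[of "g i x" "L i x", symmetric, THEN arg_cong[of _ _ length], simplified])
  qed
qed

lemma tm_upt [tm_rules]:
  assumes "tm F c"
  shows "tm (\<lambda>i x. [0..<F i x]) (\<lambda>i x. c i x + F i x)"
proof -
  have "tm (\<lambda>i x. (\<lambda>_ z. (0 :: nat, [0..<fst z] @ snd z)) i ((\<lambda>i x. (F i x, [] :: nat list)) i x))
    (\<lambda>i x. c i x + (\<lambda>_ z. fst z) i ((\<lambda>i x. (F i x, [] :: nat list)) i x))"
  proof (rule tm_while[where B = "\<lambda>_ z. 0 < fst z" and S = "\<lambda>_ z. (fst z - 1, (fst z - 1) # snd z)"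
        and I = "\<lambda>_ _. True" and b = "\<lambda>_ _. 0" and s = "\<lambda>_ _. 0"])
    show "tm (\<lambda>_ (z :: nat \<times> nat list). 0 < fst z) (\<lambda>_ _. 0)"
      by (rule tm_le, (rule tm_rules)+) simp
    show "tm (\<lambda>_ (z :: nat \<times> nat list). (fst z - 1, (fst z - 1) # snd z)) (\<lambda>_ _. 0)"
      by (rule tm_le, (rule tm_rules)+) simp
    show "tm (\<lambda>i x. (F i x, [] :: nat list)) c"
      by (rule tm_le, (rule tm_rules assms)+) simp
  next
    fix z :: "nat \<times> nat list"
    assume "0 < fst z"
    then obtain k where "fst z = Suc k" by (cases "fst z") auto
    then show "True \<and> (0 :: nat, [0..<fst z] @ snd z) =
        (0, [0..<fst (fst z - 1, (fst z - 1) # snd z)] @ snd (fst z - 1, (fst z - 1) # snd z)) \<and>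
        0 + 0 + 1 + fst (fst z - 1, (fst z - 1) # snd z) \<le> fst z"
      by simp
  qed auto
  from tm_snd[OF this] show ?thesis by simp
qed


section \<open>From functions to programs\<close>

text \<open>
  The result list holds the final contents of the addresses \<open>n + 7, \<dots>, 3, 2, 0, 1\<close> in this
  order: the registers are overwritten last, starting with those that are no longer needed.
\<close>

definition out_tail :: "instr list" where
  "out_tail = concat (map (\<lambda>d. [Load d 0, Add 0 0 1, Load 0 0]) [7, 6, 5, 4, 3, 2]) @
     [Add 1 0 1, Load 0 0, Load 1 1, Load 1 1]"

text \<open>The cells are filled from address \<open>c + 7\<close> down to 8. The list being read
  lies at or above \<open>lo\<close>, beyond these cells, and the registers lie below 8, so the
  writes disturb neither.\<close>

lemma out_loop:
  assumes "placed P k (Jump_If_Zero 4 (k + 10) # [Const 5 7, Add 5 4 5, Load 6 0, Store 5 6, Add 0 0 1,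
     Load 0 0, Sub 4 4 1, Const 5 0] @ [Jump_If_Zero 5 k])"
    and "M 4 = c" "length l = c + 8" "rep M lo hi (M 0) l" "M 1 = 1" "c + 8 \<le> lo"
  shows "\<exists>t M'. t \<le> 10 * c + 1 \<and> runs P inp t (k, M) (k + 10, M') \<and> M' 1 = 1 \<and>
     rep M' lo hi (M' 0) (drop c l) \<and> (\<forall>j<c. M' (c + 7 - j) = l ! j) \<and>
     (\<forall>a\<ge>c + 8. M' a = M a)"
  using assms(2-)
proof (induction c arbitrary: M l)
  case 0
  have "runs P inp 1 (k, M) (k + 10, M)"
    by (rule runs_jump_zero[where a = 4]) (use assms(1) 0 in auto)
  then show ?case using 0 by (intro exI[of _ 1] exI[of _ M]) auto
next
  case (Suc c)
  let ?body = "[Const 5 7, Add 5 4 5, Load 6 0, Store 5 6, Add 0 0 1, Load 0 0, Sub 4 4 1, Const 5 0]"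
  obtain x l' where l: "l = x # l'" using Suc.prems(2) by (cases l) auto
  have pl: "placed P k [Jump_If_Zero 4 (k + 10)]" "placed P (Suc k) ?body"
    "placed P (k + 9) [Jump_If_Zero 5 k]"
    using assms(1) by (simp_all add: numeral_eq_Suc)
  have M0: "lo \<le> M 0" "Suc (M 0) < hi" "M (M 0) = x" "rep M lo hi (M (Suc (M 0))) l'"
    using Suc.prems(3) by (simp_all add: l rep_nat_def)
  have r1: "runs P inp 1 (k, M) (Suc k, M)"
    by (rule runs_jump_nonzero[OF pl(1)]) (use Suc.prems in auto)
  let ?M = "M(6 := x, c + 8 := x, 0 := M (Suc (M 0)), 4 := c, 5 := 0)"
  have r2: "runs P inp 8 (Suc k, M) (k + 9, ?M)"
    by (rule runs_block[OF pl(2)]) (use M0(1,3) Suc.prems(1,4,5) in \<open>auto simp: fun_eq_iff\<close>)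
  have r3: "runs P inp 1 (k + 9, ?M) (k, ?M)"
    by (rule runs_jump_zero[OF pl(3)]) simp
  have rp: "rep ?M lo hi (?M 0) l'"
    by (rule rep_mono[where M = M]) (use M0(4) Suc.prems(5) in auto)
  have "length l' = c + 8" "?M 4 = c" "?M 1 = 1" "c + 8 \<le> lo"
    using Suc.prems by (auto simp: l)
  from Suc.IH[OF this(2) this(1) rp this(3) this(4)] obtain t M' where
    IH: "t \<le> 10 * c + 1" "runs P inp t (k, ?M) (k + 10, M')" "M' 1 = 1"
     "rep M' lo hi (M' 0) (drop c l')" "\<forall>j<c. M' (c + 7 - j) = l' ! j"
     "\<forall>a\<ge>c + 8. M' a = ?M a" by blast
  have "runs P inp (1 + 8 + 1 + t) (k, M) (k + 10, M')"
    using runs_trans[OF runs_trans[OF runs_trans[OF r1 r2] r3] IH(2)] .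
  moreover have "\<forall>j<Suc c. M' (Suc c + 7 - j) = l ! j"
  proof (intro allI impI)
    fix j assume "j < Suc c"
    show "M' (Suc c + 7 - j) = l ! j"
    proof (cases j)
      case 0
      then show ?thesis using IH(6) by (auto simp: l)
    next
      case (Suc m)
      then have "Suc c + 7 - j = c + 7 - m" by simp
      then show ?thesis using IH(5) \<open>j < Suc c\<close> Suc by (simp add: l)
    qed
  qed
  ultimately show ?case using IH(1,3,4,6)
    by (intro exI[of _ "1 + 8 + 1 + t"] exI[of _ M']) (auto simp: l)
qed

lemma out_step:
  fixes inp :: input
  assumes "rep M lo hi (M 0) (x # l)" "M 1 = 1" "8 \<le> lo" "2 \<le> d" "d < 8"
  defines "M' \<equiv> exec_all inp [Load d 0, Add 0 0 1, Load 0 0] M"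
  shows "rep M' lo hi (M' 0) l" "M' 1 = 1" "M' d = x" "\<forall>a. a \<noteq> 0 \<and> a \<noteq> d \<longrightarrow> M' a = M a"
proof -
  have M0: "lo \<le> M 0" "Suc (M 0) < hi" "M (M 0) = x" "rep M lo hi (M (Suc (M 0))) l"
    using assms(1) by (simp_all add: rep_nat_def)
  have M': "M' = M(d := x, 0 := M (Suc (M 0)))"
    using M0(1,3) assms(2-5) unfolding M'_def by (auto simp: fun_eq_iff)
  show "M' 1 = 1" "M' d = x" "\<forall>a. a \<noteq> 0 \<and> a \<noteq> d \<longrightarrow> M' a = M a"
    using assms(2-5) unfolding M' by auto
  have "rep M' lo hi (M (Suc (M 0))) l"
    by (rule rep_mono[OF M0(4)]) (use assms(2-5) in \<open>auto simp: M'\<close>)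
  then show "rep M' lo hi (M' 0) l" by (simp add: M')
qed

lemma out_last:
  fixes inp :: input
  assumes "rep M lo hi (M 0) [x, y]" "M 1 = 1" "8 \<le> lo"
  defines "M' \<equiv> exec_all inp [Add 1 0 1, Load 0 0, Load 1 1, Load 1 1] M"
  shows "M' 0 = x" "M' 1 = y" "\<forall>a\<ge>2. M' a = M a"
  using assms(1-3) unfolding M'_def by (auto simp: rep_nat_def)

lemma out_tail:
  fixes inp :: input
  assumes "rep M lo hi (M 0) [x7, x6, x5, x4, x3, x2, x0, x1]" "M 1 = 1" "8 \<le> lo"
  defines "M' \<equiv> exec_all inp out_tail M"
  shows "M' 0 = x0" "M' 1 = x1" "M' 2 = x2" "M' 3 = x3" "M' 4 = x4" "M' 5 = x5" "M' 6 = x6"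
    "M' 7 = x7" "\<forall>a\<ge>8. M' a = M a"
proof -
  define s where "s d M = exec_all inp [Load d 0, Add 0 0 1, Load 0 0] M" for d M
  define M7 where "M7 = s 7 M"
  define M6 where "M6 = s 6 M7"
  define M5 where "M5 = s 5 M6"
  define M4 where "M4 = s 4 M5"
  define M3 where "M3 = s 3 M4"
  define M2 where "M2 = s 2 M3"
  have M': "M' = exec_all inp [Add 1 0 1, Load 0 0, Load 1 1, Load 1 1] M2"
    unfolding M'_def M2_def M3_def M4_def M5_def M6_def M7_def s_def out_tail_def
    by (simp del: mem_exec.simps)
  have d: "(2 :: nat) \<le> 7" "(7 :: nat) < 8" "(2 :: nat) \<le> 6" "(6 :: nat) < 8" "(2 :: nat) \<le> 5"
    "(5 :: nat) < 8" "(2 :: nat) \<le> 4" "(4 :: nat) < 8" "(2 :: nat) \<le> 3" "(3 :: nat) < 8"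
    "(2 :: nat) \<le> 2" "(2 :: nat) < 8" by simp_all
  note s7 = out_step[OF assms(1-2) assms(3) d(1,2), of inp, folded s_def, folded M7_def]
  note s6 = out_step[OF s7(1,2) assms(3) d(3,4), of inp, folded s_def, folded M6_def]
  note s5 = out_step[OF s6(1,2) assms(3) d(5,6), of inp, folded s_def, folded M5_def]
  note s4 = out_step[OF s5(1,2) assms(3) d(7,8), of inp, folded s_def, folded M4_def]
  note s3 = out_step[OF s4(1,2) assms(3) d(9,10), of inp, folded s_def, folded M3_def]
  note s2 = out_step[OF s3(1,2) assms(3) d(11,12), of inp, folded s_def, folded M2_def]
  note s1 = out_last[OF s2(1,2) assms(3), of inp, folded M']
  show "M' 0 = x0" "M' 1 = x1" "M' 2 = x2" "M' 3 = x3" "M' 4 = x4" "M' 5 = x5" "M' 6 = x6"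
    "M' 7 = x7" "\<forall>a\<ge>8. M' a = M a"
    using s1 s2(3,4) s3(3,4) s4(3,4) s5(3,4) s6(3,4) s7(3,4) by auto
qed

lemma length_8:
  assumes "length l = 8"
  obtains a b c d e f g h where "l = [a, b, c, d, e, f, g, h]"
  using assms by (auto simp: numeral_eq_Suc length_Suc_conv)

text \<open>The cells 0 to 7 are at once output cells and working registers, so a straight-line tail
  has to write them. The eight surplus entries of the result make this tail the same for every
  number of elements, also below 8.\<close>

theorem program_of_tm:
  fixes F :: "input \<Rightarrow> nat \<Rightarrow> nat list"
  assumes tm: "tm F c" and len: "\<And>i. valid_input i \<Longrightarrow> length (F i 0) = i Num_Elements 0 0 + 8"
  obtains P K where "\<And>i. valid_input i \<Longrightarrow> \<exists>t M. t \<le> K * (1 + c i 0 + i Num_Elements 0 0) \<and>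
     (\<forall>s\<ge>t. run P i s = return_pmf (length P, M)) \<and>
     (\<forall>a. 2 \<le> a \<longrightarrow> a < i Num_Elements 0 0 + 8 \<longrightarrow> M a = F i 0 ! (i Num_Elements 0 0 + 7 - a)) \<and>
     M 0 = F i 0 ! (i Num_Elements 0 0 + 6) \<and> M 1 = F i 0 ! (i Num_Elements 0 0 + 7)"
proof -
  obtain f nf K where lf: "\<And>k. length (f k) = nf" and uf: "\<And>k. \<forall>i \<in> set (f k). \<not> is_flip i"
    and f: "computes f F (\<lambda>inp x. K * (1 + c inp x))"
    by (rule tmE[OF tm]) (blast intro: that)
  define init where "init = [Const 1 1, Read 4 Num_Elements 5 5, Const 5 8, Add 2 4 5]"
  define mid where "mid = [Const 5 0, Read 4 Num_Elements 5 5]"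
  let ?k = "nf + 6"
  define loop where "loop = Jump_If_Zero 4 (?k + 10) # [Const 5 7, Add 5 4 5, Load 6 0, Store 5 6, Add 0 0 1,
     Load 0 0, Sub 4 4 1, Const 5 0] @ [Jump_If_Zero 5 ?k]"
  define P where "P = init @ f 4 @ mid @ loop @ out_tail"
  have lt: "length out_tail = 22" "\<forall>i \<in> set out_tail. \<not> is_jump i" "\<forall>i \<in> set out_tail. \<not> is_flip i"
    by (auto simp: out_tail_def)
  have ln: "length init = 4" "length mid = 2" "length loop = 10"
    by (simp_all add: init_def mid_def loop_def)
  have lP: "length P = nf + 38" by (simp add: P_def lf lt ln)
  have nfl: "\<forall>i \<in> set P. \<not> is_flip i"
    using uf lt by (auto simp: P_def init_def mid_def loop_def)
  have pl: "placed P 0 init" "placed P 4 (f 4)" "placed P (4 + nf) mid" "placed P ?k loop"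
     "placed P (?k + 10) out_tail"
  proof -
    have "placed P 0 P" using placed_middle[of "[]" P "[]"] by simp
    then have a: "placed P 0 (init @ f 4 @ mid @ loop @ out_tail)"
      unfolding P_def .
    show "placed P 0 init" "placed P 4 (f 4)" "placed P (4 + nf) mid" "placed P ?k loop"
     "placed P (?k + 10) out_tail"
      using a by (simp_all add: lf ln placed_append add_ac)
  qed
  have "\<exists>t M. t \<le> (K + 60) * (1 + c i 0 + i Num_Elements 0 0) \<and>
     (\<forall>s\<ge>t. run P i s = return_pmf (length P, M)) \<and>
     (\<forall>a. 2 \<le> a \<longrightarrow> a < i Num_Elements 0 0 + 8 \<longrightarrow> M a = F i 0 ! (i Num_Elements 0 0 + 7 - a)) \<and>
     M 0 = F i 0 ! (i Num_Elements 0 0 + 6) \<and> M 1 = F i 0 ! (i Num_Elements 0 0 + 7)"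
    if v: "valid_input i" for i
  proof -
    define n where "n = i Num_Elements 0 0"
    \<comment> \<open>The heap starts just above the output cells
      \<open>0, ..., n + 7\<close>.\<close>
    define lo where "lo = n + 8"
    let ?M1 = "(\<lambda>_ :: nat. 0 :: nat)(1 := 1, 4 := n, 5 := 8, 2 := lo)"
    have r1: "runs P i 4 (0, \<lambda>_. 0) (4, ?M1)"
      by (rule runs_block[OF pl(1)]) (auto simp: init_def fun_eq_iff lo_def n_def)
    have ok1: "heap_ok lo ?M1" "rep ?M1 lo (?M1 2) (?M1 0) (0 :: nat)"
      by (auto simp: heap_ok_def lo_def rep_nat_def)
    obtain t M2 where 2: "t \<le> K * (1 + c i 0)" "runs P i t (4, ?M1) (4 + nf, M2)"
      "heap_ext lo ?M1 M2" "rep M2 lo (M2 2) (M2 0) (F i 0)"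
      by (rule computesD[OF f v pl(2) ok1 lf])
    let ?M3 = "M2(5 := 0, 4 := n)"
    have r3: "runs P i 2 (4 + nf, M2) (?k, ?M3)"
      by (rule runs_block[OF pl(3)]) (auto simp: mid_def fun_eq_iff n_def)
    have M2: "M2 1 = 1" "8 \<le> lo" using 2(3) by (auto simp: heap_ext_def heap_ok_def)
    have rp3: "rep ?M3 lo (M2 2) (?M3 0) (F i 0)"
      by (rule rep_mono[where M = M2]) (use 2(4) M2 in auto)
    obtain u M4 where 4: "u \<le> 10 * n + 1" "runs P i u (?k, ?M3) (?k + 10, M4)" "M4 1 = 1"
      "rep M4 lo (M2 2) (M4 0) (drop n (F i 0))" "\<forall>j<n. M4 (n + 7 - j) = F i 0 ! j"
      using out_loop[OF pl(4)[unfolded loop_def], of ?M3 n "F i 0" lo "M2 2" i] rp3 M2(1) len[OF v]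
      by (auto simp: n_def lo_def)
    obtain x7 x6 x5 x4 x3 x2 x0 x1 where x: "drop n (F i 0) = [x7, x6, x5, x4, x3, x2, x0, x1]"
      by (rule length_8[of "drop n (F i 0)"]) (use len[OF v] in \<open>auto simp: n_def\<close>)
    define M5 where "M5 = exec_all i out_tail M4"
    have r5: "runs P i 22 (?k + 10, M4) (length P, M5)"
      by (rule runs_block[OF pl(5) lt(2)]) (auto simp: M5_def lP lt)
    note o = out_tail[OF 4(4)[unfolded x] 4(3) M2(2), of i, folded M5_def]
    let ?T = "4 + t + 2 + u + 22"
    have R: "runs P i ?T (0, \<lambda>_. 0) (length P, M5)"
      using runs_trans[OF runs_trans[OF runs_trans[OF runs_trans[OF r1 2(2)] r3] 4(2)] r5] .
    have "run P i s = return_pmf (length P, M5)" if "?T \<le> s" for s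
    proof -
      obtain d where s: "s = d + ?T" using \<open>?T \<le> s\<close> by (metis add.commute le_Suc_ex)
      have "(det_step P i ^^ s) (0, \<lambda>_. 0) = (det_step P i ^^ d) (length P, M5)"
        using R unfolding s runs_def by (simp add: funpow_add del: funpow.simps)
      then show ?thesis
        by (simp add: run_def run_from_det[OF nfl] det_step_halted halted_def)
    qed
    moreover have "?T \<le> (K + 60) * (1 + c i 0 + n)" using 2(1) 4(1) by (simp add: algebra_simps)
    moreover have nth: "F i 0 ! (n + j) = [x7, x6, x5, x4, x3, x2, x0, x1] ! j" if "j < 8" for j
      using x len[OF v] that by (metis n_def le_add1 nth_drop)
    have "M5 a = F i 0 ! (n + 7 - a)" if a: "2 \<le> a" "a < n + 8" for a
    proof (cases "a < 8")
      case True
      then have "a \<in> {2, 3, 4, 5, 6, 7}" using a by auto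
      then show ?thesis
        using o nth[of 0] nth[of 1] nth[of 2] nth[of 3] nth[of 4] nth[of 5]
        by (auto simp: add.commute)
    next
      case False
      then have "M5 a = M4 a" using o(9) by auto
      moreover have "n + 7 - (n + 7 - a) = a" "n + 7 - a < n" using False a by auto
      ultimately show ?thesis using 4(5) by metis
    qed
    moreover have "M5 0 = F i 0 ! (n + 6)" "M5 1 = F i 0 ! (n + 7)"
      using o nth[of 6] nth[of 7] by auto
    ultimately show ?thesis unfolding n_def by blast
  qed
  then show thesis using that by blast
qed

section \<open>Arithmetic, lists and sorting as machine routines\<close>

section \<open>Arithmetic\<close>

text \<open>Repeated addition, since the machine cannot multiply. The cost is the first factor,
  which explains the order of the factors in later products.\<close>

lemma tm_mult [tm_rules]:
  assumes "tm F c" "tm G d"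
  shows "tm (\<lambda>i x. F i x * G i x :: nat) (\<lambda>i x. c i x + d i x + F i x)"
proof -
  have "foldl (\<lambda>a _. a + y) b [0..<x] = b + x * y" for b x y :: nat
    by (induction x arbitrary: b) (auto simp: algebra_simps)
  then have *: "x * y = foldl (\<lambda>a _. a + y) 0 [0..<x]" for x y :: nat by simp
  have g: "tm (\<lambda>i (z :: nat \<times> nat). foldl (\<lambda>a _. a + snd z) 0 [0..<fst z]) (\<lambda>i z. fst z)"
    by (rule tm_weaken[where k = 2], (rule tm_rules)+) simp
  show ?thesis unfolding *
    by (rule tm_le[OF tm_fun2[OF g assms]]) simp
qed

lemma tm_pow2 [tm_rules]:
  assumes "tm F c"
  shows "tm (\<lambda>i x. 2 ^ F i x :: nat) (\<lambda>i x. c i x + F i x)"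
proof -
  have "foldl (\<lambda>a _. a + a) b [0..<x] = b * 2 ^ x" for b x :: nat
    by (induction x arbitrary: b) (auto simp: algebra_simps)
  then have *: "2 ^ x = foldl (\<lambda>a _. a + a) (1 :: nat) [0..<x]" for x :: nat by simp
  show ?thesis unfolding *
    by (rule tm_weaken[where k = 2], (rule tm_rules assms)+) simp
qed

lemma tm_min [tm_rules]:
  assumes "tm F c" "tm G d"
  shows "tm (\<lambda>i x. min (F i x) (G i x) :: nat) (\<lambda>i x. c i x + d i x)"
  unfolding min_def by (rule tm_weaken[where k = 2], (rule tm_rules assms)+) auto

text \<open>Linear search from 0. The test has to be cheap only up to the answer, which matters when
  it computes \<open>2 ^ k\<close> or \<open>k * b\<close>.\<close>

lemma tm_search:
  fixes P :: "input \<Rightarrow> 'a::rep \<Rightarrow> nat \<Rightarrow> bool"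
  assumes P: "tm (\<lambda>i z. P i (fst z) (snd z)) (\<lambda>i z. d i (fst z) (snd z))"
    and ex: "\<And>i x. valid_input i \<Longrightarrow> \<exists>k. P i x k"
    and d: "\<And>i x k. k \<le> (LEAST k. P i x k) \<Longrightarrow> d i x k \<le> e i x"
  shows "tm (\<lambda>i x. LEAST k. P i x k) (\<lambda>i x. ((LEAST k. P i x k) + 1) * (e i x + 1))"
proof -
  let ?l = "\<lambda>i x. LEAST k. P i x k"
  have "tm (\<lambda>i x. (fst (x, 0 :: nat), ?l i (fst (x, 0 :: nat))))
     (\<lambda>i x. 0 + (?l i (fst (x, 0 :: nat)) + 1 - snd (x, 0 :: nat)) * (e i (fst (x, 0 :: nat)) + 1))"
  proof (rule tm_while[where F = "\<lambda>i z. (fst z, ?l i (fst z))" and A = "\<lambda>i x. (x, 0)" and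
        c = "\<lambda>i z. (?l i (fst z) + 1 - snd z) * (e i (fst z) + 1)" and
        B = "\<lambda>i z. \<not> P i (fst z) (snd z)" and S = "\<lambda>i z. (fst z, Suc (snd z))"
        and I = "\<lambda>i z. snd z \<le> ?l i (fst z)" and b = "\<lambda>i z. d i (fst z) (snd z)" and s = "\<lambda>_ _. 0"])
    show "tm (\<lambda>i z. \<not> P i (fst z) (snd z)) (\<lambda>i z. d i (fst z) (snd z))" by (rule tm_not[OF P])
    show "tm (\<lambda>i (z :: 'a \<times> nat). (fst z, Suc (snd z))) (\<lambda>_ _. 0)"
      by (rule tm_le, (rule tm_rules)+) simp
    show "tm (\<lambda>i (x :: 'a). (x, 0 :: nat)) (\<lambda>_ _. 0)"
      by (rule tm_le, (rule tm_rules)+) simp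
  next
    fix i and z :: "'a \<times> nat"
    assume v: "valid_input i" and I: "snd z \<le> ?l i (fst z)" and B: "\<not> P i (fst z) (snd z)"
    have "P i (fst z) (?l i (fst z))" using ex[OF v] by (rule LeastI_ex)
    then have lt: "snd z < ?l i (fst z)" using I B by (cases "snd z = ?l i (fst z)") auto
    then have "?l i (fst z) + 1 - snd z = Suc (?l i (fst z) + 1 - Suc (snd z))" by simp
    then show "snd (fst z, Suc (snd z)) \<le> ?l i (fst (fst z, Suc (snd z))) \<and>
        (fst z, ?l i (fst z)) = (fst (fst z, Suc (snd z)), ?l i (fst (fst z, Suc (snd z)))) \<and>
        d i (fst z) (snd z) + 0 + 1 + (?l i (fst (fst z, Suc (snd z))) + 1 - snd (fst z, Suc (snd z))) *
          (e i (fst (fst z, Suc (snd z))) + 1) \<le> (?l i (fst z) + 1 - snd z) * (e i (fst z) + 1)"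
      using lt d[OF I] by simp
  next
    fix i and z :: "'a \<times> nat"
    assume v: "valid_input i" and I: "snd z \<le> ?l i (fst z)" and B: "\<not> \<not> P i (fst z) (snd z)"
    have "?l i (fst z) \<le> snd z" using B by (intro Least_le) simp
    then show "(fst z, ?l i (fst z)) = z \<and>
        d i (fst z) (snd z) \<le> (?l i (fst z) + 1 - snd z) * (e i (fst z) + 1)"
    proof -
      have "snd z = ?l i (fst z)" using I \<open>?l i (fst z) \<le> snd z\<close> by simp
      then show ?thesis using d[OF I] by (cases z) simp
    qed
  qed simp
  from tm_snd[OF this] show ?thesis by simp
qed

text \<open>The quotient by \<open>b + 1\<close>, rounded up; the shift excludes division by zero,
  and rounding up keeps the parameters computed from it on the safe side.\<close>

definition ceil_div :: "nat \<Rightarrow> nat \<Rightarrow> nat" where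
  "ceil_div a b = (LEAST k. a \<le> k * Suc b)"

lemma ceil_div_ge: "a \<le> ceil_div a b * Suc b"
  unfolding ceil_div_def by (rule LeastI[of _ a]) simp

lemma ceil_div_less: "ceil_div a b * Suc b < a + Suc b"
proof (cases "ceil_div a b")
  case (Suc k)
  then have "\<not> a \<le> k * Suc b" using not_less_Least[of k "\<lambda>k. a \<le> k * Suc b"]
    unfolding ceil_div_def by auto
  then show ?thesis using Suc by simp
qed simp

lemma tm_ceil_div0: "tm (\<lambda>i z. ceil_div (fst z) (snd z)) (\<lambda>i z. (ceil_div (fst z) (snd z) + 1)\<^sup>2)"
proof -
  have "tm (\<lambda>i (x :: nat \<times> nat). LEAST k. fst x \<le> k * Suc (snd x))
    (\<lambda>i x. ((LEAST k. fst x \<le> k * Suc (snd x)) + 1) * ((LEAST k. fst x \<le> k * Suc (snd x)) + 1))"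
  proof (rule tm_search)
    show "tm (\<lambda>i (z :: (nat \<times> nat) \<times> nat). fst (fst z) \<le> snd z * Suc (snd (fst z))) (\<lambda>i z. snd z)"
      by (rule tm_le, (rule tm_rules)+) simp
    show "\<exists>k. fst x \<le> k * Suc (snd x)" for x :: "nat \<times> nat" by (rule exI[of _ "fst x"]) simp
  qed
  then show ?thesis by (simp add: ceil_div_def power2_eq_square)
qed

lemmas tm_ceil_div [tm_rules] = tm_fun2[OF tm_ceil_div0]

definition log_ceil :: "nat \<Rightarrow> nat" where
  "log_ceil n = (LEAST k. n \<le> 2 ^ k)"

lemma log_ceil_ge: "n \<le> 2 ^ log_ceil n"
  unfolding log_ceil_def by (rule LeastI[of _ n]) (simp add: less_imp_le)

lemma tm_log_ceil0: "tm (\<lambda>i n. log_ceil n) (\<lambda>i n. (log_ceil n + 1)\<^sup>2)"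
proof -
  have "tm (\<lambda>i (n :: nat). LEAST k. n \<le> 2 ^ k) (\<lambda>i n. ((LEAST k. n \<le> 2 ^ k) + 1) * ((LEAST k. n \<le> 2 ^ k) + 1))"
  proof (rule tm_search)
    show "tm (\<lambda>i (z :: nat \<times> nat). fst z \<le> 2 ^ snd z) (\<lambda>i z. snd z)"
      by (rule tm_le, (rule tm_rules)+) simp
    show "\<exists>k. n \<le> 2 ^ k" for n :: nat by (rule exI[of _ n]) (simp add: less_imp_le)
  qed
  then show ?thesis by (simp add: log_ceil_def power2_eq_square)
qed

lemmas tm_log_ceil [tm_rules] = tm_fun1[OF tm_log_ceil0]

definition beta_index :: "input \<Rightarrow> nat" where
  "beta_index i = (LEAST k. i Beta k 0 \<noteq> 0)"

lemma tm_beta_index [tm_rules]: "tm (\<lambda>i (x :: 'a::rep). beta_index i) (\<lambda>i x. beta_index i)"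
proof -
  have "tm (\<lambda>i (x :: 'a). LEAST k. i Beta k 0 \<noteq> 0) (\<lambda>i x. ((LEAST k. i Beta k 0 \<noteq> 0) + 1) * (0 + 1))"
  proof (rule tm_search[where d = "\<lambda>_ _ _. 0"])
    show "tm (\<lambda>i (z :: 'a \<times> nat). i Beta (snd z) 0 \<noteq> 0) (\<lambda>i z. 0)"
      by (rule tm_le, (rule tm_rules)+) simp
  qed (auto simp: valid_input_def)
  then have "tm (\<lambda>i (x :: 'a). beta_index i) (\<lambda>i x. beta_index i + 1)" by (simp add: beta_index_def)
  then show ?thesis by (rule tm_weaken[where k = 1]) simp
qed


section \<open>List operations\<close>

lemma tm_split_at:
  fixes L :: "input \<Rightarrow> 'a::rep \<Rightarrow> 'e::rep list"
  assumes "tm F c" "tm L d"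
  shows "tm (\<lambda>i x. (take (F i x) (L i x), drop (F i x) (L i x))) (\<lambda>i x. c i x + d i x + F i x)"
proof -
  let ?s = "\<lambda>a (_ :: nat). case snd a of [] \<Rightarrow> a | h # t \<Rightarrow> (h # fst a, t)"
  have *: "foldl ?s (ys, xs) [0..<k] = (rev (take k xs) @ ys, drop k xs)" for k and xs ys :: "'e list"
  proof (induction k)
    case (Suc k)
    show ?case
    proof (cases "drop k xs")
      case Nil
      then show ?thesis using Suc by simp
    next
      case (Cons h t)
      then have "k < length xs" using Suc_le_eq by fastforce
      then have "take (Suc k) xs = take k xs @ [h]" "drop (Suc k) xs = t"
        using Cons by (metis Cons_nth_drop_Suc list.inject take_Suc_conv_app_nth)+
      then show ?thesis using Suc Cons by simp
    qed
  qed simp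
  have "tm (\<lambda>i x. let p = foldl ?s ([], L i x) [0..<F i x] in (rev (fst p), snd p))
    (\<lambda>i x. c i x + d i x + F i x)"
    by (rule tm_weaken[where k = 3], (rule tm_rules assms)+)
       (auto simp: *)
  then show ?thesis by (simp add: * Let_def)
qed

lemma tm_take [tm_rules]:
  assumes "tm F c" "tm L d"
  shows "tm (\<lambda>i x. take (F i x) (L i x :: 'e::rep list)) (\<lambda>i x. c i x + d i x + F i x)"
  using tm_fst[OF tm_split_at[OF assms]] by simp

lemma tm_drop [tm_rules]:
  assumes "tm F c" "tm L d"
  shows "tm (\<lambda>i x. drop (F i x) (L i x :: 'e::rep list)) (\<lambda>i x. c i x + d i x + F i x)"
  using tm_snd[OF tm_split_at[OF assms]] by simp

lemma tm_eq_pairs [tm_rules]: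
  fixes F G :: "input \<Rightarrow> 'a::rep \<Rightarrow> (nat \<times> nat) list"
  assumes "tm F c" "tm G d"
  shows "tm (\<lambda>i x. F i x = G i x) (\<lambda>i x. c i x + d i x + length (F i x))"
proof -
  let ?s = "\<lambda>a x. case snd a of [] \<Rightarrow> (False, []) | h # t \<Rightarrow>
     (fst a \<and> fst x = fst h \<and> snd x = snd h, t)"
  have False: "\<not> fst (foldl ?s (False, ys) xs)" for xs ys :: "(nat \<times> nat) list"
    by (induction xs arbitrary: ys) (auto split: list.splits)
  have *: "(case snd (foldl ?s (True, ys) xs) of [] \<Rightarrow> fst (foldl ?s (True, ys) xs) | h # t \<Rightarrow> False)
      = (xs = ys)" for xs ys :: "(nat \<times> nat) list"
  proof (induction xs arbitrary: ys)
    case (Cons x xs)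
    show ?case
    proof (cases ys)
      case Nil
      then show ?thesis using False[of "[]" xs] by (auto split: list.splits)
    next
      case (Cons y t)
      then show ?thesis using Cons.IH[of t] False[of t xs]
        by (cases "x = y") (auto simp: prod_eq_iff split: list.splits)
    qed
  qed (auto split: list.splits)
  have "tm (\<lambda>i x. let p = foldl ?s (True, G i x) (F i x) in
      case snd p of [] \<Rightarrow> fst p | h # t \<Rightarrow> False) (\<lambda>i x. c i x + d i x + length (F i x))"
    by (rule tm_weaken[where k = 3], (rule tm_rules assms)+)
       (auto simp: *)
  then show ?thesis by (simp add: * Let_def)
qed

text \<open>A dropping loop with a budget, of which it returns the rest. The downward scan of a
  level rereads old records and cannot be amortized, so fuel pays for it and it must stop when the
  fuel is gone. A returned budget of 0 is later recognized as an abort.\<close>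

fun drop_limited :: "nat \<Rightarrow> ('e \<Rightarrow> bool) \<Rightarrow> 'e list \<Rightarrow> nat \<times> 'e list" where
  "drop_limited (Suc k) P (x # xs) = (if P x then drop_limited k P xs else (Suc k, x # xs))"
| "drop_limited k P xs = (k, xs)"

lemma drop_limited_le: "fst (drop_limited k P xs) \<le> k"
  by (induction k P xs rule: drop_limited.induct) auto

lemma tm_drop_limited:
  fixes P :: "input \<Rightarrow> 'a::rep \<Rightarrow> 'e::rep \<Rightarrow> bool"
  assumes P: "tm (\<lambda>i z. P i (fst z) (snd z)) (\<lambda>_ _. 0)" and "tm F c" "tm L d"
  shows "tm (\<lambda>i x. drop_limited (F i x) (P i x) (L i x))
    (\<lambda>i x. c i x + d i x + (F i x - fst (drop_limited (F i x) (P i x) (L i x))))"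
proof -
  let ?r = "\<lambda>i z. drop_limited (fst (snd z)) (P i (fst z)) (snd (snd z))"
  let ?S = "\<lambda>z :: 'a \<times> nat \<times> 'e list. (fst z, fst (snd z) - 1, case snd (snd z) of [] \<Rightarrow> [] | h # t \<Rightarrow> t)"
  have "tm (\<lambda>i x. (\<lambda>i z. (fst z, ?r i z)) i ((\<lambda>i x. (x, F i x, L i x)) i x))
     (\<lambda>i x. c i x + d i x + (\<lambda>i z. fst (snd z) - fst (?r i z)) i ((\<lambda>i x. (x, F i x, L i x)) i x))"
  proof (rule tm_while[where I = "\<lambda>_ _. True" and b = "\<lambda>_ _. 0" and s = "\<lambda>_ _. 0" and
        B = "\<lambda>i z. 0 < fst (snd z) \<and> (case snd (snd z) of [] \<Rightarrow> False | h # t \<Rightarrow> P i (fst z) h)" and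
        S = "\<lambda>i z. (fst z, fst (snd z) - 1, case snd (snd z) of [] \<Rightarrow> [] | h # t \<Rightarrow> t)"])
    show "tm (\<lambda>i (z :: 'a \<times> nat \<times> 'e list). 0 < fst (snd z) \<and>
        (case snd (snd z) of [] \<Rightarrow> False | h # t \<Rightarrow> P i (fst z) h)) (\<lambda>_ _. 0)"
      by (rule tm_le, (rule tm_rules tm_fun2[OF P])+) (auto split: list.splits)
    show "tm (\<lambda>i (z :: 'a \<times> nat \<times> 'e list). (fst z, fst (snd z) - 1,
        case snd (snd z) of [] \<Rightarrow> [] | h # t \<Rightarrow> t)) (\<lambda>_ _. 0)"
      by (rule tm_le, (rule tm_rules)+) (auto split: list.splits)
    show "tm (\<lambda>i x. (x, F i x, L i x)) (\<lambda>i x. c i x + d i x)"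
      by (rule tm_le, (rule tm_rules assms)+) simp
  next
    fix i and z :: "'a \<times> nat \<times> 'e list"
    assume B: "0 < fst (snd z) \<and> (case snd (snd z) of [] \<Rightarrow> False | h # t \<Rightarrow> P i (fst z) h)"
    obtain x k xs where z: "z = (x, Suc k, xs)" using B by (cases z) (metis fst_conv gr0_implies_Suc prod.collapse snd_conv)
    obtain h t where xs: "xs = h # t" "P i x h" using B z by (cases xs) auto
    have "fst (drop_limited k (P i x) t) \<le> k" by (rule drop_limited_le)
    then show "True \<and> (fst z, ?r i z) = (fst (?S z), ?r i (?S z)) \<and>
       0 + 0 + 1 + (fst (snd (?S z)) - fst (?r i (?S z))) \<le> fst (snd z) - fst (?r i z)"
      using xs by (simp add: z Let_def)
  next
    fix i and z :: "'a \<times> nat \<times> 'e list"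
    assume "\<not> (0 < fst (snd z) \<and> (case snd (snd z) of [] \<Rightarrow> False | h # t \<Rightarrow> P i (fst z) h))"
    then show "(fst z, ?r i z) = z \<and> 0 \<le> fst (snd z) - fst (?r i z)"
      by (cases z; cases "fst (snd z)"; cases "snd (snd z)") auto
  qed simp
  from tm_snd[OF this] show ?thesis by simp
qed

lemma tm_dropWhile:
  fixes P :: "input \<Rightarrow> 'a::rep \<Rightarrow> 'e::rep \<Rightarrow> bool"
  assumes P: "tm (\<lambda>i z. P i (fst z) (snd z)) (\<lambda>_ _. 0)" and "tm L d"
  shows "tm (\<lambda>i x. (rev (takeWhile (P i x) (L i x)), dropWhile (P i x) (L i x)))
    (\<lambda>i x. d i x + length (takeWhile (P i x) (L i x)))"
proof -
  let ?r = "\<lambda>i z. (rev (takeWhile (P i (fst z)) (snd (snd z))) @ fst (snd z), dropWhile (P i (fst z)) (snd (snd z)))"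
  have "tm (\<lambda>i x. (\<lambda>i z. (fst z, ?r i z)) i ((\<lambda>i x. (x, [], L i x)) i x))
     (\<lambda>i x. d i x + (\<lambda>i z. length (takeWhile (P i (fst z)) (snd (snd z)))) i ((\<lambda>i x. (x, [] :: 'e list, L i x)) i x))"
  proof (rule tm_while[where I = "\<lambda>_ _. True" and b = "\<lambda>_ _. 0" and s = "\<lambda>_ _. 0" and
        B = "\<lambda>i z. (case snd (snd z) of [] \<Rightarrow> False | h # t \<Rightarrow> P i (fst z) h)" and
        S = "\<lambda>i z. case snd (snd z) of [] \<Rightarrow> z | h # t \<Rightarrow> (fst z, h # fst (snd z), t)"])
    show "tm (\<lambda>i z. case snd (snd z) of [] \<Rightarrow> False | h # t \<Rightarrow> P i (fst z) h) (\<lambda>_ _. 0)"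
      by (rule tm_le, (rule tm_rules tm_fun2[OF P])+) (auto split: list.splits)
    show "tm (\<lambda>i (z :: 'a \<times> 'e list \<times> 'e list). case snd (snd z) of [] \<Rightarrow> z
        | h # t \<Rightarrow> (fst z, h # fst (snd z), t)) (\<lambda>_ _. 0)"
      by (rule tm_le, (rule tm_rules)+) (auto split: list.splits)
    show "tm (\<lambda>i x. (x, [] :: 'e list, L i x)) (\<lambda>i x. d i x)"
      by (rule tm_le, (rule tm_rules assms)+) simp
  qed (auto split: list.splits)
  from tm_snd[OF this] show ?thesis by simp
qed


section \<open>Sorting by the first component\<close>

type_synonym keyed = "(nat \<times> nat) list"

fun merge_acc :: "keyed \<times> keyed \<times> keyed \<Rightarrow> keyed" where
  "merge_acc ([], ys, acc) = rev acc @ ys"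
| "merge_acc (xs, [], acc) = rev acc @ xs"
| "merge_acc (x # xs, y # ys, acc) =
    (if fst x \<le> fst y then merge_acc (xs, y # ys, x # acc) else merge_acc (x # xs, ys, y # acc))"

lemma mset_merge_acc: "mset (merge_acc (xs, ys, acc)) = mset xs + mset ys + mset acc"
  by (induction "(xs, ys, acc)" arbitrary: xs ys acc rule: merge_acc.induct) auto

lemma sorted_merge_acc:
  assumes "sorted (map fst xs)" "sorted (map fst ys)" "sorted (map fst (rev acc))"
    "\<forall>a \<in> set acc. \<forall>b \<in> set xs \<union> set ys. fst a \<le> fst b"
  shows "sorted (map fst (merge_acc (xs, ys, acc)))"
  using assms
proof (induction "(xs, ys, acc)" arbitrary: xs ys acc rule: merge_acc.induct)
  case (3 x xs y ys acc)
  show ?case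
  proof (cases "fst x \<le> fst y")
    case True
    then have "\<forall>b \<in> set ys. fst x \<le> fst b" using 3(4) by (auto intro: order_trans)
    then show ?thesis using 3 True by (auto simp: sorted_append rev_map[symmetric])
  next
    case False
    then have "\<forall>b \<in> set xs. fst y \<le> fst b" using 3(3) by (auto intro: order_trans)
    then show ?thesis using 3 False by (auto simp: sorted_append rev_map[symmetric])
  qed
qed (auto simp: sorted_append rev_map[symmetric])

lemma length_merge_acc:
  "length (merge_acc z) = length (fst z) + length (fst (snd z)) + length (snd (snd z))"
  by (induction z rule: merge_acc.induct) auto

lemma tm_merge_acc:
  "tm (\<lambda>i z. merge_acc z) (\<lambda>i z. length (fst z) + length (fst (snd z)) + length (snd (snd z)))"
proof -
  let ?c = "\<lambda>z. length (fst z) + length (fst (snd z)) + length (snd (snd z))"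
  text \<open>The loop stops as soon as one of the lists is empty.\<close>
  let ?S = "\<lambda>z :: keyed \<times> keyed \<times> keyed. case fst z of [] \<Rightarrow> (case fst (snd z) of [] \<Rightarrow> z | h # t \<Rightarrow> ([], t, h # snd (snd z)))
           | x # xs \<Rightarrow> (case fst (snd z) of [] \<Rightarrow> (xs, [], x # snd (snd z)) | y # ys \<Rightarrow>
              if fst x \<le> fst y then (xs, fst (snd z), x # snd (snd z)) else (fst z, ys, y # snd (snd z)))"
  let ?F = "\<lambda>z :: keyed \<times> keyed \<times> keyed. ([] :: keyed, [] :: keyed, rev (merge_acc z))"
  have 1: "tm (\<lambda>i x. (\<lambda>i z. ?F z) i ((\<lambda>i z. z) i x)) (\<lambda>i x. 0 + (\<lambda>i z. length (fst z) + length (fst (snd z))) i ((\<lambda>i z. z) i x))"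
  proof (rule tm_while[where I = "\<lambda>_ _. True" and b = "\<lambda>_ _. 0" and s = "\<lambda>_ _. 0" and
        B = "\<lambda>i z. case fst z of [] \<Rightarrow> (case fst (snd z) of [] \<Rightarrow> False | h # t \<Rightarrow> True) | h # t \<Rightarrow> True" and
        S = "\<lambda>i z. case fst z of [] \<Rightarrow> (case fst (snd z) of [] \<Rightarrow> z | h # t \<Rightarrow> ([], t, h # snd (snd z)))
           | x # xs \<Rightarrow> (case fst (snd z) of [] \<Rightarrow> (xs, [], x # snd (snd z)) | y # ys \<Rightarrow>
              if fst x \<le> fst y then (xs, fst (snd z), x # snd (snd z)) else (fst z, ys, y # snd (snd z)))"])
    show "tm (\<lambda>i (z :: keyed \<times> keyed \<times> keyed). case fst z of [] \<Rightarrow>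
       (case fst (snd z) of [] \<Rightarrow> False | h # t \<Rightarrow> True) | h # t \<Rightarrow> True) (\<lambda>_ _. 0)"
      by (rule tm_le, (rule tm_rules)+) (auto split: list.splits)
    show "tm (\<lambda>i (z :: keyed \<times> keyed \<times> keyed).
        case fst z of [] \<Rightarrow> (case fst (snd z) of [] \<Rightarrow> z | h # t \<Rightarrow> ([], t, h # snd (snd z)))
           | x # xs \<Rightarrow> (case fst (snd z) of [] \<Rightarrow> (xs, [], x # snd (snd z)) | y # ys \<Rightarrow>
              if fst x \<le> fst y then (xs, fst (snd z), x # snd (snd z)) else (fst z, ys, y # snd (snd z)))) (\<lambda>_ _. 0)"
      by (rule tm_le, (rule tm_rules)+) (auto split: list.splits)
    show "tm (\<lambda>i (z :: keyed \<times> keyed \<times> keyed). z) (\<lambda>_ _. 0)" by (rule tm_rules)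
  next
    have a: "merge_acc ([], h # t, acc) = merge_acc ([], t, h # acc)" for h t acc by simp
    have b: "merge_acc (h # t, [], acc) = merge_acc (t, [], h # acc)" for h t acc
      by (cases t) auto
    fix z :: "keyed \<times> keyed \<times> keyed"
    assume "case fst z of [] \<Rightarrow> (case fst (snd z) of [] \<Rightarrow> False | h # t \<Rightarrow> True) | h # t \<Rightarrow> True"
    then show "True \<and> ?F z = ?F (?S z) \<and> 0 + 0 + 1 + (length (fst (?S z)) + length (fst (snd (?S z))))
        \<le> length (fst z) + length (fst (snd z))"
      by (cases z; cases "fst z"; cases "fst (snd z)") (auto simp: a b simp del: merge_acc.simps(1,2))
  qed (auto split: list.splits)
  show ?thesis
    by (rule tm_weaken[OF tm_cong[OF tm_rev[OF tm_snd[OF tm_snd[OF 1]]]], where k = 2])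
       (auto simp: length_merge_acc)
qed

definition merge_runs :: "keyed \<Rightarrow> keyed \<Rightarrow> keyed" where
  "merge_runs xs ys = merge_acc (xs, ys, [])"

lemma tm_merge_runs [tm_rules]:
  assumes "tm F c" "tm G d"
  shows "tm (\<lambda>i x. merge_runs (F i x) (G i x)) (\<lambda>i x. c i x + d i x + (length (F i x) + length (G i x)))"
  unfolding merge_runs_def by (rule tm_le, (rule tm_rules assms tm_fun1[OF tm_merge_acc])+) simp

definition pair_step :: "keyed list \<times> keyed list \<Rightarrow> keyed \<Rightarrow> keyed list \<times> keyed list" where
  "pair_step a r = (case fst a of [] \<Rightarrow> ([r], snd a) | h # t \<Rightarrow> ([], merge_runs h r # snd a))"

definition merge_pass :: "keyed list \<Rightarrow> keyed list" where
  "merge_pass rs = (let a = foldl pair_step ([], []) rs in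
     case fst a of [] \<Rightarrow> snd a | h # t \<Rightarrow> h # snd a)"

lemma tm_merge_pass [tm_rules]:
  assumes "tm F c"
  shows "tm (\<lambda>i x. merge_pass (F i x)) (\<lambda>i x. c i x + (length (F i x) + length (concat (F i x))))"
proof -
  have I: "length (fst (pair_step a e)) \<le> 1 \<and>
      (case fst a of [] \<Rightarrow> 0 | x # xs \<Rightarrow> length x + length e) + length (concat (fst (pair_step a e)))
      \<le> length (concat (fst a)) + length e" if "length (fst a) \<le> 1" for a and e :: keyed
    using that by (auto simp: pair_step_def split: list.splits)
  have p: "fold_cost (\<lambda>a h. case fst a of [] \<Rightarrow> 0 | x # xs \<Rightarrow> length x + length h) pair_step ([], []) rs
     \<le> (\<Sum>r\<leftarrow>rs. length r + 1)" for rs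
  proof -
    \<comment> \<open>The potential is the length of the run that waits for a partner: it is charged
      on arrival, and released by the merge.\<close>
    have "fold_cost (\<lambda>a h. case fst a of [] \<Rightarrow> 0 | x # xs \<Rightarrow> length x + length h) pair_step ([], []) rs +
      length (concat (fst (foldl pair_step ([], []) rs))) \<le> length (concat (fst ([] :: keyed list, [] :: keyed list)))
        + (\<Sum>r\<leftarrow>rs. length r + 1)"
      by (rule fold_cost_pot[where I = "\<lambda>a. length (fst a) \<le> 1"]) (use I in auto)
    then show ?thesis by simp
  qed
  have s: "(\<Sum>r\<leftarrow>rs. length r + 1) = length rs + length (concat rs)" for rs :: "keyed list"
    by (induction rs) auto
  show ?thesis
    unfolding merge_pass_def pair_step_def
    by (rule tm_le, (rule tm_rules assms)+)
       (use p s in \<open>simp add: pair_step_def[abs_def] cong: list.case_cong\<close>)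
qed

lemma merge_pass:
  assumes "\<forall>r \<in> set rs. sorted (map fst r)" "length rs \<le> 2 * k"
  shows "(\<forall>r \<in> set (merge_pass rs). sorted (map fst r)) \<and> length (merge_pass rs) \<le> k \<and>
    mset (concat (merge_pass rs)) = mset (concat rs)"
proof -
  have "(\<forall>r \<in> set (fst a) \<union> set (snd a). sorted (map fst r)) \<and> length (fst a) \<le> 1 \<longrightarrow>
     (\<forall>r \<in> set (fst (foldl pair_step a rs)) \<union> set (snd (foldl pair_step a rs)). sorted (map fst r)) \<and>
     length (fst (foldl pair_step a rs)) \<le> 1 \<and>
     2 * length (snd (foldl pair_step a rs)) + length (fst (foldl pair_step a rs)) =
       2 * length (snd a) + length (fst a) + length rs \<and>
     mset (concat (fst (foldl pair_step a rs))) + mset (concat (snd (foldl pair_step a rs))) =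
       mset (concat (fst a)) + mset (concat (snd a)) + mset (concat rs)" for a
    using assms(1)
  proof (induction rs arbitrary: a)
    case (Cons r rs)
    show ?case
    proof (intro impI)
      assume a: "(\<forall>r \<in> set (fst a) \<union> set (snd a). sorted (map fst r)) \<and> length (fst a) \<le> 1"
      have r: "sorted (map fst r)" using Cons.prems by simp
      have "(\<forall>r \<in> set (fst (pair_step a r)) \<union> set (snd (pair_step a r)). sorted (map fst r)) \<and>
         length (fst (pair_step a r)) \<le> 1 \<and>
         2 * length (snd (pair_step a r)) + length (fst (pair_step a r)) =
           2 * length (snd a) + length (fst a) + 1 \<and>
         mset (concat (fst (pair_step a r))) + mset (concat (snd (pair_step a r))) =
           mset (concat (fst a)) + mset (concat (snd a)) + mset r"
        using a r by (cases "fst a")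
          (auto simp: pair_step_def merge_runs_def mset_merge_acc sorted_merge_acc)
      then show "(\<forall>q \<in> set (fst (foldl pair_step a (r # rs))) \<union> set (snd (foldl pair_step a (r # rs))).
           sorted (map fst q)) \<and>
         length (fst (foldl pair_step a (r # rs))) \<le> 1 \<and>
         2 * length (snd (foldl pair_step a (r # rs))) + length (fst (foldl pair_step a (r # rs))) =
           2 * length (snd a) + length (fst a) + length (r # rs) \<and>
         mset (concat (fst (foldl pair_step a (r # rs)))) + mset (concat (snd (foldl pair_step a (r # rs)))) =
           mset (concat (fst a)) + mset (concat (snd a)) + mset (concat (r # rs))"
        using Cons.IH[of "pair_step a r"] Cons.prems by (simp add: add_ac)
    qed
  qed simp
  from this[of "([], [])"] show ?thesis
    using assms(2) unfolding merge_pass_def Let_def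
    by (cases "fst (foldl pair_step ([], []) rs)") auto
qed

text \<open>Bottom-up, because the available control structure is a loop: starting from singletons,
  each pass halves the number of sorted runs.\<close>

definition merge_sort :: "keyed \<Rightarrow> keyed" where
  "merge_sort xs = (case foldl (\<lambda>rs _. merge_pass rs) (map (\<lambda>x. [x]) xs) [0..<log_ceil (length xs)] of
     [] \<Rightarrow> [] | r # t \<Rightarrow> r)"

lemma merge_sort_passes:
  assumes "length xs \<le> 2 ^ k" "j \<le> k"
  defines "rs \<equiv> foldl (\<lambda>rs _. merge_pass rs) (map (\<lambda>x. [x]) xs) [0..<j]"
  shows "(\<forall>r \<in> set rs. sorted (map fst r)) \<and> length rs \<le> 2 ^ (k - j) \<and> mset (concat rs) = mset xs"
  using assms(2) unfolding rs_def
proof (induction j)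
  case 0
  have "concat (map (\<lambda>x. [x]) xs) = xs" by (induction xs) auto
  then show ?case using assms(1) by auto
next
  case (Suc j)
  have "(2 :: nat) ^ (k - j) = 2 * 2 ^ (k - Suc j)"
    using Suc.prems by (metis Suc_diff_Suc Suc_le_lessD power_Suc)
  then show ?case using merge_pass[of "foldl (\<lambda>rs _. merge_pass rs) (map (\<lambda>x. [x]) xs) [0..<j]"
        "2 ^ (k - Suc j)"] Suc by simp
qed

lemma merge_sort: "sorted (map fst (merge_sort xs)) \<and> mset (merge_sort xs) = mset xs"
proof -
  define rs where "rs = foldl (\<lambda>rs _. merge_pass rs) (map (\<lambda>x. [x]) xs) [0..<log_ceil (length xs)]"
  have "(\<forall>r \<in> set rs. sorted (map fst r)) \<and> length rs \<le> 1 \<and> mset (concat rs) = mset xs"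
    using merge_sort_passes[OF log_ceil_ge order_refl, of xs] by (simp add: rs_def)
  then show ?thesis unfolding merge_sort_def rs_def[symmetric] by (cases rs) auto
qed

lemma tm_merge_sort [tm_rules]:
  assumes "tm F c"
  shows "tm (\<lambda>i x. merge_sort (F i x))
    (\<lambda>i x. c i x + length (F i x) * (log_ceil (length (F i x)) + 1) + (log_ceil (length (F i x)) + 1)\<^sup>2)"
proof -
  have b: "fold_cost (\<lambda>rs (h :: nat). length rs + length (concat rs)) (\<lambda>rs _. merge_pass rs) (map (\<lambda>x. [x]) xs)
     [0..<k] \<le> k * (3 * length xs + 1)" for xs k
  proof -
    have I: "length rs \<le> length xs \<and> length (concat rs) = length xs \<Longrightarrow>
       (\<forall>r \<in> set rs. sorted (map fst r)) \<Longrightarrow>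
       length (merge_pass rs) \<le> length xs \<and> length (concat (merge_pass rs)) = length xs \<and>
       (\<forall>r \<in> set (merge_pass rs). sorted (map fst r))" for rs
      using merge_pass[of rs "length xs"] by (metis mset_eq_length order_trans le_add1 mult_2)
    have "concat (map (\<lambda>x. [x]) xs) = xs" by (induction xs) auto
    then have "fold_cost (\<lambda>rs (h :: nat). length rs + length (concat rs)) (\<lambda>rs _. merge_pass rs) (map (\<lambda>x. [x]) xs)
     [0..<k] + 0 \<le> 0 + (\<Sum>e\<leftarrow>[0..<k]. 3 * length xs + 1)"
      by (intro fold_cost_pot[where I = "\<lambda>rs. length rs \<le> length xs \<and> length (concat rs) = length xs \<and>
         (\<forall>r \<in> set rs. sorted (map fst r))" and \<Phi> = "\<lambda>_. 0"]) (use I in auto)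
    then show ?thesis by (simp add: sum_list_triv)
  qed
  have g: "tm (\<lambda>i xs. merge_sort xs) (\<lambda>i xs. length xs * (log_ceil (length xs) + 1) + (log_ceil (length xs) + 1)\<^sup>2)"
    unfolding merge_sort_def
  proof (rule tm_weaken[where k = 8], (rule tm_rules)+)
    fix i and xs :: keyed
    let ?l = "log_ceil (length xs)"
    have "?l \<le> (?l + 1)\<^sup>2" by (simp add: power2_eq_square)
    moreover have "(\<Sum>e\<leftarrow>xs. 1 :: nat) = length xs" by (simp add: sum_list_triv)
    ultimately show "0 + (\<Sum>e\<leftarrow>xs. 0 + 0 + 1) + (0 + length xs + (log_ceil (length xs) + 1)\<^sup>2 + log_ceil (length xs)) +
           fold_cost (\<lambda>a h. 0 + (length (fst (snd (xs, a, h))) + length (concat (fst (snd (xs, a, h))))))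
            (\<lambda>rs _. merge_pass rs) (map (\<lambda>x. [x]) xs) [0..<log_ceil (length xs)] +
        (case foldl (\<lambda>rs _. merge_pass rs) (map (\<lambda>x. [x]) xs) [0..<log_ceil (length xs)] of
           [] \<Rightarrow> 0 | h # t \<Rightarrow> 0)
        \<le> 8 * (1 + (length xs * (log_ceil (length xs) + 1) + (log_ceil (length xs) + 1)\<^sup>2))"
      using b[of xs ?l] by (simp add: algebra_simps)
  qed
  show ?thesis by (rule tm_le[OF tm_fun1[OF g assms]]) simp
qed

section \<open>The dynamic program over prefixes, and its compilation\<close>

section \<open>The algorithm\<close>

text \<open>
  In a record \<open>(q, e, X, rq)\<close>, \<open>e\<close> is the element of rank \<open>q\<close> in the Borda order, \<open>X\<close> is twice the
  number of votes against this order across the cut before rank \<open>q\<close>, and \<open>rq\<close> is \<open>r * q\<close>.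
\<close>

type_synonym rec = "nat \<times> nat \<times> nat \<times> nat"

text \<open>
  A state \<open>(R, c, path)\<close> of the dynamic program stands for a set of already placed elements:
  \<open>R\<close> lists the remaining elements in the current window (with their ranks), \<open>path\<close> is a cheapest
  order of the placed elements found so far, last element first, and \<open>c\<close> is its cost.
\<close>

type_synonym state = "keyed \<times> nat \<times> nat list"

type_synonym dp = "rec list \<times> rec list \<times> state list \<times> nat"

definition votes :: "input \<Rightarrow> nat \<Rightarrow> nat \<Rightarrow> nat \<Rightarrow> nat" where
  "votes i r u v = foldl (\<lambda>a k. if i Ranking k u < i Ranking k v then Suc a else a) 0 [0..<r]"

definition borda :: "input \<Rightarrow> nat \<Rightarrow> nat \<Rightarrow> nat" where
  "borda i r e = foldl (\<lambda>a k. a + i Ranking k e) 0 [0..<r]"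

text \<open>All cut excesses follow from the Borda sums alone, in constant time per rank: from cut
  \<open>k\<close> to cut \<open>k + 1\<close> the excess grows by twice the Borda sum of the
  element of rank \<open>k\<close> and shrinks by \<open>2 * r * k\<close>. The product
  \<open>r * k\<close> is kept as a running sum because multiplication is not a unit-cost
  operation.\<close>

definition record_step :: "nat \<Rightarrow> nat \<times> nat \<times> nat \<times> rec list \<Rightarrow> nat \<times> nat \<Rightarrow> nat \<times> nat \<times> nat \<times> rec list" where
  "record_step r a b = (Suc (fst a),
     (fst (snd a) + (fst b + fst b)) - (fst (snd (snd a)) + fst (snd (snd a))),
     fst (snd (snd a)) + r,
     (fst a, snd b, fst (snd a), fst (snd (snd a))) # snd (snd (snd a)))"

definition records :: "nat \<Rightarrow> keyed \<Rightarrow> rec list" where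
  "records r es = (let a = foldl (record_step r) (0, 0, 0, []) es in
     rev ((fst a, 0, fst (snd a), fst (snd (snd a))) # snd (snd (snd a))))"

definition votes_for :: "input \<Rightarrow> nat \<Rightarrow> keyed \<Rightarrow> nat \<Rightarrow> nat" where
  "votes_for i r us v = foldl (\<lambda>a u. a + votes i r (snd u) v) 0 us"

definition votes_against :: "input \<Rightarrow> nat \<Rightarrow> keyed \<Rightarrow> nat \<Rightarrow> nat" where
  "votes_against i r us v = foldl (\<lambda>a u. a + votes i r v (snd u)) 0 us"

definition count_below :: "nat \<Rightarrow> keyed \<Rightarrow> nat" where
  "count_below p us = foldl (\<lambda>c u. if fst u < p then Suc c else c) 0 us"

text \<open>Only the head of the window is compared with \<open>lo\<close>, which is enough as
  windows are sorted by rank.\<close>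

definition admissible :: "nat \<Rightarrow> nat \<Rightarrow> rec \<Rightarrow> keyed \<Rightarrow> bool" where
  "admissible r lo tgt us \<longleftrightarrow> (case us of [] \<Rightarrow> True | h # t \<Rightarrow> lo \<le> fst h) \<and>
     (let m = count_below (fst tgt) us in m * (m * r) \<le> fst (snd (snd tgt)))"

text \<open>One linear pass both finds an equal key and keeps the cheaper of the two states. Keys
  are windows, so equal keys mean equal sets of placed elements.\<close>

definition insert_step :: "state \<times> state list \<Rightarrow> state \<Rightarrow> state \<times> state list" where
  "insert_step z t = (if fst t = fst (fst z)
     then (if fst (snd t) < fst (snd (fst z)) then (t, snd z) else z) else (fst z, t # snd z))"

definition insert_state :: "state \<Rightarrow> state list \<Rightarrow> state list" where
  "insert_state s ts = (let z = foldl insert_step (s, []) ts in fst z # snd z)"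

text \<open>The offset \<open>off\<close> keeps the costs nonnegative.\<close>

definition extend :: "input \<Rightarrow> nat \<Rightarrow> nat \<Rightarrow> nat \<Rightarrow> rec \<Rightarrow> keyed \<Rightarrow> nat \<times> nat list \<Rightarrow> state list \<Rightarrow> nat \<Rightarrow> state list" where
  "extend i r off lo tgt us cp out t = (case drop t us of [] \<Rightarrow> out | v # post \<Rightarrow>
     (let pre = take t us; us' = pre @ post in
      if admissible r lo tgt us'
      then insert_state (us', (fst cp + (off + votes_for i r pre (snd v))) - votes_against i r pre (snd v),
             snd v # snd cp) out
      else out))"

definition expand :: "input \<Rightarrow> nat \<Rightarrow> nat \<Rightarrow> nat \<Rightarrow> rec \<Rightarrow> keyed \<Rightarrow> state list \<Rightarrow> state \<Rightarrow> state list" where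
  "expand i r off lo tgt D out s = (let us = fst s @ D in
     foldl (extend i r off lo tgt us (snd s)) out [0..<length us])"

text \<open>The first state speaks for all, since every state of a level has equally many elements
  left in its window.\<close>

definition window :: "keyed \<Rightarrow> state list \<Rightarrow> nat" where
  "window D states = (case states of [] \<Rightarrow> 0 | s # _ \<Rightarrow> length (fst s) + length D)"

text \<open>The work of expanding a level: \<open>N * L\<close> candidates, each compared with up to
  \<open>N * L\<close> states by keys of length up to \<open>L\<close>. It is known before the
  expansion starts, so the program can abort without having spent it.\<close>

definition estimate :: "keyed \<Rightarrow> state list \<Rightarrow> nat" where
  "estimate D states = (let N = length states; L = window D states in N * (N * (L * (L * L))))"

definition scan_up :: "rec list \<Rightarrow> rec \<Rightarrow> rec list \<times> rec list" where
  "scan_up fut tgt = (rev (takeWhile (\<lambda>x. snd (snd (snd x)) < fst (snd (snd x)) + snd (snd (snd tgt))) fut),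
     dropWhile (\<lambda>x. snd (snd (snd x)) < fst (snd (snd x)) + snd (snd (snd tgt))) fut)"

definition scan_down :: "nat \<Rightarrow> rec list \<Rightarrow> rec \<Rightarrow> nat \<times> rec list" where
  "scan_down fuel past tgt = drop_limited fuel
     (\<lambda>x. snd (snd (snd tgt)) < fst (snd (snd x)) + snd (snd (snd x))) past"

definition dp_finish :: "input \<Rightarrow> nat \<Rightarrow> nat \<Rightarrow> rec \<Rightarrow> rec list \<Rightarrow> rec list \<Rightarrow> keyed \<Rightarrow> state list \<Rightarrow>
    nat \<times> rec list \<Rightarrow> dp" where
  "dp_finish i r off tgt fut past D states down = (if fst down \<le> estimate D states then (fut, past, [], 0)
     else (case snd down of [] \<Rightarrow> (fut, past, [], 0) | h # _ \<Rightarrow>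
       (fut, past, foldl (expand i r off (fst h) tgt D) [] states, fst down - estimate D states)))"

text \<open>Fuel 0 marks an aborted run, which the later levels pass on unchanged.\<close>

definition dp_level :: "input \<Rightarrow> nat \<Rightarrow> nat \<Rightarrow> dp \<Rightarrow> rec \<Rightarrow> dp" where
  "dp_level i r off cfg tgt = (if snd (snd (snd cfg)) = 0 then cfg else
     (let up = scan_up (fst cfg) tgt in
      dp_finish i r off tgt (snd up) (tgt # fst (snd cfg)) (map (\<lambda>x. (fst x, fst (snd x))) (rev (fst up)))
        (fst (snd (snd cfg))) (scan_down (snd (snd (snd cfg))) (tgt # fst (snd cfg)) tgt)))"

definition solve :: "input \<Rightarrow> nat \<Rightarrow> nat \<Rightarrow> keyed \<Rightarrow> nat list" where
  "solve i r fuel es = (let recs = records r es in case recs of [] \<Rightarrow> [] | h # t \<Rightarrow>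
     (let off = length es * r; cfg = foldl (dp_level i r off) (recs, [h], [([], 0, [])], fuel) t in
      case fst (snd (snd cfg)) of [] \<Rightarrow> [] | s # _ \<Rightarrow> rev (snd (snd s))))"


section \<open>Running times\<close>

lemma tm_votes0: "tm (\<lambda>i z. votes i (fst z) (fst (snd z)) (snd (snd z))) (\<lambda>i z. fst z)"
  unfolding votes_def
  by (rule tm_weaken[where k = 2], (rule tm_rules)+) simp

lemmas tm_votes [tm_rules] = tm_fun3[OF tm_votes0]

lemma tm_borda0: "tm (\<lambda>i z. borda i (fst z) (snd z)) (\<lambda>i z. fst z)"
  unfolding borda_def
  by (rule tm_weaken[where k = 2], (rule tm_rules)+) simp

lemmas tm_borda [tm_rules] = tm_fun2[OF tm_borda0]

lemma tm_records0: "tm (\<lambda>i z. records (fst z) (snd z)) (\<lambda>i z. length (snd z))"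
proof -
  have l: "length (snd (snd (snd (foldl (record_step r) a es)))) = length es + length (snd (snd (snd a)))" for r a es
    by (induction es arbitrary: a) (auto simp: record_step_def)
  show ?thesis unfolding records_def record_step_def
    by (rule tm_weaken[where k = 2], (rule tm_rules)+) (simp add: l[unfolded record_step_def[abs_def]])
qed

lemmas tm_records [tm_rules] = tm_fun2[OF tm_records0]

lemma tm_votes_for0: "tm (\<lambda>i z. votes_for i (fst z) (fst (snd z)) (snd (snd z)))
    (\<lambda>i z. length (fst (snd z)) * (fst z + 1))"
  unfolding votes_for_def
  by (rule tm_le, (rule tm_rules)+) (auto intro!: order_trans[OF fold_cost_const_le])

lemmas tm_votes_for [tm_rules] = tm_fun3[OF tm_votes_for0]

lemma tm_votes_against0: "tm (\<lambda>i z. votes_against i (fst z) (fst (snd z)) (snd (snd z)))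
    (\<lambda>i z. length (fst (snd z)) * (fst z + 1))"
  unfolding votes_against_def
  by (rule tm_le, (rule tm_rules)+) (auto intro!: order_trans[OF fold_cost_const_le])

lemmas tm_votes_against [tm_rules] = tm_fun3[OF tm_votes_against0]

lemma tm_count_below0: "tm (\<lambda>i z. count_below (fst z) (snd z)) (\<lambda>i z. length (snd z))"
  unfolding count_below_def
  by (rule tm_le, (rule tm_rules)+) simp

lemmas tm_count_below [tm_rules] = tm_fun2[OF tm_count_below0]

lemma count_below: "count_below p us = length (filter (\<lambda>u. fst u < p) us)"
proof -
  have "foldl (\<lambda>c u. if fst u < p then Suc c else c) k us = k + length (filter (\<lambda>u. fst u < p) us)" for k
    by (induction us arbitrary: k) auto
  then show ?thesis by (simp add: count_below_def)
qed

lemma tm_admissible0: "tm (\<lambda>i z. admissible (fst z) (fst (snd z)) (fst (snd (snd z))) (snd (snd (snd z))))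
    (\<lambda>i z. length (snd (snd (snd z))))"
proof -
  have *: "count_below p us \<le> length us" for p us by (simp add: count_below)
  show ?thesis unfolding admissible_def
    apply (rule tm_weaken[where k = 3], (rule tm_rules)+)
    subgoal for i z using *[of "fst (fst (snd (snd z)))" "snd (snd (snd z))"] by simp
    done
qed

lemmas tm_admissible [tm_rules] = tm_fun4[OF tm_admissible0]

lemma tm_insert_state0: "tm (\<lambda>i z. insert_state (fst z) (snd z))
    (\<lambda>i z. (\<Sum>t\<leftarrow>snd z. length (fst t) + 1))"
  unfolding insert_state_def insert_step_def
  apply (rule tm_le, (rule tm_rules)+)
  apply simp
  apply (rule order_trans[OF fold_cost_le[where k = "\<lambda>t. length (fst t)"]])
   apply auto
  done

lemmas tm_insert_state [tm_rules] = tm_fun2[OF tm_insert_state0]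


lemma tm_fun7:
  assumes "tm (\<lambda>i z. g i (fst z) (fst (snd z)) (fst (snd (snd z))) (fst (snd (snd (snd z)))) (fst (snd (snd (snd (snd z))))) (fst (snd (snd (snd (snd (snd z)))))) (snd (snd (snd (snd (snd (snd z))))))) d"
    "tm F0 c0" "tm F1 c1" "tm F2 c2" "tm F3 c3" "tm F4 c4" "tm F5 c5" "tm F6 c6"
  shows "tm (\<lambda>i x. g i (F0 i x) (F1 i x) (F2 i x) (F3 i x) (F4 i x) (F5 i x) (F6 i x))
    (\<lambda>i x. c0 i x + c1 i x + c2 i x + c3 i x + c4 i x + c5 i x + c6 i x + d i (F0 i x, F1 i x, F2 i x, F3 i x, F4 i x, F5 i x, F6 i x))"
  using tm_comp[OF tm_pair[OF assms(2) tm_pair[OF assms(3) tm_pair[OF assms(4) tm_pair[OF assms(5) tm_pair[OF assms(6) tm_pair[OF assms(7) assms(8)]]]]]] assms(1)]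
  by (simp add: add.assoc)

lemma tm_fun8:
  assumes "tm (\<lambda>i z. g i (fst z) (fst (snd z)) (fst (snd (snd z))) (fst (snd (snd (snd z)))) (fst (snd (snd (snd (snd z))))) (fst (snd (snd (snd (snd (snd z)))))) (fst (snd (snd (snd (snd (snd (snd z))))))) (snd (snd (snd (snd (snd (snd (snd z)))))))) d"
    "tm F0 c0" "tm F1 c1" "tm F2 c2" "tm F3 c3" "tm F4 c4" "tm F5 c5" "tm F6 c6" "tm F7 c7"
  shows "tm (\<lambda>i x. g i (F0 i x) (F1 i x) (F2 i x) (F3 i x) (F4 i x) (F5 i x) (F6 i x) (F7 i x))
    (\<lambda>i x. c0 i x + c1 i x + c2 i x + c3 i x + c4 i x + c5 i x + c6 i x + c7 i x + d i (F0 i x, F1 i x, F2 i x, F3 i x, F4 i x, F5 i x, F6 i x, F7 i x))"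
  using tm_comp[OF tm_pair[OF assms(2) tm_pair[OF assms(3) tm_pair[OF assms(4) tm_pair[OF assms(5) tm_pair[OF assms(6) tm_pair[OF assms(7) tm_pair[OF assms(8) assms(9)]]]]]]] assms(1)]
  by (simp add: add.assoc)

lemma length_drop_Cons: "drop k l = h # t \<Longrightarrow> length t \<le> length l"
  by (metis length_drop diff_le_self impossible_Cons le_trans nle_le)

lemma extend_bound:
  fixes k l t p r S :: nat
  assumes "k \<le> l" "k \<le> t" "p \<le> l"
  shows "k + (k + (p + (k + (k * r + (k + k * r))))) \<le> 9 * S + (8 * t + (10 + (10 * l + 10 * (l * r))))"
    "k + (k + p) \<le> 8 * t + (10 + (10 * l + (10 * (l * r) + 10 * S)))"
proof -
  have "k * r \<le> l * r" using assms(1) by simp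
  then show "k + (k + (p + (k + (k * r + (k + k * r))))) \<le> 9 * S + (8 * t + (10 + (10 * l + 10 * (l * r))))"
    "k + (k + p) \<le> 8 * t + (10 + (10 * l + (10 * (l * r) + 10 * S)))"
    using assms by linarith+
qed

lemma tm_extend0:
  "tm (\<lambda>i z. extend i (fst z) (fst (snd z)) (fst (snd (snd z))) (fst (snd (snd (snd z)))) (fst (snd (snd (snd (snd z))))) (fst (snd (snd (snd (snd (snd z)))))) (fst (snd (snd (snd (snd (snd (snd z))))))) (snd (snd (snd (snd (snd (snd (snd z))))))))
    (\<lambda>i z. (snd (snd (snd (snd (snd (snd (snd z))))))) + length (fst (snd (snd (snd (snd z))))) * ((fst z) + 1) + (\<Sum>t\<leftarrow>(fst (snd (snd (snd (snd (snd (snd z))))))). length (fst t) + 1))"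
  unfolding extend_def
  apply (rule tm_weaken[where k = 10], (rule tm_rules)+)
  apply (clarsimp split: list.splits)
  subgoal for i r lo q e X rq us out t a b post
    using length_drop_Cons[of t us "(a, b)" post] extend_bound[of "min (length us) t" "length us" t "length post" r]
    by (auto simp del: min_def)
  done

lemmas tm_extend [tm_rules] = tm_fun8[OF tm_extend0]

text \<open>The price of an insertion depends on the states collected so far. Such costs are carried
  through the compilation as folds and bounded afterwards by an invariant of the run.\<close>

definition expand_cost :: "input \<Rightarrow> nat \<Rightarrow> nat \<Rightarrow> nat \<Rightarrow> rec \<Rightarrow> keyed \<Rightarrow> state list \<Rightarrow> state \<Rightarrow> nat" where
  "expand_cost i r off lo tgt D out s = (let us = fst s @ D in length us +
     fold_cost (\<lambda>out t. t + length us * (r + 1) + (\<Sum>t\<leftarrow>out. length (fst t) + 1))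
       (extend i r off lo tgt us (snd s)) out [0..<length us])"

lemma tm_expand0:
  "tm (\<lambda>i z. expand i (fst z) (fst (snd z)) (fst (snd (snd z))) (fst (snd (snd (snd z)))) (fst (snd (snd (snd (snd z))))) (fst (snd (snd (snd (snd (snd z)))))) (snd (snd (snd (snd (snd (snd z))))))) (\<lambda>i z. expand_cost i (fst z) (fst (snd z)) (fst (snd (snd z))) (fst (snd (snd (snd z)))) (fst (snd (snd (snd (snd z))))) (fst (snd (snd (snd (snd (snd z)))))) (snd (snd (snd (snd (snd (snd z)))))))"
  unfolding expand_def
  apply (rule tm_weaken[where k = 3], (rule tm_rules)+)
  apply (clarsimp simp: expand_cost_def Let_def)
  done

lemmas tm_expand [tm_rules] = tm_fun7[OF tm_expand0]

lemma tm_window0: "tm (\<lambda>i z. window (fst z) (snd z)) (\<lambda>i z. window (fst z) (snd z))"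
  unfolding window_def
  by (rule tm_le, (rule tm_rules)+) (auto split: list.splits)

lemmas tm_window [tm_rules] = tm_fun2[OF tm_window0]

lemma tm_estimate0: "tm (\<lambda>i z. estimate (fst z) (snd z)) (\<lambda>i z. length (snd z) + window (fst z) (snd z))"
  unfolding estimate_def
  by (rule tm_weaken[where k = 4], (rule tm_rules)+) simp

lemmas tm_estimate [tm_rules] = tm_fun2[OF tm_estimate0]

lemma tm_scan_up0: "tm (\<lambda>i z. scan_up (fst z) (snd z)) (\<lambda>i z. length (fst (scan_up (fst z) (snd z))))"
proof -
  have P: "tm (\<lambda>i z. (\<lambda>i z x. snd (snd (snd x)) < fst (snd (snd x)) + snd (snd (snd (snd z)))) i (fst z) (snd z))
      (\<lambda>_ (_ :: (rec list \<times> rec) \<times> rec). 0)"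
    by (rule tm_le, (rule tm_rules)+) simp
  show ?thesis unfolding scan_up_def
    by (rule tm_le, (rule tm_dropWhile[OF P] tm_rules)+) simp
qed

lemmas tm_scan_up [tm_rules] = tm_fun2[OF tm_scan_up0]

lemma tm_scan_down0: "tm (\<lambda>i z. scan_down (fst z) (fst (snd z)) (snd (snd z)))
   (\<lambda>i z. fst z - fst (scan_down (fst z) (fst (snd z)) (snd (snd z))))"
proof -
  have P: "tm (\<lambda>i z. (\<lambda>i z x. snd (snd (snd (snd (snd z)))) < fst (snd (snd x)) + snd (snd (snd x))) i (fst z) (snd z))
      (\<lambda>_ (_ :: (nat \<times> rec list \<times> rec) \<times> rec). 0)"
    by (rule tm_le, (rule tm_rules)+) simp
  show ?thesis unfolding scan_down_def
    by (rule tm_le, (rule tm_drop_limited[OF P] tm_rules)+) simp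
qed

lemmas tm_scan_down [tm_rules] = tm_fun3[OF tm_scan_down0]

definition finish_cost :: "input \<Rightarrow> nat \<Rightarrow> nat \<Rightarrow> rec \<Rightarrow> rec list \<Rightarrow> rec list \<Rightarrow> keyed \<Rightarrow> state list \<Rightarrow>
    nat \<times> rec list \<Rightarrow> nat" where
  "finish_cost i r off tgt fut past D states down = length states + window D states +
     (if fst down \<le> estimate D states then 0 else (case snd down of [] \<Rightarrow> 0 | h # _ \<Rightarrow>
       fold_cost (expand_cost i r off (fst h) tgt D) (expand i r off (fst h) tgt D) [] states))"

lemma tm_dp_finish0:
  "tm (\<lambda>i z. dp_finish i (fst z) (fst (snd z)) (fst (snd (snd z))) (fst (snd (snd (snd z)))) (fst (snd (snd (snd (snd z))))) (fst (snd (snd (snd (snd (snd z)))))) (fst (snd (snd (snd (snd (snd (snd z))))))) (snd (snd (snd (snd (snd (snd (snd z)))))))) (\<lambda>i z. finish_cost i (fst z) (fst (snd z)) (fst (snd (snd z))) (fst (snd (snd (snd z)))) (fst (snd (snd (snd (snd z))))) (fst (snd (snd (snd (snd (snd z)))))) (fst (snd (snd (snd (snd (snd (snd z))))))) (snd (snd (snd (snd (snd (snd (snd z))))))))"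
  unfolding dp_finish_def
  apply (rule tm_weaken[where k = 6], (rule tm_rules)+)
  apply (auto simp: finish_cost_def split: list.splits)
  done

lemmas tm_dp_finish [tm_rules] = tm_fun8[OF tm_dp_finish0]

definition level_cost :: "input \<Rightarrow> nat \<Rightarrow> nat \<Rightarrow> dp \<Rightarrow> rec \<Rightarrow> nat" where
  "level_cost i r off cfg tgt = (if snd (snd (snd cfg)) = 0 then 0 else
     (let up = scan_up (fst cfg) tgt; down = scan_down (snd (snd (snd cfg))) (tgt # fst (snd cfg)) tgt
      in length (fst up) + (snd (snd (snd cfg)) - fst down) +
      finish_cost i r off tgt (snd up) (tgt # fst (snd cfg)) (map (\<lambda>x. (fst x, fst (snd x))) (rev (fst up)))
        (fst (snd (snd cfg))) down))"

lemma tm_dp_level0: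
  "tm (\<lambda>i z. dp_level i (fst z) (fst (snd z)) (fst (snd (snd z))) (snd (snd (snd z)))) (\<lambda>i z. level_cost i (fst z) (fst (snd z)) (fst (snd (snd z))) (snd (snd (snd z))))"
  unfolding dp_level_def
  apply (rule tm_weaken[where k = 6], (rule tm_rules)+)
  apply (auto simp: level_cost_def Let_def sum_list_triv)
  done

lemmas tm_dp_level [tm_rules] = tm_fun4[OF tm_dp_level0]

definition solve_cost :: "input \<Rightarrow> nat \<Rightarrow> nat \<Rightarrow> keyed \<Rightarrow> nat" where
  "solve_cost i r fuel es = length es + length (solve i r fuel es) +
    (case records r es of [] \<Rightarrow> 0 | h # t \<Rightarrow>
       fold_cost (level_cost i r (length es * r)) (dp_level i r (length es * r))
         (records r es, [h], [([], 0, [])], fuel) t)"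

lemma tm_solve0:
  "tm (\<lambda>i z. solve i (fst z) (fst (snd z)) (snd (snd z)))
    (\<lambda>i z. solve_cost i (fst z) (fst (snd z)) (snd (snd z)))"
  unfolding solve_def
  apply (rule tm_weaken[where k = 6], (rule tm_rules)+)
  apply (auto simp: solve_cost_def solve_def Let_def split: list.splits)
  done

lemmas tm_solve [tm_rules] = tm_fun3[OF tm_solve0]

section \<open>Optimal orders compared with the cuts of the Borda order\<close>

section \<open>Exchange argument\<close>

text \<open>The total Kemeny distance of an order to the voters, where \<open>V y x\<close> counts
  those who place \<open>y\<close> before \<open>x\<close>; see
  \<open>vote_cost_kemeny\<close>.\<close>

primrec vote_cost :: "(nat \<Rightarrow> nat \<Rightarrow> nat) \<Rightarrow> nat list \<Rightarrow> nat" where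
  "vote_cost V [] = 0"
| "vote_cost V (x # l) = (\<Sum>y\<leftarrow>l. V y x) + vote_cost V l"

text \<open>For \<open>g\<close> constantly 1, the number of inversions of the list across the cut
  \<open>q\<close>.\<close>

primrec cross_sum :: "(nat \<Rightarrow> nat \<Rightarrow> nat) \<Rightarrow> nat \<Rightarrow> nat list \<Rightarrow> nat" where
  "cross_sum g q [] = 0"
| "cross_sum g q (y # l) = (if y < q then 0 else (\<Sum>x\<leftarrow>filter (\<lambda>x. x < q) l. g y x)) + cross_sum g q l"

lemma vote_cost_insert:
  "vote_cost V (A @ z # B) = vote_cost V (A @ B) + (\<Sum>a\<leftarrow>A. V z a) + (\<Sum>b\<leftarrow>B. V b z)"
  by (induction A) auto

lemma sum_list_partition:
  "(\<Sum>x\<leftarrow>l. f x) = (\<Sum>x\<leftarrow>filter P l. f x) + (\<Sum>x\<leftarrow>filter (\<lambda>x. \<not> P x) l. f x :: nat)"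
  by (induction l) auto

text \<open>Moving the elements below the cut to the front, with their mutual order kept, reverses
  exactly the pairs over which \<open>cross_sum\<close> runs. Both sides are additive to avoid
  subtraction of naturals.\<close>

lemma exchange:
  "vote_cost V (filter (\<lambda>x. x < q) l @ filter (\<lambda>x. \<not> x < q) l) + cross_sum (\<lambda>y x. V x y) q l =
    vote_cost V l + cross_sum V q l"
proof (induction l)
  case (Cons z l)
  have "(\<Sum>x\<leftarrow>l. V x z) = (\<Sum>x\<leftarrow>filter (\<lambda>x. x < q) l. V x z) + (\<Sum>x\<leftarrow>filter (\<lambda>x. \<not> x < q) l. V x z)"
    by (rule sum_list_partition)
  then show ?case using Cons by (auto simp: vote_cost_insert)
qed simp

lemma cross_sum_add: "cross_sum f q l + cross_sum g q l = cross_sum (\<lambda>y x. f y x + g y x) q l"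
  by (induction l) (auto simp: sum_list_addf)

lemma cross_sum_cong:
  assumes "\<And>x y. x \<in> set l \<Longrightarrow> y \<in> set l \<Longrightarrow> x < q \<Longrightarrow> q \<le> y \<Longrightarrow> f y x = g y x"
  shows "cross_sum f q l = cross_sum g q l"
  using assms
proof (induction l)
  case (Cons z l)
  have "map (f z) (filter (\<lambda>x. x < q) l) = map (g z) (filter (\<lambda>x. x < q) l)" if "\<not> z < q"
    using Cons.prems that by auto
  moreover have "cross_sum f q l = cross_sum g q l" by (rule Cons.IH) (use Cons.prems in auto)
  ultimately show ?case by (cases "z < q") (simp_all del: map_eq_conv)
qed simp

lemma cross_sum_const: "cross_sum (\<lambda>_ _. r) q l = r * cross_sum (\<lambda>_ _. 1) q l"
  by (induction l) (auto simp: algebra_simps sum_list_triv)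

lemma cross_sum_append_ge:
  "length (filter (\<lambda>x. \<not> x < q) s) * length (filter (\<lambda>x. x < q) t) \<le> cross_sum (\<lambda>_ _. 1) q (s @ t)"
  by (induction s) (auto simp: sum_list_triv)

lemma cross_sum_le:
  assumes "distinct l" "set l \<subseteq> {..<n}"
  shows "cross_sum g q l \<le> (\<Sum>v\<in>{q..<n}. \<Sum>u<q. g v u)"
proof -
  have "cross_sum g q l \<le> (\<Sum>v\<in>set l \<inter> {q..<n}. \<Sum>u<q. g v u)"
    using assms
  proof (induction l)
    case (Cons y l)
    have IH: "cross_sum g q l \<le> (\<Sum>v\<in>set l \<inter> {q..<n}. \<Sum>u<q. g v u)" using Cons by auto
    show ?case
    proof (cases "y < q")
      case True
      then have "set (y # l) \<inter> {q..<n} = set l \<inter> {q..<n}" by auto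
      then show ?thesis using True IH by simp
    next
      case False
      have "(\<Sum>x\<leftarrow>filter (\<lambda>x. x < q) l. g y x) = (\<Sum>x\<in>set (filter (\<lambda>x. x < q) l). g y x)"
        using Cons.prems by (intro sum_list_distinct_conv_sum_set) auto
      also have "\<dots> \<le> (\<Sum>u<q. g y u)" by (intro sum_mono2) auto
      finally have "(\<Sum>x\<leftarrow>filter (\<lambda>x. x < q) l. g y x) \<le> (\<Sum>u<q. g y u)" .
      moreover have "set (y # l) \<inter> {q..<n} = insert y (set l \<inter> {q..<n})" "y \<notin> set l \<inter> {q..<n}"
        using False Cons.prems by auto
      ultimately show ?thesis using False IH by simp
    qed
  qed simp
  also have "\<dots> \<le> (\<Sum>v\<in>{q..<n}. \<Sum>u<q. g v u)" by (intro sum_mono2) auto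
  finally show ?thesis .
qed

definition order_list :: "nat \<Rightarrow> nat list \<Rightarrow> bool" where
  "order_list n l \<longleftrightarrow> distinct l \<and> set l = {..<n}"

definition optimal_order :: "nat \<Rightarrow> (nat \<Rightarrow> nat \<Rightarrow> nat) \<Rightarrow> nat list \<Rightarrow> bool" where
  "optimal_order n V l \<longleftrightarrow> order_list n l \<and> (\<forall>l'. order_list n l' \<longrightarrow> vote_cost V l \<le> vote_cost V l')"

lemma length_order_list: "order_list n l \<Longrightarrow> length l = n"
  unfolding order_list_def by (metis card_lessThan distinct_card)

lemma optimal_order_exists:
  obtains l where "optimal_order n V l"
proof -
  have "order_list n [0..<n]" by (auto simp: order_list_def)
  then show thesis
    using that ex_has_least_nat[of "order_list n" "[0..<n]" "vote_cost V"]
    unfolding optimal_order_def by blast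
qed

text \<open>The factor 2 is the one lost in \<open>crossings_le_excess\<close>, where half of the
  votes on a set of pairs stand for all of them.\<close>

definition cut_excess :: "nat \<Rightarrow> (nat \<Rightarrow> nat \<Rightarrow> nat) \<Rightarrow> nat \<Rightarrow> nat" where
  "cut_excess n V q = 2 * (\<Sum>v\<in>{q..<n}. \<Sum>u<q. V v u)"

locale voting =
  fixes n r :: nat and V :: "nat \<Rightarrow> nat \<Rightarrow> nat"
  assumes r_pos: "0 < r" and votes_total: "\<And>u v. u < n \<Longrightarrow> v < n \<Longrightarrow> u \<noteq> v \<Longrightarrow> V u v + V v u = r"
begin

abbreviation "X \<equiv> cut_excess n V"

text \<open>By optimality the exchange at the cut does not pay. So of the votes on the crossing
  pairs, \<open>r\<close> for each pair, at least half go against the Borda order, and these are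
  among all votes against it across the cut.\<close>

lemma crossings_le_excess:
  assumes "optimal_order n V l"
  shows "r * cross_sum (\<lambda>_ _. 1) q l \<le> X q"
proof -
  let ?l' = "filter (\<lambda>x. x < q) l @ filter (\<lambda>x. \<not> x < q) l"
  have l: "distinct l" "set l = {..<n}" using assms by (auto simp: optimal_order_def order_list_def)
  have "order_list n ?l'" using l by (auto simp: order_list_def)
  then have "vote_cost V l \<le> vote_cost V ?l'" using assms by (simp add: optimal_order_def)
  then have 1: "cross_sum (\<lambda>y x. V x y) q l \<le> cross_sum V q l" using exchange[of V q l] by linarith
  have "r * cross_sum (\<lambda>_ _. 1) q l = cross_sum (\<lambda>y x. V x y + V y x) q l"
    unfolding cross_sum_const[symmetric] by (rule cross_sum_cong) (use l votes_total in auto)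
  also have "\<dots> = cross_sum (\<lambda>y x. V x y) q l + cross_sum V q l" by (simp add: cross_sum_add)
  also have "\<dots> \<le> 2 * cross_sum V q l" using 1 by simp
  also have "\<dots> \<le> X q" unfolding cut_excess_def using cross_sum_le[of l n V q] l by simp
  finally show ?thesis .
qed

text \<open>Each element above the cut inside the prefix precedes each element below the cut outside
  of it. Counting the prefix in two ways relates the two numbers.\<close>

lemma prefix_crossing:
  assumes "optimal_order n V l" "p \<le> n" "q \<le> n"
  defines "\<alpha> \<equiv> card (set (take p l) \<inter> {q..})" and "\<beta> \<equiv> card ({..<q} - set (take p l))"
  shows "r * (\<alpha> * \<beta>) \<le> X q" "\<beta> + p = \<alpha> + q"
proof -
  have l: "distinct l" "set l = {..<n}" "length l = n"
    using assms(1) length_order_list by (auto simp: optimal_order_def order_list_def)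
  have split: "set (take p l) \<union> set (drop p l) = {..<n}" "set (take p l) \<inter> set (drop p l) = {}"
    using l by (metis append_take_drop_id set_append, metis append_take_drop_id distinct_append)
  have "{..<q} - set (take p l) = set (filter (\<lambda>x. x < q) (drop p l))"
    using split assms(3) by fastforce
  then have b: "\<beta> = length (filter (\<lambda>x. x < q) (drop p l))"
    unfolding \<beta>_def using l(1) by (simp add: distinct_card del: set_filter)
  have "set (take p l) \<inter> {q..} = set (filter (\<lambda>x. \<not> x < q) (take p l))" by auto
  then have a: "\<alpha> = length (filter (\<lambda>x. \<not> x < q) (take p l))"
    unfolding \<alpha>_def using l(1) by (simp add: distinct_card del: set_filter)
  have "\<alpha> * \<beta> \<le> cross_sum (\<lambda>_ _. 1) q (take p l @ drop p l)"
    unfolding a b by (rule cross_sum_append_ge)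
  then have "r * (\<alpha> * \<beta>) \<le> r * cross_sum (\<lambda>_ _. 1) q l" by simp
  then show "r * (\<alpha> * \<beta>) \<le> X q" using crossings_le_excess[OF assms(1), of q] by linarith
  have "card ({..<q} - set (take p l)) + card ({..<q} \<inter> set (take p l)) = q"
    by (subst card_Un_disjoint[symmetric]) (auto intro!: arg_cong[where f = card, of _ "{..<q}", simplified])
  moreover have "card (set (take p l) \<inter> {q..}) + card ({..<q} \<inter> set (take p l)) = card (set (take p l))"
    by (subst card_Un_disjoint[symmetric]) (auto intro!: arg_cong[where f = card])
  moreover have "card (set (take p l)) = p" using l assms(2) by (simp add: distinct_card)
  ultimately show "\<beta> + p = \<alpha> + q" unfolding \<alpha>_def \<beta>_def by linarith
qed

text \<open>A single intruder from beyond \<open>q\<close> pushes more than \<open>q - p\<close>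
  elements below \<open>q\<close> out of the prefix. This makes more than \<open>q - p\<close>
  crossings at the price of \<open>r\<close> each, which the excess does not allow.
  \<open>prefix_lower\<close> is the mirror image.\<close>

lemma prefix_upper:
  assumes "optimal_order n V l" "p \<le> q" "q \<le> n" "X q + r * p \<le> r * q"
  shows "set (take p l) \<subseteq> {..<q}"
proof (rule ccontr)
  assume "\<not> ?thesis"
  then have "set (take p l) \<inter> {q..} \<noteq> {}" by auto
  then have "0 < card (set (take p l) \<inter> {q..})" (is "0 < ?a") by (simp add: card_gt_0_iff)
  moreover note c = prefix_crossing[OF assms(1) _ assms(3), of p]
  ultimately have "q - p < card ({..<q} - set (take p l))" (is "_ < ?b") using assms(2,3) by simp
  then have "Suc (q - p) \<le> ?a * ?b" using \<open>0 < ?a\<close> by (metis Suc_leI le_trans mult_le_mono1 nat_mult_1 One_nat_def)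
  then have "r * Suc (q - p) \<le> X q" using c(1) assms(2,3) by (meson le_trans mult_le_mono2)
  then have "r * q < X q + r * p" using assms(2) r_pos by (simp add: right_diff_distrib' algebra_simps)
  then show False using assms(4) by simp
qed

lemma prefix_lower:
  assumes "optimal_order n V l" "a \<le> p" "p \<le> n" "X a + r * a \<le> r * p"
  shows "{..<a} \<subseteq> set (take p l)"
proof (rule ccontr)
  assume "\<not> ?thesis"
  then have "{..<a} - set (take p l) \<noteq> {}" by auto
  then have "0 < card ({..<a} - set (take p l))" (is "0 < ?b") by (simp add: card_gt_0_iff)
  moreover note c = prefix_crossing[OF assms(1) assms(3), of a]
  ultimately have "p - a < card (set (take p l) \<inter> {a..})" (is "_ < ?a") using assms(2,3) by simp
  then have "Suc (p - a) \<le> ?a * ?b" using \<open>0 < ?b\<close> by (metis Suc_leI le_trans mult_le_mono2 nat_mult_1_right One_nat_def)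
  then have "r * Suc (p - a) \<le> X a" using c(1) assms(2,3) by (meson le_trans mult_le_mono2)
  then have "r * p < X a + r * a" using assms(2) r_pos by (simp add: right_diff_distrib' algebra_simps)
  then show False using assms(4) by simp
qed

lemma prefix_middle:
  assumes "optimal_order n V l" "p \<le> n"
  defines "m \<equiv> card ({..<p} - set (take p l))"
  shows "m * (m * r) \<le> X p"
  using prefix_crossing[OF assms(1,2,2)] unfolding m_def by (simp add: mult_ac)

lemma X_0: "X 0 = 0" and X_n: "X n = 0"
  by (simp_all add: cut_excess_def)

text \<open>The nearest cut from \<open>p\<close> on whose excess divided by \<open>r\<close> is at
  most its distance from \<open>p\<close>. It exists up to \<open>n\<close> because
  \<open>X n = 0\<close>; likewise \<open>lo\<close> exists because \<open>X 0 = 0\<close>.\<close>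

definition up :: "nat \<Rightarrow> nat" where
  "up p = (LEAST q. p \<le> q \<and> X q + r * p \<le> r * q)"

definition lo :: "nat \<Rightarrow> nat" where
  "lo p = (GREATEST a. a \<le> p \<and> X a + r * a \<le> r * p)"

lemma up: "p \<le> n \<Longrightarrow> p \<le> up p \<and> X (up p) + r * p \<le> r * up p"
  unfolding up_def by (rule LeastI[of _ n]) (simp add: X_n)

lemma up_le: "p \<le> n \<Longrightarrow> up p \<le> n"
  unfolding up_def by (rule Least_le) (simp add: X_n)

lemma below_up: "p \<le> q \<Longrightarrow> q < up p \<Longrightarrow> r * q < X q + r * p"
  unfolding up_def using not_less_Least by fastforce

lemma up_mono: "Suc p \<le> n \<Longrightarrow> up p \<le> up (Suc p)"
  using up[of "Suc p"] unfolding up_def[of p] by (intro Least_le) auto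

lemma up_n: "up n = n"
  using up[of n] up_le[of n] by simp

lemma up_0: "up 0 = 0"
  unfolding up_def by (rule Least_eq_0) (simp add: X_0)

lemma lo: "lo p \<le> p \<and> X (lo p) + r * lo p \<le> r * p"
  unfolding lo_def by (rule GreatestI_nat[of _ 0 p]) (auto simp: X_0)

lemma above_lo: "lo p < a \<Longrightarrow> a \<le> p \<Longrightarrow> r * p < X a + r * a"
proof (rule ccontr)
  assume "lo p < a" "a \<le> p" "\<not> r * p < X a + r * a"
  then have "a \<le> lo p" unfolding lo_def by (intro Greatest_le_nat[of _ _ p]) auto
  then show False using \<open>lo p < a\<close> by simp
qed

definition missing :: "nat \<Rightarrow> nat list \<Rightarrow> nat list" where
  "missing b \<tau> = filter (\<lambda>u. u \<notin> set \<tau>) [0..<b]"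

lemma set_missing: "set (missing b \<tau>) = {..<b} - set \<tau>"
  by (auto simp: missing_def)

text \<open>Charging a prefix with the missing elements appended in Borda order makes the price of
  the next element local: only its pairs with smaller missing ranks change, and these lie in the
  window.\<close>

definition completed_cost :: "nat list \<Rightarrow> nat" where
  "completed_cost \<tau> = vote_cost V (\<tau> @ missing n \<tau>)"

lemma missing_split:
  assumes "v < b" "v \<notin> set \<tau>"
  shows "missing b \<tau> = missing v \<tau> @ v # filter (\<lambda>u. u \<notin> set \<tau>) [Suc v..<b]"
    "missing b (\<tau> @ [v]) = missing v \<tau> @ filter (\<lambda>u. u \<notin> set \<tau>) [Suc v..<b]"
proof -
  have u: "[0..<b] = [0..<v] @ v # [Suc v..<b]"
    using assms(1) by (metis le0 less_imp_le_nat upt_add_eq_append upt_conv_Cons le_add_diff_inverse add_0)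
  show "missing b \<tau> = missing v \<tau> @ v # filter (\<lambda>u. u \<notin> set \<tau>) [Suc v..<b]"
    unfolding missing_def u using assms(2) by simp
  have "filter (\<lambda>u. u \<notin> set (\<tau> @ [v])) [0..<v] = filter (\<lambda>u. u \<notin> set \<tau>) [0..<v]"
    "filter (\<lambda>u. u \<notin> set (\<tau> @ [v])) [Suc v..<b] = filter (\<lambda>u. u \<notin> set \<tau>) [Suc v..<b]"
    by (rule filter_cong; auto)+
  then show "missing b (\<tau> @ [v]) = missing v \<tau> @ filter (\<lambda>u. u \<notin> set \<tau>) [Suc v..<b]"
    unfolding missing_def u by simp
qed

lemma completed_cost_step:
  assumes "v < n" "v \<notin> set \<tau>"
  shows "completed_cost (\<tau> @ [v]) + (\<Sum>u\<leftarrow>missing v \<tau>. V v u) =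
    completed_cost \<tau> + (\<Sum>u\<leftarrow>missing v \<tau>. V u v)"
proof -
  let ?P = "missing v \<tau>" and ?Q = "filter (\<lambda>u. u \<notin> set \<tau>) [Suc v..<n]"
  have "completed_cost (\<tau> @ [v]) = vote_cost V (\<tau> @ v # (?P @ ?Q))"
    unfolding completed_cost_def missing_split(2)[OF assms] by simp
  moreover have "completed_cost \<tau> = vote_cost V ((\<tau> @ ?P) @ v # ?Q)"
    unfolding completed_cost_def missing_split(1)[OF assms] by simp
  ultimately show ?thesis unfolding vote_cost_insert by simp
qed

lemma completed_cost_full: "order_list n \<tau> \<Longrightarrow> completed_cost \<tau> = vote_cost V \<tau>"
  by (simp add: completed_cost_def missing_def order_list_def)

lemma completed_cost_Nil: "completed_cost [] = vote_cost V [0..<n]"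
  by (simp add: completed_cost_def missing_def)

end



section \<open>Invariant of the dynamic program and the number of its states\<close>

section \<open>Sets of states\<close>

lemma foldl_insert_step:
  defines "same \<equiv> \<lambda>z t :: state. fst t = fst (fst z)"
  shows "fst (fst (foldl insert_step z ts)) = fst (fst z)"
    "snd (foldl insert_step z ts) = rev (filter (\<lambda>t. \<not> same z t) ts) @ snd z"
    "fst (foldl insert_step z ts) \<in> insert (fst z) {t \<in> set ts. same z t}"
    "t \<in> insert (fst z) {t \<in> set ts. same z t} \<Longrightarrow> fst (snd (fst (foldl insert_step z ts))) \<le> fst (snd t)"
proof -
  show 1: "fst (fst (foldl insert_step z ts)) = fst (fst z)" for z
    by (induction ts arbitrary: z) (auto simp: insert_step_def)
  show "snd (foldl insert_step z ts) = rev (filter (\<lambda>t. \<not> same z t) ts) @ snd z"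
    unfolding same_def by (induction ts arbitrary: z) (auto simp: insert_step_def)
  show "fst (foldl insert_step z ts) \<in> insert (fst z) {t \<in> set ts. same z t}"
    unfolding same_def
  proof (induction ts arbitrary: z)
    case (Cons t ts)
    show ?case using Cons[of "insert_step z t"] by (auto simp: insert_step_def split: if_splits)
  qed simp
  show "t \<in> insert (fst z) {t \<in> set ts. same z t} \<Longrightarrow> fst (snd (fst (foldl insert_step z ts))) \<le> fst (snd t)"
    unfolding same_def
  proof (induction ts arbitrary: z t)
    case (Cons u ts)
    let ?z = "insert_step z u"
    have f: "fst (fst ?z) = fst (fst z)" "fst (snd (fst ?z)) \<le> fst (snd (fst z))"
      "fst u = fst (fst z) \<Longrightarrow> fst (snd (fst ?z)) \<le> fst (snd u)"
      by (auto simp: insert_step_def)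
    have a: "fst (snd (fst (foldl insert_step ?z ts))) \<le> fst (snd (fst ?z))"
      by (rule Cons.IH) simp
    consider "t = fst z" | "t = u" "fst t = fst (fst z)" | "t \<in> set ts" "fst t = fst (fst ?z)"
      using Cons.prems f(1) by auto
    then show ?case
    proof cases
      case 3
      then show ?thesis using Cons.IH[of t ?z] by simp
    qed (use a f in auto)
  qed simp
qed

lemma insert_state:
  assumes "distinct (map fst ts)"
  shows "distinct (map fst (insert_state s ts))" "set (insert_state s ts) \<subseteq> insert s (set ts)"
    "\<And>t. t \<in> insert s (set ts) \<Longrightarrow> \<exists>t' \<in> set (insert_state s ts). fst t' = fst t \<and> fst (snd t') \<le> fst (snd t)"
    "length (insert_state s ts) \<le> Suc (length ts)"
proof -
  obtain b oth where z: "foldl insert_step (s, []) ts = (b, oth)" by fastforce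
  let ?oth = "rev (filter (\<lambda>t. fst t \<noteq> fst s) ts)"
  note f = foldl_insert_step[where z = "(s, [])" and ts = ts, unfolded z fst_conv snd_conv append_Nil2]
  have i: "insert_state s ts = b # ?oth"
    unfolding insert_state_def Let_def z fst_conv snd_conv f(2) ..
  have d: "distinct (map fst (filter (\<lambda>t. fst t \<noteq> fst s) ts))"
    using assms by (rule distinct_map_filter)
  have "fst b \<notin> fst ` set (filter (\<lambda>t. fst t \<noteq> fst s) ts)" unfolding f(1) by force
  then show "distinct (map fst (insert_state s ts))"
    using d unfolding i by (simp only: list.map distinct.simps set_map set_rev rev_map[symmetric] distinct_rev) simp
  show "set (insert_state s ts) \<subseteq> insert s (set ts)" unfolding i using f(3) by auto
  show "length (insert_state s ts) \<le> Suc (length ts)" unfolding i by simp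
  show "\<exists>t' \<in> set (insert_state s ts). fst t' = fst t \<and> fst (snd t') \<le> fst (snd t)"
    if t: "t \<in> insert s (set ts)" for t
  proof (cases "fst t = fst s")
    case True
    then have "t \<in> insert s {t \<in> set ts. fst t = fst s}" using t by blast
    from f(4)[OF this] have "fst b = fst t \<and> fst (snd b) \<le> fst (snd t)" using f(1) True by simp
    moreover have "b \<in> set (insert_state s ts)" unfolding i by simp
    ultimately show ?thesis by blast
  next
    case False
    then have "t \<in> set (insert_state s ts)" using t unfolding i by auto
    then show ?thesis by blast
  qed
qed

lemma insert_states:
  assumes "distinct (map fst out)"
  shows "distinct (map fst (foldl (\<lambda>o' c. insert_state c o') out cs)) \<and>
    set (foldl (\<lambda>o' c. insert_state c o') out cs) \<subseteq> set out \<union> set cs \<and>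
    (\<forall>t \<in> set out \<union> set cs. \<exists>t' \<in> set (foldl (\<lambda>o' c. insert_state c o') out cs).
       fst t' = fst t \<and> fst (snd t') \<le> fst (snd t))"
  using assms
proof (induction cs arbitrary: out)
  case (Cons c cs)
  note i = insert_state[OF Cons.prems, where s = c]
  note IH = Cons.IH[OF i(1)]
  let ?r = "foldl (\<lambda>o' c. insert_state c o') (insert_state c out) cs"
  have r: "foldl (\<lambda>o' c. insert_state c o') out (c # cs) = ?r" by simp
  have "\<exists>t' \<in> set ?r. fst t' = fst t \<and> fst (snd t') \<le> fst (snd t)" if t_in: "t \<in> set out \<union> set (c # cs)" for t
  proof -
    consider "t \<in> insert c (set out)" | "t \<in> set cs" using t_in by auto
    then show ?thesis
    proof cases
      case 1
      obtain t' where t': "t' \<in> set (insert_state c out)" "fst t' = fst t" "fst (snd t') \<le> fst (snd t)"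
        using i(3)[OF 1] by blast
      have "t' \<in> set (insert_state c out) \<union> set cs" using t'(1) by blast
      then obtain t'' where t'': "t'' \<in> set ?r" "fst t'' = fst t'" "fst (snd t'') \<le> fst (snd t')"
        using IH by blast
      have "fst t'' = fst t" "fst (snd t'') \<le> fst (snd t)" using t' t'' by simp_all
      then show ?thesis using t''(1) by blast
    next
      case 2
      then show ?thesis using IH by blast
    qed
  qed
  moreover have "set ?r \<subseteq> set out \<union> set (c # cs)"
  proof -
    have "set ?r \<subseteq> set (insert_state c out) \<union> set cs" using IH by blast
    then show ?thesis using i(2) by auto
  qed
  moreover have "distinct (map fst ?r)" using IH by blast
  ultimately show ?case unfolding r by blast
qed auto

text \<open>The at most one state produced at position \<open>t\<close>. Separating what is
  generated from how it is inserted turns a whole level into a single fold of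
  \<open>insert_state\<close>.\<close>

definition candidates :: "input \<Rightarrow> nat \<Rightarrow> nat \<Rightarrow> nat \<Rightarrow> rec \<Rightarrow> keyed \<Rightarrow> nat \<times> nat list \<Rightarrow> nat \<Rightarrow> state list" where
  "candidates i r off lo tgt us cp t = (case drop t us of [] \<Rightarrow> [] | v # post \<Rightarrow>
     (if admissible r lo tgt (take t us @ post)
      then [(take t us @ post, (fst cp + (off + votes_for i r (take t us) (snd v))) - votes_against i r (take t us) (snd v),
             snd v # snd cp)]
      else []))"

lemma extend_eq:
  "extend i r off lo tgt us cp out t = foldl (\<lambda>o' c. insert_state c o') out (candidates i r off lo tgt us cp t)"
  by (auto simp: extend_def candidates_def Let_def split: list.splits)

lemma foldl_concat_map:
  assumes "\<And>out x. g out x = foldl h out (f x)"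
  shows "foldl g out xs = foldl h out (concat (map f xs))"
  by (induction xs arbitrary: out) (auto simp: assms)

definition all_candidates :: "input \<Rightarrow> nat \<Rightarrow> nat \<Rightarrow> nat \<Rightarrow> rec \<Rightarrow> keyed \<Rightarrow> state \<Rightarrow> state list" where
  "all_candidates i r off lo tgt D s =
     concat (map (candidates i r off lo tgt (fst s @ D) (snd s)) [0..<length (fst s @ D)])"

lemma expand_eq:
  "expand i r off lo tgt D out s = foldl (\<lambda>o' c. insert_state c o') out (all_candidates i r off lo tgt D s)"
  unfolding expand_def Let_def all_candidates_def by (rule foldl_concat_map) (rule extend_eq)

lemma expand_all_eq:
  "foldl (expand i r off lo tgt D) out sts =
    foldl (\<lambda>o' c. insert_state c o') out (concat (map (all_candidates i r off lo tgt D) sts))"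
  by (rule foldl_concat_map) (rule expand_eq)


section \<open>Correctness of the dynamic program\<close>

locale election = voting n r V for n r :: nat and V :: "nat \<Rightarrow> nat \<Rightarrow> nat" +
  fixes i :: input and e :: "nat \<Rightarrow> nat"
  assumes V_eq: "V u v = votes i r (e u) (e v)"
begin

definition Rec :: "nat \<Rightarrow> rec" where
  "Rec k = (k, (if k < n then e k else 0), X k, r * k)"

definition tag :: "nat list \<Rightarrow> keyed" where
  "tag us = map (\<lambda>u. (u, e u)) us"

definition fits :: "nat \<Rightarrow> nat list \<Rightarrow> bool" where
  "fits p \<tau> \<longleftrightarrow> {..<lo p} \<subseteq> set \<tau> \<and> card ({..<p} - set \<tau>) * (card ({..<p} - set \<tau>) * r) \<le> X p"

text \<open>Every level adds the offset \<open>n * r\<close>, so the stored cost is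
  \<open>completed_cost \<tau>\<close> minus the cost of the Borda order plus
  \<open>p * (n * r)\<close>, stated here without subtraction. The path lists elements, whereas
  \<tau> lists their ranks.\<close>

definition represents :: "nat \<Rightarrow> state \<Rightarrow> nat list \<Rightarrow> bool" where
  "represents p s \<tau> \<longleftrightarrow> distinct \<tau> \<and> length \<tau> = p \<and> set \<tau> \<subseteq> {..<up p} \<and> fits p \<tau> \<and>
     fst s = tag (missing (up p) \<tau>) \<and> snd (snd s) = rev (map e \<tau>) \<and>
     fst (snd s) + vote_cost V [0..<n] = p * (n * r) + completed_cost \<tau>"

definition states_ok :: "nat \<Rightarrow> state list \<Rightarrow> bool" where
  "states_ok p sts \<longleftrightarrow> distinct (map fst sts) \<and> (\<forall>s \<in> set sts. \<exists>\<tau>. represents p s \<tau>)"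

text \<open>The invariant behind optimality: the set of the optimal prefix is present, reached at no
  greater cost, possibly along another path.\<close>

definition covers :: "nat \<Rightarrow> state list \<Rightarrow> nat list \<Rightarrow> bool" where
  "covers p sts l \<longleftrightarrow> (\<exists>s \<in> set sts. \<exists>\<tau>. represents p s \<tau> \<and> set \<tau> = set (take p l) \<and>
     completed_cost \<tau> \<le> completed_cost (take p l))"

lemma votes_for_tag: "votes_for i r (tag us) (e v) = (\<Sum>u\<leftarrow>us. V u v)"
proof -
  have "foldl (\<lambda>a u. a + votes i r (snd u) (e v)) k (tag us) = k + (\<Sum>u\<leftarrow>us. V u v)" for k
    by (induction us arbitrary: k) (auto simp: tag_def V_eq)
  then show ?thesis by (simp add: votes_for_def)
qed

lemma votes_against_tag: "votes_against i r (tag us) (e v) = (\<Sum>u\<leftarrow>us. V v u)"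
proof -
  have "foldl (\<lambda>a u. a + votes i r (e v) (snd u)) k (tag us) = k + (\<Sum>u\<leftarrow>us. V v u)" for k
    by (induction us arbitrary: k) (auto simp: tag_def V_eq)
  then show ?thesis by (simp add: votes_against_def)
qed

text \<open>The list holds everything missing below \<open>up (Suc p)\<close> in increasing order.
  So its head decides whether a rank below \<open>lo (Suc p)\<close> is missing, and counting its
  entries below \<open>Suc p\<close> is exact.\<close>

lemma admissible_tag:
  assumes "Suc p \<le> n"
  shows "admissible r (lo (Suc p)) (Rec (Suc p)) (tag (missing (up (Suc p)) \<tau>)) \<longleftrightarrow> fits (Suc p) \<tau>"
proof -
  let ?p = "Suc p" let ?us = "missing (up ?p) \<tau>"
  have b: "?p \<le> up ?p" "lo ?p \<le> ?p" using up[OF assms] lo[of ?p] by auto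
  have "set (filter (\<lambda>u. u < ?p) ?us) = {..<?p} - set \<tau>" using b by (auto simp: missing_def)
  moreover have "distinct ?us" by (simp add: missing_def)
  ultimately have "length (filter (\<lambda>u. u < ?p) ?us) = card ({..<?p} - set \<tau>)"
    by (metis distinct_card distinct_filter)
  moreover have "count_below ?p (tag ?us) = length (filter (\<lambda>u. u < ?p) ?us)"
    unfolding count_below tag_def by (simp add: filter_map comp_def)
  moreover have "(case tag ?us of [] \<Rightarrow> True | h # t \<Rightarrow> lo ?p \<le> fst h) \<longleftrightarrow> {..<lo ?p} \<subseteq> set \<tau>"
  proof -
    have srt: "sorted ?us" by (simp add: missing_def sorted_wrt_filter)
    have "{..<lo ?p} \<subseteq> set \<tau> \<longleftrightarrow> (\<forall>u \<in> set ?us. lo ?p \<le> u)" (is "_ = ?R")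
      using b by (force simp: missing_def not_less[symmetric])
    also have "?R \<longleftrightarrow> (case tag ?us of [] \<Rightarrow> True | h # t \<Rightarrow> lo ?p \<le> fst h)"
      using srt by (cases ?us) (auto simp: tag_def)
    finally show ?thesis by simp
  qed
  ultimately show ?thesis by (simp add: admissible_def Let_def Rec_def fits_def)
qed

lemma V_le: "u < n \<Longrightarrow> v < n \<Longrightarrow> u \<noteq> v \<Longrightarrow> V u v \<le> r"
  using votes_total[of u v] by simp

text \<open>Both directions are used: soundness preserves \<open>states_ok\<close>, completeness
  preserves \<open>covers\<close>.\<close>

lemma all_candidates_eq:
  assumes p: "Suc p \<le> n" and s: "represents p s \<tau>"
  defines "D \<equiv> tag [up p..<up (Suc p)]"
  shows "c \<in> set (all_candidates i r (n * r) (lo (Suc p)) (Rec (Suc p)) D s) \<longleftrightarrow>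
    (\<exists>v. v < up (Suc p) \<and> v \<notin> set \<tau> \<and> represents (Suc p) c (\<tau> @ [v]))"
    (is "?L \<longleftrightarrow> ?R")
proof -
  let ?b = "up (Suc p)" let ?us = "missing ?b \<tau>"
  have \<tau>: "distinct \<tau>" "length \<tau> = p" "set \<tau> \<subseteq> {..<up p}" "fst s = tag (missing (up p) \<tau>)"
    "snd (snd s) = rev (map e \<tau>)" "fst (snd s) + vote_cost V [0..<n] = p * (n * r) + completed_cost \<tau>"
    using s by (auto simp: represents_def)
  have b: "up p \<le> ?b" "?b \<le> n" using up_mono[OF p] up_le[OF p] by auto
  have "missing ?b \<tau> = missing (up p) \<tau> @ filter (\<lambda>u. u \<notin> set \<tau>) [up p..<?b]"
    unfolding missing_def using b(1) by (metis filter_append le0 le_add_diff_inverse upt_add_eq_append)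
  also have "filter (\<lambda>u. u \<notin> set \<tau>) [up p..<?b] = [up p..<?b]"
    using \<tau>(3) by (auto simp: filter_id_conv)
  finally have us: "fst s @ D = tag ?us" by (simp add: \<tau>(4) D_def tag_def)
  let ?new = "\<lambda>v. (tag (missing ?b (\<tau> @ [v])),
     (fst (snd s) + (n * r + (\<Sum>u\<leftarrow>missing v \<tau>. V u v))) - (\<Sum>u\<leftarrow>missing v \<tau>. V v u), rev (map e (\<tau> @ [v])))"
  have cand: "set (candidates i r (n * r) (lo (Suc p)) (Rec (Suc p)) (tag ?us) (snd s) t) =
      (if fits (Suc p) (\<tau> @ [?us ! t]) then {?new (?us ! t)} else {})" if t: "t < length ?us" for t
  proof -
    define v where "v = ?us ! t"
    have v: "v < ?b" "v \<notin> set \<tau>" using nth_mem[OF t] unfolding v_def[symmetric] by (auto simp: missing_def)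
    note ms = missing_split[OF v]
    have "?us = take t ?us @ v # drop (Suc t) ?us" using id_take_nth_drop[OF t] by (simp add: v_def)
    then have "missing v \<tau> @ v # filter (\<lambda>u. u \<notin> set \<tau>) [Suc v..<?b] = take t ?us @ v # drop (Suc t) ?us"
      using ms(1) by (simp only:)
    moreover have "v \<notin> set (missing v \<tau>)" "v \<notin> set (filter (\<lambda>u. u \<notin> set \<tau>) [Suc v..<?b])"
      by (auto simp: missing_def)
    ultimately have "missing v \<tau> = take t ?us \<and> filter (\<lambda>u. u \<notin> set \<tau>) [Suc v..<?b] = drop (Suc t) ?us"
      by (metis append_Cons_eq_iff)
    then have sp: "take t ?us = missing v \<tau>" "drop (Suc t) ?us = filter (\<lambda>u. u \<notin> set \<tau>) [Suc v..<?b]"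
      by simp_all
    have "drop t (tag ?us) = (v, e v) # tag (drop (Suc t) ?us)"
    proof -
      have "drop t ?us = v # drop (Suc t) ?us" using Cons_nth_drop_Suc[OF t] by (simp add: v_def)
      then show ?thesis by (simp add: tag_def drop_map del: drop_Suc)
    qed
    moreover have "take t (tag ?us) = tag (missing v \<tau>)" by (simp add: tag_def take_map sp(1))
    moreover have "tag (missing v \<tau>) @ tag (drop (Suc t) ?us) = tag (missing ?b (\<tau> @ [v]))"
      by (simp add: ms(2) sp(2) tag_def)
    ultimately show ?thesis
      unfolding candidates_def v_def[symmetric]
      by (simp add: admissible_tag[OF p] votes_for_tag votes_against_tag \<tau>(5))
  qed
  have new: "represents (Suc p) (?new v) (\<tau> @ [v]) \<longleftrightarrow> fits (Suc p) (\<tau> @ [v])"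
    if v: "v < ?b" "v \<notin> set \<tau>" for v
  proof -
    have vn: "v < n" using v b by simp
    \<comment> \<open>The subtraction is never truncated: the votes taken off are at most the offset
      \<open>n * r\<close> just added.\<close>
    have "(\<Sum>u\<leftarrow>missing v \<tau>. V v u) \<le> (\<Sum>u\<leftarrow>missing v \<tau>. r)"
      using vn by (intro sum_list_mono V_le) (auto simp: missing_def)
    also have "\<dots> \<le> n * r" using vn length_filter_le[of "\<lambda>u. u \<notin> set \<tau>" "[0..<v]"]
      by (auto simp: sum_list_triv missing_def)
    finally have "(\<Sum>u\<leftarrow>missing v \<tau>. V v u) \<le> n * r" .
    then have "fst (snd (?new v)) + vote_cost V [0..<n] = Suc p * (n * r) + completed_cost (\<tau> @ [v])"
      using completed_cost_step[OF vn v(2)] \<tau>(6) by simp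
    then show ?thesis using \<tau> v b by (auto simp: represents_def)
  qed
  have uniq: "c = ?new v" if "represents (Suc p) c (\<tau> @ [v])" "represents (Suc p) (?new v) (\<tau> @ [v])" for v
    using that unfolding represents_def by (intro prod_eqI) auto
  show ?thesis
  proof
    assume ?L
    then obtain t where t: "t < length ?us" "c \<in> set (candidates i r (n * r) (lo (Suc p)) (Rec (Suc p)) (tag ?us) (snd s) t)"
      unfolding all_candidates_def us by (auto simp: tag_def)
    then have c: "c = ?new (?us ! t)" "fits (Suc p) (\<tau> @ [?us ! t])" using cand[OF t(1)] by (auto split: if_splits)
    have v: "?us ! t < ?b" "?us ! t \<notin> set \<tau>" using nth_mem[OF t(1)] by (auto simp: missing_def)
    show ?R using new[OF v] c v by blast
  next
    assume ?R
    then obtain v where v: "v < ?b" "v \<notin> set \<tau>" "represents (Suc p) c (\<tau> @ [v])" by blast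
    then have f: "fits (Suc p) (\<tau> @ [v])" by (simp add: represents_def)
    have "v \<in> set ?us" using v by (simp add: missing_def)
    then obtain t where t: "t < length ?us" "?us ! t = v" by (auto simp: in_set_conv_nth)
    have "c = ?new v" using uniq[OF v(3)] new[OF v(1,2)] f by blast
    then have "c \<in> set (candidates i r (n * r) (lo (Suc p)) (Rec (Suc p)) (tag ?us) (snd s) t)"
      using cand[OF t(1)] f t(2) by simp
    then show ?L unfolding all_candidates_def us using t(1) by (auto simp: tag_def)
  qed
qed

lemma fits_optimal:
  assumes "optimal_order n V l" "p \<le> n"
  shows "fits p (take p l)" "set (take p l) \<subseteq> {..<up p}"
  using prefix_lower[OF assms(1) _ assms(2), of "lo p"] lo[of p] prefix_middle[OF assms]
    prefix_upper[OF assms(1) _ up_le[OF assms(2)], of p] up[OF assms(2)]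
  by (auto simp: fits_def)

lemma fits_cong: "set \<tau> = set \<tau>' \<Longrightarrow> fits p \<tau> = fits p \<tau>'"
  by (simp add: fits_def)

lemma missing_cong: "set \<tau> = set \<tau>' \<Longrightarrow> missing b \<tau> = missing b \<tau>'"
  by (simp add: missing_def)

text \<open>The price of appending an element depends only on the set already placed. Hence a
  cheaper path to the set of the optimal prefix remains at least as cheap after the next element of
  the optimum.\<close>

lemma level_states:
  assumes p: "Suc p \<le> n" and ok: "states_ok p sts" and opt: "optimal_order n V l" and cov: "covers p sts l"
  defines "sts' \<equiv> foldl (expand i r (n * r) (lo (Suc p)) (Rec (Suc p)) (tag [up p..<up (Suc p)])) [] sts"
  shows "states_ok (Suc p) sts'" "covers (Suc p) sts' l"
proof -
  let ?C = "all_candidates i r (n * r) (lo (Suc p)) (Rec (Suc p)) (tag [up p..<up (Suc p)])"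
  have "distinct (map fst ([] :: state list))" by simp
  note ins = insert_states[OF this, of "concat (map ?C sts)", folded expand_all_eq, folded sts'_def]
  show "states_ok (Suc p) sts'"
    unfolding states_ok_def
  proof (intro conjI ballI)
    show "distinct (map fst sts')" using ins by simp
    fix c assume "c \<in> set sts'"
    then obtain s where s: "s \<in> set sts" "c \<in> set (?C s)" using ins by auto
    then obtain \<tau> where "represents p s \<tau>" using ok by (auto simp: states_ok_def)
    then show "\<exists>\<tau>. represents (Suc p) c \<tau>" using all_candidates_eq[OF p] s(2) by blast
  qed
  obtain s \<tau> where s: "s \<in> set sts" "represents p s \<tau>" "set \<tau> = set (take p l)"
    "completed_cost \<tau> \<le> completed_cost (take p l)" using cov by (auto simp: covers_def)
  have l: "distinct l" "set l = {..<n}" "length l = n"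
    using opt length_order_list by (auto simp: optimal_order_def order_list_def)
  define v where "v = l ! p"
  have tk: "take (Suc p) l = take p l @ [v]" using l p by (simp add: v_def take_Suc_conv_app_nth)
  have "distinct (take p l @ [v])" using l(1) tk by (metis distinct_take)
  moreover have "v \<in> set l" unfolding v_def by (rule nth_mem) (use l p in simp)
  ultimately have v: "v \<notin> set (take p l)" "v < n" using l(2) by auto
  have sub: "set (take (Suc p) l) \<subseteq> {..<up (Suc p)}" "fits (Suc p) (take (Suc p) l)"
    using fits_optimal[OF opt p] by auto
  then have vb: "v < up (Suc p)" by (auto simp: tk)
  have v\<tau>: "v \<notin> set \<tau>" using v s(3) by simp
  have cost: "completed_cost (\<tau> @ [v]) \<le> completed_cost (take p l @ [v])"
    using completed_cost_step[OF v(2) v\<tau>] completed_cost_step[OF v(2,1)] s(4) missing_cong[OF s(3), of v]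
    by simp
  have \<tau>: "distinct \<tau>" "length \<tau> = p" "set \<tau> \<subseteq> {..<up p}" "snd (snd s) = rev (map e \<tau>)"
     "fst (snd s) + vote_cost V [0..<n] = p * (n * r) + completed_cost \<tau>"
    using s(2) by (auto simp: represents_def)
  have ft: "fits (Suc p) (\<tau> @ [v])" using sub(2) fits_cong[of "\<tau> @ [v]" "take (Suc p) l"] s(3) by (simp add: tk)
  define c :: state where "c = (tag (missing (up (Suc p)) (\<tau> @ [v])),
     Suc p * (n * r) + completed_cost (\<tau> @ [v]) - vote_cost V [0..<n], rev (map e (\<tau> @ [v])))"
  have "vote_cost V [0..<n] \<le> Suc p * (n * r) + completed_cost (\<tau> @ [v])"
  proof -
    have "(\<Sum>u\<leftarrow>missing v \<tau>. V v u) \<le> (\<Sum>u\<leftarrow>missing v \<tau>. r)"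
      using v(2) by (intro sum_list_mono V_le) (auto simp: missing_def)
    also have "\<dots> \<le> n * r" using v(2) length_filter_le[of "\<lambda>u. u \<notin> set \<tau>" "[0..<v]"]
      by (auto simp: sum_list_triv missing_def)
    finally show ?thesis using completed_cost_step[OF v(2) v\<tau>] \<tau>(5) by simp
  qed
  then have "represents (Suc p) c (\<tau> @ [v])"
    using \<tau> vb v\<tau> ft up_mono[OF p] by (auto simp: represents_def c_def)
  then have "c \<in> set (?C s)" using all_candidates_eq[OF p s(2)] vb v\<tau> by blast
  then have "c \<in> set (concat (map ?C sts))" using s(1) by auto
  moreover have "\<forall>t \<in> set [] \<union> set (concat (map ?C sts)). \<exists>t' \<in> set sts'. fst t' = fst t \<and> fst (snd t') \<le> fst (snd t)"
    using ins by blast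
  ultimately obtain c' where c': "c' \<in> set sts'" "fst c' = fst c" "fst (snd c') \<le> fst (snd c)"
    by blast
  obtain \<tau>' where \<tau>': "represents (Suc p) c' \<tau>'"
    using \<open>states_ok (Suc p) sts'\<close> c'(1) by (auto simp: states_ok_def)
  \<comment> \<open>A key determines the ranks missing below \<open>up (Suc p)\<close>, and with
    them the placed set, because nothing from \<open>up (Suc p)\<close> on is placed.\<close>
  have "map fst (tag (missing (up (Suc p)) \<tau>')) = map fst (tag (missing (up (Suc p)) (\<tau> @ [v])))"
    using \<tau>' c'(2) by (simp add: represents_def c_def)
  then have "missing (up (Suc p)) \<tau>' = missing (up (Suc p)) (\<tau> @ [v])" by (simp add: tag_def comp_def)
  then have "{..<up (Suc p)} - set \<tau>' = {..<up (Suc p)} - set (\<tau> @ [v])"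
    by (simp only: set_missing[symmetric])
  moreover have "set \<tau>' \<subseteq> {..<up (Suc p)}" "set (\<tau> @ [v]) \<subseteq> {..<up (Suc p)}"
    using \<tau>' \<open>represents (Suc p) c (\<tau> @ [v])\<close> by (auto simp: represents_def)
  ultimately have "set \<tau>' = set (\<tau> @ [v])" by blast
  moreover have "completed_cost \<tau>' \<le> completed_cost (\<tau> @ [v])"
    using \<tau>' \<open>represents (Suc p) c (\<tau> @ [v])\<close> c'(3) unfolding represents_def by linarith
  ultimately show "covers (Suc p) sts' l"
    unfolding covers_def using c'(1) \<tau>' s(3) cost by (intro bexI[of _ c'] exI[of _ \<tau>']) (auto simp: tk)
qed


subsection \<open>Number of states\<close>

definition half_width :: "nat \<Rightarrow> nat" where
  "half_width p = nat \<lfloor>sqrt (real (X p) / real r)\<rfloor>"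

text \<open>A state is fixed by the missing ranks in \<open>{lo p..<p}\<close> and the extra ones in
  \<open>{p..<up p}\<close>. Both sets have the same size, at most
  \<open>half_width p\<close>.\<close>

definition state_bound :: "nat \<Rightarrow> nat" where
  "state_bound p = (1 + (p - lo p)) ^ half_width p * (1 + (up p - p)) ^ half_width p"

lemma half_width_ge: "m * (m * r) \<le> X p \<Longrightarrow> m \<le> half_width p"
proof -
  assume "m * (m * r) \<le> X p"
  then have "real (m * (m * r)) \<le> real (X p)" by (simp only: of_nat_le_iff)
  then have "real m ^ 2 * real r \<le> real (X p)" by (simp add: power2_eq_square mult_ac)
  then have "real m ^ 2 \<le> real (X p) / real r" using r_pos by (simp add: pos_le_divide_eq)
  then have "real m \<le> sqrt (real (X p) / real r)" by (rule real_le_rsqrt)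
  then show ?thesis unfolding half_width_def by (simp add: le_nat_floor)
qed

text \<open>Choose \<open>k\<close> times an element of \<open>A\<close> or nothing; every small
  subset arises.\<close>

lemma card_small_subsets:
  assumes "finite A"
  shows "card {B. B \<subseteq> A \<and> card B \<le> k} \<le> (1 + card A) ^ k"
proof (induction k)
  case 0
  have "{B. B \<subseteq> A \<and> card B \<le> 0} = {{}}" using assms by (auto dest: finite_subset)
  then show ?case by simp
next
  case (Suc k)
  let ?S = "\<lambda>k. {B. B \<subseteq> A \<and> card B \<le> k}"
  have fin: "finite (?S k)" using assms by (auto intro: finite_subset[of _ "Pow A"])
  have "?S (Suc k) \<subseteq> (\<lambda>(a, B). case a of None \<Rightarrow> B | Some x \<Rightarrow> insert x B) ` (insert None (Some ` A) \<times> ?S k)"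
  proof
    fix B assume B: "B \<in> ?S (Suc k)"
    show "B \<in> (\<lambda>(a, B). case a of None \<Rightarrow> B | Some x \<Rightarrow> insert x B) ` (insert None (Some ` A) \<times> ?S k)"
    proof (cases "card B \<le> k")
      case True
      then show ?thesis using B by (intro image_eqI[of _ _ "(None, B)"]) auto
    next
      case False
      then obtain x where x: "x \<in> B" using B by fastforce
      have "finite B" using B assms by (auto dest: finite_subset)
      then have "card (B - {x}) \<le> k" using B x by (auto simp: card_Diff_singleton)
      then show ?thesis using B x by (intro image_eqI[of _ _ "(Some x, B - {x})"]) auto
    qed
  qed
  then have "card (?S (Suc k)) \<le> card ((\<lambda>(a, B). case a of None \<Rightarrow> B | Some x \<Rightarrow> insert x B) ` (insert None (Some ` A) \<times> ?S k))"
    using assms fin by (intro card_mono) auto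
  also have "\<dots> \<le> card (insert None (Some ` A) \<times> ?S k)"
    using assms fin by (intro card_image_le) auto
  also have "\<dots> = (1 + card A) * card (?S k)"
    using assms by (simp add: card_cartesian_product card_image)
  also have "\<dots> \<le> (1 + card A) * (1 + card A) ^ k" using Suc by (rule mult_le_mono2)
  finally show ?case by simp
qed

lemma length_states:
  assumes p: "p \<le> n" and ok: "states_ok p sts"
  shows "length sts \<le> state_bound p"
proof -
  define h where "h s = (SOME \<tau>. represents p s \<tau>)" for s
  have h: "represents p s (h s)" if "s \<in> set sts" for s
    using ok that unfolding h_def states_ok_def by (metis someI_ex)
  define g where "g s = ({..<p} - set (h s), set (h s) \<inter> {p..})" for s
  let ?A = "{B. B \<subseteq> {lo p..<p} \<and> card B \<le> half_width p}"
  let ?B = "{B. B \<subseteq> {p..<up p} \<and> card B \<le> half_width p}"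
  have dist: "distinct (map fst sts)" using ok by (simp add: states_ok_def)
  have "inj_on g (set sts)"
  proof (rule inj_onI)
    fix s t assume st: "s \<in> set sts" "t \<in> set sts" "g s = g t"
    have "set (h s) = ({..<p} - fst (g s)) \<union> snd (g s)" for s by (auto simp: g_def)
    then have "set (h s) = set (h t)" using st(3) by simp
    then have "missing (up p) (h s) = missing (up p) (h t)" by (simp add: missing_def)
    then have "fst s = fst t" using h[OF st(1)] h[OF st(2)] by (simp add: represents_def)
    then show "s = t" using dist st by (simp add: distinct_map inj_on_def)
  qed
  moreover have "distinct sts" using dist by (simp add: distinct_map)
  ultimately have "length sts = card (g ` set sts)" by (simp add: card_image distinct_card)
  also have "\<dots> \<le> card (?A \<times> ?B)"
  proof (rule card_mono)
    show "finite (?A \<times> ?B)" by (auto intro: finite_subset[of _ "Pow {lo p..<p}"] finite_subset[of _ "Pow {p..<up p}"])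
    show "g ` set sts \<subseteq> ?A \<times> ?B"
    proof
      fix x assume "x \<in> g ` set sts"
      then obtain s where s: "s \<in> set sts" "x = g s" by auto
      note r = h[OF s(1), unfolded represents_def fits_def]
      let ?S = "set (h s)"
      have "card ?S = p" using r by (simp add: distinct_card)
      moreover have "card ?S = card (?S \<inter> {..<p}) + card (?S \<inter> {p..})"
        by (subst card_Un_disjoint[symmetric]) (auto intro!: arg_cong[where f = card])
      moreover have "p = card ({..<p} - ?S) + card (?S \<inter> {..<p})"
      proof -
        have "{..<p} = ({..<p} - ?S) \<union> (?S \<inter> {..<p})" by auto
        then have "card {..<p} = card ({..<p} - ?S) + card (?S \<inter> {..<p})"
          by (metis (no_types, lifting) Diff_disjoint Int_Diff card_Un_disjoint finite_Diff finite_Int finite_lessThan inf_commute inf_left_commute inf_bot_right)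
        then show ?thesis by simp
      qed
      ultimately have eq: "card (?S \<inter> {p..}) = card ({..<p} - ?S)" by linarith
      have m: "card ({..<p} - ?S) \<le> half_width p" using r by (intro half_width_ge) auto
      have "{..<p} - ?S \<subseteq> {lo p..<p}" using r by (auto simp: not_less[symmetric])
      moreover have "?S \<inter> {p..} \<subseteq> {p..<up p}" using r by auto
      ultimately show "x \<in> ?A \<times> ?B" using m eq unfolding s(2) g_def by auto
    qed
  qed
  also have "\<dots> = card ?A * card ?B" by (rule card_cartesian_product)
  also have "\<dots> \<le> (1 + card {lo p..<p}) ^ half_width p * (1 + card {p..<up p}) ^ half_width p"
    by (intro mult_le_mono card_small_subsets) auto
  finally show ?thesis by (simp add: state_bound_def)
qed


subsection \<open>The levels\<close>

text \<open>Covers the step from level \<open>p\<close> to \<open>Suc p\<close>: the downward scan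
  and a bound on \<open>estimate\<close>. The upward scan is absent because it is paid for by the
  records it removes.\<close>

definition level_fuel :: "nat \<Rightarrow> nat" where
  "level_fuel p = (Suc p - lo (Suc p)) + (state_bound p)\<^sup>2 * (up (Suc p) - p) ^ 3"

definition cfg_ok :: "nat \<Rightarrow> dp \<Rightarrow> bool" where
  "cfg_ok p cfg \<longleftrightarrow> fst cfg = map Rec [up p..<Suc n] \<and> fst (snd cfg) = map Rec (rev [0..<Suc p]) \<and>
     states_ok p (fst (snd (snd cfg)))"

lemma upt_split:
  assumes "a \<le> b" "b < c"
  shows "[a..<c] = [a..<b] @ b # [Suc b..<c]"
proof -
  have "[a..<c] = [a..<b] @ [b..<c]"
    using upt_add_eq_append[of a b "c - b"] assms by simp
  then show ?thesis using upt_conv_Cons[OF assms(2)] by simp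
qed

lemma drop_limited_prefix:
  assumes "\<forall>x \<in> set xs. P x" "\<not> P y" "length xs \<le> k"
  shows "drop_limited k P (xs @ y # ys) = (k - length xs, y # ys)"
  using assms
proof (induction xs arbitrary: k)
  case Nil
  then show ?case by (cases k) auto
next
  case (Cons x xs)
  then obtain k' where "k = Suc k'" by (cases k) auto
  then show ?case using Cons by simp
qed

lemma dp_level_step:
  assumes p: "Suc p \<le> n" and ok: "cfg_ok p cfg" and opt: "optimal_order n V l"
    and cov: "covers p (fst (snd (snd cfg))) l" and fuel: "level_fuel p < snd (snd (snd cfg))"
  defines "cfg' \<equiv> dp_level i r (n * r) cfg (Rec (Suc p))"
  shows "cfg_ok (Suc p) cfg'" "covers (Suc p) (fst (snd (snd cfg'))) l"
    "snd (snd (snd cfg)) \<le> snd (snd (snd cfg')) + level_fuel p"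
proof -
  obtain fut past sts fl where cfg: "cfg = (fut, past, sts, fl)" by (cases cfg)
  have c: "fut = map Rec [up p..<Suc n]" "past = map Rec (rev [0..<Suc p])" "states_ok p sts"
    "covers p sts l" "level_fuel p < fl"
    using ok cov fuel by (auto simp: cfg cfg_ok_def)
  let ?b = "up (Suc p)" let ?a = "lo (Suc p)"
  note ub = up[OF p] and lb = lo[of "Suc p"]
  have bn: "?b \<le> n" "up p \<le> ?b" using up_le[OF p] up_mono[OF p] by auto
  have rec: "fst (Rec k) = k" "fst (snd (snd (Rec k))) = X k" "snd (snd (snd (Rec k))) = r * k" for k
    by (simp_all add: Rec_def)
  let ?P = "\<lambda>x. snd (snd (snd x)) < fst (snd (snd x)) + snd (snd (snd (Rec (Suc p))))"
  have fut: "fut = map Rec [up p..<?b] @ Rec ?b # map Rec [Suc ?b..<Suc n]"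
  proof -
    have "[up p..<Suc n] = [up p..<?b] @ ?b # [Suc ?b..<Suc n]"
      by (rule upt_split) (use bn in auto)
    then show ?thesis by (simp add: c(1))
  qed
  have P1: "\<forall>x \<in> set (map Rec [up p..<?b]). ?P x"
  proof
    fix x assume "x \<in> set (map Rec [up p..<?b])"
    then obtain q where q: "x = Rec q" "up p \<le> q" "q < ?b" by auto
    have "r * q < X q + r * Suc p"
    proof (cases "Suc p \<le> q")
      case True
      then show ?thesis using below_up q(3) by blast
    next
      \<comment> \<open>This happens only for \<open>q = up p = p\<close>, where the additional
        summand \<open>r\<close> decides the test.\<close>
      case False
      then have "r * q \<le> r * p" by simp
      moreover have "r * Suc p = r + r * p" by simp
      ultimately show ?thesis using r_pos by linarith
    qed
    then show "?P x" by (simp add: q rec)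
  qed
  have P2: "\<not> ?P (Rec ?b)" using ub by (simp add: rec add.commute)
  have su: "scan_up fut (Rec (Suc p)) = (rev (map Rec [up p..<?b]), map Rec [?b..<Suc n])"
  proof -
    have "takeWhile ?P fut = map Rec [up p..<?b]" "dropWhile ?P fut = Rec ?b # map Rec [Suc ?b..<Suc n]"
      unfolding fut using P1 P2 by (simp_all only: takeWhile_append2 dropWhile_append2 Ball_def takeWhile.simps dropWhile.simps if_False append_Nil2)
    moreover have "Rec ?b # map Rec [Suc ?b..<Suc n] = map Rec [?b..<Suc n]" using bn by (simp add: upt_conv_Cons del: upt_Suc)
    ultimately show ?thesis unfolding scan_up_def by simp
  qed
  let ?D = "tag [up p..<?b]"
  have D: "map (\<lambda>x. (fst x, fst (snd x))) (rev (fst (scan_up fut (Rec (Suc p))))) = ?D"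
    unfolding su fst_conv rev_rev_ident tag_def map_map by (rule map_cong) (use bn in \<open>auto simp: Rec_def\<close>)
  let ?past = "Rec (Suc p) # past"
  let ?Q = "\<lambda>x. snd (snd (snd (Rec (Suc p)))) < fst (snd (snd x)) + snd (snd (snd x))"
  have pst: "?past = map Rec (rev [Suc ?a..<Suc (Suc p)]) @ Rec ?a # map Rec (rev [0..<?a])"
  proof -
    have "[0..<Suc (Suc p)] = [0..<?a] @ ?a # [Suc ?a..<Suc (Suc p)]"
      by (rule upt_split) (use lb in auto)
    then have "rev [0..<Suc (Suc p)] = rev [Suc ?a..<Suc (Suc p)] @ ?a # rev [0..<?a]" by simp
    moreover have "?past = map Rec (rev [0..<Suc (Suc p)])" by (simp add: c(2))
    ultimately show ?thesis by (simp del: upt_Suc)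
  qed
  have Q1: "\<forall>x \<in> set (map Rec (rev [Suc ?a..<Suc (Suc p)])). ?Q x"
    using above_lo[of "Suc p"] by (auto simp: rec Suc_le_eq simp del: mult_Suc_right)
  have Q2: "\<not> ?Q (Rec ?a)" using lb by (simp add: rec)
  have len: "length (map Rec (rev [Suc ?a..<Suc (Suc p)])) = Suc p - ?a" by (simp del: upt_Suc)
  have "Suc p - ?a \<le> fl" using c(5) by (simp add: level_fuel_def)
  then have sd: "scan_down fl ?past (Rec (Suc p)) = (fl - (Suc p - ?a), Rec ?a # map Rec (rev [0..<?a]))"
    unfolding scan_down_def pst using drop_limited_prefix[OF Q1 Q2, of fl] by (simp only: len)
  obtain s0 rest where sts: "sts = s0 # rest" using c(4) by (cases sts) (auto simp: covers_def)
  obtain \<tau>0 where \<tau>0: "represents p s0 \<tau>0" using c(3) by (auto simp: states_ok_def sts)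
  have "length (missing (up p) \<tau>0) = up p - p"
  proof -
    have "length (missing (up p) \<tau>0) = card ({..<up p} - set \<tau>0)"
    proof -
      have "distinct (missing (up p) \<tau>0)" by (simp add: missing_def)
      from distinct_card[OF this] show ?thesis by (simp only: set_missing)
    qed
    also have "\<dots> = up p - p" using \<tau>0 by (simp add: represents_def card_Diff_subset distinct_card)
    finally show ?thesis .
  qed
  moreover have "p \<le> up p" using up[of p] p by simp
  ultimately have win: "window ?D sts = ?b - p"
    using \<tau>0 bn by (simp add: window_def sts represents_def tag_def)
  have est: "estimate ?D sts \<le> (state_bound p)\<^sup>2 * (?b - p) ^ 3"
  proof -
    have "estimate ?D sts = (length sts)\<^sup>2 * (?b - p) ^ 3"
      by (simp add: estimate_def Let_def win power2_eq_square power3_eq_cube)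
    also have "\<dots> \<le> (state_bound p)\<^sup>2 * (?b - p) ^ 3"
      using length_states[OF _ c(3)] p by (intro mult_le_mono1 power_mono) auto
    finally show ?thesis .
  qed
  have lt: "\<not> fl - (Suc p - ?a) \<le> estimate ?D sts" using est c(5) by (simp add: level_fuel_def)
  let ?sts' = "foldl (expand i r (n * r) ?a (Rec (Suc p)) ?D) [] sts"
  have "fl \<noteq> 0" using c(5) by simp
  then have cfg': "cfg' = (map Rec [?b..<Suc n], ?past, ?sts', fl - (Suc p - ?a) - estimate ?D sts)"
    unfolding cfg'_def dp_level_def Let_def cfg fst_conv snd_conv su D[unfolded su fst_conv] sd dp_finish_def
    using lt by (simp add: rec del: upt_Suc)
  note ls = level_states[OF p c(3) opt c(4)]
  show "cfg_ok (Suc p) cfg'" unfolding cfg_ok_def cfg' using ls(1) c(2) by simp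
  show "covers (Suc p) (fst (snd (snd cfg'))) l" unfolding cfg' using ls(2) by simp
  show "snd (snd (snd cfg)) \<le> snd (snd (snd cfg')) + level_fuel p"
    unfolding cfg' cfg using est by (simp add: level_fuel_def)
qed

lemma represents_start: "represents 0 ([], 0, []) []"
  by (simp add: represents_def fits_def up_0 tag_def missing_def completed_cost_Nil)
     (use lo[of 0] in simp)

lemma dp_levels:
  assumes "p \<le> n" and opt: "optimal_order n V l" and "(\<Sum>j<n. level_fuel j) < fuel"
  defines "cfg \<equiv> foldl (dp_level i r (n * r)) (map Rec [0..<Suc n], [Rec 0], [([], 0, [])], fuel) (map Rec [1..<Suc p])"
  shows "cfg_ok p cfg \<and> covers p (fst (snd (snd cfg))) l \<and>
    fuel \<le> snd (snd (snd cfg)) + (\<Sum>j<p. level_fuel j)"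
  using assms(1) unfolding cfg_def
proof (induction p)
  case 0
  show ?case using represents_start
    by (auto simp: cfg_ok_def states_ok_def covers_def up_0 upt_conv_Cons simp del: upt_Suc intro!: exI[of _ "[]"])
next
  case (Suc p)
  let ?c = "foldl (dp_level i r (n * r)) (map Rec [0..<Suc n], [Rec 0], [([], 0, [])], fuel) (map Rec [1..<Suc p])"
  have IH: "cfg_ok p ?c" "covers p (fst (snd (snd ?c))) l" "fuel \<le> snd (snd (snd ?c)) + (\<Sum>j<p. level_fuel j)"
    using Suc by auto
  have "(\<Sum>j<Suc p. level_fuel j) \<le> (\<Sum>j<n. level_fuel j)" using Suc.prems by (intro sum_mono2) auto
  then have "level_fuel p < snd (snd (snd ?c))" using IH(3) assms(3) by simp
  note st = dp_level_step[OF Suc.prems IH(1) opt IH(2) this]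
  have e: "foldl (dp_level i r (n * r)) (map Rec [0..<Suc n], [Rec 0], [([], 0, [])], fuel) (map Rec [1..<Suc (Suc p)]) =
      dp_level i r (n * r) ?c (Rec (Suc p))" by simp
  show ?case unfolding e using st IH(3) by simp
qed

lemma records_eq:
  assumes "length es = n" "\<And>k. k < n \<Longrightarrow> snd (es ! k) = e k"
    "\<And>k. k < n \<Longrightarrow> fst (es ! k) = (\<Sum>v\<in>{..<n} - {k}. V v k)"
  shows "records r es = map Rec [0..<Suc n]"
proof -
  \<comment> \<open>The Borda sum of rank \<open>k\<close> splits into votes from higher ranks,
    which enter the next cut, and votes from lower ranks, which are \<open>r * k\<close> minus the
    votes that leave the cut.\<close>
  have X_Suc: "X (Suc k) = X k + (fst (es ! k) + fst (es ! k)) - (r * k + r * k)"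
    "r * k + r * k \<le> X k + (fst (es ! k) + fst (es ! k))" if k: "k < n" for k
  proof -
    define A where "A = (\<Sum>v\<in>{Suc k..<n}. \<Sum>u<k. V v u)"
    have s: "{k..<n} = insert k {Suc k..<n}" using k by auto
    have x0: "X k = 2 * ((\<Sum>u<k. V k u) + A)" by (simp add: cut_excess_def s A_def)
    have x1: "X (Suc k) = 2 * ((\<Sum>v\<in>{Suc k..<n}. V v k) + A)"
      by (simp add: cut_excess_def A_def sum.distrib)
    have "{..<n} - {k} = {..<k} \<union> {Suc k..<n}" using k by auto
    then have "fst (es ! k) = (\<Sum>v\<in>{..<k} \<union> {Suc k..<n}. V v k)" using assms(3)[OF k] by argo
    also have "\<dots> = (\<Sum>u<k. V u k) + (\<Sum>v\<in>{Suc k..<n}. V v k)" by (rule sum.union_disjoint) auto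
    finally have b: "fst (es ! k) = (\<Sum>u<k. V u k) + (\<Sum>v\<in>{Suc k..<n}. V v k)" .
    have "(\<Sum>u<k. V u k) + (\<Sum>u<k. V k u) = (\<Sum>u<k. r)"
      unfolding sum.distrib[symmetric] using k votes_total by (intro sum.cong) auto
    then have "(\<Sum>u<k. V u k) + (\<Sum>u<k. V k u) = r * k" by (simp add: mult.commute)
    then have "r * k + r * k + X (Suc k) = X k + (fst (es ! k) + fst (es ! k))"
      using x0 x1 b unfolding distrib_left by linarith
    then show "X (Suc k) = X k + (fst (es ! k) + fst (es ! k)) - (r * k + r * k)"
      "r * k + r * k \<le> X k + (fst (es ! k) + fst (es ! k))" by linarith+
  qed
  have "foldl (record_step r) (0, 0, 0, []) (take k es) = (k, X k, r * k, rev (map Rec [0..<k]))" if "k \<le> n" for k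
    using that
  proof (induction k)
    case (Suc k)
    have "take (Suc k) es = take k es @ [es ! k]" using Suc.prems assms(1) by (simp add: take_Suc_conv_app_nth)
    then show ?case using Suc X_Suc[of k] assms(2)[of k] by (simp add: record_step_def Rec_def)
  qed (simp add: X_0)
  from this[of n] show ?thesis using assms(1) by (simp add: records_def Let_def Rec_def X_n)
qed

theorem solve_optimal:
  assumes "length es = n" "\<And>k. k < n \<Longrightarrow> snd (es ! k) = e k"
    "\<And>k. k < n \<Longrightarrow> fst (es ! k) = (\<Sum>v\<in>{..<n} - {k}. V v k)"
    "(\<Sum>j<n. level_fuel j) < fuel"
  obtains \<tau> where "optimal_order n V \<tau>" "solve i r fuel es = map e \<tau>"
proof -
  obtain l where l: "optimal_order n V l" by (rule optimal_order_exists)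
  define C where "C = foldl (dp_level i r (n * r)) (map Rec [0..<Suc n], [Rec 0], [([], 0, [])], fuel) (map Rec [1..<Suc n])"
  define sts where "sts = fst (snd (snd C))"
  have c: "cfg_ok n C" "covers n sts l"
    using dp_levels[OF order_refl l assms(4)] unfolding C_def sts_def by blast+
  then obtain s \<tau> where s: "s \<in> set sts" "represents n s \<tau>" "set \<tau> = set (take n l)"
    "completed_cost \<tau> \<le> completed_cost (take n l)" by (auto simp: covers_def)
  have full: "order_list n \<tau>'" if "represents n s' \<tau>'" for s' \<tau>'
  proof -
    have "card (set \<tau>') = n" "set \<tau>' \<subseteq> {..<n}" "distinct \<tau>'"
      using that by (auto simp: represents_def up_n distinct_card)
    then show ?thesis unfolding order_list_def by (metis card_lessThan card_subset_eq finite_lessThan)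
  qed
  have ol: "order_list n l" using l by (simp add: optimal_order_def)
  have "vote_cost V \<tau> \<le> vote_cost V l"
    using s(4) completed_cost_full[OF full[OF s(2)]] completed_cost_full[OF ol] length_order_list[OF ol] by simp
  then have opt: "optimal_order n V \<tau>"
    using l full[OF s(2)] unfolding optimal_order_def by (meson le_trans)
  obtain s0 rest where sts: "sts = s0 # rest" using s(1) by (cases sts) auto
  \<comment> \<open>At level \<open>n\<close> all windows are empty, so distinct keys leave exactly
    one state. The head of the list, which \<open>solve\<close> reads, is therefore the covering
    state.\<close>
  have key: "fst s' = []" if s_in: "s' \<in> set sts" for s'
  proof -
    obtain \<tau>' where r': "represents n s' \<tau>'" using c(1) s_in unfolding cfg_ok_def states_ok_def sts_def by blast
    have "missing (up n) \<tau>' = []" using full[OF r'] by (simp add: missing_def up_n order_list_def)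
    then show ?thesis using r' by (simp add: represents_def tag_def)
  qed
  have "distinct (map fst sts)" using c(1) by (simp add: cfg_ok_def states_ok_def sts_def)
  moreover have "fst s0 = fst s" using key[of s0] key[OF s(1)] sts by simp
  moreover have "s0 \<in> set sts" using sts by simp
  ultimately have "s0 = s" using s(1) by (simp add: distinct_map inj_on_def)
  then have "snd (snd s0) = rev (map e \<tau>)" using s(2) by (simp add: represents_def)
  moreover have "solve i r fuel es = rev (snd (snd s0))"
  proof -
    have "map Rec [0..<Suc n] = Rec 0 # map Rec [1..<Suc n]" by (simp add: upt_conv_Cons del: upt_Suc)
    moreover have "records r es = map Rec [0..<Suc n]" by (rule records_eq[OF assms(1-3)])
    ultimately have "records r es = Rec 0 # map Rec [1..<Suc n]" by simp
    then show ?thesis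
      using sts \<open>map Rec [0..<Suc n] = Rec 0 # map Rec [1..<Suc n]\<close> assms(1)
      unfolding solve_def Let_def sts_def C_def by (simp del: upt_Suc)
  qed
  ultimately show thesis using that opt by simp
qed

end

section \<open>Exponential moments under Mallows' model by q-counting\<close>

section \<open>Counting pairs in a list\<close>

primrec count_pairs :: "('a \<Rightarrow> 'a \<Rightarrow> bool) \<Rightarrow> 'a list \<Rightarrow> nat" where
  "count_pairs Q [] = 0"
| "count_pairs Q (y # l) = length (filter (Q y) l) + count_pairs Q l"

lemma count_pairs_card:
  "count_pairs Q l = card {(a, b). a < b \<and> b < length l \<and> Q (l ! a) (l ! b)}"
proof (induction l)
  case (Cons y l)
  let ?A = "(\<lambda>b. (0 :: nat, Suc b)) ` {b. b < length l \<and> Q y (l ! b)}"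
  let ?B = "(\<lambda>(a, b). (Suc a, Suc b)) ` {(a, b). a < b \<and> b < length l \<and> Q (l ! a) (l ! b)}"
  have "{(a, b). a < b \<and> b < length (y # l) \<and> Q ((y # l) ! a) ((y # l) ! b)} = ?A \<union> ?B"
  proof (intro equalityI subsetI)
    fix x assume "x \<in> {(a, b). a < b \<and> b < length (y # l) \<and> Q ((y # l) ! a) ((y # l) ! b)}"
    then obtain a b where x: "x = (a, Suc b)" "a < Suc b" "b < length l" "Q ((y # l) ! a) (l ! b)"
      by (auto elim!: less_natE)
    show "x \<in> ?A \<union> ?B"
    proof (cases a)
      case 0
      then show ?thesis using x by auto
    next
      case (Suc a')
      then have "(a', b) \<in> {(a, b). a < b \<and> b < length l \<and> Q (l ! a) (l ! b)}" using x by auto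
      then show ?thesis using x Suc by (intro UnI2 image_eqI[of _ _ "(a', b)"]) auto
    qed
  qed auto
  moreover have "?A \<inter> ?B = {}" by auto
  moreover have "finite {(a, b). a < b \<and> b < length l \<and> Q (l ! a) (l ! b)}"
    by (rule finite_subset[of _ "{..<length l} \<times> {..<length l}"]) auto
  moreover have "card ?A = length (filter (Q y) l)"
    by (subst card_image) (auto simp: inj_on_def length_filter_conv_card)
  moreover have "card ?B = count_pairs Q l"
    unfolding Cons.IH by (rule card_image) (auto simp: inj_on_def)
  ultimately show ?case by (simp add: card_Un_disjoint)
qed simp


section \<open>The generating function of crossing inversions\<close>

definition qnum :: "real \<Rightarrow> nat \<Rightarrow> real" where
  "qnum q a = (\<Sum>i<a. q ^ i)"

lemma qnum_add: "qnum q (a + m) = qnum q a + q ^ a * qnum q m"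
  unfolding qnum_def by (induction m) (auto simp: algebra_simps power_add)

lemma qnum_nonneg: "0 \<le> q \<Longrightarrow> 0 \<le> qnum q a"
  unfolding qnum_def by (intro sum_nonneg) auto

lemma qnum_closed: "(1 - q) * qnum q a = 1 - q ^ a"
proof (induction a)
  case (Suc a)
  have "qnum q (Suc a) = qnum q a + q ^ a" by (simp add: qnum_def)
  then have "(1 - q) * qnum q (Suc a) = (1 - q) * qnum q a + (1 - q) * q ^ a"
    by (simp only: distrib_left)
  then show ?case using Suc by (simp add: left_diff_distrib)
qed (simp add: qnum_def)

lemma qnum_pos: "0 < q \<Longrightarrow> 0 < a \<Longrightarrow> 0 < qnum q a"
  unfolding qnum_def by (intro sum_pos) auto

definition crossing :: "nat \<Rightarrow> nat \<Rightarrow> nat \<Rightarrow> bool" where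
  "crossing p y x \<longleftrightarrow> x < p \<and> p \<le> y"

definition one_sided :: "nat \<Rightarrow> nat \<Rightarrow> nat \<Rightarrow> bool" where
  "one_sided p y x \<longleftrightarrow> x < y \<and> (x < p \<longleftrightarrow> y < p)"

text \<open>Inversions within one side of the cut weigh \<open>q\<close>, those across it
  \<open>x\<close>. For \<open>x = q = exp (- \<beta>)\<close> this is the Mallows normalizer. For
  \<open>q = exp (- \<beta>)\<close> and \<open>x = exp (- \<beta> / 2)\<close> it is the tilted sum
  whose quotient by the normalizer is the moment sought.\<close>

definition shuffle_sum :: "nat \<Rightarrow> real \<Rightarrow> real \<Rightarrow> nat set \<Rightarrow> real" where
  "shuffle_sum p q x A = (\<Sum>l\<in>permutations_of_set A.
     q ^ count_pairs (one_sided p) l * x ^ count_pairs (crossing p) l)"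

lemma shuffle_sum_empty [simp]: "shuffle_sum p q x {} = 1"
  by (simp add: shuffle_sum_def)

lemma shuffle_sum_rec:
  assumes "finite A" "A \<noteq> {}"
  shows "shuffle_sum p q x A = (\<Sum>y\<in>A. q ^ card {z \<in> A. one_sided p y z} *
    x ^ card {z \<in> A. crossing p y z} * shuffle_sum p q x (A - {y}))"
proof -
  let ?w = "\<lambda>l. q ^ count_pairs (one_sided p) l * x ^ count_pairs (crossing p) l"
  have "shuffle_sum p q x A = (\<Sum>l\<in>(\<Union>y\<in>A. (\<lambda>l. y # l) ` permutations_of_set (A - {y})). ?w l)"
    unfolding shuffle_sum_def by (subst permutations_of_set_nonempty[OF assms(2)]) simp
  also have "\<dots> = (\<Sum>y\<in>A. \<Sum>l\<in>(\<lambda>l. y # l) ` permutations_of_set (A - {y}). ?w l)"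
    using assms(1) by (intro sum.UNION_disjoint) auto
  also have "\<dots> = (\<Sum>y\<in>A. \<Sum>l\<in>permutations_of_set (A - {y}). ?w (y # l))"
    by (rule sum.cong[OF refl]) (simp add: sum.reindex inj_on_def)
  also have "\<dots> = (\<Sum>y\<in>A. q ^ card {z \<in> A. one_sided p y z} *
    x ^ card {z \<in> A. crossing p y z} * shuffle_sum p q x (A - {y}))"
  proof (intro sum.cong refl)
    fix y assume "y \<in> A"
    have *: "length (filter Q l) = card {z \<in> A. Q z}"
      if "l \<in> permutations_of_set (A - {y})" "\<not> Q y" for l Q
    proof -
      have "distinct l" "set l = A - {y}" using that(1) by (auto simp: permutations_of_set_def)
      then have "length (filter Q l) = card {z \<in> A - {y}. Q z}"
        by (metis distinct_card distinct_filter set_filter)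
      moreover have "{z \<in> A - {y}. Q z} = {z \<in> A. Q z}" using that(2) by auto
      ultimately show ?thesis by simp
    qed
    have "?w (y # l) = q ^ card {z \<in> A. one_sided p y z} * x ^ card {z \<in> A. crossing p y z} * ?w l"
      if "l \<in> permutations_of_set (A - {y})" for l
      using *[OF that, of "one_sided p y"] *[OF that, of "crossing p y"]
      by (simp add: one_sided_def crossing_def power_add)
    then show "(\<Sum>l\<in>permutations_of_set (A - {y}). ?w (y # l)) = q ^ card {z \<in> A. one_sided p y z} *
      x ^ card {z \<in> A. crossing p y z} * shuffle_sum p q x (A - {y})"
      unfolding shuffle_sum_def by (simp add: sum_distrib_left)
  qed
  finally show ?thesis .
qed

lemma sum_rank:
  fixes B :: "nat set"
  assumes "finite B"
  shows "(\<Sum>y\<in>B. (q :: real) ^ card {z \<in> B. z < y}) = qnum q (card B)"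
  using assms
proof (induction B rule: finite_linorder_max_induct)
  case (insert b B)
  have "(\<Sum>y\<in>B. q ^ card {z \<in> insert b B. z < y}) = (\<Sum>y\<in>B. q ^ card {z \<in> B. z < y})"
    using insert(2) by (intro sum.cong refl arg_cong[where f = "\<lambda>S. q ^ card S"]) auto
  moreover have "{z \<in> insert b B. z < b} = B" using insert(2) by auto
  moreover have "b \<notin> B" using insert(2) by auto
  ultimately show ?case using insert by (simp add: qnum_def)
qed (simp add: qnum_def)

definition qfact :: "real \<Rightarrow> nat \<Rightarrow> real" where
  "qfact q n = (\<Prod>k<n. qnum q (Suc k))"

text \<open>Crossing inversions of a shuffle of a and m elements are counted by the Gaussian
  binomial in x, whereas the normalizer contains the one in x^2. Since 1 - x^(2i) = (1 - x^i) (1 +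
  x^i), their quotient is the product of (1 + x^i) / (1 + x^(m+i)) over 1 <= i <= a. Dropping the
  denominators gives this product, which is free of m.\<close>

definition cross_bound :: "real \<Rightarrow> nat \<Rightarrow> real" where
  "cross_bound x a = (\<Prod>i<a. 1 + x ^ Suc i)"

text \<open>The sums split by the first element of the list. If it is below the cut it creates no
  crossing inversion; if above, one with each element below. Summing over its rank on its own side
  gives the q-integer.\<close>

lemma shuffle_sum_split:
  fixes S :: "nat set \<Rightarrow> real"
  assumes "finite A"
    and "\<And>y. y \<in> A \<Longrightarrow> y < p \<Longrightarrow> S (A - {y}) = u" "\<And>y. y \<in> A \<Longrightarrow> p \<le> y \<Longrightarrow> S (A - {y}) = v"
  shows "(\<Sum>y\<in>A. q ^ card {z \<in> A. one_sided p y z} * x ^ card {z \<in> A. crossing p y z} * S (A - {y}))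
    = qnum q (card {z \<in> A. z < p}) * u +
      x ^ card {z \<in> A. z < p} * qnum q (card {z \<in> A. p \<le> z}) * v"
proof -
  let ?L = "{z \<in> A. z < p}" and ?R = "{z \<in> A. p \<le> z}"
  let ?f = "\<lambda>y. q ^ card {z \<in> A. one_sided p y z} * x ^ card {z \<in> A. crossing p y z} * S (A - {y})"
  have fin: "finite ?L" "finite ?R" using assms(1) by auto
  have "A = ?L \<union> ?R" by auto
  then have "(\<Sum>y\<in>A. ?f y) = (\<Sum>y\<in>?L. ?f y) + (\<Sum>y\<in>?R. ?f y)"
    using assms(1) by (subst sum.union_disjoint[symmetric]) auto
  also have "(\<Sum>y\<in>?L. ?f y) = (\<Sum>y\<in>?L. q ^ card {z \<in> ?L. z < y} * u)"
  proof (intro sum.cong refl)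
    fix y assume y: "y \<in> ?L"
    then have *: "{z \<in> A. one_sided p y z} = {z \<in> ?L. z < y}" "{z \<in> A. crossing p y z} = {}"
      by (auto simp: one_sided_def crossing_def)
    show "?f y = q ^ card {z \<in> ?L. z < y} * u" unfolding * using y assms(2) by simp
  qed
  also have "\<dots> = qnum q (card ?L) * u"
    by (simp only: sum_distrib_right[symmetric] sum_rank[OF fin(1)])
  also have "(\<Sum>y\<in>?R. ?f y) = (\<Sum>y\<in>?R. q ^ card {z \<in> ?R. z < y} * (x ^ card ?L * v))"
  proof (intro sum.cong refl)
    fix y assume y: "y \<in> ?R"
    then have *: "{z \<in> A. one_sided p y z} = {z \<in> ?R. z < y}" "{z \<in> A. crossing p y z} = ?L"
      by (auto simp: one_sided_def crossing_def)
    show "?f y = q ^ card {z \<in> ?R. z < y} * (x ^ card ?L * v)" unfolding * using y assms(3) by simp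
  qed
  also have "\<dots> = qnum q (card ?R) * (x ^ card ?L * v)"
    by (simp only: sum_distrib_right[symmetric] sum_rank[OF fin(2)])
  finally show ?thesis by (simp add: mult_ac)
qed

lemma card_remove_low:
  assumes "finite A" "y \<in> A" "y < p"
  shows "card {z \<in> A - {y}. z < p} = card {z \<in> A. z < p} - 1"
proof -
  have "{z \<in> A - {y}. z < p} = {z \<in> A. z < p} - {y}" by auto
  then show ?thesis using assms by (simp add: card_Diff_singleton)
qed

lemma card_remove_high:
  assumes "p \<le> y"
  shows "card {z \<in> A - {y}. z < p} = card {z \<in> A. z < (p :: nat)}"
proof -
  have "{z \<in> A - {y}. z < p} = {z \<in> A. z < p}" using assms by auto
  then show ?thesis by simp
qed

lemma card_split:
  assumes "finite (A :: nat set)"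
  shows "card A = card {z \<in> A. z < p} + card {z \<in> A. p \<le> z}"
proof -
  have "A = {z \<in> A. z < p} \<union> {z \<in> A. p \<le> z}" by auto
  then show ?thesis using assms by (subst card_Un_disjoint[symmetric]) auto
qed

text \<open>With equal weights the cut disappears, and the classical product for counting
  permutations by inversions remains.\<close>

lemma shuffle_sum_diag: "finite A \<Longrightarrow> shuffle_sum p q q A = qfact q (card A)"
proof (induction "card A" arbitrary: A)
  case (Suc n)
  have ne: "A \<noteq> {}" using Suc.hyps(2) by auto
  have "shuffle_sum p q q (A - {y}) = qfact q n" if "y \<in> A" for y
  proof -
    have "n = card (A - {y})" using Suc.hyps(2) Suc.prems that by (metis card_Diff_singleton diff_Suc_1)
    then show ?thesis using Suc.hyps(1)[of "A - {y}"] Suc.prems by simp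
  qed
  then have "shuffle_sum p q q A = qnum q (card {z \<in> A. z < p}) * qfact q n +
      q ^ card {z \<in> A. z < p} * qnum q (card {z \<in> A. p \<le> z}) * qfact q n"
    unfolding shuffle_sum_rec[OF Suc.prems ne]
    by (intro shuffle_sum_split Suc.prems) auto
  also have "\<dots> = qnum q (card A) * qfact q n"
    by (simp add: card_split[OF Suc.prems, of p] qnum_add algebra_simps)
  also have "\<dots> = qfact q (Suc n)" by (simp add: qfact_def Suc.hyps(2)[symmetric] mult.commute)
  finally show ?case using Suc.hyps(2) by simp
qed (simp add: qfact_def)

lemma qfact_pos: "0 < q \<Longrightarrow> 0 < qfact q n"
  unfolding qfact_def by (intro prod_pos) (auto intro: qnum_pos)

lemma cross_bound_pos: "0 < x \<Longrightarrow> 0 < cross_bound x a"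
  unfolding cross_bound_def by (intro prod_pos) (auto intro!: add_pos_pos)

text \<open>For a > 0, after division by \<open>cross_bound x (a - 1)\<close> the claim becomes (1 -
  q^a) [m] <= [a] for q = x^2, with [k] the q-integer. It follows from 1 - q^a = (1 - q) [a] and (1
  - q) [m] <= 1.\<close>

lemma cross_bound_step:
  assumes "0 < x" "x < 1"
  shows "(if a = 0 then 0 else qnum (x\<^sup>2) a * cross_bound x (a - 1)) + x ^ a * qnum (x\<^sup>2) m * cross_bound x a
    \<le> cross_bound x a * qnum (x\<^sup>2) (a + m)"
proof (cases a)
  case 0
  then show ?thesis by (simp add: qnum_def)
next
  case (Suc b)
  let ?q = "x\<^sup>2"
  have q: "0 < ?q" "?q < 1" using assms by (auto simp: power_less_one_iff)
  have C: "cross_bound x a = (1 + x ^ a) * cross_bound x b" by (simp add: cross_bound_def Suc)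
  have qa: "?q ^ a = x ^ a * x ^ a" by (metis power_even_eq power_mult power2_eq_square power_mult_distrib mult.commute)
  have "(1 - ?q) * qnum ?q m \<le> 1" using q by (simp add: qnum_closed)
  then have "((1 - ?q) * qnum ?q m) * qnum ?q a \<le> 1 * qnum ?q a"
    using q by (intro mult_right_mono qnum_nonneg) auto
  then have "(1 - ?q ^ a) * qnum ?q m \<le> qnum ?q a"
    by (simp add: qnum_closed[of ?q a, symmetric] mult_ac)
  then have "(x ^ a * cross_bound x b) * ((1 - ?q ^ a) * qnum ?q m) \<le> (x ^ a * cross_bound x b) * qnum ?q a"
    using assms cross_bound_pos[of x b] by (intro mult_left_mono) auto
  then show ?thesis
    unfolding C qnum_add qa using Suc by (simp add: algebra_simps)
qed

lemma merge_terms: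
  "qnum q a * (cross_bound x (a - 1) * F) + y * (z * F) =
    ((if a = 0 then 0 else qnum q a * cross_bound x (a - 1)) + y * z) * F"
  by (cases "a = 0") (simp_all add: qnum_def algebra_simps)

lemma shuffle_sum_bound:
  assumes "0 < x" "x < 1" "finite A"
  shows "shuffle_sum p (x\<^sup>2) x A \<le> cross_bound x (card {z \<in> A. z < p}) * qfact (x\<^sup>2) (card A)"
  using assms(3)
proof (induction "card A" arbitrary: A)
  case (Suc n)
  let ?a = "card {z \<in> A. z < p}" and ?m = "card {z \<in> A. p \<le> z}" and ?q = "x\<^sup>2"
  have ne: "A \<noteq> {}" using Suc.hyps(2) by auto
  let ?S = "\<lambda>B. cross_bound x (card {z \<in> B. z < p}) * qfact ?q n"
  have "shuffle_sum p ?q x A \<le> (\<Sum>y\<in>A. ?q ^ card {z \<in> A. one_sided p y z} *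
    x ^ card {z \<in> A. crossing p y z} * ?S (A - {y}))"
    unfolding shuffle_sum_rec[OF Suc.prems ne]
  proof (intro sum_mono mult_left_mono)
    fix y assume "y \<in> A"
    then show "shuffle_sum p ?q x (A - {y}) \<le> ?S (A - {y})"
    proof -
      assume "y \<in> A"
      then have "n = card (A - {y})" using Suc.hyps(2) Suc.prems by (metis card_Diff_singleton diff_Suc_1)
      then show ?thesis using Suc.hyps(1)[of "A - {y}"] Suc.prems by simp
    qed
  qed (use assms in auto)
  also have "\<dots> = qnum ?q ?a * (cross_bound x (?a - 1) * qfact ?q n) +
      x ^ ?a * qnum ?q ?m * (cross_bound x ?a * qfact ?q n)"
  proof (intro shuffle_sum_split Suc.prems)
    fix y assume "y \<in> A" "y < p"
    then show "?S (A - {y}) = cross_bound x (?a - 1) * qfact ?q n"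
      using card_remove_low[OF Suc.prems] by (simp only:)
  next
    fix y assume "y \<in> A" "p \<le> y"
    then show "?S (A - {y}) = cross_bound x ?a * qfact ?q n"
      using card_remove_high[of p y A] by (simp only:)
  qed
  also have "\<dots> = ((if ?a = 0 then 0 else qnum ?q ?a * cross_bound x (?a - 1)) +
      x ^ ?a * qnum ?q ?m * cross_bound x ?a) * qfact ?q n"
    by (rule merge_terms)
  also have "\<dots> \<le> (cross_bound x ?a * qnum ?q (?a + ?m)) * qfact ?q n"
    using assms(1,2) by (intro mult_right_mono cross_bound_step less_imp_le[OF qfact_pos]) auto
  also have "\<dots> = cross_bound x ?a * qfact ?q (Suc n)"
  proof -
    have am: "?a + ?m = Suc n" using Suc.hyps(2) card_split[OF Suc.prems, of p] by linarith
    show ?thesis by (simp only: am) (simp add: qfact_def)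
  qed
  finally show ?case using Suc.hyps(2) by simp
qed (simp add: qfact_def cross_bound_def)

text \<open>By 1 + t <= exp t the product is at most exp (x / (1 - x)), and x / (1 - x) = 1 / (exp
  (\<beta> / 2) - 1) <= 2 / \<beta>.\<close>

lemma cross_bound_le:
  assumes "0 < \<beta>"
  shows "cross_bound (exp (- \<beta> / 2)) a \<le> exp (2 / \<beta>)"
proof -
  let ?x = "exp (- \<beta> / 2)"
  have x: "0 < ?x" "?x < 1" using assms by auto
  have "cross_bound ?x a \<le> (\<Prod>i<a. exp (?x ^ Suc i))"
    unfolding cross_bound_def by (intro prod_mono) (use x in \<open>auto intro: add_nonneg_nonneg\<close>)
  also have "\<dots> = exp (?x * qnum ?x a)"
    unfolding qnum_def by (simp add: exp_sum sum_distrib_left)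
  also have "\<dots> \<le> exp (2 / \<beta>)"
  proof -
    have "1 + \<beta> / 2 \<le> exp (\<beta> / 2)" by (rule exp_ge_add_one_self)
    then have "?x * (1 + \<beta> / 2) \<le> ?x * exp (\<beta> / 2)" by (intro mult_left_mono) auto
    also have "\<dots> = 1" by (simp add: exp_add[symmetric])
    finally have a: "?x * (\<beta> / 2) \<le> 1 - ?x" by (simp add: algebra_simps)
    have "(1 - ?x) * qnum ?x a \<le> 1" using x by (simp add: qnum_closed)
    then have "(?x * (\<beta> / 2)) * qnum ?x a \<le> 1"
      using mult_right_mono[OF a qnum_nonneg[OF less_imp_le[OF x(1)], of a]] by linarith
    then have "?x * qnum ?x a * (\<beta> / 2) \<le> 1" by (simp add: mult_ac)
    then have "?x * qnum ?x a \<le> 2 / \<beta>" using assms by (simp add: field_simps)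
    then show ?thesis by simp
  qed
  finally show ?thesis .
qed



section \<open>Moments of a Mallows ranking\<close>

definition cross_inv :: "nat \<Rightarrow> (nat \<Rightarrow> nat) \<Rightarrow> nat \<Rightarrow> (nat \<Rightarrow> nat) \<Rightarrow> nat" where
  "cross_inv n c q p = card {(i, j). i < n \<and> j < n \<and> c i < q \<and> q \<le> c j \<and> p i > p j}"

text \<open>The center ranks read off in the order of \<open>p\<close>. Inversions of this list are
  the disagreements of \<open>p\<close> with \<open>c\<close>, so sums over rankings become sums
  over \<open>permutations_of_set\<close>.\<close>

definition ranked_list :: "nat \<Rightarrow> (nat \<Rightarrow> nat) \<Rightarrow> (nat \<Rightarrow> nat) \<Rightarrow> nat list" where
  "ranked_list n c p = map (\<lambda>k. c (inv p k)) [0..<n]"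

lemma count_pairs_ranked:
  assumes p: "p permutes {..<n}"
  shows "count_pairs Q (ranked_list n c p) = card {(i, j). i < n \<and> j < n \<and> p i > p j \<and> Q (c j) (c i)}"
proof -
  have lt: "p i < n \<longleftrightarrow> i < n" "inv p i < n \<longleftrightarrow> i < n" for i
    using permutes_in_image[OF p, of i] permutes_in_image[OF permutes_inv[OF p], of i] by auto
  let ?A = "{(a, b). a < b \<and> b < n \<and> Q (c (inv p a)) (c (inv p b))}"
  let ?B = "{(i, j). i < n \<and> j < n \<and> p i > p j \<and> Q (c j) (c i)}"
  have "bij_betw (\<lambda>(a, b). (inv p b, inv p a)) ?A ?B"
    by (rule bij_betw_byWitness[where f' = "\<lambda>(i, j). (p j, p i)"])
       (auto simp: permutes_inverses[OF p] lt)
  then have "card ?A = card ?B" by (rule bij_betw_same_card)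
  moreover have "count_pairs Q (ranked_list n c p) = card ?A"
    unfolding count_pairs_card ranked_list_def
    by (intro arg_cong[where f = card]) auto
  ultimately show ?thesis by simp
qed

lemma ranked_list_bij:
  assumes c: "c permutes {..<n}"
  shows "bij_betw (ranked_list n c) {p. p permutes {..<n}} (permutations_of_set {..<n})"
proof (rule bij_betw_imageI)
  show "inj_on (ranked_list n c) {p. p permutes {..<n}}"
  proof (rule inj_onI)
    fix p q assume "p \<in> {p. p permutes {..<n}}" "q \<in> {p. p permutes {..<n}}"
      and eq: "ranked_list n c p = ranked_list n c q"
    then have p: "p permutes {..<n}" and q: "q permutes {..<n}" by auto
    have "inv p k = inv q k" for k
    proof (cases "k < n")
      case True
      then have "c (inv p k) = c (inv q k)" using eq by (auto simp: ranked_list_def)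
      then show ?thesis using permutes_inj[OF c] by (auto dest: injD)
    next
      case False
      then show ?thesis
        using permutes_inv[OF p] permutes_inv[OF q] by (metis lessThan_iff permutes_not_in)
    qed
    then have "inv p = inv q" by auto
    then show "p = q" using permutes_inv_inv[OF p] permutes_inv_inv[OF q] by metis
  qed
  have sub: "ranked_list n c ` {p. p permutes {..<n}} \<subseteq> permutations_of_set {..<n}"
  proof
    fix l assume "l \<in> ranked_list n c ` {p. p permutes {..<n}}"
    then obtain p where p: "p permutes {..<n}" "l = ranked_list n c p" by auto
    have cp: "(\<lambda>k. c (inv p k)) permutes {..<n}"
      using permutes_compose[OF permutes_inv[OF p(1)] c] by (simp add: comp_def)
    show "l \<in> permutations_of_set {..<n}"
      unfolding p(2) ranked_list_def permutations_of_set_def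
      using permutes_image[OF cp] permutes_inj_on[OF cp, of "{0..<n}"]
      by (auto simp: distinct_map lessThan_atLeast0)
  qed
  moreover have "card (ranked_list n c ` {p. p permutes {..<n}}) = card (permutations_of_set {..<n})"
    using card_image[OF \<open>inj_on (ranked_list n c) {p. p permutes {..<n}}\<close>]
    by (simp add: card_permutations[of "{..<n}" n])
  ultimately show "ranked_list n c ` {p. p permutes {..<n}} = permutations_of_set {..<n}"
    by (intro card_subset_eq) auto
qed

lemma inv_split:
  assumes p: "p permutes {..<n}"
  shows "kemeny_dist n p c = count_pairs (one_sided q) (ranked_list n c p) + cross_inv n c q p"
    "cross_inv n c q p = count_pairs (crossing q) (ranked_list n c p)"
proof -
  show 1: "cross_inv n c q p = count_pairs (crossing q) (ranked_list n c p)"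
    unfolding count_pairs_ranked[OF p] cross_inv_def crossing_def
    by (intro arg_cong[where f = card]) auto
  let ?A = "{(i, j). i < n \<and> j < n \<and> p i > p j \<and> one_sided q (c j) (c i)}"
  let ?B = "{(i, j). i < n \<and> j < n \<and> c i < q \<and> q \<le> c j \<and> p i > p j}"
  have fin: "finite ?A" "finite ?B"
    by (rule finite_subset[of _ "{..<n} \<times> {..<n}"]; auto)+
  have "{(i, j). i < n \<and> j < n \<and> c i < c j \<and> p i > p j} = ?A \<union> ?B"
    by (auto simp: one_sided_def)
  moreover have "?A \<inter> ?B = {}" by (auto simp: one_sided_def)
  ultimately show "kemeny_dist n p c = count_pairs (one_sided q) (ranked_list n c p) + cross_inv n c q p"
    unfolding kemeny_dist_def count_pairs_ranked[OF p] cross_inv_def using fin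
    by (simp add: card_Un_disjoint)
qed

lemma finite_set_mallows: "finite (set_pmf (mallows n \<beta> c))"
  by (rule finite_subset[OF _ finite_permutations[of "{..<n}"]])
     (auto simp: set_pmf_iff pmf_mallows split: if_splits)

lemma set_mallows: "p \<in> set_pmf (mallows n \<beta> c) \<Longrightarrow> p permutes {..<n}"
  by (auto simp: set_pmf_iff pmf_mallows split: if_splits)

lemma expectation_mallows:
  "measure_pmf.expectation (mallows n \<beta> c) f =
    (\<Sum>p | p permutes {..<n}. exp (- \<beta> * real (kemeny_dist n p c)) * f p) / mallows_Z n \<beta> c"
proof -
  have "measure_pmf.expectation (mallows n \<beta> c) f =
      (\<Sum>p | p permutes {..<n}. pmf (mallows n \<beta> c) p *\<^sub>R f p)"
    by (rule integral_measure_pmf) (auto simp: finite_permutations dest: set_mallows)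
  then show ?thesis by (simp add: pmf_mallows sum_divide_distrib mult.commute)
qed

text \<open>The factor \<open>exp (\<beta> / 2)\<close> per crossing inversion halves the exponent
  of these inversions and of no others, so the moment is a quotient of two values of
  \<open>shuffle_sum\<close> in which the q-factorials cancel.\<close>

lemma mallows_cross_moment:
  assumes \<beta>: "0 < \<beta>" and c: "c permutes {..<n}"
  shows "measure_pmf.expectation (mallows n \<beta> c) (\<lambda>p. exp (\<beta> / 2 * real (cross_inv n c q p))) \<le> exp (2 / \<beta>)"
proof -
  let ?x = "exp (- \<beta> / 2)" and ?A = "{..<n}"
  have q: "?x\<^sup>2 = exp (- \<beta>)" by (simp add: exp_double[symmetric])
  have pw: "exp a ^ k = exp (a * real k)" for a k by (simp add: exp_of_nat_mult[symmetric] mult.commute)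
  have 1: "exp (- \<beta> * real (kemeny_dist n p c)) =
      exp (- \<beta>) ^ count_pairs (one_sided q) (ranked_list n c p) * exp (- \<beta>) ^ count_pairs (crossing q) (ranked_list n c p)"
    and 2: "exp (- \<beta> * real (kemeny_dist n p c)) * exp (\<beta> / 2 * real (cross_inv n c q p)) =
      exp (- \<beta>) ^ count_pairs (one_sided q) (ranked_list n c p) * ?x ^ count_pairs (crossing q) (ranked_list n c p)"
    if "p permutes {..<n}" for p
    unfolding inv_split(1)[OF that, of c q] inv_split(2)[OF that, of c q] pw exp_add[symmetric]
    by (simp_all add: algebra_simps)
  have Z: "mallows_Z n \<beta> c = shuffle_sum q (?x\<^sup>2) (?x\<^sup>2) ?A"
    unfolding mallows_Z_def shuffle_sum_def q sum.reindex_bij_betw[OF ranked_list_bij[OF c], symmetric]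
    by (rule sum.cong[OF refl]) (use 1 in simp)
  have "(\<Sum>p | p permutes {..<n}. exp (- \<beta> * real (kemeny_dist n p c)) * exp (\<beta> / 2 * real (cross_inv n c q p))) =
      shuffle_sum q (?x\<^sup>2) ?x ?A"
    unfolding shuffle_sum_def q sum.reindex_bij_betw[OF ranked_list_bij[OF c], symmetric]
    by (rule sum.cong[OF refl]) (use 2 in simp)
  also have "\<dots> \<le> cross_bound ?x (card {z \<in> ?A. z < q}) * qfact (?x\<^sup>2) (card ?A)"
    using \<beta> by (intro shuffle_sum_bound) auto
  also have "\<dots> \<le> exp (2 / \<beta>) * qfact (?x\<^sup>2) (card ?A)"
    by (intro mult_right_mono cross_bound_le[OF \<beta>] less_imp_le[OF qfact_pos]) auto
  also have "qfact (?x\<^sup>2) (card ?A) = mallows_Z n \<beta> c"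
    by (simp add: Z shuffle_sum_diag del: card_lessThan)
  finally show ?thesis
    unfolding expectation_mallows using mallows_Z_pos[of n \<beta> c] by (simp add: pos_divide_le_eq)
qed

lemma kemeny_swap_less:
  assumes p: "p i > p j" and ij: "i < j" "j < n"
  defines "p' \<equiv> p \<circ> Transposition.transpose i j"
  shows "kemeny_dist n p' id < kemeny_dist n p id"
proof -
  let ?I = "\<lambda>p. {(a, b). a < n \<and> b < n \<and> a < b \<and> p a > p b}"
  define t where "t = Transposition.transpose i j"
  have t: "t i = j" "t j = i" "\<And>a. a \<noteq> i \<Longrightarrow> a \<noteq> j \<Longrightarrow> t a = a" "\<And>a. t (t a) = a"
    by (auto simp: t_def Transposition.transpose_def)
  have p': "p' a = p (t a)" for a by (simp add: p'_def t_def)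
  \<comment> \<open>An injection of the inversions of \<open>p'\<close> into those of
    \<open>p\<close> that misses \<open>(i, j)\<close>. A pair that starts left of \<open>i\<close>
    has its right end swapped, one that otherwise ends right of \<open>j\<close> its left end, and
    pairs inside \<open>[i, j]\<close> stay. On increasing pairs the map is its own inverse, hence
    injective.\<close>
  define f where "f = (\<lambda>(a, b). if a < i then (a, t b) else if b > j then (t a, b) else (a, b))"
  have fin: "finite (?I p)" by (rule finite_subset[of _ "{..<n} \<times> {..<n}"]) auto
  have eq: "a = i \<or> a = j \<or> t a = a" for a using t(3) by blast
  have img: "f x \<in> ?I p - {(i, j)}" if x_in: "x \<in> ?I p'" for x
  proof -
    obtain a b where x: "x = (a, b)" "a < n" "b < n" "a < b" "p (t a) > p (t b)"
      using x_in by (auto simp: p')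
    consider "a < i" | "i \<le> a" "b > j" | "i \<le> a" "b \<le> j" by linarith
    then show ?thesis
    proof cases
      case 1
      then have "t a = a" using t(3) ij by auto
      moreover have "a < t b \<and> t b < n" using eq[of b] t(1,2) 1 x ij by auto
      ultimately show ?thesis using x 1 by (auto simp: f_def)
    next
      case 2
      then have "t b = b" using t(3) ij by auto
      moreover have "t a < b \<and> t a < n" using eq[of a] t(1,2) 2 x ij by auto
      ultimately show ?thesis using x 2 by (auto simp: f_def)
    next
      case 3
      have "(a, b) \<noteq> (i, j)" using x(5) t(1,2) p by auto
      moreover have "p a > p b"
      proof (cases "a = i")
        case True
        then have "b \<noteq> j" using x(5) t p by auto
        then have "t b = b" using True x(4) t(3) by auto
        then show ?thesis using True x(5) t(1) p by auto
      next
        case False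
        then have "t a = a" using 3 x(4) t(3) by auto
        then show ?thesis using x(5) p t(2) eq[of b] 3 False x(4) by (cases "b = j") auto
      qed
      ultimately show ?thesis using x 3 by (auto simp: f_def)
    qed
  qed
  have inj: "inj_on f (?I p')"
  proof (rule inj_onI)
    fix x y assume "x \<in> ?I p'" "y \<in> ?I p'" and e: "f x = f y"
    then obtain a b a' b' where xy: "x = (a, b)" "y = (a', b')" "a < b" "a' < b'" by auto
    have inv: "f (f (a, b)) = (a, b)" if "a < b" for a b
    proof -
      consider "a < i" | "i \<le> a" "b > j" | "i \<le> a" "b \<le> j" by linarith
      then show ?thesis
      proof cases
        case 2
        have "i \<le> t a" using eq[of a] t(1,2) 2 ij by auto
        then show ?thesis using 2 by (auto simp: f_def t(4))
      qed (auto simp: f_def t(4))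
    qed
    show "x = y" using inv[OF xy(3)] inv[OF xy(4)] e xy(1,2) by metis
  qed
  have 1: "card (?I p') \<le> card (?I p - {(i, j)})"
  proof (rule card_inj_on_le[OF inj _ finite_Diff[OF fin]])
    show "f ` ?I p' \<subseteq> ?I p - {(i, j)}" by (rule image_subsetI) (rule img)
  qed
  have 2: "(i, j) \<in> ?I p" using p ij by simp
  have "card (?I p') < card (?I p)"
    by (rule le_less_trans[OF 1 card_Diff1_less[OF fin 2]])
  moreover have "kemeny_dist n f id = card (?I f)" for f by (simp only: kemeny_dist_def id_apply)
  ultimately show ?thesis by (simp only:)
qed

text \<open>Renaming the elements by their center ranks reduces this to the identity as
  center.\<close>

lemma kemeny_swap_less_center:
  assumes c: "c permutes {..<n}" and "p i > p j" "c i < c j" "i < n" "j < n"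
  shows "kemeny_dist n (p \<circ> Transposition.transpose i j) c < kemeny_dist n p c"
proof -
  let ?d = "inv c"
  have d: "?d permutes {..<n}" by (rule permutes_inv[OF c])
  have cn: "c j < n" using permutes_in_image[OF c, of j] assms by simp
  have e: "?d (c i) = i" "?d (c j) = j" using permutes_inverses[OF c] by auto
  have "kemeny_dist n ((p \<circ> ?d) \<circ> Transposition.transpose (c i) (c j)) id < kemeny_dist n (p \<circ> ?d) id"
    by (rule kemeny_swap_less) (use assms cn e in auto)
  moreover have "(p \<circ> ?d) \<circ> Transposition.transpose (c i) (c j) = (p \<circ> Transposition.transpose i j) \<circ> ?d"
  proof
    fix x
    have "?d x = i \<longleftrightarrow> x = c i" "?d x = j \<longleftrightarrow> x = c j" using permutes_inverses[OF c] by metis+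
    then show "((p \<circ> ?d) \<circ> Transposition.transpose (c i) (c j)) x = ((p \<circ> Transposition.transpose i j) \<circ> ?d) x"
      by (auto simp: Transposition.transpose_def e)
  qed
  moreover have "c \<circ> ?d = id" using permutes_inv_o[OF c] by simp
  ultimately show ?thesis using kemeny_dist_comp[OF d, of p c] kemeny_dist_comp[OF d, of "p \<circ> Transposition.transpose i j" c] by simp
qed

text \<open>Swapping the positions of \<open>i\<close> and \<open>j\<close> gains at least a factor \<open>exp \<beta>\<close>.\<close>

lemma mallows_pair_moment:
  assumes \<beta>: "0 < \<beta>" and c: "c permutes {..<n}" and ij: "c i < c j" "i < n" "j < n"
  shows "measure_pmf.expectation (mallows n \<beta> c) (\<lambda>p. exp (\<beta> * (of_bool (p i > p j) - 1 / 2))) \<le> 1 / cosh (\<beta> / 2)"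
proof -
  let ?P = "{p. p permutes {..<n}}" let ?w = "\<lambda>p. exp (- \<beta> * real (kemeny_dist n p c))"
  define A where "A = (\<Sum>p | p permutes {..<n} \<and> p i > p j. ?w p)"
  define B where "B = (\<Sum>p | p permutes {..<n} \<and> \<not> p i > p j. ?w p)"
  have fin: "finite ?P" by (simp add: finite_permutations)
  have ne: "i \<noteq> j" using ij by auto
  have tr: "Transposition.transpose i j permutes {..<n}" using ij by (intro permutes_swap_id) auto
  have part: "(\<Sum>p\<in>?P. f p) = (\<Sum>p | p permutes {..<n} \<and> p i > p j. f p) +
      (\<Sum>p | p permutes {..<n} \<and> \<not> p i > p j. f p)" for f :: "_ \<Rightarrow> real"
    using fin by (subst sum.union_disjoint[symmetric]) (auto intro!: sum.cong)
  have Z: "mallows_Z n \<beta> c = A + B" unfolding mallows_Z_def A_def B_def by (rule part)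
  have "A \<le> (\<Sum>p | p permutes {..<n} \<and> p i > p j. exp (- \<beta>) * ?w (p \<circ> Transposition.transpose i j))"
    unfolding A_def
  proof (rule sum_mono)
    fix p assume "p \<in> {p. p permutes {..<n} \<and> p i > p j}"
    then have "kemeny_dist n (p \<circ> Transposition.transpose i j) c + 1 \<le> kemeny_dist n p c"
      using kemeny_swap_less_center[OF c _ ij] by (simp add: Suc_le_eq)
    then have "\<beta> * (real (kemeny_dist n (p \<circ> Transposition.transpose i j) c) + 1) \<le> \<beta> * real (kemeny_dist n p c)"
      using \<beta> by (intro mult_left_mono) linarith+
    then have "- \<beta> * real (kemeny_dist n p c) \<le> - \<beta> + - \<beta> * real (kemeny_dist n (p \<circ> Transposition.transpose i j) c)"
      by (simp add: algebra_simps)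
    then have "?w p \<le> exp (- \<beta> + - \<beta> * real (kemeny_dist n (p \<circ> Transposition.transpose i j) c))"
      by (simp only: exp_le_cancel_iff)
    then show "?w p \<le> exp (- \<beta>) * ?w (p \<circ> Transposition.transpose i j)" by (simp only: exp_add)
  qed
  also have "\<dots> = exp (- \<beta>) * (\<Sum>p | p permutes {..<n} \<and> p i > p j. ?w (p \<circ> Transposition.transpose i j))"
    by (simp add: sum_distrib_left)
  also have "(\<Sum>p | p permutes {..<n} \<and> p i > p j. ?w (p \<circ> Transposition.transpose i j)) =
     (\<Sum>p\<in>(\<lambda>p. p \<circ> Transposition.transpose i j) ` {p. p permutes {..<n} \<and> p i > p j}. ?w p)"
  proof (rule sum.reindex[symmetric, unfolded comp_def])
    show "inj_on (\<lambda>p. p \<circ> Transposition.transpose i j) {p. p permutes {..<n} \<and> p i > p j}"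
    proof (rule inj_onI)
      fix p q :: "nat \<Rightarrow> nat"
      assume "p \<circ> Transposition.transpose i j = q \<circ> Transposition.transpose i j"
      then have "p (Transposition.transpose i j (Transposition.transpose i j x)) =
          q (Transposition.transpose i j (Transposition.transpose i j x))" for x
        by (metis comp_apply)
      then show "p = q" by auto
    qed
  qed
  also have "\<dots> \<le> B"
    unfolding B_def
  proof (rule sum_mono2)
    show "finite {p. p permutes {..<n} \<and> \<not> p i > p j}" using fin by auto
    show "(\<lambda>p. p \<circ> Transposition.transpose i j) ` {p. p permutes {..<n} \<and> p i > p j} \<subseteq> {p. p permutes {..<n} \<and> \<not> p i > p j}"
      using permutes_compose[OF tr] by auto
  qed auto
  finally have AB: "A \<le> exp (- \<beta>) * B" by simp
  have pos: "0 < A + B" using mallows_Z_pos[of n \<beta> c] Z by simp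
  let ?e = "exp (\<beta> / 2)" and ?f = "exp (- (\<beta> / 2))"
  have e: "?e * ?e = exp \<beta>" "?f * ?f = exp (- \<beta>)" "?e * ?f = 1" "1 \<le> exp \<beta>" "exp \<beta> * exp (- \<beta>) = 1"
    using \<beta> by (auto simp: exp_add[symmetric])
  \<comment> \<open>The moment \<open>(A * ?e + B * ?f) / (A + B)\<close> grows with the share of
    \<open>A\<close>. At the extreme \<open>A = exp (- \<beta>) * B\<close> it equals
    \<open>1 / cosh (\<beta> / 2)\<close>.\<close>
  have "(A * ?e + B * ?f) * (?e + ?f) = A * exp \<beta> + (A + B) + B * exp (- \<beta>)"
    using e by (simp add: algebra_simps)
  also have "\<dots> \<le> 2 * (A + B)"
  proof -
    have "A * (exp \<beta> - 1) \<le> (exp (- \<beta>) * B) * (exp \<beta> - 1)" using AB e by (intro mult_right_mono) auto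
    also have "\<dots> = B - B * exp (- \<beta>)" using e(5) by (simp add: algebra_simps)
    finally show ?thesis by (simp add: algebra_simps)
  qed
  finally have main: "A * ?e + B * ?f \<le> (A + B) / cosh (\<beta> / 2)"
    by (simp add: cosh_def pos_le_divide_eq field_simps add_pos_pos)
  have "(\<Sum>p\<in>?P. ?w p * exp (\<beta> * (of_bool (p i > p j) - 1 / 2))) = A * ?e + B * ?f"
    unfolding part A_def B_def sum_distrib_right
    by (intro arg_cong2[where f = "(+)"] sum.cong refl) auto
  then have "measure_pmf.expectation (mallows n \<beta> c) (\<lambda>p. exp (\<beta> * (of_bool (p i > p j) - 1 / 2))) =
      (A * ?e + B * ?f) / (A + B)"
    unfolding expectation_mallows Z by simp
  also have "\<dots> \<le> 1 / cosh (\<beta> / 2)"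
    using main pos by (simp add: pos_divide_le_eq)
  finally show ?thesis .
qed

section \<open>Amortized worst-case cost of the dynamic program\<close>

section \<open>Cost of the dynamic program\<close>

lemma fold_cost_append: "fold_cost c g a (xs @ ys) = fold_cost c g a xs + fold_cost c g (foldl g a xs) ys"
  by (induction xs arbitrary: a) auto

text \<open>The step cost is bounded at the accumulators that actually occur, so an invariant on the
  length of the state list can be used.\<close>

lemma fold_cost_prefix_le:
  assumes "\<And>xs x ys. es = xs @ x # ys \<Longrightarrow> c (foldl g a xs) x \<le> k"
  shows "fold_cost c g a es \<le> length es * (k + 1)"
  using assms
proof (induction es rule: rev_induct)
  case (snoc e es)
  have "fold_cost c g a es \<le> length es * (k + 1)"
  proof (rule snoc.IH)
    fix xs x ys assume "es = xs @ x # ys"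
    then show "c (foldl g a xs) x \<le> k" using snoc.prems[of xs x "ys @ [e]"] by simp
  qed
  moreover have "c (foldl g a es) e \<le> k" using snoc.prems[of es e "[]"] by simp
  ultimately show ?case by (simp add: fold_cost_append)
qed simp

text \<open>All states of a level have windows of the same length \<open>L\<close>.\<close>

definition keys_of_length :: "nat \<Rightarrow> state list \<Rightarrow> bool" where
  "keys_of_length L sts \<longleftrightarrow> (\<forall>s \<in> set sts. length (fst s) = L)"

lemma insert_step_set:
  "set (fst (foldl insert_step z ts) # snd (foldl insert_step z ts)) \<subseteq> set (fst z # snd z @ ts)"
proof (induction ts arbitrary: z)
  case (Cons t ts)
  show ?case using Cons[of "insert_step z t"] by (auto simp: insert_step_def split: if_splits)
qed simp

lemma insert_state_set: "set (insert_state s ts) \<subseteq> insert s (set ts)"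
  using insert_step_set[of "(s, [])" ts] by (simp add: insert_state_def Let_def)

lemma length_insert_state: "length (insert_state s ts) \<le> Suc (length ts)"
proof -
  have "length (snd (foldl insert_step z ts)) \<le> length (snd z) + length ts" for z
  proof (induction ts arbitrary: z)
    case (Cons t ts)
    show ?case using Cons[of "insert_step z t"] by (auto simp: insert_step_def split: if_splits)
  qed simp
  from this[of "(s, [])"] show ?thesis by (simp add: insert_state_def Let_def)
qed

lemma extend_invariant:
  assumes "keys_of_length (length us - 1) out" "t < length us"
  shows "keys_of_length (length us - 1) (extend i r off lo tgt us cp out t)"
    "length (extend i r off lo tgt us cp out t) \<le> Suc (length out)"
proof -
  obtain v post where d: "drop t us = v # post" using assms(2) by (cases "drop t us") auto
  then have "length post = length us - t - 1" by (metis length_drop length_tl list.sel(3))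
  then have l: "length (take t us @ post) = length us - 1" using assms(2) by simp
  have ins: "keys_of_length (length us - 1) (insert_state s out)" if "length (fst s) = length us - 1" for s
    using insert_state_set[of s out] that assms(1) by (auto simp: keys_of_length_def)
  have ins': "keys_of_length (length us - 1) (insert_state (take t us @ post, x) out)" for x
    by (rule ins) (simp only: fst_conv l)
  show "keys_of_length (length us - 1) (extend i r off lo tgt us cp out t)"
    using assms(1) ins' unfolding extend_def d Let_def list.case by (cases "admissible r lo tgt (take t us @ post)") simp_all
  show "length (extend i r off lo tgt us cp out t) \<le> Suc (length out)"
    using length_insert_state by (auto simp: extend_def d Let_def)
qed

lemma extends_invariant:
  assumes "keys_of_length (length us - 1) out" "\<forall>t \<in> set ts. t < length us"
  shows "keys_of_length (length us - 1) (foldl (extend i r off lo tgt us cp) out ts)"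
    "length (foldl (extend i r off lo tgt us cp) out ts) \<le> length out + length ts"
proof -
  have "keys_of_length (length us - 1) (foldl (extend i r off lo tgt us cp) out ts) \<and>
      length (foldl (extend i r off lo tgt us cp) out ts) \<le> length out + length ts"
    using assms
  proof (induction ts arbitrary: out)
    case (Cons t ts)
    have t: "t < length us" using Cons.prems by simp
    have "\<forall>t \<in> set ts. t < length us" using Cons.prems(2) by simp
    note IH = Cons.IH[OF extend_invariant(1)[OF Cons.prems(1) t, of i r off lo tgt cp] this]
    show ?case
      using IH extend_invariant(2)[OF Cons.prems(1) t, of i r off lo tgt cp]
      by auto
  qed simp
  then show "keys_of_length (length us - 1) (foldl (extend i r off lo tgt us cp) out ts)"
    "length (foldl (extend i r off lo tgt us cp) out ts) \<le> length out + length ts" by auto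
qed

lemma keys_sum: "keys_of_length (L - 1) out \<Longrightarrow> 0 < L \<Longrightarrow> (\<Sum>t\<leftarrow>out. length (fst t) + 1) = length out * L"
  by (induction out) (auto simp: keys_of_length_def)

lemma expand_bounds:
  assumes "length (fst s) + length D = L" "keys_of_length (L - 1) out" "length out + L \<le> m"
  shows "keys_of_length (L - 1) (expand i r off lo tgt D out s)"
    "length (expand i r off lo tgt D out s) \<le> length out + L"
    "expand_cost i r off lo tgt D out s \<le> L + L * (L + L * (r + 1) + m * L + 1)"
proof -
  let ?us = "fst s @ D"
  have L: "length ?us = L" using assms(1) by simp
  note ei = extends_invariant[of ?us out, unfolded L, OF assms(2)]
  show "keys_of_length (L - 1) (expand i r off lo tgt D out s)"
    "length (expand i r off lo tgt D out s) \<le> length out + L"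
    unfolding expand_def Let_def L using ei(1)[of "[0..<L]"] ei(2)[of "[0..<L]"] by auto
  have "fold_cost (\<lambda>out t. t + length ?us * (r + 1) + (\<Sum>t\<leftarrow>out. length (fst t) + 1))
       (extend i r off lo tgt ?us (snd s)) out [0..<length ?us] \<le> length [0..<length ?us] * ((L + L * (r + 1) + m * L) + 1)"
  proof (rule fold_cost_prefix_le)
    fix xs x ys assume e: "[0..<length ?us] = xs @ x # ys"
    have x: "x < L" and xs: "\<forall>t \<in> set xs. t < L" and lx: "length xs \<le> L"
      using arg_cong[OF e, of set] arg_cong[OF e, of length] L by auto
    let ?o = "foldl (extend i r off lo tgt ?us (snd s)) out xs"
    have k: "keys_of_length (L - 1) ?o" "length ?o \<le> length out + length xs"
      using ei(1)[OF xs] ei(2)[OF xs] by auto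
    have "(\<Sum>t\<leftarrow>?o. length (fst t) + 1) = length ?o * L" using keys_sum[OF k(1)] x by simp
    also have "\<dots> \<le> m * L" using k(2) lx assms(3) by (intro mult_le_mono1) linarith
    finally show "x + length ?us * (r + 1) + (\<Sum>t\<leftarrow>?o. length (fst t) + 1) \<le> L + L * (r + 1) + m * L"
      using x L by (intro add_mono) auto
  qed
  then show "expand_cost i r off lo tgt D out s \<le> L + L * (L + L * (r + 1) + m * L + 1)"
    unfolding expand_cost_def Let_def L by simp
qed

text \<open>The main term is that of \<open>estimate\<close>; the factor \<open>r + 1\<close> comes
  from the votes counted for each candidate.\<close>

lemma expand_all_bounds:
  assumes "\<forall>s \<in> set sts. length (fst s) + length D = L"
  shows "keys_of_length (L - 1) (foldl (expand i r off lo tgt D) [] sts)"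
    "length (foldl (expand i r off lo tgt D) [] sts) \<le> length sts * L"
    "fold_cost (expand_cost i r off lo tgt D) (expand i r off lo tgt D) [] sts \<le>
      length sts + 6 * (r + 1) * (length sts * (length sts * (L * (L * L))))"
proof -
  let ?N = "length sts"
  have pre: "keys_of_length (L - 1) (foldl (expand i r off lo tgt D) [] xs) \<and>
      length (foldl (expand i r off lo tgt D) [] xs) \<le> length xs * L"
    if "\<forall>s \<in> set xs. length (fst s) + length D = L" for xs
    using that
  proof (induction xs rule: rev_induct)
    case Nil
    then show ?case by (simp add: keys_of_length_def)
  next
    case (snoc x xs)
    let ?o = "foldl (expand i r off lo tgt D) [] xs"
    have IH: "keys_of_length (L - 1) ?o" "length ?o \<le> length xs * L" using snoc by auto
    have "length (fst x) + length D = L" using snoc.prems by simp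
    note eb = expand_bounds[OF this IH(1) order_refl, of i r off lo tgt]
    show ?case using eb(1,2) IH(2) by simp
  qed
  show "keys_of_length (L - 1) (foldl (expand i r off lo tgt D) [] sts)"
    "length (foldl (expand i r off lo tgt D) [] sts) \<le> ?N * L"
    using pre[OF assms] by auto
  have "fold_cost (expand_cost i r off lo tgt D) (expand i r off lo tgt D) [] sts \<le>
      ?N * ((L + L * (L + L * (r + 1) + (?N * L) * L + 1)) + 1)"
  proof (rule fold_cost_prefix_le)
    fix xs x ys assume e: "sts = xs @ x # ys"
    have a: "\<forall>s \<in> set xs. length (fst s) + length D = L" "length (fst x) + length D = L"
      using assms e by auto
    have "length (foldl (expand i r off lo tgt D) [] xs) + L \<le> length xs * L + L"
      using pre[OF a(1)] by simp
    also have "\<dots> \<le> ?N * L" using e by (simp add: algebra_simps)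
    finally show "expand_cost i r off lo tgt D (foldl (expand i r off lo tgt D) [] xs) x
        \<le> L + L * (L + L * (r + 1) + (?N * L) * L + 1)"
      using expand_bounds(3)[OF a(2)] pre[OF a(1)] by blast
  qed
  also have "\<dots> \<le> ?N + 6 * (r + 1) * (?N * (?N * (L * (L * L))))"
  proof (cases "L = 0 \<or> ?N = 0")
    case False
    define e where "e = ?N * (?N * (L * (L * L)))"
    obtain L' N' where L': "L = Suc L'" "?N = Suc N'" using False by (meson not0_implies_Suc)
    have 1: "?N * L \<le> e" "?N * (L * L) \<le> e" "?N * (L * ((?N * L) * L)) = e"
      unfolding e_def L' by (simp_all add: algebra_simps)
    have 2: "?N * (L * (L * (r + 1))) \<le> (r + 1) * e"
      using mult_le_mono2[OF 1(2), of "r + 1"] by (simp only: mult_ac)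
    have "?N * ((L + L * (L + L * (r + 1) + (?N * L) * L + 1)) + 1) =
        ?N + 2 * (?N * L) + ?N * (L * L) + ?N * (L * (L * (r + 1))) + ?N * (L * ((?N * L) * L))"
      by (simp add: algebra_simps)
    also have "\<dots> \<le> ?N + 2 * e + e + (r + 1) * e + e" using 1 2 by linarith
    also have "\<dots> \<le> ?N + 6 * (r + 1) * e" by (simp add: algebra_simps)
    finally show ?thesis by (simp add: e_def)
  qed auto
  finally show "fold_cost (expand_cost i r off lo tgt D) (expand i r off lo tgt D) [] sts \<le>
      ?N + 6 * (r + 1) * (?N * (?N * (L * (L * L))))" .
qed

definition head_length :: "state list \<Rightarrow> nat" where
  "head_length sts = (case sts of [] \<Rightarrow> 0 | s # _ \<Rightarrow> length (fst s))"

text \<open>Each unit of fuel pays for \<open>20 * (r + 1)\<close> steps, each future record for its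
  own upward scan, and the states of the current level together with one window length for the fixed
  overhead of the next level.\<close>

definition potential :: "nat \<Rightarrow> dp \<Rightarrow> nat" where
  "potential r cfg = 20 * (r + 1) * snd (snd (snd cfg)) + 2 * length (fst cfg) +
     3 * (length (fst (snd (snd cfg))) + head_length (fst (snd (snd cfg))))"

text \<open>An aborted level is covered as well: it gives up all its fuel, and this pays for its
  downward scan.\<close>

lemma level_cost_potential:
  assumes "keys_of_length (head_length (fst (snd (snd cfg)))) (fst (snd (snd cfg)))"
  shows "keys_of_length (head_length (fst (snd (snd (dp_level i r off cfg tgt))))) (fst (snd (snd (dp_level i r off cfg tgt))))"
    "level_cost i r off cfg tgt + potential r (dp_level i r off cfg tgt) \<le> potential r cfg"
proof -
  obtain fut past sts fl where cfg: "cfg = (fut, past, sts, fl)" by (cases cfg)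
  have k: "keys_of_length (head_length sts) sts" using assms by (simp add: cfg)
  define up where "up = scan_up fut tgt"
  define D where "D = map (\<lambda>x. (fst x, fst (snd x))) (rev (fst up))"
  define down where "down = scan_down fl (tgt # past) tgt"
  have lf: "length (fst up) + length (snd up) = length fut"
    unfolding up_def scan_up_def by (simp add: length_append[symmetric] del: length_append)
  have lD: "length D = length (fst up)" by (simp add: D_def)
  have dn: "fst down \<le> fl" unfolding down_def scan_down_def by (rule drop_limited_le)
  define L where "L = window D sts"
  define N where "N = length sts"
  have est: "estimate D sts = N * (N * (L * (L * L)))" by (simp add: estimate_def Let_def L_def N_def)
  have L: "\<forall>s \<in> set sts. length (fst s) + length D = L"
    using k unfolding L_def window_def head_length_def keys_of_length_def by (cases sts) auto
  have L_le: "L \<le> head_length sts + length (fst up)"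
    unfolding L_def window_def head_length_def using lD by (cases sts) auto
  have N0: "N = 0 \<Longrightarrow> L = 0" unfolding L_def window_def N_def by simp
  define e where "e = N * (N * (L * (L * L)))"
  have le: "N * L \<le> e" "L \<le> e"
  proof -
    show "N * L \<le> e" unfolding e_def by (cases N; cases L) (auto simp: algebra_simps)
    show "L \<le> e" using N0 unfolding e_def by (cases N; cases L) (auto simp: algebra_simps)
  qed
  consider (zero) "fl = 0" | (abort) "fl \<noteq> 0" "fst down \<le> e \<or> snd down = []"
    | (go) h t where "fl \<noteq> 0" "\<not> fst down \<le> e" "snd down = h # t" by (cases "snd down") auto
  then have "keys_of_length (head_length (fst (snd (snd (dp_level i r off cfg tgt))))) (fst (snd (snd (dp_level i r off cfg tgt))))
    \<and> level_cost i r off cfg tgt + potential r (dp_level i r off cfg tgt) \<le> potential r cfg"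
  proof cases
    case zero
    then show ?thesis using k by (simp add: cfg dp_level_def level_cost_def)
  next
    case abort
    have dl: "dp_level i r off cfg tgt = (snd up, tgt # past, [], 0)"
      using abort unfolding dp_level_def Let_def cfg fst_conv snd_conv up_def[symmetric] D_def[symmetric] down_def[symmetric]
        dp_finish_def est e_def[symmetric] by (auto split: list.splits)
    have lc: "level_cost i r off cfg tgt = length (fst up) + (fl - fst down) + (N + L)"
      using abort unfolding level_cost_def Let_def cfg fst_conv snd_conv up_def[symmetric] D_def[symmetric] down_def[symmetric]
        finish_cost_def est e_def[symmetric] by (auto simp: N_def L_def split: list.splits)
    have "fl - fst down \<le> 20 * (r + 1) * fl" by (simp add: algebra_simps)
    then show ?thesis unfolding dl lc using lf L_le
      by (simp add: potential_def cfg keys_of_length_def head_length_def N_def)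
  next
    case go
    let ?sts = "foldl (expand i r off (fst h) tgt D) [] sts"
    have dl: "dp_level i r off cfg tgt = (snd up, tgt # past, ?sts, fst down - e)"
      using go unfolding dp_level_def Let_def cfg fst_conv snd_conv up_def[symmetric] D_def[symmetric] down_def[symmetric]
        dp_finish_def est e_def[symmetric] by simp
    have lc: "level_cost i r off cfg tgt = length (fst up) + (fl - fst down) + (N + L +
         fold_cost (expand_cost i r off (fst h) tgt D) (expand i r off (fst h) tgt D) [] sts)"
      using go unfolding level_cost_def Let_def cfg fst_conv snd_conv up_def[symmetric] D_def[symmetric] down_def[symmetric]
        finish_cost_def est e_def[symmetric] by (simp add: N_def L_def)
    note eb = expand_all_bounds[OF L, of i r off "fst h" tgt, folded N_def, folded e_def]
    have hl: "?sts \<noteq> [] \<Longrightarrow> head_length ?sts = L - 1"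
      using eb(1) by (cases ?sts) (auto simp: keys_of_length_def head_length_def)
    have hl': "head_length ?sts \<le> L" using hl by (cases "?sts = []") (auto simp: head_length_def)
    have kk: "keys_of_length (head_length ?sts) ?sts"
      using eb(1) hl by (cases "?sts = []") (auto simp: keys_of_length_def)
    have d: "20 * (r + 1) * fl = 20 * (r + 1) * (fst down - e) + 20 * (r + 1) * e + 20 * (r + 1) * (fl - fst down)"
    proof -
      have "fl = (fst down - e) + e + (fl - fst down)" using dn go(2) by simp
      then show ?thesis by (metis distrib_left)
    qed
    have arith: "lu + d + (N' + L' + F) + (q1 + 2 * ls + 3 * (s + h)) \<le> q1 + q2 + q3 + 2 * f + 3 * (n' + k)"
      if "d \<le> q3" "q4 + 7 * e' \<le> q2" "lu + ls = f" "s \<le> m" "F \<le> N' + q4" "h \<le> L'" "m \<le> e'" "L' \<le> e'" "N' = n'"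
      for lu d N' L' F q1 q2 q3 q4 ls s h f n' k e' m :: nat
      using that by (simp only: distrib_left)
    have 1: "6 * (r + 1) * e + 7 * e \<le> 20 * (r + 1) * e" by (simp add: algebra_simps)
    have 2: "fl - fst down \<le> 20 * (r + 1) * (fl - fst down)" by (simp add: algebra_simps)
    show ?thesis unfolding dl lc unfolding potential_def cfg fst_conv snd_conv d
      using kk arith[OF 2 1 lf eb(2,3) hl' le N_def] by (intro conjI)
  qed
  then show "keys_of_length (head_length (fst (snd (snd (dp_level i r off cfg tgt))))) (fst (snd (snd (dp_level i r off cfg tgt))))"
    "level_cost i r off cfg tgt + potential r (dp_level i r off cfg tgt) \<le> potential r cfg" by auto
qed

lemma length_records: "length (records r es) = length es + 1"
proof -
  have "length (snd (snd (snd (foldl (record_step r) a es)))) = length es + length (snd (snd (snd a)))" for a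
    by (induction es arbitrary: a) (auto simp: record_step_def)
  then show ?thesis by (simp add: records_def Let_def)
qed

lemma path_length_level:
  assumes "\<forall>s \<in> set (fst (snd (snd cfg))). length (snd (snd s)) \<le> m"
  shows "\<forall>s \<in> set (fst (snd (snd (dp_level i r off cfg tgt)))). length (snd (snd s)) \<le> Suc m"
proof -
  have sub: "set (foldl (\<lambda>o' c. insert_state c o') out cs) \<subseteq> set out \<union> set cs" for out cs
  proof (induction cs arbitrary: out)
    case (Cons c cs)
    show ?case using Cons[of "insert_state c out"] insert_state_set[of c out] by auto
  qed simp
  have cand: "length (snd (snd c)) = Suc (length (snd (snd s)))" if "c \<in> set (all_candidates i r off lo tgt D s)" for c lo D s
    using that by (auto simp: all_candidates_def candidates_def split: list.splits if_splits)
  have "length (snd (snd c)) \<le> Suc m"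
    if c: "c \<in> set (foldl (expand i r off lo tgt D) [] (fst (snd (snd cfg))))" for c lo D
  proof -
    obtain s where "s \<in> set (fst (snd (snd cfg)))" "c \<in> set (all_candidates i r off lo tgt D s)"
      using c sub[of "[]"] unfolding expand_all_eq by fastforce
    then show ?thesis using cand assms by fastforce
  qed
  then show ?thesis using assms
    by (auto simp: dp_level_def dp_finish_def Let_def le_SucI split: list.splits)
qed

lemma length_solve: "length (solve i r fuel es) \<le> length es"
proof -
  have lev: "\<forall>s \<in> set (fst (snd (snd (foldl (dp_level i r off) cfg ts)))). length (snd (snd s)) \<le> m + length ts"
    if "\<forall>s \<in> set (fst (snd (snd cfg))). length (snd (snd s)) \<le> m" for off cfg ts m
    using that
  proof (induction ts arbitrary: cfg m)
    case (Cons t ts)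
    from Cons.IH[OF path_length_level[OF Cons.prems]] show ?case by simp
  qed simp
  obtain h t where r: "records r es = h # t" "length t = length es"
    using length_records[of r es] by (cases "records r es") auto
  let ?c = "foldl (dp_level i r (length es * r)) (records r es, [h], [([], 0, [])], fuel) t"
  have "\<forall>s \<in> set (fst (snd (snd ?c))). length (snd (snd s)) \<le> length es"
    using lev[of "(records r es, [h], [([], 0, [])], fuel)" 0 "length es * r" t] r(2) by simp
  moreover have "solve i r fuel es = (case fst (snd (snd ?c)) of [] \<Rightarrow> [] | s # _ \<Rightarrow> rev (snd (snd s)))"
    unfolding solve_def Let_def by (simp only: r(1) list.case)
  ultimately show ?thesis by (cases "fst (snd (snd ?c))") auto
qed

text \<open>No assumption on the input words is made, since fuel caps the work even if they are not
  rankings. This is the source of the deterministic time bound.\<close>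

lemma solve_cost_le: "solve_cost i r fuel es \<le> 30 * ((r + 1) * (fuel + length es + 1))"
proof -
  obtain h t where r: "records r es = h # t" "length t = length es"
    using length_records[of r es] by (cases "records r es") auto
  let ?a = "(records r es, [h], [([], 0, [])], fuel)"
  let ?F = "fold_cost (level_cost i r (length es * r)) (dp_level i r (length es * r)) ?a t"
  have "?F + potential r (foldl (dp_level i r (length es * r)) ?a t) \<le> potential r ?a + (\<Sum>e\<leftarrow>t. 0 + 1)"
  proof (rule fold_cost_pot[where I = "\<lambda>cfg. keys_of_length (head_length (fst (snd (snd cfg)))) (fst (snd (snd cfg)))"])
    show "keys_of_length (head_length (fst (snd (snd ?a)))) (fst (snd (snd ?a)))"
      by (simp add: keys_of_length_def head_length_def)
  qed (use level_cost_potential in auto)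
  then have "?F \<le> 20 * (r + 1) * fuel + 2 * (length es + 1) + 3 + length es"
    using r(2) length_records[of r es] by (simp add: potential_def head_length_def sum_list_triv)
  moreover have "solve_cost i r fuel es = length es + length (solve i r fuel es) + ?F"
    unfolding solve_cost_def by (subst r(1)) simp
  ultimately have "solve_cost i r fuel es \<le> 20 * (r + 1) * fuel + 5 * length es + 5"
    using length_solve[of i r fuel es] by simp
  also have "\<dots> \<le> 30 * ((r + 1) * (fuel + length es + 1))" by (simp add: algebra_simps)
  finally show ?thesis .
qed

section \<open>The whole algorithm: parameters, sorting and output\<close>

section \<open>The complete algorithm\<close>

definition num_elements :: "input \<Rightarrow> nat" where
  "num_elements i = i Num_Elements 0 0"

definition log_size :: "input \<Rightarrow> nat" where
  "log_size i = log_ceil (num_elements i)"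

text \<open>The denominator of the approximation of \<beta> whose numerator is
  \<open>beta_word\<close>: the integer part over 1 if \<beta> >= 1, otherwise 1 over a power of two
  given by the first binary digit 1. The quotient is at most \<beta> and more than half of
  it.\<close>

definition beta_scale :: "input \<Rightarrow> nat" where
  "beta_scale i = 2 ^ beta_index i"

definition beta_word :: "input \<Rightarrow> nat" where
  "beta_word i = i Beta (beta_index i) 0"

text \<open>A fixed-point upper bound of \<alpha> with l = \<open>log_size i\<close> fractional
  bits. This precision is enough because \<alpha> enters with a factor of at most l, and l <=
  2^l.\<close>

definition alpha_up :: "input \<Rightarrow> nat" where
  "alpha_up i = Suc (foldl (\<lambda>a k. a + a + i Alpha (Suc k) 0) (i Alpha 0 0) [0..<log_size i])"

definition beta_units :: "input \<Rightarrow> nat" where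
  "beta_units i = 2 ^ log_size i * beta_word i"

text \<open>
  The algorithm looks at the first \<open>used_samples\<close> rankings only: beyond this number, each further
  ranking would cost time without improving the exponent.
\<close>

definition used_samples :: "input \<Rightarrow> nat" where
  "used_samples i = min (i Num_Samples 0 0)
     (32 * (beta_scale i * (beta_scale i * (log_size i * (ceil_div (alpha_up i) (beta_units i - 1) + 4)))))"

text \<open>Rounds \<alpha> l / (R b) up, so that the \<open>R * b\<close>-th power of
  \<open>2 ^ quality i\<close> is at least n^\<alpha>; see \<open>quality_enough\<close>.\<close>

definition quality :: "input \<Rightarrow> nat" where
  "quality i = ceil_div (log_size i * alpha_up i) (used_samples i * beta_units i - 1)"

text \<open>The part of the exponent that absorbs the constants of the moment bound. The square of
  \<open>beta_scale i\<close> is of order at most 1 + 1 / \<beta>^2.\<close>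

definition slack :: "nat \<Rightarrow> input \<Rightarrow> nat" where
  "slack K i = K * (beta_scale i * beta_scale i)"

definition fuel_of :: "nat \<Rightarrow> input \<Rightarrow> nat" where
  "fuel_of K i = num_elements i * 2 ^ (quality i + slack K i)"

definition sorted_elements :: "input \<Rightarrow> nat \<Rightarrow> keyed" where
  "sorted_elements i r = merge_sort (map (\<lambda>e. (borda i r e, e)) [0..<num_elements i])"

definition positions :: "nat list \<Rightarrow> nat list" where
  "positions \<sigma> = map snd (merge_sort (snd (foldl (\<lambda>a e. (Suc (fst a), (e, fst a) # snd a)) (0, []) \<sigma>)))"

text \<open>The zero padding supplies the eight surplus cells and keeps the length right even if
  \<open>solve\<close> was aborted and returned the empty list.\<close>

definition output_cells :: "nat \<Rightarrow> nat list \<Rightarrow> nat list" where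
  "output_cells n ps = (case take (n + 8) (ps @ map (\<lambda>_. 0) [0..<n + 8]) of [] \<Rightarrow> [] | v # t \<Rightarrow>
     (case t of [] \<Rightarrow> [] | w # vs \<Rightarrow> rev_append vs [v, w]))"

definition algorithm :: "nat \<Rightarrow> input \<Rightarrow> nat list" where
  "algorithm K i = (let r = used_samples i in
     output_cells (num_elements i) (positions (solve i r (fuel_of K i) (sorted_elements i r))))"

lemma tm_num_elements [tm_rules]: "tm (\<lambda>i (x :: 'a::rep). num_elements i) (\<lambda>_ _. 0)"
  unfolding num_elements_def by (rule tm_le, (rule tm_rules)+) simp

lemma tm_log_size [tm_rules]: "tm (\<lambda>i (x :: 'a::rep). log_size i) (\<lambda>i x. (log_size i + 1)\<^sup>2)"
  unfolding log_size_def by (rule tm_le, (rule tm_rules)+) simp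

lemma tm_beta_scale [tm_rules]: "tm (\<lambda>i (x :: 'a::rep). beta_scale i) (\<lambda>i x. beta_index i)"
  unfolding beta_scale_def by (rule tm_weaken[where k = 2], (rule tm_rules)+) simp

lemma tm_beta_word [tm_rules]: "tm (\<lambda>i (x :: 'a::rep). beta_word i) (\<lambda>i x. beta_index i)"
  unfolding beta_word_def by (rule tm_le, (rule tm_rules)+) simp

lemma tm_alpha_up [tm_rules]: "tm (\<lambda>i (x :: 'a::rep). alpha_up i) (\<lambda>i x. (log_size i + 1)\<^sup>2)"
  unfolding alpha_up_def
  by (rule tm_weaken[where k = 6], (rule tm_rules)+) (simp add: power2_eq_square)

definition parameter_cost :: "input \<Rightarrow> nat" where
  "parameter_cost i = 2 ^ log_size i + (log_size i + 1)\<^sup>2 + beta_scale i +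
     (ceil_div (alpha_up i) (beta_units i - 1) + 1)\<^sup>2"

lemma beta_index_le: "beta_index i \<le> beta_scale i"
  unfolding beta_scale_def by (simp add: less_imp_le)

lemma log_size_le: "log_size i \<le> 2 ^ log_size i"
  by (simp add: less_imp_le)

lemma tm_beta_units [tm_rules]: "tm (\<lambda>i (x :: 'a::rep). beta_units i) (\<lambda>i x. 2 ^ log_size i + (log_size i + 1)\<^sup>2 + beta_scale i)"
  unfolding beta_units_def
  apply (rule tm_weaken[where k = 3], (rule tm_rules)+)
  subgoal for i x using beta_index_le[of i] log_size_le[of i] by (simp add: power2_eq_square)
  done

lemma tm_used_samples [tm_rules]: "tm (\<lambda>i (x :: 'a::rep). used_samples i) (\<lambda>i x. parameter_cost i)"
  unfolding used_samples_def
  apply (rule tm_weaken[where k = 20], (rule tm_rules)+)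
  subgoal for i x using beta_index_le[of i] by (simp add: parameter_cost_def power2_eq_square)
  done

definition full_parameter_cost :: "nat \<Rightarrow> input \<Rightarrow> nat" where
  "full_parameter_cost K i = parameter_cost i + used_samples i + (quality i + 1)\<^sup>2 +
     slack K i + num_elements i"

lemma tm_quality: "tm (\<lambda>i (x :: 'a::rep). quality i) (\<lambda>i x. full_parameter_cost K i)"
  unfolding quality_def
  apply (rule tm_weaken[where k = 20], (rule tm_rules)+)
  subgoal for i x using beta_index_le[of i] log_size_le[of i]
    by (simp add: full_parameter_cost_def parameter_cost_def power2_eq_square quality_def)
  done

lemma slack_ge: "K \<le> slack K i"
  unfolding slack_def beta_scale_def by simp

lemma tm_slack [tm_rules]: "tm (\<lambda>i (x :: 'a::rep). slack K i) (\<lambda>i x. slack K i + beta_scale i)"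
  unfolding slack_def
  apply (rule tm_weaken[where k = 5], (rule tm_rules)+)
  subgoal for i x using beta_index_le[of i] slack_ge[of K i] unfolding slack_def[symmetric] by simp
  done

lemma tm_fuel_of [tm_rules]: "tm (\<lambda>i (x :: 'a::rep). fuel_of K i) (\<lambda>i x. full_parameter_cost K i)"
  unfolding fuel_of_def
  apply (rule tm_weaken[where k = 20], (rule tm_rules tm_quality[where K = K])+)
  subgoal for i x
  proof -
    have "q \<le> (q + 1)\<^sup>2" for q :: nat by (simp add: power2_eq_square)
    from order_trans[OF this] have "quality i \<le> full_parameter_cost K i" by (simp add: full_parameter_cost_def)
    moreover have "slack K i \<le> full_parameter_cost K i" "num_elements i \<le> full_parameter_cost K i"
      "beta_scale i \<le> full_parameter_cost K i"
      by (simp_all add: full_parameter_cost_def parameter_cost_def)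
    ultimately have "0 + (full_parameter_cost K i + (slack K i + beta_scale i) + (quality i + slack K i)) +
        num_elements i \<le> 20 * (1 + full_parameter_cost K i)" by simp
    then show ?thesis by (simp only: add_0)
  qed
  done

lemma tm_sorted_elements0: "tm (\<lambda>i r. sorted_elements i r)
    (\<lambda>i r. num_elements i * (r + log_size i + 1) + (log_size i + 1)\<^sup>2)"
  unfolding sorted_elements_def
  apply (rule tm_weaken[where k = 5], (rule tm_rules)+)
  apply (simp add: log_size_def sum_list_triv algebra_simps)
  done

lemmas tm_sorted_elements [tm_rules] = tm_fun1[OF tm_sorted_elements0]

lemma tm_positions0: "tm (\<lambda>i \<sigma>. positions \<sigma>) (\<lambda>i \<sigma>. length \<sigma> * (log_ceil (length \<sigma>) + 1) + (log_ceil (length \<sigma>) + 1)\<^sup>2)"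
proof -
  have l: "length (snd (foldl (\<lambda>a e. (Suc (fst a), (e, fst a) # snd a)) a \<sigma>)) = length \<sigma> + length (snd a)" for a \<sigma>
    by (induction \<sigma> arbitrary: a) auto
  have m: "length (merge_sort xs) = length xs" for xs using mset_eq_length[OF merge_sort[of xs, THEN conjunct2]] .
  show ?thesis
    unfolding positions_def
    apply (rule tm_weaken[where k = 5], (rule tm_rules)+)
    apply (simp add: l m sum_list_triv algebra_simps)
    done
qed

lemmas tm_positions [tm_rules] = tm_fun1[OF tm_positions0]

lemma tm_output_cells0: "tm (\<lambda>i z. output_cells (fst z) (snd z)) (\<lambda>i z. fst z + length (snd z))"
  unfolding output_cells_def
  apply (rule tm_weaken[where k = 100], (rule tm_rules)+)
  subgoal for i x
    apply (rule order_trans[where y = "length (snd x) + 3 * (fst x + 8) + length (take (fst x + 8) (snd x @ map (\<lambda>_. 0) [0..<fst x + 8]))"])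
    subgoal by (auto simp: sum_list_triv simp del: length_take take_append split: list.splits)
    subgoal by (simp add: min_def)
    done
  done

lemmas tm_output_cells [tm_rules] = tm_fun2[OF tm_output_cells0]

lemma log_ceil_mono: "m \<le> n \<Longrightarrow> log_ceil m \<le> log_ceil n"
  unfolding log_ceil_def[of m] by (rule Least_le) (use log_ceil_ge[of n] in linarith)

lemma length_sorted_elements [simp]: "length (sorted_elements i r) = num_elements i"
  unfolding sorted_elements_def
  using mset_eq_length[OF merge_sort[of "map (\<lambda>e. (borda i r e, e)) [0..<num_elements i]", THEN conjunct2]] by simp

definition cost_of :: "nat \<Rightarrow> input \<Rightarrow> nat" where
  "cost_of K i = parameter_cost i + (quality i + 1)\<^sup>2 + slack K i +
     num_elements i * (log_size i + 1) + (used_samples i + 1) * (fuel_of K i + num_elements i + 1)"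

lemma tm_algorithm: "tm (\<lambda>i (x :: nat). algorithm K i) (\<lambda>i x. cost_of K i)"
  unfolding algorithm_def
  apply (rule tm_weaken[where k = 100], (rule tm_rules)+)
  subgoal for i x
  proof -
    let ?r = "used_samples i" and ?n = "num_elements i"
    let ?S = "solve i ?r (fuel_of K i) (sorted_elements i ?r)"
    have l: "length ?S \<le> ?n" using length_solve[of i ?r "fuel_of K i" "sorted_elements i ?r"] by simp
    have g: "log_ceil (length ?S) \<le> log_size i" unfolding log_size_def by (rule log_ceil_mono[OF l])
    have 1: "length ?S * (log_ceil (length ?S) + 1) \<le> ?n * (log_size i + 1)" using l g by (intro mult_mono) auto
    define A B where "A = (Suc (log_ceil (length ?S)))\<^sup>2" and "B = (Suc (log_size i))\<^sup>2"
    have 2: "A \<le> B" unfolding A_def B_def using g by (intro power_mono) auto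
    have 3: "solve_cost i ?r (fuel_of K i) (sorted_elements i ?r) \<le> 30 * ((?r + 1) * (fuel_of K i + ?n + 1))"
      using solve_cost_le[of i ?r "fuel_of K i" "sorted_elements i ?r"] by simp
    have 4: "length (positions ?S) = length ?S"
    proof -
      have "length (snd (foldl (\<lambda>a e. (Suc (fst a), (e, fst a) # snd a)) a \<sigma>)) = length \<sigma> + length (snd a)" for a and \<sigma> :: "nat list"
        by (induction \<sigma> arbitrary: a) auto
      moreover have "length (merge_sort xs) = length xs" for xs
        using mset_eq_length[OF merge_sort[of xs, THEN conjunct2]] .
      ultimately show ?thesis unfolding positions_def by simp
    qed
    have 6: "?n \<le> ?n * (log_size i + 1)" by simp
    have 5: "?n * (?r + log_size i + 1) \<le> ?n * (log_size i + 1) + (?r + 1) * (fuel_of K i + ?n + 1)"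
      "?r + 1 + ?n \<le> (?r + 1) * (fuel_of K i + ?n + 1)"
      by (simp_all add: algebra_simps)
    show ?thesis
      using 1 2 3 l 5 6 unfolding cost_of_def full_parameter_cost_def parameter_cost_def
      by (simp add: 4 A_def[symmetric] B_def[symmetric])
  qed
  done

lemma length_output_cells: "length (output_cells n ps) = n + 8"
  by (auto simp: output_cells_def rev_append split: list.splits dest: arg_cong[of _ _ length])

section \<open>From votes and Borda sums to Kemeny distances\<close>

section \<open>Correctness\<close>

lemma of_bool_card: "finite A \<Longrightarrow> (\<Sum>x\<in>A. of_bool (P x)) = card {x \<in> A. P x}" for P :: "'a \<Rightarrow> bool"
  by (simp add: sum.inter_filter[symmetric] of_bool_def)

text \<open>A position counts the elements ahead, which turns sums of positions into sums of
  pairwise votes.\<close>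

lemma permutes_rank:
  fixes p :: "nat \<Rightarrow> nat"
  assumes "p permutes {..<n}" "x < n"
  shows "(\<Sum>y<n. of_bool (p y < p x)) = p x"
proof -
  have px: "p x < n" using permutes_in_image[OF assms(1), of x] assms(2) by simp
  have "p ` {y \<in> {..<n}. p y < p x} = {..<p x}"
  proof (intro equalityI subsetI)
    fix z assume z: "z \<in> {..<p x}"
    then have "z \<in> p ` {..<n}" using permutes_image[OF assms(1)] px by simp
    then show "z \<in> p ` {y \<in> {..<n}. p y < p x}" using z by auto
  qed auto
  moreover have "inj_on p {y \<in> {..<n}. p y < p x}" using permutes_inj_on[OF assms(1)] .
  ultimately have "card {y \<in> {..<n}. p y < p x} = p x" by (metis card_image card_lessThan)
  then show ?thesis by (simp only: of_bool_card finite_lessThan)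
qed

definition vote_count :: "(nat \<Rightarrow> nat) list \<Rightarrow> nat \<Rightarrow> nat \<Rightarrow> nat" where
  "vote_count qs u v = (\<Sum>p\<leftarrow>qs. of_bool (p u < p v))"

lemma sum_list_swap: "(\<Sum>x\<in>A. \<Sum>p\<leftarrow>qs. f x p) = (\<Sum>p\<leftarrow>qs. \<Sum>x\<in>A. f x p)" for f :: "'a \<Rightarrow> 'b \<Rightarrow> nat"
  by (induction qs) (simp_all add: sum.distrib)

lemma sum_list_upt: "(\<Sum>p\<leftarrow>qs. f p) = (\<Sum>k<length qs. f (qs ! k))" for f :: "'b \<Rightarrow> nat"
  using sum_list_sum_nth[of "map f qs"] by (simp add: atLeast0LessThan)

lemma kemeny_dist_sum: "kemeny_dist n p m = (\<Sum>i<n. \<Sum>j<n. of_bool (m i < m j) * of_bool (p j < p i))"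
proof -
  have "(\<Sum>i<n. \<Sum>j<n. of_bool (m i < m j) * of_bool (p j < p i)) =
      (\<Sum>x\<in>{..<n} \<times> {..<n}. of_bool (m (fst x) < m (snd x) \<and> p (snd x) < p (fst x)) :: nat)"
    unfolding sum.cartesian_product by (intro sum.cong) (auto simp: of_bool_def)
  also have "\<dots> = card {x \<in> {..<n} \<times> {..<n}. m (fst x) < m (snd x) \<and> p (snd x) < p (fst x)}"
    by (rule of_bool_card) simp
  also have "{x \<in> {..<n} \<times> {..<n}. m (fst x) < m (snd x) \<and> p (snd x) < p (fst x)} =
      {(i, j). i < n \<and> j < n \<and> m i < m j \<and> p i > p j}" by auto
  finally show ?thesis by (simp add: kemeny_dist_def)
qed

lemma kemeny_total:
  "(\<Sum>p\<leftarrow>qs. kemeny_dist n p m) = (\<Sum>i<n. \<Sum>j<n. of_bool (m i < m j) * vote_count qs j i)"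
proof -
  have "(\<Sum>i<n. \<Sum>j<n. of_bool (m i < m j) * vote_count qs j i) =
      (\<Sum>i<n. \<Sum>p\<leftarrow>qs. \<Sum>j<n. of_bool (m i < m j) * of_bool (p j < p i))"
    by (intro sum.cong refl) (simp only: sum_list_swap[symmetric] vote_count_def sum_list_const_mult[symmetric])
  also have "\<dots> = (\<Sum>p\<leftarrow>qs. \<Sum>i<n. \<Sum>j<n. of_bool (m i < m j) * of_bool (p j < p i))"
    by (rule sum_list_swap)
  finally show ?thesis by (simp only: kemeny_dist_sum)
qed

lemma vote_cost_positions:
  assumes "sorted_wrt (\<lambda>x y. m x < m y) l"
  shows "vote_cost W l = (\<Sum>x\<in>set l. \<Sum>y\<in>set l. of_bool (m x < (m y :: nat)) * W y x)"
  using assms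
proof (induction l)
  case (Cons x l)
  have x: "x \<notin> set l" "\<And>y. y \<in> set l \<Longrightarrow> m x < m y" using Cons.prems by auto
  have d: "distinct l"
  proof -
    have "sorted_wrt (\<lambda>x y. m x < m y) l" using Cons.prems by simp
    then show ?thesis by (induction l) auto
  qed
  have nl: "\<not> m z < m x" if "z \<in> set l" for z using x(2)[OF that] by simp
  have 1: "(\<Sum>z\<in>set l. \<Sum>y\<in>insert x (set l). of_bool (m z < m y) * W y z) =
      (\<Sum>z\<in>set l. \<Sum>y\<in>set l. of_bool (m z < m y) * W y z)"
    by (rule sum.cong[OF refl]) (simp add: x(1) nl)
  have 2: "(\<Sum>y\<in>insert x (set l). of_bool (m x < m y) * W y x) = (\<Sum>y\<in>set l. W y x)"
  proof -
    have "(\<Sum>y\<in>insert x (set l). of_bool (m x < m y) * W y x) =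
        of_bool (m x < m x) * W x x + (\<Sum>y\<in>set l. of_bool (m x < m y) * W y x)"
      by (rule sum.insert) (simp_all add: x(1))
    also have "\<dots> = 0 + (\<Sum>y\<in>set l. W y x)"
      by (intro arg_cong2[where f = "(+)"], simp, rule sum.cong[OF refl], simp add: x(2))
    finally show ?thesis by simp
  qed
  have "(\<Sum>z\<in>insert x (set l). \<Sum>y\<in>insert x (set l). of_bool (m z < m y) * W y z) =
      (\<Sum>y\<in>insert x (set l). of_bool (m x < m y) * W y x) + (\<Sum>z\<in>set l. \<Sum>y\<in>insert x (set l). of_bool (m z < m y) * W y z)"
    by (rule sum.insert) (simp_all add: x(1))
  also have "\<dots> = vote_cost W (x # l)"
    using Cons unfolding 1 2 by (simp only: vote_cost.simps sum_list_distinct_conv_sum_set[OF d] sorted_wrt.simps)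
  finally show ?case by (simp only: list.set)
qed simp

lemma vote_cost_kemeny:
  assumes "order_list n \<sigma>" "\<And>k. k < n \<Longrightarrow> m (\<sigma> ! k) = k"
  shows "vote_cost (vote_count qs) \<sigma> = (\<Sum>p\<leftarrow>qs. kemeny_dist n p m)"
proof -
  have "sorted_wrt (\<lambda>x y. m x < m y) \<sigma>"
    using assms(2) length_order_list[OF assms(1)] by (simp add: sorted_wrt_iff_nth_less)
  then show ?thesis unfolding kemeny_total
    using vote_cost_positions[of m \<sigma>] assms(1) by (simp add: order_list_def)
qed

lemma order_list_of_permutation:
  assumes "q permutes {..<n}"
  shows "order_list n (map (inv q) [0..<n])" "\<And>k. k < n \<Longrightarrow> q (map (inv q) [0..<n] ! k) = k"
proof -
  have i: "inv q permutes {..<n}" using permutes_inv[OF assms] .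
  show "order_list n (map (inv q) [0..<n])"
    using permutes_image[OF i] permutes_inj_on[OF i] by (simp add: order_list_def distinct_map atLeast0LessThan)
  show "q (map (inv q) [0..<n] ! k) = k" if "k < n" for k
    using that permutes_inverses(1)[OF assms] by simp
qed

text \<open>\<open>qs\<close> consists of the \<open>R\<close> rankings actually read, possibly a
  proper prefix of the sample.\<close>

locale ranked_input =
  fixes i :: input and n R :: nat and qs :: "(nat \<Rightarrow> nat) list"
  assumes num: "num_elements i = n" and R_pos: "0 < R" and len: "length qs = R"
    and perm: "\<And>p. p \<in> set qs \<Longrightarrow> p permutes {..<n}"
    and ranking: "\<And>k x. k < R \<Longrightarrow> x < n \<Longrightarrow> i Ranking k x = (qs ! k) x"
begin

definition elem :: "nat \<Rightarrow> nat" where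
  "elem k = snd (sorted_elements i R ! k)"

definition pref :: "nat \<Rightarrow> nat \<Rightarrow> nat" where
  "pref u v = votes i R (elem u) (elem v)"

lemma votes_eq: "u < n \<Longrightarrow> v < n \<Longrightarrow> votes i R u v = vote_count qs u v"
proof -
  assume u: "u < n" "v < n"
  have "foldl (\<lambda>a k. if i Ranking k u < i Ranking k v then Suc a else a) 0 [0..<m] =
      (\<Sum>k<m. of_bool (i Ranking k u < i Ranking k v))" for m
    by (induction m) auto
  then have "votes i R u v = (\<Sum>k<R. of_bool (i Ranking k u < i Ranking k v))" by (simp add: votes_def)
  also have "\<dots> = vote_count qs u v"
    unfolding vote_count_def sum_list_upt len using u ranking by (intro sum.cong) auto
  finally show ?thesis .
qed

lemma borda_eq: "x < n \<Longrightarrow> borda i R x = (\<Sum>y<n. votes i R y x)"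
proof -
  assume x: "x < n"
  have "foldl (\<lambda>a k. a + i Ranking k x) 0 [0..<m] = (\<Sum>k<m. i Ranking k x)" for m
    by (induction m) auto
  then have "borda i R x = (\<Sum>k<R. i Ranking k x)" by (simp add: borda_def)
  also have "\<dots> = (\<Sum>p\<leftarrow>qs. p x)" unfolding sum_list_upt len using x ranking by (intro sum.cong) auto
  also have "\<dots> = (\<Sum>p\<leftarrow>qs. \<Sum>y<n. of_bool (p y < p x))"
    using permutes_rank[OF perm x] by (intro arg_cong[where f = sum_list] map_cong) auto
  also have "\<dots> = (\<Sum>y<n. vote_count qs y x)" unfolding vote_count_def by (rule sum_list_swap[symmetric])
  also have "\<dots> = (\<Sum>y<n. votes i R y x)" using x votes_eq by (intro sum.cong) auto
  finally show ?thesis .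
qed

lemma mset_elems: "mset (sorted_elements i R) = mset (map (\<lambda>e. (borda i R e, e)) [0..<n])"
  unfolding sorted_elements_def num using merge_sort by blast

lemma elem_bij: "bij_betw elem {..<n} {..<n}"
proof -
  have "mset (map snd (sorted_elements i R)) = mset [0..<n]"
    unfolding mset_map mset_elems by (simp add: image_mset.compositionality comp_def)
  then have "distinct (map snd (sorted_elements i R))" "set (map snd (sorted_elements i R)) = {..<n}"
    by (metis distinct_upt mset_eq_imp_distinct_iff, metis atLeast0LessThan atLeast_upt mset_eq_setD)
  then have "bij_betw ((!) (map snd (sorted_elements i R))) {..<n} {..<n}"
    by (intro bij_betw_nth) (auto simp: num)
  then show ?thesis by (rule bij_betw_cong[THEN iffD1, rotated]) (simp add: elem_def num)
qed

lemma elem_less: "k < n \<Longrightarrow> elem k < n"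
  using bij_betwE[OF elem_bij] by auto

lemma fst_sorted: "k < n \<Longrightarrow> fst (sorted_elements i R ! k) = borda i R (elem k)"
proof -
  assume "k < n"
  then have "sorted_elements i R ! k \<in> set (sorted_elements i R)" by (simp add: num)
  then show ?thesis using mset_eq_setD[OF mset_elems] by (auto simp: elem_def)
qed

lemma borda_mono: "a \<le> b \<Longrightarrow> b < n \<Longrightarrow> borda i R (elem a) \<le> borda i R (elem b)"
  using merge_sort[of "map (\<lambda>e. (borda i R e, e)) [0..<n]"] sorted_nth_mono[of "map fst (sorted_elements i R)" a b]
  by (simp add: fst_sorted[symmetric] sorted_elements_def[symmetric] num[symmetric])

lemma votes_both:
  assumes "u < n" "v < n" "u \<noteq> v"
  shows "votes i R u v + votes i R v u = R"
proof -
  have "votes i R u v + votes i R v u = (\<Sum>p\<leftarrow>qs. of_bool (p u < p v) + of_bool (p v < p u))"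
    using assms by (simp add: votes_eq vote_count_def sum_list_addf)
  also have "\<dots> = (\<Sum>p\<leftarrow>qs. 1)"
  proof (intro arg_cong[where f = sum_list] map_cong refl)
    fix p assume "p \<in> set qs"
    then have "p u \<noteq> p v" using permutes_inj[OF perm] assms(3) by (auto dest: injD)
    then show "of_bool (p u < p v) + of_bool (p v < p u) = (1 :: nat)" by auto
  qed
  finally show ?thesis by (simp add: sum_list_triv len)
qed

lemma votes_same: "votes i R u u = 0"
  unfolding votes_def by (induction R) auto

sublocale election n R pref i elem
proof
  show "0 < R" by (rule R_pos)
  show "pref u v + pref v u = R" if "u < n" "v < n" "u \<noteq> v" for u v
    unfolding pref_def using that elem_less bij_betw_imp_inj_on[OF elem_bij]
    by (intro votes_both) (auto dest: inj_onD)
qed (simp add: pref_def)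

lemma fst_sorted_pref: "k < n \<Longrightarrow> fst (sorted_elements i R ! k) = (\<Sum>v\<in>{..<n} - {k}. pref v k)"
proof -
  assume k: "k < n"
  have "fst (sorted_elements i R ! k) = (\<Sum>y<n. votes i R y (elem k))"
    using k by (simp add: fst_sorted borda_eq elem_less)
  also have "\<dots> = (\<Sum>v<n. pref v k)" unfolding pref_def by (rule sum.reindex_bij_betw[OF elem_bij, symmetric])
  also have "\<dots> = (\<Sum>v\<in>{..<n} - {k}. pref v k)"
    using k by (subst sum.remove[of _ k]) (auto simp: pref_def votes_same)
  finally show ?thesis .
qed

text \<open>Each pair inside \<open>A\<close> contributes \<open>R\<close> votes whatever the
  rankings are. So among sets of equal size, the Borda sum and the votes against the set across its
  boundary differ by a constant.\<close>

lemma twice_borda_sum: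
  assumes "A \<subseteq> {..<n}"
  shows "2 * (\<Sum>x\<in>A. borda i R x) + R * card A =
    2 * (\<Sum>y\<in>{..<n} - A. \<Sum>x\<in>A. votes i R y x) + R * (card A * card A)"
proof -
  have fin: "finite A" using assms finite_subset by blast
  have "(\<Sum>x\<in>A. borda i R x) = (\<Sum>x\<in>A. \<Sum>y<n. votes i R y x)"
    using assms by (intro sum.cong borda_eq) auto
  also have "\<dots> = (\<Sum>x\<in>A. (\<Sum>y\<in>{..<n} - A. votes i R y x) + (\<Sum>y\<in>A. votes i R y x))"
    by (intro sum.cong refl sum.subset_diff assms) simp
  also have "\<dots> = (\<Sum>y\<in>{..<n} - A. \<Sum>x\<in>A. votes i R y x) + (\<Sum>x\<in>A. \<Sum>y\<in>A. votes i R y x)"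
    unfolding sum.distrib by (rule arg_cong[where f = "\<lambda>z. z + _"], rule sum.swap)
  finally have 1: "(\<Sum>x\<in>A. borda i R x) = \<dots>" .
  have "2 * (\<Sum>x\<in>A. \<Sum>y\<in>A. votes i R y x) + R * card A = (\<Sum>x\<in>A. \<Sum>y\<in>A. votes i R y x + votes i R x y + (if x = y then R else 0))"
  proof -
    have "(\<Sum>x\<in>A. \<Sum>y\<in>A. votes i R x y) = (\<Sum>x\<in>A. \<Sum>y\<in>A. votes i R y x)" by (rule sum.swap)
    moreover have "(\<Sum>x\<in>A. \<Sum>y\<in>A. if x = y then R else 0) = R * card A" using fin by (simp add: mult.commute)
    ultimately show ?thesis unfolding sum.distrib by linarith
  qed
  also have "\<dots> = (\<Sum>x\<in>A. \<Sum>y\<in>A. R)"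
    using assms votes_both by (intro sum.cong refl) (auto simp: votes_same subset_iff)
  finally show ?thesis unfolding 1 by (simp add: distrib_left mult_ac)
qed

lemma borda_sum_least:
  assumes "A \<subseteq> {..<n}" "card A = q"
  shows "(\<Sum>x\<in>elem ` {..<q}. borda i R x) \<le> (\<Sum>x\<in>A. borda i R x)"
proof -
  have fin: "finite A" using assms(1) finite_subset by blast
  have qn: "q \<le> n" using assms card_mono[OF finite_lessThan assms(1)] by simp
  let ?B = "elem ` {..<q}"
  have cB: "card ?B = q"
    using qn inj_on_subset[OF bij_betw_imp_inj_on[OF elem_bij], of "{..<q}"] by (simp add: card_image)
  have Bn: "?B \<subseteq> {..<n}" using elem_less qn by auto
  show ?thesis
  proof (cases "q = n")
    case True
    then have "A = {..<n}" "?B = {..<n}" using assms cB Bn by (metis card_lessThan card_subset_eq finite_lessThan)+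
    then show ?thesis by simp
  next
    case False
    define t where "t = borda i R (elem q)"
    have lo: "borda i R x \<le> t" if "x \<in> ?B" for x
      using that borda_mono[of _ q] False qn by (auto simp: t_def)
    have hi: "t \<le> borda i R x" if x: "x \<in> A - ?B" for x
    proof -
      have "x \<in> elem ` {..<n}" using x assms bij_betw_imp_surj_on[OF elem_bij] by auto
      then obtain k where k: "k < n" "x = elem k" by auto
      then have "q \<le> k" using x by (cases "k < q") auto
      then show ?thesis using borda_mono[of q k] k by (simp add: t_def)
    qed
    have c: "card (?B - A) = card (A - ?B)"
      using card_Diff_subset_Int[of ?B A] card_Diff_subset_Int[of A ?B] fin cB assms(2) by (simp add: Int_commute)
    have "(\<Sum>x\<in>?B. borda i R x) = (\<Sum>x\<in>?B - A. borda i R x) + (\<Sum>x\<in>A \<inter> ?B. borda i R x)"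
      by (subst sum.Int_Diff[of _ _ A]) (auto simp: Int_commute)
    also have "(\<Sum>x\<in>?B - A. borda i R x) \<le> (\<Sum>x\<in>?B - A. t)" by (intro sum_mono lo) auto
    also have "\<dots> = (\<Sum>x\<in>A - ?B. t)" using c by simp
    also have "\<dots> \<le> (\<Sum>x\<in>A - ?B. borda i R x)" by (intro sum_mono hi) auto
    also have "\<dots> + (\<Sum>x\<in>A \<inter> ?B. borda i R x) = (\<Sum>x\<in>A. borda i R x)"
      using fin by (subst (2) sum.Int_Diff[of _ _ ?B]) auto
    finally show ?thesis by simp
  qed
qed

text \<open>The Borda order has the least number of votes against it across each cut.\<close>

lemma excess_le:
  assumes c: "c permutes {..<n}" and q: "q \<le> n"
  shows "cut_excess n pref q \<le> 2 * (\<Sum>p\<leftarrow>qs. cross_inv n c q p)"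
proof -
  \<comment> \<open>The first \<open>q\<close> elements of the center, a competitor of the same size
    for the first \<open>q\<close> Borda ranks.\<close>
  define A where "A = {x \<in> {..<n}. c x < q}"
  let ?B = "elem ` {..<q}"
  have inj: "inj_on elem {..<n}" by (rule bij_betw_imp_inj_on[OF elem_bij])
  have surj: "elem ` {..<n} = {..<n}" by (rule bij_betw_imp_surj_on[OF elem_bij])
  have B: "?B \<subseteq> {..<n}" using elem_less q by auto
  have cB: "card ?B = q" using q inj_on_subset[OF inj, of "{..<q}"] by (simp add: card_image)
  have "c ` A = {..<q}"
  proof (intro equalityI subsetI)
    fix z assume z: "z \<in> {..<q}"
    then have "z \<in> c ` {..<n}" using permutes_image[OF c] q by simp
    then show "z \<in> c ` A" using z by (auto simp: A_def)
  qed (auto simp: A_def)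
  then have cA: "card A = q" using card_image[OF permutes_inj_on[OF c], of A] by simp
  have An: "A \<subseteq> {..<n}" by (auto simp: A_def)
  have e: "elem ` {q..<n} = {..<n} - ?B"
  proof -
    have "{q..<n} = {..<n} - {..<q}" by auto
    moreover have "elem ` ({..<n} - {..<q}) = elem ` {..<n} - elem ` {..<q}"
      by (rule inj_on_image_set_diff[OF inj]) (use q in auto)
    ultimately show ?thesis by (simp only: surj)
  qed
  have "(\<Sum>y\<in>{..<n} - ?B. \<Sum>x\<in>?B. votes i R y x) = (\<Sum>v\<in>{q..<n}. \<Sum>u<q. pref v u)"
  proof -
    have i1: "inj_on elem {..<q}" and i2: "inj_on elem {q..<n}" by (rule inj_on_subset[OF inj], use q in auto)+
    show ?thesis unfolding e[symmetric] sum.reindex[OF i1] sum.reindex[OF i2] by (simp add: pref_def)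
  qed
  then have 1: "cut_excess n pref q = 2 * (\<Sum>y\<in>{..<n} - ?B. \<Sum>x\<in>?B. votes i R y x)" by (simp add: cut_excess_def)
  have "2 * (\<Sum>y\<in>{..<n} - ?B. \<Sum>x\<in>?B. votes i R y x) \<le> 2 * (\<Sum>y\<in>{..<n} - A. \<Sum>x\<in>A. votes i R y x)"
    using twice_borda_sum[OF B] twice_borda_sum[OF An] borda_sum_least[OF An cA] unfolding cA cB by linarith
  also have "(\<Sum>y\<in>{..<n} - A. \<Sum>x\<in>A. votes i R y x) = (\<Sum>y\<in>{..<n} - A. \<Sum>x\<in>A. vote_count qs y x)"
    by (intro sum.cong refl votes_eq) (auto simp: A_def)
  also have "\<dots> = (\<Sum>p\<leftarrow>qs. \<Sum>y\<in>{..<n} - A. \<Sum>x\<in>A. of_bool (p y < p x))"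
    unfolding vote_count_def sum_list_swap ..
  also have "\<dots> = (\<Sum>p\<leftarrow>qs. cross_inv n c q p)"
  proof (intro arg_cong[where f = sum_list] map_cong refl)
    fix p :: "nat \<Rightarrow> nat"
    have "(\<Sum>y\<in>{..<n} - A. \<Sum>x\<in>A. of_bool (p y < p x)) = (\<Sum>x\<in>A. \<Sum>y\<in>{..<n} - A. of_bool (p y < p x) :: nat)"
      by (rule sum.swap)
    also have "\<dots> = (\<Sum>z\<in>A \<times> ({..<n} - A). of_bool (p (snd z) < p (fst z)))"
      unfolding sum.cartesian_product by (intro sum.cong) auto
    also have "\<dots> = card {z \<in> A \<times> ({..<n} - A). p (snd z) < p (fst z)}"
      by (rule of_bool_card) (simp add: A_def)
    also have "{z \<in> A \<times> ({..<n} - A). p (snd z) < p (fst z)} = {(i, j). i < n \<and> j < n \<and> c i < q \<and> q \<le> c j \<and> p i > p j}"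
      by (auto simp: A_def)
    finally show "(\<Sum>y\<in>{..<n} - A. \<Sum>x\<in>A. of_bool (p y < p x)) = cross_inv n c q p" by (simp add: cross_inv_def)
  qed
  finally show ?thesis using 1 by simp
qed

lemma solve_correct:
  assumes "(\<Sum>j<n. level_fuel j) < fuel"
  defines "\<sigma> \<equiv> solve i R fuel (sorted_elements i R)"
  assumes m: "m permutes {..<n}" "\<And>k. k < n \<Longrightarrow> m (\<sigma> ! k) = k" and q: "q permutes {..<n}"
  shows "(\<Sum>p\<leftarrow>qs. kemeny_dist n p m) \<le> (\<Sum>p\<leftarrow>qs. kemeny_dist n p q)"
proof -
  obtain \<tau> where \<tau>: "optimal_order n pref \<tau>" "\<sigma> = map elem \<tau>"
    unfolding \<sigma>_def
    by (rule solve_optimal[of "sorted_elements i R", OF _ _ _ assms(1)]) (auto simp: num elem_def fst_sorted_pref)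
  have inj: "inj_on elem {..<n}" by (rule bij_betw_imp_inj_on[OF elem_bij])
  have surj: "elem ` {..<n} = {..<n}" by (rule bij_betw_imp_surj_on[OF elem_bij])
  have cost: "vote_cost (vote_count qs) (map elem l) = vote_cost pref l" if "set l \<subseteq> {..<n}" for l
    using that
  proof (induction l)
    case (Cons x l)
    then have "(\<Sum>y\<leftarrow>map elem l. vote_count qs y (elem x)) = (\<Sum>y\<leftarrow>l. pref y x)"
      by (auto simp: comp_def pref_def votes_eq elem_less subset_iff intro!: arg_cong[where f = sum_list])
    with Cons show ?case by simp
  qed simp
  have o\<tau>: "order_list n \<tau>" using \<tau>(1) by (simp add: optimal_order_def)
  then have o\<sigma>: "order_list n \<sigma>" using inj surj by (simp add: \<tau>(2) order_list_def distinct_map)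
  define \<sigma>' where "\<sigma>' = map (inv q) [0..<n]"
  note \<sigma>' = order_list_of_permutation[OF q, folded \<sigma>'_def]
  define \<tau>' where "\<tau>' = map (inv_into {..<n} elem) \<sigma>'"
  have e: "map elem \<tau>' = \<sigma>'"
    unfolding \<tau>'_def map_map comp_def using \<sigma>'(1) surj
    by (intro map_idI) (auto simp: order_list_def intro!: f_inv_into_f)
  have "order_list n \<tau>'"
    using \<sigma>'(1) bij_betw_inv_into[OF elem_bij] unfolding \<tau>'_def order_list_def bij_betw_def by (simp add: distinct_map)
  then have "vote_cost pref \<tau> \<le> vote_cost pref \<tau>'" "set \<tau>' \<subseteq> {..<n}" "set \<tau> \<subseteq> {..<n}"
    using \<tau>(1) o\<tau> by (auto simp: optimal_order_def order_list_def)
  then have "vote_cost (vote_count qs) \<sigma> \<le> vote_cost (vote_count qs) \<sigma>'"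
    using cost[of \<tau>] cost[of \<tau>'] by (simp add: \<tau>(2) e)
  then show ?thesis
    using vote_cost_kemeny[OF o\<sigma> m(2)] vote_cost_kemeny[OF \<sigma>'] by simp
qed

lemma solve_order:
  assumes "(\<Sum>j<n. level_fuel j) < fuel"
  shows "order_list n (solve i R fuel (sorted_elements i R))"
proof -
  obtain \<tau> where "optimal_order n pref \<tau>" "solve i R fuel (sorted_elements i R) = map elem \<tau>"
    by (rule solve_optimal[of "sorted_elements i R", OF _ _ _ assms]) (auto simp: num elem_def fst_sorted_pref)
  then show ?thesis using elem_bij by (simp add: optimal_order_def order_list_def distinct_map bij_betw_def)
qed

end

text \<open>Sorting pairs of element and index by the element inverts the permutation.\<close>

lemma positions_nth:
  assumes "order_list n \<sigma>"
  shows "length (positions \<sigma>) = n" "\<And>k. k < n \<Longrightarrow> positions \<sigma> ! (\<sigma> ! k) = k"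
proof -
  have ln: "length \<sigma> = n" by (rule length_order_list[OF assms])
  have d: "distinct \<sigma>" "set \<sigma> = {..<n}" using assms by (auto simp: order_list_def)
  have "snd (foldl (\<lambda>a e. (Suc (fst a), (e, fst a) # snd a)) (m, acc) l) = rev (zip l [m..<m + length l]) @ acc"
    for m acc and l :: "nat list"
  proof (induction l arbitrary: m acc)
    case (Cons x l)
    have "[m..<m + length (x # l)] = m # [Suc m..<Suc m + length l]" by (simp add: upt_conv_Cons del: upt_Suc)
    then show ?case using Cons[of "Suc m" "(x, m) # acc"] by simp
  qed simp
  from this[of 0 "[]" \<sigma>] have p: "positions \<sigma> = map snd (merge_sort (rev (zip \<sigma> [0..<n])))"
    by (simp add: positions_def ln)
  define S where "S = merge_sort (rev (zip \<sigma> [0..<n]))"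
  have S: "sorted (map fst S)" "mset S = mset (zip \<sigma> [0..<n])"
    using merge_sort[of "rev (zip \<sigma> [0..<n])"] by (auto simp: S_def)
  have lS: "length S = n" using mset_eq_length[OF S(2)] by (simp add: ln)
  then show "length (positions \<sigma>) = n" by (simp add: p S_def)
  have "mset (map fst S) = mset (map fst (zip \<sigma> [0..<n]))" unfolding mset_map S(2) ..
  also have "map fst (zip \<sigma> [0..<n]) = \<sigma>" by (simp add: ln)
  also have "mset \<sigma> = mset [0..<n]" 
    using set_eq_iff_mset_eq_distinct[OF d(1) distinct_upt[of 0 n]] d(2) by (simp add: atLeast0LessThan)
  finally have "sort [0..<n] = map fst S" by (rule properties_for_sort[OF _ S(1)])
  then have fS: "map fst S = [0..<n]" by (simp add: sorted_sort_id)
  show "positions \<sigma> ! (\<sigma> ! k) = k" if k: "k < n" for k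
  proof -
    have "\<sigma> ! k \<in> set \<sigma>" using k ln by simp
    then have x: "\<sigma> ! k < n" using d(2) by simp
    then have "S ! (\<sigma> ! k) \<in> set S" using lS by simp
    then have "S ! (\<sigma> ! k) \<in> set (zip \<sigma> [0..<n])" using mset_eq_setD[OF S(2)] by simp
    then obtain k' where k': "k' < n" "S ! (\<sigma> ! k) = (\<sigma> ! k', k')" by (auto simp: set_zip ln)
    have "fst (S ! (\<sigma> ! k)) = \<sigma> ! k" using arg_cong[OF fS, of "\<lambda>l. l ! (\<sigma> ! k)"] x lS by simp
    then have "k' = k" using k' k d(1) ln by (simp add: nth_eq_iff_index_eq)
    then show ?thesis using k'(2) x lS by (simp add: p S_def[symmetric])
  qed
qed

lemma output_cells_nth:
  assumes "length ps = n" "2 \<le> n"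
  shows "\<And>a. 2 \<le> a \<Longrightarrow> a < n \<Longrightarrow> output_cells n ps ! (n + 7 - a) = ps ! a"
    "output_cells n ps ! (n + 6) = ps ! 0" "output_cells n ps ! (n + 7) = ps ! 1"
proof -
  obtain v w t where ps: "ps = v # w # t" using assms by (metis Suc_le_length_iff numeral_2_eq_2)
  define vs where "vs = t @ replicate 8 (0 :: nat)"
  have l: "length vs = n + 6" using assms by (simp add: vs_def ps)
  have "take (n + 8) (ps @ map (\<lambda>_. 0) [0..<n + 8]) = v # w # vs"
    using assms(1) by (auto simp: ps vs_def map_replicate_const take_Cons')
  then have o: "output_cells n ps = rev vs @ [v, w]" by (simp add: output_cells_def rev_append)
  show "output_cells n ps ! (n + 6) = ps ! 0" "output_cells n ps ! (n + 7) = ps ! 1"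
    unfolding o using l by (simp_all add: nth_append ps)
  show "output_cells n ps ! (n + 7 - a) = ps ! a" if a: "2 \<le> a" "a < n" for a
  proof -
    have "output_cells n ps ! (n + 7 - a) = vs ! (a - 2)"
    proof -
      have lt: "n + 7 - a < length vs" unfolding l using a by linarith
      have "output_cells n ps ! (n + 7 - a) = rev vs ! (n + 7 - a)" unfolding o using lt by (simp add: nth_append)
      also have "\<dots> = vs ! (length vs - Suc (n + 7 - a))" by (rule rev_nth[OF lt])
      also have "length vs - Suc (n + 7 - a) = a - 2" using a l by simp
      finally show ?thesis .
    qed
    also have "\<dots> = ps ! a" using a assms(1) by (auto simp: ps vs_def nth_append nth_Cons' numeral_2_eq_2)
    finally show ?thesis .
  qed
qed

section \<open>Powers of the fuel bounded by exponentials of the cut excesses\<close>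

section \<open>Bounding the fuel by the cut excesses\<close>

lemma ln_le_linear:
  fixes x \<eta> :: real
  assumes "0 < x" "0 < \<eta>"
  shows "ln x \<le> \<eta> * x + 1 / \<eta>"
proof -
  have "ln x = ln (\<eta> * x) + ln (1 / \<eta>)" using assms by (simp add: ln_mult ln_div)
  also have "\<dots> \<le> (\<eta> * x - 1) + (1 / \<eta> - 1)" using assms by (intro add_mono ln_le_minus_one) auto
  finally show ?thesis by simp
qed

text \<open>With u = x^(1/3) one has (ln x)^2 <= 36 u. Then 72 u / \<eta> is at most \<eta> u^3 if u
  > 9 / \<eta>, and otherwise at most 72 * 9 / \<eta>^2 = 648 / \<eta>^2.\<close>

lemma ln_square_le:
  fixes x \<eta> :: real
  assumes "1 \<le> x" "0 < \<eta>"
  shows "2 / \<eta> * (ln x)\<^sup>2 \<le> \<eta> * x + 648 / \<eta>\<^sup>2"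
proof -
  define u where "u = exp (ln x / 3)"
  have "u ^ 3 = exp (3 * (ln x / 3))" unfolding u_def by (simp only: exp_of_nat_mult[of 3, simplified])
  then have u3: "u ^ 3 = x" using assms by simp
  have u: "1 \<le> u" unfolding u_def using assms by simp
  have e: "exp (ln x / 6) * exp (ln x / 6) = u" unfolding u_def by (simp add: exp_add[symmetric])
  have "ln x / 6 \<le> exp (ln x / 6)" using exp_ge_add_one_self[of "ln x / 6"] by linarith
  then have "(ln x / 6)\<^sup>2 \<le> (exp (ln x / 6))\<^sup>2" using assms by (intro power_mono) auto
  then have l: "(ln x)\<^sup>2 \<le> 36 * u" using e by (simp add: power2_eq_square)
  have "72 / \<eta> * u \<le> \<eta> * u ^ 3 + 648 / \<eta>\<^sup>2"
  proof (cases "u \<le> 9 / \<eta>")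
    case True
    then have "72 / \<eta> * u \<le> 72 / \<eta> * (9 / \<eta>)" using assms by (intro mult_left_mono) auto
    also have "\<dots> = 648 / \<eta>\<^sup>2" by (simp add: power2_eq_square)
    finally show ?thesis using u assms by (simp add: add_increasing)
  next
    case False
    then have "9 \<le> \<eta> * u" using assms by (simp add: field_simps)
    then have "81 \<le> (\<eta> * u) * (\<eta> * u)" using mult_mono[of 9 "\<eta> * u" 9 "\<eta> * u"] by simp
    then have "u / \<eta> * 81 \<le> u / \<eta> * ((\<eta> * u) * (\<eta> * u))" using u assms by (intro mult_left_mono) auto
    also have "\<dots> = \<eta> * u ^ 3" using assms by (simp add: power3_eq_cube)
    finally have "81 / \<eta> * u \<le> \<eta> * u ^ 3" by (simp add: mult.commute)
    moreover have "72 / \<eta> * u \<le> 81 / \<eta> * u" using assms u by (intro mult_right_mono divide_right_mono) auto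
    moreover have "0 \<le> 648 / \<eta>\<^sup>2" by simp
    ultimately show ?thesis by linarith
  qed
  moreover have "2 / \<eta> * (ln x)\<^sup>2 \<le> 2 / \<eta> * (36 * u)" using l assms by (intro mult_left_mono) auto
  ultimately show ?thesis by (simp add: u3)
qed

text \<open>The logarithm of the number of states is of the form sqrt E * ln x, with E the excess
  rate and x a window length. The arithmetic-geometric mean inequality splits it into a part linear
  in E and (ln x)^2 / \<eta>, which is linear in x up to O(1 / \<eta>^2). As \<eta> will be of order
  min 1 \<beta>, this is where 1 / \<beta>^2 in the running time comes from.\<close>

lemma sqrt_ln_le:
  fixes x \<eta> E h :: real
  assumes "1 \<le> x" "0 < \<eta>" "0 \<le> E" "0 \<le> h" "h \<le> sqrt E"
  shows "2 * h * ln x \<le> \<eta> / 2 * E + \<eta> * x + 648 / \<eta>\<^sup>2"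
proof -
  have "2 * h * ln x \<le> 2 * sqrt E * ln x" using assms by (intro mult_right_mono mult_left_mono) auto
  also have "\<dots> \<le> \<eta> / 2 * E + 2 / \<eta> * (ln x)\<^sup>2"
  proof -
    have "0 \<le> (\<eta> * sqrt E - 2 * ln x)\<^sup>2 / (2 * \<eta>)" using assms by simp
    also have "\<dots> = \<eta> / 2 * E + 2 / \<eta> * (ln x)\<^sup>2 - 2 * sqrt E * ln x"
      using assms by (simp add: power2_diff power_mult_distrib field_simps) (simp add: power2_eq_square)
    finally show ?thesis by simp
  qed
  also have "\<dots> \<le> \<eta> / 2 * E + (\<eta> * x + 648 / \<eta>\<^sup>2)" using ln_square_le[OF assms(1,2)] by simp
  finally show ?thesis by simp
qed

context election
begin

abbreviation "excess_rate p \<equiv> real (X p) / real r"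

lemma level_fuel_le_exp:
  assumes "0 < \<eta>" "\<eta> \<le> 1" "Suc p \<le> n"
  shows "real (level_fuel p) \<le> exp (\<eta> * (excess_rate p + (up p - p) + (p - lo p) +
    (up (Suc p) - Suc p) + (Suc p - lo (Suc p))) + 1311 / \<eta>\<^sup>2)"
proof -
  define a b c d h where "a = 1 + real (p - lo p)" and "b = 1 + real (up p - p)"
    and "c = 1 + real (Suc p - lo (Suc p))" and "d = 1 + real (up (Suc p) - Suc p)"
    and "h = half_width p"
  have ge: "1 \<le> a" "1 \<le> b" "1 \<le> c" "1 \<le> d" by (simp_all add: a_def b_def c_def d_def)
  have E: "0 \<le> excess_rate p" by simp
  have h: "0 \<le> real h" "real h \<le> sqrt (excess_rate p)" unfolding h_def half_width_def by (simp_all add: of_nat_nat)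
  have d': "real (up (Suc p) - p) = d" using up[OF assms(3)] by (simp add: d_def)
  have c': "real (Suc p - lo (Suc p)) \<le> c" by (simp add: c_def)
  have sb: "real ((state_bound p)\<^sup>2) = (a ^ h)\<^sup>2 * (b ^ h)\<^sup>2"
    unfolding state_bound_def a_def b_def h_def by (simp add: power_mult_distrib)
  have "real (level_fuel p) = real (Suc p - lo (Suc p)) + ((a ^ h)\<^sup>2 * (b ^ h)\<^sup>2) * d ^ 3"
    unfolding level_fuel_def of_nat_add of_nat_mult of_nat_power[of "up (Suc p) - p"] d' sb[symmetric] by simp
  also have "\<dots> \<le> c + ((a ^ h)\<^sup>2 * (b ^ h)\<^sup>2) * d ^ 3" using c' by simp
  also have "\<dots> \<le> 2 * (c * (((a ^ h)\<^sup>2 * (b ^ h)\<^sup>2) * d ^ 3))"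
  proof -
    have "1 \<le> ((a ^ h)\<^sup>2 * (b ^ h)\<^sup>2) * d ^ 3" (is "1 \<le> ?m")
      using ge by (intro mult_ge1_I one_le_power) auto
    then have "c * 1 \<le> c * ?m" "1 * ?m \<le> c * ?m" using ge(3) by (intro mult_left_mono mult_right_mono; simp)+
    then show ?thesis by simp
  qed
  also have "\<dots> = exp (ln 2 + ln c + (2 * real h * ln a + 2 * real h * ln b) + 3 * ln d)"
  proof -
    have 1: "exp (2 * real h * ln x) = (x ^ h)\<^sup>2" if "1 \<le> x" for x :: real
    proof -
      have "(x ^ h)\<^sup>2 = exp (ln ((x ^ h)\<^sup>2))" using that by simp
      also have "ln ((x ^ h)\<^sup>2) = 2 * real h * ln x" using that by (simp add: ln_realpow)
      finally show ?thesis by simp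
    qed
    have 2: "exp (3 * ln d) = d ^ 3"
    proof -
      have "d ^ 3 = exp (ln (d ^ 3))" using ge by simp
      also have "ln (d ^ 3) = 3 * ln d" using ge by (simp add: ln_realpow)
      finally show ?thesis by simp
    qed
    have "exp (ln c) = c" using ge by simp
    then show ?thesis using ge unfolding exp_add 1[OF ge(1)] 1[OF ge(2)] 2 by simp
  qed
  also have "\<dots> \<le> exp (\<eta> * (excess_rate p + (up p - p) + (p - lo p) +
    (up (Suc p) - Suc p) + (Suc p - lo (Suc p))) + 1311 / \<eta>\<^sup>2)"
  proof -
    have 1: "ln 2 \<le> (1 :: real)" using ln_le_minus_one[of "2 :: real"] by simp
    have 2: "ln c \<le> \<eta> * c + 1 / \<eta>" by (rule ln_le_linear) (use ge assms in auto)
    have 3: "3 * ln d \<le> \<eta> * d + 9 / \<eta>" using ln_le_linear[of d "\<eta> / 3"] ge assms by simp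
    have 4: "2 * real h * ln a \<le> \<eta> / 2 * excess_rate p + \<eta> * a + 648 / \<eta>\<^sup>2"
      by (rule sqrt_ln_le) (use ge assms h in auto)
    have 5: "2 * real h * ln b \<le> \<eta> / 2 * excess_rate p + \<eta> * b + 648 / \<eta>\<^sup>2"
      by (rule sqrt_ln_le) (use ge assms h in auto)
    have "1 \<le> 1 / \<eta>" using assms by simp
    then have "1 / \<eta> * 1 \<le> 1 / \<eta> * (1 / \<eta>)" using assms by (intro mult_left_mono) auto
    then have "1 / \<eta> \<le> 1 / \<eta>\<^sup>2" by (simp add: power2_eq_square)
    \<comment> \<open>As \<eta> <= 1, each term is at most its coefficient times
      \<open>1 / \<eta>\<^sup>2\<close>, and 1 + 4 + 10 + 1296 = 1311. The 1296 is twice the 648 of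
      \<open>sqrt_ln_le\<close>, once for each side of the window.\<close>
    then have 6: "1 + 4 * \<eta> + 10 * (1 / \<eta>) + 1296 * (1 / \<eta>\<^sup>2) \<le> 1311 * (1 / \<eta>\<^sup>2)" using assms \<open>1 \<le> 1 / \<eta>\<close> by linarith
    have 7: "\<eta> * (excess_rate p + (up p - p) + (p - lo p) + (up (Suc p) - Suc p) + (Suc p - lo (Suc p))) =
        (\<eta> / 2 * excess_rate p + \<eta> * a) + (\<eta> / 2 * excess_rate p + \<eta> * b) + \<eta> * c + \<eta> * d - 4 * \<eta>"
      unfolding a_def b_def c_def d_def by (simp add: algebra_simps add_divide_distrib)
    have "ln 2 + ln c + (2 * real h * ln a + 2 * real h * ln b) + 3 * ln d \<le>
       1 + (\<eta> * c + 1 / \<eta>) + ((\<eta> / 2 * excess_rate p + \<eta> * a + 648 / \<eta>\<^sup>2) + (\<eta> / 2 * excess_rate p + \<eta> * b + 648 / \<eta>\<^sup>2)) + (\<eta> * d + 9 / \<eta>)"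
      by (intro add_mono 1 2 3 4 5)
    also have "\<dots> = (\<eta> / 2 * excess_rate p + \<eta> * a) + (\<eta> / 2 * excess_rate p + \<eta> * b) + \<eta> * c + \<eta> * d - 4 * \<eta>
        + (1 + 4 * \<eta> + 10 * (1 / \<eta>) + 1296 * (1 / \<eta>\<^sup>2))" by simp
    also have "\<dots> \<le> \<eta> * (excess_rate p + (up p - p) + (p - lo p) + (up (Suc p) - Suc p) + (Suc p - lo (Suc p))) + 1311 * (1 / \<eta>\<^sup>2)"
      unfolding 7 using 6 by simp
    finally show ?thesis by simp
  qed
  finally show ?thesis .
qed

text \<open>A window side of width y + 1 exhibits an excess rate above y at distance y. Of the
  weight 2 \<theta> one half pays for the damping over that distance and the other half for the
  width, so the sum dominates the width without naming its far end. Summed over \<open>p\<close>,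
  each cut counts only O(1 + 1 / \<theta>) times.\<close>

definition damped_sum :: "real \<Rightarrow> nat \<Rightarrow> real" where
  "damped_sum \<theta> p = (\<Sum>q\<le>n. exp (- \<theta> * \<bar>real p - real q\<bar>) * exp (2 * \<theta> * excess_rate q))"

lemma damped_sum_ge: "q \<le> n \<Longrightarrow> exp (- \<theta> * \<bar>real p - real q\<bar>) * exp (2 * \<theta> * excess_rate q) \<le> damped_sum \<theta> p"
  unfolding damped_sum_def by (rule member_le_sum) auto

lemma exp_excess_le: "0 \<le> \<theta> \<Longrightarrow> p \<le> n \<Longrightarrow> exp (\<theta> * excess_rate p) \<le> damped_sum \<theta> p"
proof -
  assume "0 \<le> \<theta>" "p \<le> n"
  then have "exp (\<theta> * excess_rate p) \<le> exp (2 * \<theta> * excess_rate p)"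
    using mult_right_mono[of \<theta> "2 * \<theta>" "excess_rate p"] by simp
  also have "\<dots> \<le> damped_sum \<theta> p" using damped_sum_ge[OF \<open>p \<le> n\<close>, of \<theta> p] by simp
  finally show ?thesis .
qed

lemma damped_sum_ge1: "0 \<le> \<theta> \<Longrightarrow> p \<le> n \<Longrightarrow> 1 \<le> damped_sum \<theta> p"
  using exp_excess_le[of \<theta> p] one_le_exp_iff[of "\<theta> * excess_rate p"]
  by (meson divide_nonneg_nonneg mult_nonneg_nonneg of_nat_0_le_iff order_trans)

text \<open>Each rank passed on the way to the end of a window has an excess exceeding its distance.\<close>

lemma exp_window_le:
  assumes "0 \<le> \<theta>" "q \<le> n" "real y < excess_rate q" "\<bar>real p - real q\<bar> = real y"
  shows "exp (\<theta> * real (Suc y)) \<le> exp \<theta> * damped_sum \<theta> p"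
proof -
  have "\<theta> * real (Suc y) \<le> \<theta> + (- \<theta> * real y + 2 * \<theta> * excess_rate q)"
    using mult_left_mono[OF less_imp_le[OF assms(3)], of "2 * \<theta>"] assms(1) by (simp add: algebra_simps)
  then have "exp (\<theta> * real (Suc y)) \<le> exp (\<theta> + (- \<theta> * real y + 2 * \<theta> * excess_rate q))" by simp
  also have "\<dots> = exp \<theta> * (exp (- \<theta> * \<bar>real p - real q\<bar>) * exp (2 * \<theta> * excess_rate q))"
    unfolding exp_add assms(4) ..
  also have "\<dots> \<le> exp \<theta> * damped_sum \<theta> p" by (intro mult_left_mono damped_sum_ge assms(2)) auto
  finally show ?thesis .
qed

lemma exp_up_le:
  assumes "0 \<le> \<theta>" "p \<le> n"
  shows "exp (\<theta> * real (up p - p)) \<le> exp \<theta> * damped_sum \<theta> p"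
proof (cases "up p - p")
  case 0
  have "1 * 1 \<le> exp \<theta> * damped_sum \<theta> p" using assms by (intro mult_mono damped_sum_ge1) auto
  then show ?thesis by (simp add: 0)
next
  case (Suc y)
  have "r * (p + y) < X (p + y) + r * p" by (rule below_up) (use Suc in auto)
  then have "r * y < X (p + y)" by (simp add: distrib_left)
  then have "real r * real y < real (X (p + y))" by (metis of_nat_less_iff of_nat_mult)
  then have "real y < excess_rate (p + y)" using r_pos by (simp add: pos_less_divide_eq mult.commute)
  then show ?thesis unfolding Suc using exp_window_le[of \<theta> "p + y" y p] assms up_le[OF assms(2)] Suc by simp
qed

lemma exp_lo_le:
  assumes "0 \<le> \<theta>" "p \<le> n"
  shows "exp (\<theta> * real (p - lo p)) \<le> exp \<theta> * damped_sum \<theta> p"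
proof (cases "p - lo p")
  case 0
  have "1 * 1 \<le> exp \<theta> * damped_sum \<theta> p" using assms by (intro mult_mono damped_sum_ge1) auto
  then show ?thesis by (simp add: 0)
next
  case (Suc y)
  have y: "y \<le> p" using Suc by simp
  have "r * p < X (p - y) + r * (p - y)" by (rule above_lo) (use Suc in auto)
  moreover have "r * p = r * (p - y) + r * y" using y by (simp add: distrib_left[symmetric])
  ultimately have "r * y < X (p - y)" by simp
  then have "real r * real y < real (X (p - y))" by (metis of_nat_less_iff of_nat_mult)
  then have "real y < excess_rate (p - y)" using r_pos by (simp add: pos_less_divide_eq mult.commute)
  then show ?thesis unfolding Suc using exp_window_le[of \<theta> "p - y" y p] assms y by (simp add: of_nat_diff)
qed

text \<open>The exponent is a sum of five quantities. Its exponential is at most the sum of their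
  exponentials at five times the rate, whence \<theta> = 5 s \<eta>.\<close>

lemma level_fuel_power_le:
  assumes "0 < \<eta>" "\<eta> \<le> 1" "Suc p \<le> n"
  shows "real (level_fuel p) ^ s \<le> exp (s * (1311 / \<eta>\<^sup>2 + 5 * \<eta>)) *
    (3 * damped_sum (5 * s * \<eta>) p + 2 * damped_sum (5 * s * \<eta>) (Suc p))"
proof -
  define \<theta> where "\<theta> = 5 * s * \<eta>"
  have \<theta>: "0 \<le> \<theta>" using assms by (simp add: \<theta>_def)
  have p: "p \<le> n" using assms by simp
  have avg: "exp (\<theta> / 5 * (x1 + x2 + x3 + x4 + x5)) \<le> exp (\<theta> * x1) + exp (\<theta> * x2) + exp (\<theta> * x3) + exp (\<theta> * x4) + exp (\<theta> * x5)"
    for x1 x2 x3 x4 x5 :: real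
  proof -
    define m where "m = Max {x1, x2, x3, x4, x5}"
    have ge: "x1 \<le> m" "x2 \<le> m" "x3 \<le> m" "x4 \<le> m" "x5 \<le> m" by (simp_all add: m_def)
    have "m \<in> {x1, x2, x3, x4, x5}" unfolding m_def by (rule Max_in) auto
    then have m: "exp (\<theta> * m) \<le> exp (\<theta> * x1) + exp (\<theta> * x2) + exp (\<theta> * x3) + exp (\<theta> * x4) + exp (\<theta> * x5)"
      by (auto simp: add_nonneg_nonneg add_increasing add_increasing2)
    have "\<theta> / 5 * (x1 + x2 + x3 + x4 + x5) \<le> \<theta> / 5 * (5 * m)" using ge \<theta> by (intro mult_left_mono) auto
    then have "exp (\<theta> / 5 * (x1 + x2 + x3 + x4 + x5)) \<le> exp (\<theta> * m)" by simp
    with m show ?thesis by linarith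
  qed
  let ?T = "excess_rate p + (up p - p) + (p - lo p) + (up (Suc p) - Suc p) + (Suc p - lo (Suc p))"
  have "real (level_fuel p) ^ s \<le> exp (\<eta> * ?T + 1311 / \<eta>\<^sup>2) ^ s"
    by (intro power_mono level_fuel_le_exp assms) auto
  also have "\<dots> = exp (s * (\<eta> * ?T + 1311 / \<eta>\<^sup>2))" by (rule exp_of_nat_mult[symmetric])
  also have "\<dots> = exp (s * (1311 / \<eta>\<^sup>2)) * exp (\<theta> / 5 * ?T)"
    unfolding \<theta>_def exp_add[symmetric] by (simp add: algebra_simps)
  also have "\<dots> \<le> exp (s * (1311 / \<eta>\<^sup>2)) * (exp \<theta> * damped_sum \<theta> p + exp \<theta> * damped_sum \<theta> p + exp \<theta> * damped_sum \<theta> p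
     + exp \<theta> * damped_sum \<theta> (Suc p) + exp \<theta> * damped_sum \<theta> (Suc p))"
  proof (rule mult_left_mono)
    have "exp (\<theta> * excess_rate p) \<le> 1 * damped_sum \<theta> p" using exp_excess_le[OF \<theta> p] by simp
    also have "\<dots> \<le> exp \<theta> * damped_sum \<theta> p"
      using \<theta> damped_sum_ge1[OF \<theta> p] by (intro mult_right_mono) auto
    finally show "exp (\<theta> / 5 * ?T) \<le> exp \<theta> * damped_sum \<theta> p + exp \<theta> * damped_sum \<theta> p + exp \<theta> * damped_sum \<theta> p
     + exp \<theta> * damped_sum \<theta> (Suc p) + exp \<theta> * damped_sum \<theta> (Suc p)"
      by (intro order_trans[OF avg] add_mono exp_up_le exp_lo_le \<theta> p assms(3))
  qed simp
  also have "\<dots> = (exp (s * (1311 / \<eta>\<^sup>2)) * exp \<theta>) * (3 * damped_sum \<theta> p + 2 * damped_sum \<theta> (Suc p))"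
    by (simp add: algebra_simps)
  also have "exp (s * (1311 / \<eta>\<^sup>2)) * exp \<theta> = exp (s * (1311 / \<eta>\<^sup>2 + 5 * \<eta>))"
    unfolding \<theta>_def exp_add[symmetric] by (simp add: algebra_simps)
  finally show ?thesis by (simp add: \<theta>_def)
qed

end

lemma sum_geometric_two_sided:
  fixes \<theta> :: real
  assumes "0 < \<theta>"
  shows "(\<Sum>p\<le>m. exp (- \<theta> * \<bar>real p - real q\<bar>)) \<le> 2 * (1 + 1 / \<theta>)"
proof -
  define \<rho> where "\<rho> = exp (- \<theta>)"
  have \<rho>: "0 \<le> \<rho>" "\<rho> < 1" using assms by (simp_all add: \<rho>_def)
  have geo: "(\<Sum>d\<in>D. \<rho> ^ d) \<le> 1 + 1 / \<theta>" if "finite D" for D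
  proof -
    have "(\<Sum>d\<in>D. \<rho> ^ d) \<le> (\<Sum>d. \<rho> ^ d)"
      using \<rho> that by (intro sum_le_suminf summable_geometric) auto
    also have "\<dots> = 1 / (1 - \<rho>)" using \<rho> by (intro suminf_geometric) auto
    also have "\<dots> \<le> 1 + 1 / \<theta>"
    proof -
      have "(1 + \<theta>) * \<rho> \<le> exp \<theta> * \<rho>" using \<rho> exp_ge_add_one_self[of \<theta>] by (intro mult_right_mono) auto
      also have "\<dots> = 1" unfolding \<rho>_def by (simp add: exp_minus)
      finally have "(1 + \<theta>) * (1 - \<rho>) \<ge> \<theta>" by (simp add: algebra_simps)
      then show ?thesis using \<rho> assms by (simp add: field_simps)
    qed
    finally show ?thesis .
  qed
  have e: "exp (- \<theta> * real d) = \<rho> ^ d" for d :: nat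
    unfolding \<rho>_def by (simp add: exp_of_nat_mult[symmetric] mult.commute)
  have "(\<Sum>p\<le>m. exp (- \<theta> * \<bar>real p - real q\<bar>)) \<le> (\<Sum>p\<le>m. if p \<le> q then \<rho> ^ (q - p) else 0) + (\<Sum>p\<le>m. if q \<le> p then \<rho> ^ (p - q) else 0)"
    unfolding sum.distrib[symmetric]
  proof (rule sum_mono)
    fix p
    show "exp (- \<theta> * \<bar>real p - real q\<bar>) \<le> (if p \<le> q then \<rho> ^ (q - p) else 0) + (if q \<le> p then \<rho> ^ (p - q) else 0)"
    proof (cases "p \<le> q")
      case True
      then have a: "\<bar>real p - real q\<bar> = real (q - p)" by (simp add: of_nat_diff)
      show ?thesis unfolding a e using True \<rho> by simp
    next
      case False
      then have a: "\<bar>real p - real q\<bar> = real (p - q)" by (simp add: of_nat_diff)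
      show ?thesis unfolding a e using False \<rho> by simp
    qed
  qed
  also have "(\<Sum>p\<le>m. if p \<le> q then \<rho> ^ (q - p) else 0) = (\<Sum>d\<in>(\<lambda>p. q - p) ` ({..m} \<inter> {..q}). \<rho> ^ d)"
  proof -
    have "(\<Sum>p\<le>m. if p \<le> q then \<rho> ^ (q - p) else 0) = (\<Sum>p\<in>{..m} \<inter> {..q}. \<rho> ^ (q - p))"
      by (subst sum.inter_restrict) (auto intro: sum.cong)
    also have "\<dots> = (\<Sum>d\<in>(\<lambda>p. q - p) ` ({..m} \<inter> {..q}). \<rho> ^ d)"
      by (subst sum.reindex) (auto simp: inj_on_def)
    finally show ?thesis .
  qed
  also have "\<dots> \<le> 1 + 1 / \<theta>" by (rule geo) auto
  also have "(\<Sum>p\<le>m. if q \<le> p then \<rho> ^ (p - q) else 0) = (\<Sum>d\<in>(\<lambda>p. p - q) ` ({..m} \<inter> {q..}). \<rho> ^ d)"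
  proof -
    have "(\<Sum>p\<le>m. if q \<le> p then \<rho> ^ (p - q) else 0) = (\<Sum>p\<in>{..m} \<inter> {q..}. \<rho> ^ (p - q))"
      by (subst sum.inter_restrict) (auto intro: sum.cong)
    also have "\<dots> = (\<Sum>d\<in>(\<lambda>p. p - q) ` ({..m} \<inter> {q..}). \<rho> ^ d)"
      by (subst sum.reindex) (auto simp: inj_on_def)
    finally show ?thesis .
  qed
  also have "\<dots> \<le> 1 + 1 / \<theta>" by (rule geo) auto
  finally show ?thesis by simp
qed

text \<open>The power mean inequality for numbers of mean at least 1, by Bernoulli's inequality y^s
  >= 1 + s (y - 1).\<close>

lemma bernoulli_sum:
  fixes y :: "nat \<Rightarrow> real"
  assumes "\<And>j. j < n \<Longrightarrow> 0 \<le> y j" "real n \<le> (\<Sum>j<n. y j)" "0 < s"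
  shows "real n \<le> (\<Sum>j<n. y j ^ s)"
proof -
  have "real n \<le> real n + s * ((\<Sum>j<n. y j) - real n)" using assms by simp
  also have "\<dots> = (\<Sum>j<n. 1 + s * (y j - 1))"
    by (simp add: sum.distrib sum_subtractf sum_distrib_left[symmetric])
  also have "\<dots> \<le> (\<Sum>j<n. y j ^ s)"
  proof (rule sum_mono)
    fix j assume "j \<in> {..<n}"
    then have "- 1 \<le> y j - 1" using assms(1) by simp
    from Bernoulli_inequality[OF this, of s] show "1 + s * (y j - 1) \<le> y j ^ s" by simp
  qed
  finally show ?thesis .
qed

context election
begin

text \<open>The factor \<open>n\<close> on the left survives because the power mean inequality is
  applied to the average level; it will cancel the \<open>n + 1\<close> summands on the right once
  expectations are taken.\<close>

lemma fuel_shortage: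
  assumes "0 < \<eta>" "\<eta> \<le> 1" "0 < s" "0 < \<Lambda>" "real n * \<Lambda> \<le> real (\<Sum>j<n. level_fuel j)"
  shows "real n * \<Lambda> ^ s \<le> exp (s * (1311 / \<eta>\<^sup>2 + 5 * \<eta>)) * (10 * (1 + 1 / (5 * s * \<eta>))) *
    (\<Sum>q\<le>n. exp (10 * s * \<eta> * excess_rate q))"
proof -
  define \<theta> where "\<theta> = 5 * s * \<eta>"
  have \<theta>: "0 < \<theta>" using assms by (simp add: \<theta>_def)
  let ?c = "exp (s * (1311 / \<eta>\<^sup>2 + 5 * \<eta>))"
  have d0: "0 \<le> damped_sum \<theta> p" for p unfolding damped_sum_def by (intro sum_nonneg) auto
  have "real n \<le> (\<Sum>j<n. (real (level_fuel j) / \<Lambda>) ^ s)"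
    using assms by (intro bernoulli_sum) (auto simp: sum_divide_distrib[symmetric] pos_le_divide_eq)
  then have "real n * \<Lambda> ^ s \<le> (\<Sum>j<n. real (level_fuel j) ^ s)"
    using assms(4) by (simp add: power_divide sum_divide_distrib[symmetric] pos_le_divide_eq)
  also have "\<dots> \<le> (\<Sum>j<n. ?c * (3 * damped_sum \<theta> j + 2 * damped_sum \<theta> (Suc j)))"
    unfolding \<theta>_def using level_fuel_power_le[OF assms(1,2)] by (intro sum_mono) (auto simp: Suc_le_eq)
  also have "\<dots> = ?c * (3 * (\<Sum>j<n. damped_sum \<theta> j) + 2 * (\<Sum>j<n. damped_sum \<theta> (Suc j)))"
    by (simp add: sum_distrib_left sum.distrib distrib_left)
  also have "\<dots> \<le> ?c * (3 * (\<Sum>j\<le>n. damped_sum \<theta> j) + 2 * (\<Sum>j\<le>n. damped_sum \<theta> j))"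
  proof (intro mult_left_mono add_mono)
    show "(\<Sum>j<n. damped_sum \<theta> j) \<le> (\<Sum>j\<le>n. damped_sum \<theta> j)" by (intro sum_mono2 d0) auto
    have "(\<Sum>j<n. damped_sum \<theta> (Suc j)) = (\<Sum>j\<in>Suc ` {..<n}. damped_sum \<theta> j)"
      by (subst sum.reindex) auto
    also have "\<dots> \<le> (\<Sum>j\<le>n. damped_sum \<theta> j)" by (intro sum_mono2 d0) auto
    finally show "(\<Sum>j<n. damped_sum \<theta> (Suc j)) \<le> (\<Sum>j\<le>n. damped_sum \<theta> j)" .
  qed auto
  also have "\<dots> = ?c * 5 * (\<Sum>j\<le>n. damped_sum \<theta> j)" by simp
  also have "(\<Sum>j\<le>n. damped_sum \<theta> j) = (\<Sum>q\<le>n. (\<Sum>j\<le>n. exp (- \<theta> * \<bar>real j - real q\<bar>)) * exp (2 * \<theta> * excess_rate q))"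
    unfolding damped_sum_def by (subst sum.swap) (simp add: sum_distrib_right)
  also have "?c * 5 * \<dots> \<le> ?c * 5 * (\<Sum>q\<le>n. (2 * (1 + 1 / \<theta>)) * exp (2 * \<theta> * excess_rate q))"
    by (intro mult_left_mono sum_mono mult_right_mono sum_geometric_two_sided \<theta>) auto
  also have "\<dots> = ?c * (10 * (1 + 1 / \<theta>)) * (\<Sum>q\<le>n. exp (2 * \<theta> * excess_rate q))"
    by (simp add: sum_distrib_left[symmetric])
  finally have *: "real n * \<Lambda> ^ s \<le> ?c * (10 * (1 + 1 / \<theta>)) * (\<Sum>q\<le>n. exp (2 * \<theta> * excess_rate q))" .
  have "10 * real s * \<eta> = 2 * \<theta>" "5 * real s * \<eta> = \<theta>" by (simp_all add: \<theta>_def)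
  then show ?thesis using * by (simp only:)
qed

end

section \<open>Tail bounds over the samples\<close>

section \<open>Probabilities\<close>

text \<open>Independence of the samples, stated for the first \<open>k\<close> of them because the
  algorithm reads a prefix.\<close>

lemma nn_integral_replicate_pmf:
  fixes f :: "'a \<Rightarrow> ennreal"
  assumes "k \<le> r"
  shows "(\<integral>\<^sup>+ps. (\<Prod>p\<leftarrow>take k ps. f p) \<partial>measure_pmf (replicate_pmf r \<mu>)) = (\<integral>\<^sup>+p. f p \<partial>measure_pmf \<mu>) ^ k"
  using assms
proof (induction r arbitrary: k)
  case (Suc r)
  show ?case
  proof (cases k)
    case (Suc k')
    then have "(\<integral>\<^sup>+ps. (\<Prod>p\<leftarrow>take k ps. f p) \<partial>measure_pmf (replicate_pmf (Suc r) \<mu>)) =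
        (\<integral>\<^sup>+x. \<integral>\<^sup>+ps. f x * (\<Prod>p\<leftarrow>take k' ps. f p) \<partial>measure_pmf (replicate_pmf r \<mu>) \<partial>measure_pmf \<mu>)"
      by simp
    also have "\<dots> = (\<integral>\<^sup>+x. f x * (\<integral>\<^sup>+p. f p \<partial>measure_pmf \<mu>) ^ k' \<partial>measure_pmf \<mu>)"
      using Suc.IH[of k'] Suc.prems Suc by (simp add: nn_integral_cmult)
    also have "\<dots> = (\<integral>\<^sup>+p. f p \<partial>measure_pmf \<mu>) ^ k" using Suc by (simp add: nn_integral_multc)
    finally show ?thesis .
  qed simp
qed simp

text \<open>Markov's inequality at threshold 1.\<close>

lemma emeasure_le_nn_integral:
  assumes "\<And>x. x \<in> set_pmf p \<Longrightarrow> x \<in> A \<Longrightarrow> 1 \<le> F x"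
  shows "emeasure (measure_pmf p) A \<le> (\<integral>\<^sup>+x. F x \<partial>measure_pmf p)"
proof -
  have "emeasure (measure_pmf p) A = (\<integral>\<^sup>+x. indicator A x \<partial>measure_pmf p)" by simp
  also have "\<dots> \<le> (\<integral>\<^sup>+x. F x \<partial>measure_pmf p)"
    by (rule nn_integral_mono_AE) (use assms in \<open>auto simp: AE_measure_pmf_iff indicator_def\<close>)
  finally show ?thesis .
qed

lemma prob_le_of_emeasure:
  assumes "emeasure (measure_pmf p) A \<le> ennreal b" "0 \<le> b"
  shows "measure_pmf.prob p A \<le> b"
  using assms by (simp add: measure_pmf.emeasure_eq_measure)

lemma nn_integral_mallows:
  assumes "\<And>p. 0 \<le> f p"
  shows "(\<integral>\<^sup>+p. ennreal (f p) \<partial>measure_pmf (mallows n \<beta> c)) = ennreal (measure_pmf.expectation (mallows n \<beta> c) f)"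
  by (rule nn_integral_eq_integral)
     (auto intro: integrable_measure_pmf_finite finite_set_mallows assms)

lemma prod_list_exp: "(\<Prod>p\<leftarrow>ps. ennreal (exp (f p))) = ennreal (exp (\<Sum>p\<leftarrow>ps. f p))"
  by (induction ps) (simp_all add: exp_add ennreal_mult'')

definition majority :: "nat \<Rightarrow> (nat \<Rightarrow> nat) \<Rightarrow> (nat \<Rightarrow> nat) list \<Rightarrow> bool" where
  "majority n c qs \<longleftrightarrow> (\<forall>x<n. \<forall>y<n. c x < c y \<longrightarrow> vote_count qs y x < vote_count qs x y)"

text \<open>Chernoff's bound for each pair and a union bound over the pairs; the factor n^2 is
  affordable here because the rankings read are numerous.\<close>

lemma majority_prob:
  assumes \<beta>: "0 < \<beta>" and c: "c permutes {..<n}" and k: "k \<le> r"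
  shows "measure_pmf.prob (replicate_pmf r (mallows n \<beta> c)) {ps. \<not> majority n c (take k ps)} \<le>
    real n ^ 2 * (1 / cosh (\<beta> / 2)) ^ k"
proof (rule prob_le_of_emeasure)
  let ?\<mu> = "replicate_pmf r (mallows n \<beta> c)"
  define S where "S = {z \<in> {..<n} \<times> {..<n}. c (fst z) < c (snd z)}"
  define B where "B z = {ps. vote_count (take k ps) (fst z) (snd z) \<le> vote_count (take k ps) (snd z) (fst z)}" for z
  have fin: "finite S" by (simp add: S_def)
  have pair: "emeasure (measure_pmf ?\<mu>) (B z) \<le> ennreal ((1 / cosh (\<beta> / 2)) ^ k)" if z: "z \<in> S" for z
  proof -
    obtain x y where xy: "z = (x, y)" "x < n" "y < n" "c x < c y" using z by (auto simp: S_def)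
    let ?f = "\<lambda>p :: nat \<Rightarrow> nat. \<beta> * (of_bool (p x > p y) - 1 / 2)"
    have "emeasure (measure_pmf ?\<mu>) (B z) \<le> (\<integral>\<^sup>+ps. (\<Prod>p\<leftarrow>take k ps. ennreal (exp (?f p))) \<partial>measure_pmf ?\<mu>)"
    proof (rule emeasure_le_nn_integral)
      fix ps assume ps: "ps \<in> set_pmf ?\<mu>" "ps \<in> B z"
      have perm: "p permutes {..<n}" if "p \<in> set (take k ps)" for p
        using ps(1) set_mallows in_set_takeD[OF that] by (auto simp: set_replicate_pmf)
      have "(\<Sum>p\<leftarrow>qs. ?f p) = \<beta> / 2 * (real (vote_count qs y x) - real (vote_count qs x y))"
        if "\<And>p. p \<in> set qs \<Longrightarrow> p permutes {..<n}" for qs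
        using that
      proof (induction qs)
        case (Cons p qs)
        have "p x \<noteq> p y" using permutes_inj[OF Cons.prems[of p]] xy(4) by (auto dest: injD)
        then show ?case using Cons by (auto simp: vote_count_def algebra_simps)
      qed (simp add: vote_count_def)
      from this[of "take k ps"] have "(\<Sum>p\<leftarrow>take k ps. ?f p) = \<beta> / 2 * (real (vote_count (take k ps) y x) - real (vote_count (take k ps) x y))"
        using perm by blast
      also have "\<dots> \<ge> 0" using ps(2) \<beta> by (simp add: B_def xy)
      finally show "1 \<le> (\<Prod>p\<leftarrow>take k ps. ennreal (exp (?f p)))"
        unfolding prod_list_exp by (simp add: ennreal_1[symmetric] del: ennreal_1)
    qed
    also have "\<dots> = (\<integral>\<^sup>+p. ennreal (exp (?f p)) \<partial>measure_pmf (mallows n \<beta> c)) ^ k"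
      by (rule nn_integral_replicate_pmf[OF k])
    also have "\<dots> \<le> ennreal (1 / cosh (\<beta> / 2)) ^ k"
      unfolding nn_integral_mallows[OF exp_ge_zero]
      by (intro power_mono ennreal_leI mallows_pair_moment \<beta> c xy) auto
    also have "\<dots> = ennreal ((1 / cosh (\<beta> / 2)) ^ k)" by (rule ennreal_power) (simp add: cosh_real_nonneg)
    finally show ?thesis .
  qed
  have "{ps. \<not> majority n c (take k ps)} \<subseteq> (\<Union>z\<in>S. B z)"
    by (auto simp: majority_def S_def B_def not_less intro!: bexI[of _ "(_, _)"])
  then have "emeasure (measure_pmf ?\<mu>) {ps. \<not> majority n c (take k ps)} \<le> emeasure (measure_pmf ?\<mu>) (\<Union>z\<in>S. B z)"
    by (intro emeasure_mono) auto
  also have "\<dots> \<le> (\<Sum>z\<in>S. emeasure (measure_pmf ?\<mu>) (B z))"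
    by (rule emeasure_subadditive_finite[OF fin]) auto
  also have "\<dots> \<le> (\<Sum>z\<in>S. ennreal ((1 / cosh (\<beta> / 2)) ^ k))" by (intro sum_mono pair)
  also have "\<dots> = of_nat (card S) * ennreal ((1 / cosh (\<beta> / 2)) ^ k)" by simp
  also have "\<dots> = ennreal (real (card S) * (1 / cosh (\<beta> / 2)) ^ k)"
    by (simp add: ennreal_mult'' ennreal_of_nat_eq_real_of_nat cosh_real_nonneg)
  also have "\<dots> \<le> ennreal (real n ^ 2 * (1 / cosh (\<beta> / 2)) ^ k)"
  proof (intro ennreal_leI mult_right_mono)
    have "card S \<le> card ({..<n} \<times> {..<n})" by (rule card_mono) (auto simp: S_def)
    then have "real (card S) \<le> real (n * n)" by (simp only: card_cartesian_product card_lessThan of_nat_le_iff)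
    then show "real (card S) \<le> real n ^ 2" by (simp add: power2_eq_square)
  qed (simp add: cosh_real_nonneg)
  finally show "emeasure (measure_pmf ?\<mu>) {ps. \<not> majority n c (take k ps)} \<le> ennreal (real n ^ 2 * (1 / cosh (\<beta> / 2)) ^ k)" .
qed (simp add: cosh_real_nonneg)

text \<open>The center takes the cheaper side of every pair at once, and any other order pays
  strictly more on a pair that it reverses.\<close>

lemma majority_unique:
  assumes c: "c permutes {..<n}" and m: "m permutes {..<n}" and maj: "majority n c qs" and ne: "m \<noteq> c"
  shows "(\<Sum>p\<leftarrow>qs. kemeny_dist n p c) < (\<Sum>p\<leftarrow>qs. kemeny_dist n p m)"
proof -
  define g where "g h i j = of_bool (h i < (h j :: nat)) * vote_count qs j i + of_bool (h j < h i) * vote_count qs i j" for h :: "nat \<Rightarrow> nat" and i j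
  have twice: "2 * (\<Sum>p\<leftarrow>qs. kemeny_dist n p h) = (\<Sum>z\<in>{..<n} \<times> {..<n}. g h (fst z) (snd z))" for h
  proof -
    have "2 * (\<Sum>p\<leftarrow>qs. kemeny_dist n p h) = (\<Sum>i<n. \<Sum>j<n. of_bool (h i < h j) * vote_count qs j i) +
        (\<Sum>i<n. \<Sum>j<n. of_bool (h j < h i) * vote_count qs i j)"
    proof -
      have "(\<Sum>i<n. \<Sum>j<n. of_bool (h i < h j) * vote_count qs j i) = (\<Sum>i<n. \<Sum>j<n. of_bool (h j < h i) * vote_count qs i j)"
        by (rule sum.swap)
      then show ?thesis unfolding kemeny_total by linarith
    qed
    also have "\<dots> = (\<Sum>i<n. \<Sum>j<n. g h i j)" by (simp only: g_def sum.distrib)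
    finally show ?thesis by (simp add: sum.cartesian_product case_prod_unfold)
  qed
  have ord: "vote_count qs y x < vote_count qs x y" if "x < n" "y < n" "c x < c y" for x y
    using maj that by (simp add: majority_def)
  have neq: "h x \<noteq> h y" if "h permutes {..<n}" "x \<noteq> y" for h :: "nat \<Rightarrow> nat" and x y
    using permutes_inj[OF that(1)] that(2) by (auto dest: injD)
  have le: "g c x y \<le> g m x y" if xy: "x < n" "y < n" for x y
  proof (cases "x = y")
    case False
    have m': "m x < m y \<or> m y < m x" using neq[OF m False] by linarith
    consider "c x < c y" | "c y < c x" using neq[OF c False] by linarith
    then show ?thesis
    proof cases
      case 1
      with m' ord[OF xy 1] show ?thesis by (elim disjE) (simp_all add: g_def)
    next
      case 2
      with m' ord[OF xy(2,1) 2] show ?thesis by (elim disjE) (simp_all add: g_def)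
    qed
  qed (simp add: g_def)
  have "\<exists>x<n. \<exists>y<n. c x < c y \<and> \<not> m x < m y"
  proof (rule ccontr)
    assume "\<not> ?thesis"
    then have mono: "m x < m y" if "x < n" "y < n" "c x < c y" for x y using that by blast
    have "m x = c x" if x: "x < n" for x
    proof -
      have "of_bool (m y < m x) = (of_bool (c y < c x) :: nat)" if "y < n" for y
      proof -
        consider "x = y" | "c x < c y" | "c y < c x" using neq[OF c, of x y] by linarith
        then show ?thesis
        proof cases
          case 2
          with mono[OF x that 2] show ?thesis by simp
        next
          case 3
          with mono[OF that x 3] show ?thesis by simp
        qed simp
      qed
      then have "(\<Sum>y<n. of_bool (m y < m x)) = (\<Sum>y<n. of_bool (c y < c x) :: nat)" by (intro sum.cong) auto
      then show ?thesis by (simp only: permutes_rank[OF m x] permutes_rank[OF c x])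
    qed
    moreover have "m x = c x" if "\<not> x < n" for x using permutes_not_in[OF m] permutes_not_in[OF c] that by simp
    ultimately show False using ne by blast
  qed
  then obtain x y where xy: "x < n" "y < n" "c x < c y" "\<not> m x < m y" by blast
  then have "m y < m x" using neq[OF m, of x y] by (cases "x = y") auto
  then have "g c x y < g m x y" using xy ord[of x y] by (simp add: g_def)
  then have "(\<Sum>z\<in>{..<n} \<times> {..<n}. g c (fst z) (snd z)) < (\<Sum>z\<in>{..<n} \<times> {..<n}. g m (fst z) (snd z))"
    using le xy by (intro sum_strict_mono_ex1) (auto intro!: bexI[of _ "(x, y)"])
  then show ?thesis unfolding twice[symmetric] by simp
qed

text \<open>The Chernoff rate ln (cosh (\<beta> / 2)) is of order \<beta>^2 for small \<beta> and of
  order \<beta> for large \<beta>. Since b = 1 or g = 1, the one expression b / (32 g^2) is a lower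
  bound in both regimes. Its 32 reappears in \<open>used_samples\<close>.\<close>

lemma cosh_lower:
  assumes "0 < g" "0 < b" "g = 1 \<or> b = 1" "real b / real g \<le> \<beta>"
  shows "exp (real b / (32 * (real g)\<^sup>2)) \<le> cosh (\<beta> / 2)"
proof -
  define x where "x = \<beta> / 2"
  have gb: "1 \<le> real g" "1 \<le> real b" using assms by auto
  have pos: "0 < real b / real g" using gb by (intro divide_pos_pos) auto
  have x0: "0 < x" using assms(4) pos by (simp add: x_def)
  have quad: "1 + x\<^sup>2 / 4 \<le> cosh x"
  proof -
    have "1 + x + x\<^sup>2 / 2 \<le> exp x" using x0 by (intro exp_lower_Taylor_quadratic) auto
    moreover have "1 - x \<le> exp (- x)" using exp_ge_add_one_self[of "- x"] by simp
    ultimately show ?thesis by (simp add: cosh_field_def field_simps)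
  qed
  have small: "exp y \<le> 1 + y + y\<^sup>2" if "0 \<le> y" "y \<le> 1" for y :: real using exp_bound[OF that] .
  show ?thesis unfolding x_def[symmetric]
  proof (cases "g = 1")
    case True
    then have xb: "real b \<le> 2 * x" using assms(4) by (simp add: x_def)
    have "exp (real b / (32 * (real g)\<^sup>2)) \<le> exp (x / 16)" using xb True by simp
    also have "\<dots> \<le> cosh x"
    proof (cases "x \<le> 16")
      case x16: True
      have "1 * x \<le> 2 * x * x" using xb gb x0 by (intro mult_right_mono) auto
      then have "x \<le> 2 * (x * x)" by simp
      moreover have "exp (x / 16) \<le> 1 + x / 16 + x * x / 256"
        using small[of "x / 16"] x0 x16 by (simp add: power2_eq_square)
      moreover have "0 \<le> x * x" by simp
      ultimately have "exp (x / 16) \<le> 1 + x * x / 4" by linarith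
      then have "exp (x / 16) \<le> 1 + x\<^sup>2 / 4" by (simp add: power2_eq_square)
      then show ?thesis using quad by linarith
    next
      case False
      have "2 \<le> exp (x * (15 / 16))" using False exp_ge_add_one_self[of "x * (15 / 16)"] by linarith
      then have "exp (x / 16) * 2 \<le> exp (x / 16) * exp (x * (15 / 16))" by (intro mult_left_mono) auto
      also have "\<dots> = exp x" by (simp add: exp_add[symmetric])
      finally have "exp (x / 16) * 2 \<le> exp x" .
      moreover have "0 \<le> exp (- x)" by simp
      ultimately have "exp (x / 16) * 2 \<le> exp x + exp (- x)" by linarith
      then show ?thesis unfolding cosh_field_def by simp
    qed
    finally show "exp (real b / (32 * (real g)\<^sup>2)) \<le> cosh x" .
  next
    case False
    then have b: "b = 1" using assms by simp
    define y where "y = 1 / (32 * (real g)\<^sup>2)"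
    have y: "0 \<le> y" "y \<le> 1"
    proof -
      have "1 \<le> (real g)\<^sup>2" using gb by simp
      then show "y \<le> 1" unfolding y_def by (subst divide_le_eq_1) auto
    qed (simp add: y_def)
    have "1 / (2 * real g) \<le> x" using assms(4) by (simp add: b x_def)
    then have "(1 / (2 * real g))\<^sup>2 \<le> x\<^sup>2" by (intro power_mono) auto
    then have 2: "2 * y \<le> x\<^sup>2 / 4" by (simp add: y_def power_divide power_mult_distrib)
    have "y\<^sup>2 \<le> y * 1" unfolding power2_eq_square using y by (intro mult_left_mono) auto
    then have "exp y \<le> 1 + 2 * y" using small[OF y] by linarith
    also have "\<dots> \<le> cosh x" using 2 quad by linarith
    finally show "exp (real b / (32 * (real g)\<^sup>2)) \<le> cosh x" by (simp add: y_def b)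
  qed
qed

context ranked_input
begin

definition shortage :: "nat \<Rightarrow> bool" where
  "shortage fuel \<longleftrightarrow> fuel \<le> (\<Sum>j<n. level_fuel j)"

lemma shortage_bound:
  assumes "0 < g" "0 < b" "real b / real g \<le> \<beta>" "c permutes {..<n}" "shortage (n * 2 ^ J)"
  shows "real n * 2 ^ (J * (R * b)) \<le> exp (real (R * b) * (2097601 * (real g)\<^sup>2)) * (90 * real g) *
    (\<Sum>q\<le>n. exp (\<Sum>p\<leftarrow>qs. \<beta> / 2 * real (cross_inv n c q p)))"
proof -
  define s where "s = R * b"
  \<comment> \<open>Chosen so that \<open>10 * s * \<eta>\<close> times the bound
    \<open>2 * Y / R\<close> on an excess rate is \<open>b / (2 * g) * Y\<close>, hence at most
    \<open>\<beta> / 2 * Y\<close>, the exponent at which the moment of the inversions is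
    known.\<close>
  define \<eta> where "\<eta> = 1 / (40 * real g)"
  have g: "1 \<le> real g" and b: "1 \<le> real b" and R: "1 \<le> real R" using assms R_pos by auto
  have s: "0 < s" using assms(2) R_pos by (simp add: s_def)
  then have s1: "1 \<le> real s" by simp
  have \<eta>: "0 < \<eta>" "\<eta> \<le> 1" using g by (auto simp: \<eta>_def)
  have "real (n * 2 ^ J) \<le> real (\<Sum>j<n. level_fuel j)" using assms(5) unfolding shortage_def by (simp only: of_nat_le_iff)
  then have "real n * 2 ^ J \<le> real (\<Sum>j<n. level_fuel j)" by simp
  from fuel_shortage[OF \<eta> s _ this]
  have "real n * (2 ^ J) ^ s \<le> exp (s * (1311 / \<eta>\<^sup>2 + 5 * \<eta>)) * (10 * (1 + 1 / (5 * real s * \<eta>))) *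
      (\<Sum>q\<le>n. exp (10 * real s * \<eta> * excess_rate q))" by simp
  also have "\<dots> \<le> exp (real s * (2097601 * (real g)\<^sup>2)) * (90 * real g) *
      (\<Sum>q\<le>n. exp (\<Sum>p\<leftarrow>qs. \<beta> / 2 * real (cross_inv n c q p)))"
  proof -
    have "5 * \<eta> \<le> 1" using g by (simp add: \<eta>_def)
    moreover have "1 \<le> (real g)\<^sup>2" using g by simp
    \<comment> \<open>1311 * 40^2 = 2097600; one more unit in the sum covers
      \<open>5 * \<eta>\<close>.\<close>
    moreover have "1311 / \<eta>\<^sup>2 = 2097600 * (real g)\<^sup>2" using g by (simp add: \<eta>_def power_divide power_mult_distrib)
    ultimately have "1311 / \<eta>\<^sup>2 + 5 * \<eta> \<le> 2097601 * (real g)\<^sup>2" by linarith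
    then have e1: "exp (s * (1311 / \<eta>\<^sup>2 + 5 * \<eta>)) \<le> exp (real s * (2097601 * (real g)\<^sup>2))"
      by (simp add: mult_left_mono)
    have "1 / (5 * real s * \<eta>) = 8 * real g / real s" using g s by (simp add: \<eta>_def field_simps)
    also have "\<dots> \<le> 8 * real g" using s1 g by (simp add: divide_le_eq)
    finally have t: "1 / (5 * real s * \<eta>) \<le> 8 * real g" .
    have "10 * (1 + t) \<le> 90 * G" if "t \<le> 8 * G" "1 \<le> G" for t G :: real using that by simp
    from this[OF t g] have e2: "10 * (1 + 1 / (5 * real s * \<eta>)) \<le> 90 * real g" .
    have e3: "exp (10 * real s * \<eta> * excess_rate q) \<le> exp (\<Sum>p\<leftarrow>qs. \<beta> / 2 * real (cross_inv n c q p))" if "q \<in> {..n}" for q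
    proof -
      define Y where "Y = (\<Sum>p\<leftarrow>qs. cross_inv n c q p)"
      have "cut_excess n pref q \<le> 2 * Y" unfolding Y_def using that by (intro excess_le assms) auto
      then have "excess_rate q \<le> 2 * real Y / real R" by (intro divide_right_mono) linarith+
      then have "10 * real s * \<eta> * excess_rate q \<le> 10 * real s * \<eta> * (2 * real Y / real R)"
        using \<eta> by (intro mult_left_mono) auto
      also have "\<dots> = (real b / real g) / 2 * real Y" using g R by (simp add: s_def \<eta>_def field_simps)
      also have "\<dots> \<le> \<beta> / 2 * real Y" using assms(3) by (intro mult_right_mono divide_right_mono) auto
      also have "\<dots> = (\<Sum>p\<leftarrow>qs. \<beta> / 2 * real (cross_inv n c q p))"
      proof -
        have "\<beta> / 2 * real (\<Sum>p\<leftarrow>xs. cross_inv n c q p) = (\<Sum>p\<leftarrow>xs. \<beta> / 2 * real (cross_inv n c q p))" for xs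
          by (induction xs) (simp_all add: distrib_left add_divide_distrib)
        then show ?thesis by (simp only: Y_def)
      qed
      finally show ?thesis by simp
    qed
    have "0 \<le> 10 * (1 + 1 / (5 * real s * \<eta>))" using \<eta> by simp
    then show ?thesis
      by (intro mult_mono[OF mult_mono[OF e1 e2] sum_mono[OF e3]]) (use g in \<open>auto intro!: sum_nonneg mult_nonneg_nonneg\<close>)
  qed
  finally show ?thesis by (simp add: s_def power_mult)
qed

end

lemma ln2_half: "(1 :: real) / 2 \<le> ln 2"
  using ln_le_minus_one[of "1 / 2 :: real"] by (simp add: ln_div)

text \<open>The exponent is rounded up to 2100000 to absorb the polynomial factor: 720 = 4 * 180 and
  2397 = 2100000 - 2097603.\<close>

lemma exp_scale_le:
  fixes s g :: real
  assumes "1 \<le> s" "1 \<le> g"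
  shows "180 * g * exp (s * (2097603 * g\<^sup>2)) \<le> exp (2100000 * (s * g\<^sup>2)) / 4"
proof -
  have gg: "g \<le> s * g\<^sup>2" "1 \<le> s * g\<^sup>2"
  proof -
    have "g * 1 \<le> g * g" using assms by (intro mult_left_mono) auto
    moreover have "1 * (g * g) \<le> s * (g * g)" using assms by (intro mult_right_mono) auto
    ultimately show "g \<le> s * g\<^sup>2" by (simp add: power2_eq_square)
    then show "1 \<le> s * g\<^sup>2" using assms by linarith
  qed
  have "720 * g \<le> 1 + 720 * (s * g\<^sup>2)" using gg by linarith
  also have "\<dots> \<le> exp (720 * (s * g\<^sup>2))" by (rule exp_ge_add_one_self)
  also have "\<dots> \<le> exp (2397 * (s * g\<^sup>2))" using gg by simp
  finally have "720 * g * exp (s * (2097603 * g\<^sup>2)) \<le> exp (2397 * (s * g\<^sup>2)) * exp (s * (2097603 * g\<^sup>2))"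
    by (intro mult_right_mono) auto
  also have "\<dots> = exp (2100000 * (s * g\<^sup>2))" by (simp add: exp_add[symmetric] algebra_simps)
  finally show ?thesis by simp
qed

text \<open>The samples enter \<open>shortage_bound\<close> only through exponentials of sums of
  independent terms, so its expectation is a sum of \<open>R\<close>-th powers of single moments.
  The bound n^-\<alpha> / 4 leaves room for two more failure events.\<close>

lemma shortage_prob:
  assumes \<beta>: "0 < \<beta>" and c: "c permutes {..<n}" and R: "0 < R" "R \<le> r" and n: "0 < n"
    and gb: "0 < g" "0 < b" "real b / real g \<le> \<beta>" and q: "real n powr \<alpha> \<le> 2 ^ (Q * (R * b))"
    and inp: "\<And>ps. ps \<in> set_pmf (replicate_pmf r (mallows n \<beta> c)) \<Longrightarrow> ranked_input (inp ps) n R (take R ps)"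
  shows "measure_pmf.prob (replicate_pmf r (mallows n \<beta> c))
    {ps. ranked_input.shortage (inp ps) n R (n * 2 ^ (Q + 4200000 * (g * g)))} \<le> real n powr - \<alpha> / 4"
proof (rule prob_le_of_emeasure)
  let ?\<mu> = "replicate_pmf r (mallows n \<beta> c)"
  define s where "s = real (R * b)"
  define J where "J = Q + 4200000 * (g * g)"
  define A where "A = exp (s * (2097601 * (real g)\<^sup>2)) * (90 * real g) / (real n * 2 ^ (J * (R * b)))"
  let ?f = "\<lambda>q p. \<beta> / 2 * real (cross_inv n c q p)"
  have g: "1 \<le> real g" and b: "1 \<le> real b" and R1: "1 \<le> real R" using gb R by auto
  have s: "1 \<le> s" unfolding s_def using R1 b mult_mono[of 1 "real R" 1 "real b"] by simp
  have A0: "0 \<le> A" by (simp add: A_def)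
  have npos: "0 < real n * 2 ^ (J * (R * b))" using n by simp
  have "emeasure (measure_pmf ?\<mu>) {ps. ranked_input.shortage (inp ps) n R (n * 2 ^ J)} \<le>
      (\<integral>\<^sup>+ps. (\<Sum>q\<le>n. ennreal A * (\<Prod>p\<leftarrow>take R ps. ennreal (exp (?f q p)))) \<partial>measure_pmf ?\<mu>)"
  proof (rule emeasure_le_nn_integral)
    fix ps assume ps: "ps \<in> set_pmf ?\<mu>" "ps \<in> {ps. ranked_input.shortage (inp ps) n R (n * 2 ^ J)}"
    interpret ranked_input "inp ps" n R "take R ps" by (rule inp[OF ps(1)])
    have "1 \<le> A * (\<Sum>q\<le>n. exp (\<Sum>p\<leftarrow>take R ps. ?f q p))"
      using shortage_bound[OF gb c, of J] ps(2) npos by (simp add: A_def s_def pos_le_divide_eq)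
    also have "\<dots> = (\<Sum>q\<le>n. A * exp (\<Sum>p\<leftarrow>take R ps. ?f q p))" by (rule sum_distrib_left)
    finally have "ennreal 1 \<le> ennreal \<dots>" by (rule ennreal_leI)
    also have "\<dots> = (\<Sum>q\<le>n. ennreal A * (\<Prod>p\<leftarrow>take R ps. ennreal (exp (?f q p))))"
      using A0 by (simp add: prod_list_exp sum_ennreal[symmetric] ennreal_mult'')
    finally show "1 \<le> (\<Sum>q\<le>n. ennreal A * (\<Prod>p\<leftarrow>take R ps. ennreal (exp (?f q p))))" by simp
  qed
  also have "\<dots> = (\<Sum>q\<le>n. ennreal A * (\<integral>\<^sup>+p. ennreal (exp (?f q p)) \<partial>measure_pmf (mallows n \<beta> c)) ^ R)"
    by (simp add: nn_integral_sum nn_integral_cmult nn_integral_replicate_pmf[OF R(2)])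
  also have "\<dots> \<le> (\<Sum>q\<le>n. ennreal A * ennreal (exp (2 / \<beta>)) ^ R)"
    unfolding nn_integral_mallows[OF exp_ge_zero]
    by (intro sum_mono mult_left_mono power_mono ennreal_leI mallows_cross_moment \<beta> c) auto
  also have "\<dots> = ennreal (real (n + 1) * (A * exp (2 / \<beta>) ^ R))"
    using A0 by (simp add: ennreal_power ennreal_mult'' ennreal_of_nat_eq_real_of_nat[symmetric])
  also have "\<dots> \<le> ennreal (real n powr - \<alpha> / 4)"
  proof (rule ennreal_leI)
    have "exp (2 / \<beta>) ^ R = exp (real R * (2 / \<beta>))" by (rule exp_of_nat_mult[symmetric])
    also have "\<dots> \<le> exp (s * (2 * (real g)\<^sup>2))"
    proof -
      have bg: "0 < real b / real g" using g b by simp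
      have "2 / \<beta> \<le> 2 / (real b / real g)" 
        by (rule divide_left_mono[OF gb(3)]) (use mult_pos_pos[OF \<beta> bg] in simp_all)
      also have "\<dots> = 2 * real g / real b" by simp
      also have "\<dots> \<le> 2 * real g" using b g by (simp add: divide_le_eq)
      also have "\<dots> \<le> 2 * (real g)\<^sup>2" using g mult_left_mono[of 1 "real g" "real g"] by (simp add: power2_eq_square)
      finally have "real R * (2 / \<beta>) \<le> real R * (2 * (real g)\<^sup>2)" using R1 by (intro mult_left_mono) auto
      also have "\<dots> \<le> s * (2 * (real g)\<^sup>2)"
        unfolding s_def using b R1 by (intro mult_right_mono) (auto intro!: mult_le_cancel_left1[THEN iffD2])
      finally show ?thesis by simp
    qed
    finally have e: "exp (2 / \<beta>) ^ R \<le> exp (s * (2 * (real g)\<^sup>2))" .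
    \<comment> \<open>4200000 is twice 2100000 because \<open>ln 2\<close> is estimated by 1 / 2:
      the slack in base two beats the constants, and \<open>Q\<close> alone beats
      n^\<alpha>.\<close>
    have half: "exp (2100000 * (s * (real g)\<^sup>2)) * real n powr \<alpha> \<le> 2 ^ (J * (R * b))"
    proof -
      have "exp (2100000 * (s * (real g)\<^sup>2)) \<le> exp (ln 2 * real (4200000 * (g * g) * (R * b)))"
        using mult_right_mono[OF ln2_half, of "4200000 * (s * (real g)\<^sup>2)"] s by (simp add: s_def power2_eq_square mult_ac)
      also have "\<dots> = 2 ^ (4200000 * (g * g) * (R * b))"
        by (simp only: mult.commute[of "ln 2"] exp_of_nat_mult) simp
      finally have "exp (2100000 * (s * (real g)\<^sup>2)) * real n powr \<alpha> \<le> 2 ^ (4200000 * (g * g) * (R * b)) * 2 ^ (Q * (R * b))"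
        using q by (intro mult_mono) auto
      also have "\<dots> = 2 ^ (J * (R * b))" unfolding J_def power_add[symmetric] by (simp only: add.commute distrib_right)
      finally show ?thesis .
    qed
    have "real (n + 1) * (A * exp (2 / \<beta>) ^ R) \<le> (2 * real n) * (A * exp (s * (2 * (real g)\<^sup>2)))"
      using e A0 n by (intro mult_mono) auto
    also have "\<dots> = (180 * real g * (exp (s * (2097601 * (real g)\<^sup>2)) * exp (s * (2 * (real g)\<^sup>2)))) / 2 ^ (J * (R * b))"
      using n by (simp add: A_def field_simps)
    also have "exp (s * (2097601 * (real g)\<^sup>2)) * exp (s * (2 * (real g)\<^sup>2)) = exp (s * (2097603 * (real g)\<^sup>2))"
      by (simp add: exp_add[symmetric] algebra_simps)
    also have "(180 * real g * exp (s * (2097603 * (real g)\<^sup>2))) / 2 ^ (J * (R * b)) \<le>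
        (exp (2100000 * (s * (real g)\<^sup>2)) / 4) / 2 ^ (J * (R * b))"
      by (intro divide_right_mono exp_scale_le s g) auto
    also have "\<dots> \<le> (exp (2100000 * (s * (real g)\<^sup>2)) / 4) / (exp (2100000 * (s * (real g)\<^sup>2)) * real n powr \<alpha>)"
      using half n by (intro divide_left_mono) auto
    also have "\<dots> = real n powr - \<alpha> / 4" by (simp add: powr_minus_divide)
    finally show "real (n + 1) * (A * exp (2 / \<beta>) ^ R) \<le> real n powr - \<alpha> / 4" .
  qed
  finally show "emeasure (measure_pmf ?\<mu>) {ps. ranked_input.shortage (inp ps) n R (n * 2 ^ (Q + 4200000 * (g * g)))} \<le> ennreal (real n powr - \<alpha> / 4)"
    by (simp only: J_def)
qed simp

section \<open>Integer approximations of the parameters and the time bound\<close>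

section \<open>Parameters\<close>

lemma real_word_Suc:
  assumes "0 \<le> x"
  shows "nat \<lfloor>2 ^ Suc m * x\<rfloor> = nat \<lfloor>2 ^ m * x\<rfloor> + nat \<lfloor>2 ^ m * x\<rfloor> + real_word x (Suc m)"
proof -
  have "\<lfloor>2 ^ Suc m * x / real_of_int 2\<rfloor> = \<lfloor>2 ^ Suc m * x\<rfloor> div 2" by (rule floor_divide_real_eq_div) simp
  then have h: "nat \<lfloor>2 ^ m * x\<rfloor> = nat \<lfloor>2 ^ Suc m * x\<rfloor> div 2" by (simp add: nat_div_distrib mult.assoc)
  have "q = q div 2 + q div 2 + q mod 2" for q :: nat by presburger
  then show ?thesis unfolding h by (simp only: real_word_def nat.simps if_False)
qed

lemma one_plus_le_powr: "0 \<le> x \<Longrightarrow> 1 + x \<le> 2 powr (2 * x)" for x :: real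
proof -
  assume x: "0 \<le> x"
  have "1 / 2 \<le> ln (2 :: real)" using ln_le_minus_one[of "1 / 2 :: real"] by (simp add: ln_div)
  then have "x * 1 \<le> x * (2 * ln 2)" using x by (intro mult_left_mono) auto
  then have "exp x \<le> 2 powr (2 * x)" by (simp add: powr_def)
  then show ?thesis using exp_ge_add_one_self[of x] by linarith
qed

locale mallows_input =
  fixes \<alpha> \<beta> :: real and n :: nat and ps :: "(nat \<Rightarrow> nat) list"
  assumes \<alpha>: "0 < \<alpha>" and \<beta>: "0 < \<beta>" and n: "2 \<le> n" and ps: "ps \<noteq> []"
begin

definition "inp = problem_input \<alpha> \<beta> n ps"
definition "r = length ps"
definition "l = log_size inp"
definition "g = beta_scale inp"
definition "b = beta_word inp"
definition "A = alpha_up inp"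
definition "y = ceil_div A (2 ^ l * b - 1)"
definition "R = used_samples inp"
definition "Q = quality inp"

lemma inp_simps [simp]:
  "inp Num_Elements x z = n" "inp Num_Samples x z = length ps" "inp Alpha k z = real_word \<alpha> k" "inp Beta k z = real_word \<beta> k"
  by (simp_all add: inp_def problem_input_def)

lemma num [simp]: "num_elements inp = n" by (simp add: num_elements_def)

text \<open>As long as the words of \<beta> up to j vanish, 2^j \<beta> is below 1, so \<beta> > 0
  forces a nonzero word. If it is the integer part then g = 1; if it is a binary digit then b =
  1.\<close>

lemma beta_digit: "\<exists>k. real_word \<beta> k \<noteq> 0"
  and beta_bounds: "0 < b" "0 < g" "g = 1 \<or> b = 1" "real b / real g \<le> \<beta>" "\<beta> < 2 * (real b / real g)" "real g \<le> 1 + 2 / \<beta>"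
proof -
  have small: "2 ^ j * \<beta> < 1" if "\<And>i. i \<le> j \<Longrightarrow> real_word \<beta> i = 0" for j
    using that
  proof (induction j)
    case 0
    then have "nat \<lfloor>\<beta>\<rfloor> = 0" using 0[of 0] by (simp add: real_word_def)
    then show ?case using \<beta> by simp
  next
    case (Suc j)
    have "2 ^ j * \<beta> < 1" using Suc by simp
    then have "\<lfloor>2 ^ j * \<beta>\<rfloor> = 0" using \<beta> by (simp add: floor_eq_iff)
    then have "nat \<lfloor>2 ^ Suc j * \<beta>\<rfloor> = 0" using real_word_Suc[of \<beta> j] Suc.prems[of "Suc j"] \<beta> by simp
    then show ?case by simp
  qed
  show ex: "\<exists>k. real_word \<beta> k \<noteq> 0"
  proof (rule ccontr)
    assume "\<not> ?thesis"
    then have "2 ^ j * \<beta> < 1" for j using small by blast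
    moreover obtain j where "1 / \<beta> < 2 ^ j" using real_arch_pow[of 2 "1 / \<beta>"] by auto
    ultimately show False using \<beta> by (meson divide_less_eq less_asym)
  qed
  define k where "k = beta_index inp"
  have k: "real_word \<beta> k \<noteq> 0" "\<And>j. j < k \<Longrightarrow> real_word \<beta> j = 0"
    using LeastI_ex[OF ex] not_less_Least unfolding k_def beta_index_def by auto
  have b: "b = real_word \<beta> k" and g: "g = 2 ^ k" by (simp_all add: b_def g_def beta_word_def beta_scale_def k_def)
  have main: "real b \<le> 2 ^ k * \<beta> \<and> 2 ^ k * \<beta> < real b + 1 \<and> (g = 1 \<or> b = 1)"
  proof (cases k)
    case 0
    then show ?thesis using b g \<beta> by (simp add: real_word_def)
  next
    case (Suc j)
    have "2 ^ j * \<beta> < 1" using small[of j] k(2) Suc by simp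
    then have f: "\<lfloor>2 ^ j * \<beta>\<rfloor> = 0" using \<beta> by (simp add: floor_eq_iff)
    have bk: "nat \<lfloor>2 ^ k * \<beta>\<rfloor> = b" using real_word_Suc[of \<beta> j] \<beta> f by (simp add: Suc b)
    have "b < 2" unfolding b Suc real_word_def by simp
    then have "b = 1" using k(1) b by simp
    moreover have "0 \<le> 2 ^ k * \<beta>" using \<beta> by simp
    then have "real b \<le> 2 ^ k * \<beta> \<and> 2 ^ k * \<beta> < real b + 1" using bk by linarith
    ultimately show ?thesis by simp
  qed
  show b0: "0 < b" and g0: "0 < g" using k(1) b g by auto
  show gb: "g = 1 \<or> b = 1" using main by simp
  have rg: "real g = 2 ^ k" "0 < real g" using g by auto
  show "real b / real g \<le> \<beta>" using main rg by (simp add: pos_divide_le_eq mult.commute)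
  have "real b + 1 \<le> 2 * real b" using b0 by linarith
  then have "real g * \<beta> < 2 * real b" using main unfolding rg(1) by linarith
  then show 2: "\<beta> < 2 * (real b / real g)" using rg by (simp add: pos_less_divide_eq mult.commute)
  show "real g \<le> 1 + 2 / \<beta>" using gb
  proof
    assume "b = 1"
    then have "real g * \<beta> < 2" using \<open>real g * \<beta> < 2 * real b\<close> by simp
    then have "real g < 2 / \<beta>" using \<beta> by (simp add: pos_less_divide_eq)
    then show ?thesis by simp
  qed (use \<beta> in simp)
qed

lemma valid: "valid_input inp"
  using beta_digit by (simp add: valid_input_def)

lemma alpha_bounds: "2 ^ l * \<alpha> \<le> real A" "real A \<le> 2 ^ l * \<alpha> + 1"
proof -
  have "foldl (\<lambda>a k. a + a + real_word \<alpha> (Suc k)) (real_word \<alpha> 0) [0..<m] = nat \<lfloor>2 ^ m * \<alpha>\<rfloor>" for m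
  proof (induction m)
    case (Suc m)
    then show ?case using real_word_Suc[of \<alpha> m] \<alpha> by simp
  qed (simp add: real_word_def)
  then have "A = Suc (nat \<lfloor>2 ^ l * \<alpha>\<rfloor>)" by (simp add: A_def alpha_up_def l_def)
  moreover have "0 \<le> 2 ^ l * \<alpha>" using \<alpha> by simp
  ultimately show "2 ^ l * \<alpha> \<le> real A" "real A \<le> 2 ^ l * \<alpha> + 1" by linarith+
qed

lemma log_bounds: "n \<le> 2 ^ l" "2 ^ l \<le> 2 * n" "0 < l" "ln (real n) \<le> real l" "real l \<le> 2 * log 2 n" "1 \<le> log 2 n"
proof -
  have ll: "l = (LEAST k. n \<le> 2 ^ k)" by (simp add: l_def log_size_def log_ceil_def)
  show 1: "n \<le> 2 ^ l" unfolding l_def log_size_def num by (rule log_ceil_ge)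
  then show 3: "0 < l" using n by (cases l) auto
  have "\<not> n \<le> 2 ^ (l - 1)" using not_less_Least[of "l - 1" "\<lambda>k. n \<le> 2 ^ k"] 3 by (simp add: ll[symmetric])
  then have m: "2 ^ (l - 1) \<le> n" by simp
  moreover have "(2 :: nat) ^ l = 2 * 2 ^ (l - 1)" using 3 by (simp add: power_eq_if)
  ultimately show "2 ^ l \<le> 2 * n" by simp
  have "real n \<le> real (2 ^ l)" using 1 by (simp only: of_nat_le_iff)
  also have "\<dots> = 2 ^ l" by simp
  also have "\<dots> \<le> exp 1 ^ l" using exp_ge_add_one_self[of 1] by (intro power_mono) auto
  also have "\<dots> = exp (real l)" by (simp add: exp_of_nat_mult[symmetric])
  finally have "ln (real n) \<le> ln (exp (real l))" using n by (intro ln_mono) auto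
  then show "ln (real n) \<le> real l" by simp
  have "log 2 2 \<le> log 2 (real n)" using n by (intro log_mono) auto
  then show 5: "1 \<le> log 2 n" by simp
  have "real (2 ^ (l - 1)) \<le> real n" using m by (simp only: of_nat_le_iff)
  then have "log 2 (2 ^ (l - 1)) \<le> log 2 (real n)" using n by (intro log_mono) auto
  then have "real (l - 1) \<le> log 2 n" by (simp add: log_nat_power)
  then show "real l \<le> 2 * log 2 n" using 5 3 by (simp add: of_nat_diff)
qed

lemma alpha_over_b: "\<alpha> / real b \<le> 2 * (\<alpha> / \<beta>)"
proof -
  have "real b / real g \<le> real b" using beta_bounds(2) mult_left_mono[of 1 "real g" "real b"] by (simp add: divide_le_eq)
  then have "\<beta> \<le> 2 * real b" using beta_bounds(5) by linarith
  then have "\<alpha> * \<beta> \<le> \<alpha> * (2 * real b)" using \<alpha> by (intro mult_left_mono) auto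
  then show ?thesis using \<beta> beta_bounds(1) by (simp add: field_simps)
qed

lemma units: "Suc (2 ^ l * b - 1) = 2 ^ l * b" "0 < 2 ^ l * b"
  using beta_bounds(1) by simp_all

lemma R_def': "R = min r (32 * (g * (g * (l * (y + 4)))))"
  by (simp add: R_def used_samples_def r_def g_def l_def y_def A_def beta_units_def b_def)

lemma Q_def': "Q = ceil_div (l * A) (R * (2 ^ l * b) - 1)"
  by (simp add: Q_def quality_def l_def A_def R_def beta_units_def b_def)

lemma R_bounds: "0 < R" "R \<le> r"
  using beta_bounds log_bounds(3) ps by (auto simp: R_def' r_def)

lemma y_bounds: "\<alpha> \<le> real y * real b" "real y \<le> 2 * (\<alpha> / \<beta>) + 2"
proof -
  have "A \<le> y * (2 ^ l * b)" using ceil_div_ge[of A "2 ^ l * b - 1", unfolded units(1)] by (simp add: y_def)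
  then have "real A \<le> real (y * (2 ^ l * b))" by (simp only: of_nat_le_iff)
  then have "real A \<le> 2 ^ l * (real y * real b)" by (simp add: mult_ac)
  from order_trans[OF alpha_bounds(1) this] show "\<alpha> \<le> real y * real b" by (rule mult_left_le_imp_le) simp
  have "y * (2 ^ l * b) < A + 2 ^ l * b" using ceil_div_less[of A "2 ^ l * b - 1", unfolded units(1)] by (simp add: y_def)
  then have "real (y * (2 ^ l * b)) \<le> real (A + 2 ^ l * b)" by (simp only: of_nat_le_iff)
  also have "\<dots> \<le> (2 ^ l * \<alpha> + 1) + 2 ^ l * real b" using alpha_bounds(2) by simp
  also have "\<dots> \<le> 2 ^ l * (\<alpha> + 2 * real b)"
  proof -
    have "1 * 1 \<le> 2 ^ l * real b" using beta_bounds(1) by (intro mult_mono) auto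
    then show ?thesis by (simp add: algebra_simps)
  qed
  finally have "2 ^ l * (real y * real b) \<le> 2 ^ l * (\<alpha> + 2 * real b)" by (simp add: mult_ac)
  then have "real y * real b \<le> \<alpha> + 2 * real b" by simp
  then have "real y \<le> \<alpha> / real b + 2" using beta_bounds(1) by (simp add: field_simps)
  then show "real y \<le> 2 * (\<alpha> / \<beta>) + 2" using alpha_over_b by simp
qed

lemma quality_enough: "real n powr \<alpha> \<le> 2 ^ (Q * (R * b))"
proof -
  have U: "Suc (R * (2 ^ l * b) - 1) = R * (2 ^ l * b)" using R_bounds(1) units by simp
  have "l * A \<le> Q * (R * (2 ^ l * b))" using ceil_div_ge[of "l * A" "R * (2 ^ l * b) - 1"] unfolding U Q_def' .
  then have "real (l * A) \<le> real (Q * (R * (2 ^ l * b)))" by (simp only: of_nat_le_iff)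
  then have a1: "real l * real A \<le> 2 ^ l * real (Q * (R * b))" by (simp add: mult_ac)
  have a2: "2 ^ l * (real l * \<alpha>) \<le> real l * real A"
    using mult_left_mono[OF alpha_bounds(1), of "real l"] by (simp add: mult_ac)
  have la: "real l * \<alpha> \<le> real (Q * (R * b))" by (rule mult_left_le_imp_le[OF order_trans[OF a2 a1]]) simp
  have "real n \<le> real (2 ^ l)" using log_bounds(1) by (simp only: of_nat_le_iff)
  then have "real n powr \<alpha> \<le> real (2 ^ l) powr \<alpha>" using \<alpha> by (intro powr_mono2) auto
  also have "\<dots> = 2 powr (real l * \<alpha>)" by (simp add: powr_powr powr_realpow[symmetric])
  also have "\<dots> \<le> 2 powr real (Q * (R * b))" using la by (intro powr_mono) auto
  also have "\<dots> = 2 ^ (Q * (R * b))" by (rule powr_realpow) simp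
  finally show ?thesis .
qed

text \<open>If the whole sample is read, this is the definition up to rounding. If the sample is cut
  off, then R b >= \<alpha> l, and \<open>Q\<close> is at most the constant 3.\<close>

lemma quality_le: "real Q \<le> 4 * log 2 n * (\<alpha> / (\<beta> * real r)) + 3"
proof -
  have U: "Suc (R * (2 ^ l * b) - 1) = R * (2 ^ l * b)" using R_bounds(1) units by simp
  have pos: "0 < 2 ^ l * (real R * real b)" using R_bounds(1) beta_bounds(1) by simp
  have Rb: "1 * 1 \<le> real R * real b" using R_bounds(1) beta_bounds(1) by (intro mult_mono) auto
  have "Q * (R * (2 ^ l * b)) < l * A + R * (2 ^ l * b)" using ceil_div_less[of "l * A" "R * (2 ^ l * b) - 1"] unfolding U Q_def' .
  then have "real (Q * (R * (2 ^ l * b))) \<le> real (l * A + R * (2 ^ l * b))" by (simp only: of_nat_le_iff)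
  also have "\<dots> \<le> real l * (2 ^ l * \<alpha> + 1) + 2 ^ l * (real R * real b)"
    using mult_left_mono[OF alpha_bounds(2), of "real l"] by (simp add: mult_ac)
  also have "\<dots> \<le> 2 ^ l * (real l * \<alpha> + 2 * (real R * real b))"
  proof -
    have "l \<le> 2 ^ l" by (simp add: less_imp_le)
    then have "real l \<le> real (2 ^ l)" by (simp only: of_nat_le_iff)
    also have "\<dots> \<le> 2 ^ l * (real R * real b)" using Rb by simp
    finally show ?thesis by (simp add: algebra_simps)
  qed
  finally have "(2 ^ l * (real R * real b)) * real Q \<le> (2 ^ l * (real R * real b)) * (real l * \<alpha> / (real R * real b) + 2)"
    using Rb by (simp add: field_simps)
  then have Q: "real Q \<le> real l * \<alpha> / (real R * real b) + 2" using pos by (rule mult_left_le_imp_le)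
  have nn: "0 \<le> 4 * log 2 n * (\<alpha> / (\<beta> * real r))" using log_bounds(6) \<alpha> \<beta> by simp
  show ?thesis
  proof (cases "R = r")
    case True
    have rp: "0 < real r" using R_bounds by simp
    have "real l * \<alpha> / (real R * real b) = real l * (\<alpha> / real b) / real r" by (simp add: True field_simps)
    also have "\<dots> \<le> (2 * log 2 n) * (2 * (\<alpha> / \<beta>)) / real r"
      using log_bounds(5,6) alpha_over_b rp \<alpha> by (intro divide_right_mono mult_mono) auto
    also have "\<dots> = 4 * log 2 n * (\<alpha> / (\<beta> * real r))" by simp
    finally show ?thesis using Q by linarith
  next
    case False
    then have "R = 32 * (g * (g * (l * (y + 4))))" unfolding R_def' by (simp add: min_def split: if_splits)
    moreover have "l * y \<le> 32 * (g * (g * (l * (y + 4))))"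
    proof -
      have "1 * 1 * (l * y) \<le> (32 * g) * g * (l * (y + 4))" using beta_bounds(2) by (intro mult_le_mono) auto
      then show ?thesis by (simp only: mult_ac)
    qed
    ultimately have "real (l * y) \<le> real R" by (simp only: of_nat_le_iff)
    then have "real l * real y * real b \<le> real R * real b" by (intro mult_right_mono) auto
    moreover have "real l * \<alpha> \<le> real l * (real y * real b)" using y_bounds(1) by (intro mult_left_mono) auto
    ultimately have "real l * \<alpha> \<le> real R * real b" by (simp add: mult.assoc)
    then have "real l * \<alpha> / (real R * real b) \<le> 1" using Rb by (simp add: divide_le_eq)
    then show ?thesis using Q nn by linarith
  qed
qed

text \<open>The factors 32 and g^2 of \<open>used_samples\<close> cancel the rate of
  \<open>cosh_lower\<close>, which leaves the exponent l (y b + 4 b) >= (\<alpha> + 4) ln n. Of the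
  surplus n^-4 one half pays for the n^2 pairs; the other is at most 1 / 4 since n >= 2.\<close>

lemma majority_enough:
  assumes "R < r"
  shows "real n ^ 2 * (1 / cosh (\<beta> / 2)) ^ R \<le> real n powr - \<alpha> / 4"
proof -
  have R: "R = 32 * (g * (g * (l * (y + 4))))" using assms unfolding R_def' by (simp add: min_def split: if_splits)
  have g: "0 < real g" and b: "1 \<le> real b" using beta_bounds by auto
  let ?c = "exp (real b / (32 * (real g)\<^sup>2))"
  have "(1 / cosh (\<beta> / 2)) ^ R \<le> (1 / ?c) ^ R"
    using cosh_lower[OF beta_bounds(2,1,3,4)] by (intro power_mono divide_left_mono) (auto simp: cosh_real_pos)
  also have "\<dots> = exp (real R * (- (real b / (32 * (real g)\<^sup>2))))"
    by (simp only: exp_of_nat_mult exp_minus inverse_eq_divide)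
  also have "real R * (- (real b / (32 * (real g)\<^sup>2))) = - (real l * (real y * real b + 4 * real b))"
    using g by (simp add: R power2_eq_square field_simps)
  also have "exp \<dots> \<le> exp (- (ln (real n) * (\<alpha> + 4)))"
  proof -
    have "ln (real n) * (\<alpha> + 4) \<le> real l * (real y * real b + 4 * real b)"
      using log_bounds(4) y_bounds(1) b \<alpha> by (intro mult_mono) auto
    then show ?thesis by simp
  qed
  also have "\<dots> = real n powr (- \<alpha> - 4)" using n by (simp add: powr_def algebra_simps)
  finally have "real n ^ 2 * (1 / cosh (\<beta> / 2)) ^ R \<le> real n ^ 2 * real n powr (- \<alpha> - 4)" by (intro mult_left_mono) auto
  also have "\<dots> = real n powr - \<alpha> / real n ^ 2"
    using n by (simp add: powr_diff field_simps eval_nat_numeral)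
  also have "\<dots> \<le> real n powr - \<alpha> / 4"
  proof -
    have "2 ^ 2 \<le> real n ^ 2" using n by (intro power_mono) auto
    then show ?thesis by (intro divide_left_mono) (use n in auto)
  qed
  finally show ?thesis .
qed

text \<open>The 8 in the exponent of n comes from squaring 2^Q <= 8 n^(4e) in the cost of computing
  \<open>Q\<close>. The slack satisfies g^2 <= 2 + 8 / \<beta>^2, whence 8 K in the base-two
  exponent; the additional 4 covers the factors polynomial in \<alpha> / \<beta> and 1 /
  \<beta>.\<close>

lemma cost_bound:
  "real (1 + cost_of K inp + n) \<le> (124 + 8 * real K + 147456 * 2 powr (2 * real K)) *
    (real n powr (1 + 8 * (\<alpha> / (\<beta> * real r))) * 2 powr ((8 * real K + 4) * (\<alpha> / \<beta> + 1 / \<beta>\<^sup>2)) * (log 2 n)\<^sup>2)"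
proof -
  define D L e where "D = \<alpha> / \<beta> + 1 / \<beta>\<^sup>2" and "L = log 2 (real n)" and "e = \<alpha> / (\<beta> * real r)"
  define P1 P2 where "P1 = real n powr (1 + 8 * e)" and "P2 = 2 powr ((8 * real K + 4) * D)"
  define W where "W = P1 * P2 * L\<^sup>2"
  have D: "0 \<le> D" "\<alpha> / \<beta> \<le> D" "1 / \<beta>\<^sup>2 \<le> D" using \<alpha> \<beta> by (simp_all add: D_def)
  have e: "0 \<le> e" using \<alpha> \<beta> by (simp add: e_def)
  have L: "1 \<le> L" "real l \<le> 2 * L" using log_bounds by (simp_all add: L_def)
  have n1: "1 \<le> real n" using n by simp
  have LL1: "L \<le> L\<^sup>2" using L mult_left_mono[of 1 L L] by (simp add: power2_eq_square)
  then have LL2: "1 \<le> L\<^sup>2" using L by linarith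
  note LL = LL1 LL2
  have nP: "real n \<le> P1" using powr_mono[of 1 "1 + 8 * e" "real n"] e n1 by (simp add: P1_def)
  have P: "1 \<le> P1" "1 \<le> P2" using nP n1 D ge_one_powr_ge_zero[of 2 "(8 * real K + 4) * D"] by (auto simp: P2_def)
  have mono: "a * b * c \<le> W" if "a \<le> P1" "b \<le> P2" "c \<le> L\<^sup>2" "0 \<le> a" "0 \<le> b" "0 \<le> c" for a b c
    unfolding W_def using that P by (intro mult_mono) auto
  have D2: "2 powr (2 * D) \<le> P2" "2 powr (4 * D) \<le> P2"
    unfolding P2_def using D by (auto intro!: powr_mono mult_right_mono)
  have gsq: "(real g)\<^sup>2 \<le> 2 + 8 * D"
  proof -
    have "(real g)\<^sup>2 \<le> (1 + 2 / \<beta>)\<^sup>2" using beta_bounds(6) by (intro power_mono) auto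
    also have "\<dots> \<le> 2 + 8 * (1 / \<beta>\<^sup>2)"
      using zero_le_power2[of "1 - 2 / \<beta>"] by (simp add: power2_sum power2_diff power_divide)
    finally show ?thesis using D by linarith
  qed
  have ex: "1 + D \<le> 2 powr (2 * D)" by (rule one_plus_le_powr[OF D(1)])
  have g2: "(real g)\<^sup>2 \<le> 8 * 2 powr (2 * D)" using gsq ex by linarith
  have gg: "real g \<le> (real g)\<^sup>2" using beta_bounds(2) mult_left_mono[of 1 "real g" "real g"] by (simp add: power2_eq_square)
  have y6: "real y + 4 \<le> 6 * 2 powr (2 * D)" using y_bounds(2) D ex by linarith
  have t1: "1 \<le> W" using mono[of 1 1 1] P LL by simp
  have tn: "real n \<le> W" using mono[of "real n" 1 1] nP P LL by simp
  have tnL: "real n * L \<le> W" using mono[of "real n" 1 L] nP P LL L by simp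
  have c1: "2 ^ l \<le> 2 * W"
  proof -
    have "real (2 ^ l) \<le> real (2 * n)" using log_bounds(2) by (simp only: of_nat_le_iff)
    then show ?thesis using tn by simp
  qed
  have c2: "(real l + 1)\<^sup>2 \<le> 9 * W"
  proof -
    have "(real l + 1)\<^sup>2 \<le> (3 * L)\<^sup>2" using L by (intro power_mono) auto
    also have "\<dots> = 9 * L\<^sup>2" by (simp add: power_mult_distrib)
    finally show ?thesis using mono[of 1 1 "L\<^sup>2"] P by simp
  qed
  have gW: "(real g)\<^sup>2 \<le> 8 * W" using g2 mono[of 1 "2 powr (2 * D)" 1] P LL D2 by simp
  have c3: "real g \<le> 8 * W" using gW gg by linarith
  have c4: "(real y + 1)\<^sup>2 \<le> 36 * W"
  proof -
    have "(real y + 1)\<^sup>2 \<le> (6 * 2 powr (2 * D))\<^sup>2" using y6 by (intro power_mono) auto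
    also have "\<dots> = 36 * 2 powr (4 * D)" by (simp add: power_mult_distrib power2_eq_square powr_add[symmetric])
    finally show ?thesis using mono[of 1 "2 powr (4 * D)" 1] P LL D2 by simp
  qed
  have Q2: "2 ^ Q \<le> 8 * real n powr (4 * e)"
  proof -
    have "(2 :: real) ^ Q = 2 powr real Q" by (simp add: powr_realpow)
    also have "\<dots> \<le> 2 powr (4 * L * e + 3)" using quality_le by (intro powr_mono) (auto simp: L_def e_def)
    also have "\<dots> = (2 powr L) powr (4 * e) * 2 powr 3" by (simp add: powr_add powr_powr mult_ac)
    also have "2 powr L = real n" using n1 by (simp add: L_def)
    finally show ?thesis by (simp add: mult.commute)
  qed
  have c5: "(real Q + 1)\<^sup>2 \<le> 64 * W"
  proof -
    have "Suc Q \<le> 2 ^ Q" by (simp add: Suc_le_eq)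
    then have "real (Suc Q) \<le> real (2 ^ Q)" by (simp only: of_nat_le_iff)
    then have "real Q + 1 \<le> 8 * real n powr (4 * e)" using Q2 by simp
    then have "(real Q + 1)\<^sup>2 \<le> (8 * real n powr (4 * e))\<^sup>2" by (intro power_mono) auto
    also have "\<dots> = 64 * real n powr (8 * e)" by (simp add: power_mult_distrib power2_eq_square powr_add[symmetric])
    also have "real n powr (8 * e) \<le> P1" unfolding P1_def using n1 by (intro powr_mono) auto
    finally show ?thesis using mono[of P1 1 1] P LL by simp
  qed
  have c6: "real (slack K inp) \<le> 8 * real K * W"
    using mult_left_mono[OF gW, of "real K"] by (simp add: slack_def g_def power2_eq_square)
  have c7: "real n * (real l + 1) \<le> 3 * W"
  proof -
    have "real n * (real l + 1) \<le> real n * (3 * L)" using L by (intro mult_left_mono) auto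
    then show ?thesis using tnL by simp
  qed
  define F where "F = fuel_of K inp"
  have F: "real F = real n * (2 ^ Q * 2 ^ (K * (g * g)))"
    by (simp add: F_def fuel_of_def slack_def Q_def g_def power_add)
  have Fn: "n \<le> F" "1 \<le> F" using n by (auto simp: F_def fuel_of_def Suc_le_eq)
  have c8: "real R * real F \<le> 24576 * 2 powr (2 * real K) * W"
  proof -
    have "R \<le> 32 * (g * (g * (l * (y + 4))))" by (simp add: R_def')
    then have "real R \<le> real (32 * (g * (g * (l * (y + 4)))))" by (simp only: of_nat_le_iff)
    also have "\<dots> = 32 * (real g)\<^sup>2 * real l * (real y + 4)" by (simp add: power2_eq_square)
    also have "\<dots> \<le> 32 * (8 * 2 powr (2 * D)) * (2 * L) * (6 * 2 powr (2 * D))"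
      using g2 L y6 by (intro mult_mono) auto
    also have "\<dots> = 3072 * (2 powr (4 * D)) * L"
    proof -
      have "2 powr (2 * D) * 2 powr (2 * D) = 2 powr (4 * D)" by (simp add: powr_add[symmetric])
      then show ?thesis by (simp add: mult_ac)
    qed
    finally have R: "real R \<le> 3072 * 2 powr (4 * D) * L" .
    have "(2 :: real) ^ (K * (g * g)) = 2 powr (real K * (real g)\<^sup>2)"
      by (simp add: powr_realpow[symmetric] power2_eq_square)
    also have "\<dots> \<le> 2 powr (real K * (2 + 8 * D))" using gsq by (intro powr_mono mult_left_mono) auto
    also have "\<dots> = 2 powr (2 * real K) * 2 powr (8 * real K * D)" by (simp add: powr_add[symmetric] algebra_simps)
    finally have "2 ^ Q * 2 ^ (K * (g * g)) \<le> (8 * real n powr (4 * e)) * (2 powr (2 * real K) * 2 powr (8 * real K * D))"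
      using Q2 by (intro mult_mono) auto
    then have "real F \<le> real n * ((8 * real n powr (4 * e)) * (2 powr (2 * real K) * 2 powr (8 * real K * D)))"
      unfolding F by (intro mult_left_mono) auto
    then have "real R * real F \<le> (3072 * 2 powr (4 * D) * L) * (real n * ((8 * real n powr (4 * e)) * (2 powr (2 * real K) * 2 powr (8 * real K * D))))"
      using R L by (intro mult_mono) auto
    also have "\<dots> = 24576 * 2 powr (2 * real K) * ((real n * real n powr (4 * e)) * (2 powr (4 * D) * 2 powr (8 * real K * D)) * L)"
      by (simp add: mult_ac)
    also have "\<dots> \<le> 24576 * 2 powr (2 * real K) * W"
    proof (intro mult_left_mono mono)
      have "real n * real n powr (4 * e) = real n powr (1 + 4 * e)" using n1 by (simp add: powr_add)
      also have "\<dots> \<le> P1" unfolding P1_def using n1 e by (intro powr_mono) auto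
      finally show "real n * real n powr (4 * e) \<le> P1" .
      show "2 powr (4 * D) * 2 powr (8 * real K * D) \<le> P2" by (simp add: P2_def powr_add[symmetric] algebra_simps)
    qed (use L LL in auto)
    finally show ?thesis .
  qed
  have c9: "real ((R + 1) * (F + n + 1)) \<le> 147456 * 2 powr (2 * real K) * W"
  proof -
    have "(R + 1) * (F + n + 1) \<le> (2 * R) * (3 * F)" using R_bounds(1) Fn by (intro mult_le_mono) auto
    then have "real ((R + 1) * (F + n + 1)) \<le> real ((2 * R) * (3 * F))" by (simp only: of_nat_le_iff)
    also have "\<dots> = 6 * (real R * real F)" by simp
    finally show ?thesis using c8 by simp
  qed
  have co: "cost_of K inp = 2 ^ l + (l + 1)\<^sup>2 + g + (y + 1)\<^sup>2 + (Q + 1)\<^sup>2 + slack K inp + n * (l + 1) + (R + 1) * (F + n + 1)"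
    by (simp add: cost_of_def parameter_cost_def l_def g_def y_def A_def Q_def R_def F_def beta_units_def b_def)
  have "real (1 + cost_of K inp + n) = 1 + (2 ^ l + (real l + 1)\<^sup>2 + real g + (real y + 1)\<^sup>2 + (real Q + 1)\<^sup>2 +
      real (slack K inp) + real n * (real l + 1) + real ((R + 1) * (F + n + 1))) + real n"
    unfolding co by (simp add: algebra_simps)
  also have "\<dots> \<le> W + (2 * W + 9 * W + 8 * W + 36 * W + 64 * W + 8 * real K * W + 3 * W + 147456 * 2 powr (2 * real K) * W) + W"
    by (intro add_mono c1 c2 c3 c4 c5 c6 c7 c9 t1 tn)
  also have "\<dots> = (124 + 8 * real K + 147456 * 2 powr (2 * real K)) * W" by (simp add: algebra_simps)
  finally show ?thesis by (simp add: W_def P1_def P2_def D_def L_def e_def)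
qed

end

section \<open>Failure probability and the final statement\<close>

section \<open>The algorithm succeeds with high probability\<close>

text \<open>Sample size and fuel depend on the sample only through its length. They are thus
  constants in the probability estimates, and the time bound is a function of the parameters
  alone.\<close>

lemma parameters_cong:
  assumes "length ps = length ps'"
  shows "used_samples (problem_input \<alpha> \<beta> n ps) = used_samples (problem_input \<alpha> \<beta> n ps')"
    "fuel_of K (problem_input \<alpha> \<beta> n ps) = fuel_of K (problem_input \<alpha> \<beta> n ps')"
    "cost_of K (problem_input \<alpha> \<beta> n ps) = cost_of K (problem_input \<alpha> \<beta> n ps')"
  by (simp_all add: cost_of_def parameter_cost_def fuel_of_def quality_def slack_def used_samples_def beta_units_def
      alpha_up_def beta_scale_def beta_word_def log_size_def num_elements_def beta_index_def problem_input_def assms)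

context mallows_input
begin

lemma fuel_eq: "fuel_of K inp = n * 2 ^ (Q + K * (g * g))"
  by (simp add: fuel_of_def Q_def slack_def g_def)

lemma ranked:
  assumes "\<forall>p \<in> set ps. p permutes {..<n}"
  shows "ranked_input inp n R (take R ps)"
proof
  show "inp Ranking k x = (take R ps ! k) x" if "k < R" "x < n" for k x
    using that R_bounds(2) by (simp add: inp_def problem_input_def r_def)
qed (use R_bounds assms in \<open>auto simp: r_def dest: in_set_takeD\<close>)

lemma correct_output:
  assumes perms: "\<forall>p \<in> set ps. p permutes {..<n}"
    and fuel: "\<not> ranked_input.shortage inp n R (fuel_of K inp)"
    and maj: "R = r \<or> majority n c (take R ps) \<and> majority n c ps" and c: "c permutes {..<n}"
    and cells: "\<And>a. 2 \<le> a \<Longrightarrow> a < n \<Longrightarrow> M a = algorithm K inp ! (n + 7 - a)"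
      "M 0 = algorithm K inp ! (n + 6)" "M 1 = algorithm K inp ! (n + 7)"
  shows "is_max_prob_order n \<beta> ps (output_order n (pc, M))"
proof -
  interpret ranked_input inp n R "take R ps" by (rule ranked[OF perms])
  define \<sigma> where "\<sigma> = solve inp R (fuel_of K inp) (sorted_elements inp R)"
  define m where "m = output_order n (pc, M)"
  have fuel': "(\<Sum>j<n. level_fuel j) < fuel_of K inp" using fuel by (simp add: shortage_def not_le)
  have o: "order_list n \<sigma>" unfolding \<sigma>_def by (rule solve_order[OF fuel'])
  have alg: "algorithm K inp = output_cells n (positions \<sigma>)" by (simp add: algorithm_def \<sigma>_def R_def Let_def)
  have m_pos: "m a = positions \<sigma> ! a" if "a < n" for a
  proof -
    note oc = output_cells_nth[OF positions_nth(1)[OF o] n]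
    consider "a = 0" | "a = 1" | "2 \<le> a" by linarith
    then show ?thesis
      using that oc cells unfolding m_def output_order_def alg by cases auto
  qed
  have \<sigma>_less: "\<sigma> ! k < n" if "k < n" for k
    using that o length_order_list[OF o] nth_mem[of k \<sigma>] by (auto simp: order_list_def)
  have m\<sigma>: "m (\<sigma> ! k) = k" if "k < n" for k
    using m_pos[OF \<sigma>_less[OF that]] positions_nth(2)[OF o that] by simp
  have img: "m ` {..<n} = {..<n}"
  proof -
    have "{..<n} \<subseteq> m ` {..<n}"
    proof
      fix k assume "k \<in> {..<n}"
      then show "k \<in> m ` {..<n}" using m\<sigma>[of k] \<sigma>_less[of k] by (intro image_eqI[of _ _ "\<sigma> ! k"]) auto
    qed
    moreover have "card (m ` {..<n}) \<le> n" using card_image_le[of "{..<n}" m] by simp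
    ultimately show ?thesis by (metis card_lessThan card_seteq finite_imageI finite_lessThan)
  qed
  have mp: "m permutes {..<n}"
  proof (rule bij_imp_permutes)
    show "bij_betw m {..<n} {..<n}"
      unfolding bij_betw_def using img by (auto intro: eq_card_imp_inj_on)
  qed (simp add: m_def output_order_def)
  have opt: "(\<Sum>p\<leftarrow>take R ps. kemeny_dist n p m) \<le> (\<Sum>p\<leftarrow>take R ps. kemeny_dist n p q)" if "q permutes {..<n}" for q
    using solve_correct[OF fuel' mp _ that] m\<sigma> by (simp add: \<sigma>_def)
  have "(\<Sum>p\<leftarrow>ps. kemeny_dist n p m) \<le> (\<Sum>p\<leftarrow>ps. kemeny_dist n p q)" if q: "q permutes {..<n}" for q
    using maj
  proof
    assume "R = r"
    then show ?thesis using opt[OF q] by (simp add: r_def)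
  next
    assume mj: "majority n c (take R ps) \<and> majority n c ps"
    have "m = c" using majority_unique[OF c mp conjunct1[OF mj]] opt[OF c] by fastforce
    then show ?thesis using majority_unique[OF c q conjunct2[OF mj]] by (cases "q = c") auto
  qed
  then show ?thesis unfolding m_def[symmetric] using is_max_prob_order_iff[OF \<beta>] perms mp by blast
qed

end

text \<open>At most three events can cause a failure, each of probability at most n^-\<alpha> / 4;
  the missing quarter makes the inequality strict.\<close>

lemma failure_prob:
  fixes \<alpha> \<beta> :: real and n r :: nat
  defines "I \<equiv> \<lambda>ps. problem_input \<alpha> \<beta> n ps" and "\<nu> \<equiv> \<lambda>c. replicate_pmf r (mallows n \<beta> c)"
  assumes "0 < \<alpha>" "0 < \<beta>" "2 \<le> n" "1 \<le> r" and c: "c permutes {..<n}"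
    and good: "\<And>ps. length ps = r \<Longrightarrow> \<forall>p \<in> set ps. p permutes {..<n} \<Longrightarrow>
      \<not> ranked_input.shortage (I ps) n (used_samples (I ps)) (fuel_of 4200000 (I ps)) \<Longrightarrow>
      used_samples (I ps) = r \<or> majority n c (take (used_samples (I ps)) ps) \<and> majority n c ps \<Longrightarrow> G ps"
  shows "measure_pmf.prob (\<nu> c) {ps. \<not> G ps} < real n powr - \<alpha>"
proof -
  interpret p: mallows_input \<alpha> \<beta> n "replicate r id" by standard (use assms in auto)
  define R Q g where "R = p.R" and "Q = p.Q" and "g = p.g"
  have pr: "p.r = r" by (simp add: p.r_def)
  let ?\<nu> = "replicate_pmf r (mallows n \<beta> c)"
  have supp: "length ps = r \<and> (\<forall>p \<in> set ps. p permutes {..<n})" if "ps \<in> set_pmf ?\<nu>" for ps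
    using that set_mallows by (auto simp: set_replicate_pmf)
  have par: "used_samples (I ps) = R" "fuel_of 4200000 (I ps) = n * 2 ^ (Q + 4200000 * (g * g))" if "length ps = r" for ps
    using parameters_cong(1,2)[where ps = ps and ps' = "replicate r id" and \<alpha> = \<alpha> and \<beta> = \<beta> and n = n] that p.fuel_eq[of 4200000]
    by (simp_all add: I_def R_def Q_def g_def p.R_def p.inp_def)
  have Rr: "0 < R" "R \<le> r" using p.R_bounds by (simp_all add: R_def pr)
  have rnk: "ranked_input (I ps) n R (take R ps)" if ps: "ps \<in> set_pmf ?\<nu>" for ps
  proof -
    have l: "length ps = r" using supp[OF ps] by simp
    interpret m: mallows_input \<alpha> \<beta> n ps by standard (use assms l in auto)
    have "m.R = R" "m.inp = I ps" using par(1)[OF l] by (simp_all add: m.R_def m.inp_def I_def)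
    then show ?thesis using m.ranked supp[OF ps] by simp
  qed
  define S where "S = {ps. ranked_input.shortage (I ps) n R (n * 2 ^ (Q + 4200000 * (g * g)))}"
  have S: "measure_pmf.prob ?\<nu> S \<le> real n powr - \<alpha> / 4"
    unfolding S_def g_def Q_def
    by (rule shortage_prob[OF \<open>0 < \<beta>\<close> c Rr _ p.beta_bounds(2,1,4) p.quality_enough[folded R_def] rnk]) (use assms in auto)
  have pos: "0 < real n powr - \<alpha>" using assms by simp
  have sub: "measure_pmf.prob ?\<nu> {ps. \<not> G ps} \<le> measure_pmf.prob ?\<nu> X" if "{ps. \<not> G ps} \<inter> set_pmf ?\<nu> \<subseteq> X" for X
    using measure_pmf.finite_measure_mono[OF that, of ?\<nu>] by (simp add: measure_Int_set_pmf)
  have "measure_pmf.prob ?\<nu> {ps. \<not> G ps} < real n powr - \<alpha>"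
  proof (cases "R = r")
    case True
    have "{ps. \<not> G ps} \<inter> set_pmf ?\<nu> \<subseteq> S"
    proof
      fix ps assume "ps \<in> {ps. \<not> G ps} \<inter> set_pmf ?\<nu>"
      then show "ps \<in> S" using good[of ps] supp[of ps] par[of ps] True by (auto simp: S_def)
    qed
    from sub[OF this] show ?thesis using S pos by linarith
  next
    case False
    then have lt: "R < r" using Rr by simp
    define B where "B k = {ps. \<not> majority n c (take k ps)}" for k
    have ch: "0 \<le> 1 / cosh (\<beta> / 2)" "1 / cosh (\<beta> / 2) \<le> 1" using cosh_real_ge_1[of "\<beta> / 2"] by (auto simp: divide_le_eq)
    have B1: "measure_pmf.prob ?\<nu> (B R) \<le> real n powr - \<alpha> / 4"
      unfolding B_def using majority_prob[OF \<open>0 < \<beta>\<close> c Rr(2)] p.majority_enough[unfolded pr, folded R_def, OF lt] by simp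
    have "real n ^ 2 * (1 / cosh (\<beta> / 2)) ^ r \<le> real n ^ 2 * (1 / cosh (\<beta> / 2)) ^ R"
      using ch lt by (intro mult_left_mono power_decreasing) auto
    then have B2: "measure_pmf.prob ?\<nu> (B r) \<le> real n powr - \<alpha> / 4"
      unfolding B_def using majority_prob[OF \<open>0 < \<beta>\<close> c order_refl, of r] p.majority_enough[unfolded pr, folded R_def, OF lt] by simp
    have "{ps. \<not> G ps} \<inter> set_pmf ?\<nu> \<subseteq> S \<union> (B R \<union> B r)"
    proof
      fix ps assume "ps \<in> {ps. \<not> G ps} \<inter> set_pmf ?\<nu>"
      then show "ps \<in> S \<union> (B R \<union> B r)" using good[of ps] supp[of ps] par[of ps] by (auto simp: S_def B_def)
    qed
    from sub[OF this] have "measure_pmf.prob ?\<nu> {ps. \<not> G ps} \<le> measure_pmf.prob ?\<nu> (S \<union> (B R \<union> B r))" .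
    also have "\<dots> \<le> measure_pmf.prob ?\<nu> S + measure_pmf.prob ?\<nu> (B R \<union> B r)"
      by (rule measure_Un_le) auto
    also have "measure_pmf.prob ?\<nu> (B R \<union> B r) \<le> measure_pmf.prob ?\<nu> (B R) + measure_pmf.prob ?\<nu> (B r)"
      by (rule measure_Un_le) auto
    finally show ?thesis using S B1 B2 pos by linarith
  qed
  then show ?thesis by (simp add: \<nu>_def)
qed

lemma log_square_le:
  assumes "0 < \<epsilon>" "1 \<le> n"
  shows "(log 2 (real n))\<^sup>2 \<le> (4 / (\<epsilon> * ln 2))\<^sup>2 * real n powr (\<epsilon> / 2)"
proof -
  have "ln (real n) \<le> real n powr (\<epsilon> / 4) / (\<epsilon> / 4)" by (rule ln_powr_bound) (use assms in auto)
  then have "ln (real n) / ln 2 \<le> (real n powr (\<epsilon> / 4) / (\<epsilon> / 4)) / ln 2" by (rule divide_right_mono) simp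
  then have "log 2 (real n) \<le> 4 / (\<epsilon> * ln 2) * real n powr (\<epsilon> / 4)" by (simp add: log_def mult_ac)
  then have "(log 2 (real n))\<^sup>2 \<le> (4 / (\<epsilon> * ln 2) * real n powr (\<epsilon> / 4))\<^sup>2" using assms by (intro power_mono) auto
  also have "\<dots> = (4 / (\<epsilon> * ln 2))\<^sup>2 * real n powr (\<epsilon> / 2)"
    by (simp only: power_mult_distrib power2_eq_square[of "real n powr _"] powr_add[symmetric]) simp
  finally show ?thesis .
qed

theorem theorem1:
  shows "\<exists>(P :: program) (T :: real \<Rightarrow> real \<Rightarrow> nat \<Rightarrow> nat \<Rightarrow> nat).
    (\<forall>\<alpha> > 0. \<forall>\<beta> > 0. \<forall>r \<ge> 1. \<forall>n \<ge> 2.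
       (\<forall>ps. length ps = r \<and> (\<forall>p \<in> set ps. p permutes {..<n}) \<longrightarrow>
          halts_within P (problem_input \<alpha> \<beta> n ps) (T \<alpha> \<beta> r n)) \<and>
       (\<forall>center. center permutes {..<n} \<longrightarrow>
          error_prob P \<alpha> \<beta> n r center (T \<alpha> \<beta> r n) < real n powr (- \<alpha>))) \<and>
    (\<exists>C > 0. \<exists>C1 > 0. \<exists>C2 > 0. \<forall>\<alpha> > 0. \<forall>\<beta> > 0. \<forall>r \<ge> 1. \<forall>n \<ge> 2.
       real (T \<alpha> \<beta> r n) \<le> C * real n powr (1 + C1 * (\<alpha> / (\<beta> * real r)))
         * 2 powr (C2 * (\<alpha> / \<beta> + 1 / \<beta>\<^sup>2)) * (log 2 (real n))\<^sup>2) \<and>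
    (\<forall>\<alpha> > 0. \<forall>\<beta> > 0. \<forall>\<epsilon> > 0. \<exists>R. \<forall>r \<ge> R.
       (\<lambda>n. real (T \<alpha> \<beta> r n)) \<in> O(\<lambda>n. real n powr (1 + \<epsilon>)))"
proof -
  \<comment> \<open>The slack constant of \<open>shortage_prob\<close>.\<close>
  define K :: nat where "K = 4200000"
  have len: "length (algorithm K i) = i Num_Elements 0 0 + 8" for i
    by (simp add: algorithm_def Let_def length_output_cells num_elements_def)
  obtain P KK where P: "\<And>i. valid_input i \<Longrightarrow> \<exists>t M. t \<le> KK * (1 + cost_of K i + i Num_Elements 0 0) \<and>
      (\<forall>s\<ge>t. run P i s = return_pmf (length P, M)) \<and>
      (\<forall>a. 2 \<le> a \<longrightarrow> a < i Num_Elements 0 0 + 8 \<longrightarrow> M a = algorithm K i ! (i Num_Elements 0 0 + 7 - a)) \<and>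
      M 0 = algorithm K i ! (i Num_Elements 0 0 + 6) \<and> M 1 = algorithm K i ! (i Num_Elements 0 0 + 7)"
    by (rule program_of_tm[OF tm_algorithm[of K] len]) blast
  \<comment> \<open>All samples of length \<open>r\<close> give the same cost, so identity rankings
    can stand in for them.\<close>
  define T where "T \<alpha> \<beta> r n = KK * (1 + cost_of K (problem_input \<alpha> \<beta> n (replicate r id)) + n)" for \<alpha> \<beta> r n
  have run: "\<exists>M. run P (problem_input \<alpha> \<beta> n ps) (T \<alpha> \<beta> (length ps) n) = return_pmf (length P, M) \<and>
      (\<forall>a. 2 \<le> a \<longrightarrow> a < n \<longrightarrow> M a = algorithm K (problem_input \<alpha> \<beta> n ps) ! (n + 7 - a)) \<and>
      M 0 = algorithm K (problem_input \<alpha> \<beta> n ps) ! (n + 6) \<and> M 1 = algorithm K (problem_input \<alpha> \<beta> n ps) ! (n + 7)"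
    if "0 < \<alpha>" "0 < \<beta>" "2 \<le> n" "ps \<noteq> []" for \<alpha> \<beta> n ps
  proof -
    interpret mallows_input \<alpha> \<beta> n ps by standard (use that in auto)
    have "cost_of K inp = cost_of K (problem_input \<alpha> \<beta> n (replicate (length ps) id))"
      unfolding inp_def by (rule parameters_cong(3)) simp
    then have T: "T \<alpha> \<beta> (length ps) n = KK * (1 + cost_of K inp + n)" by (simp only: T_def)
    obtain t M where t: "t \<le> KK * (1 + cost_of K inp + n)" "\<forall>s\<ge>t. run P inp s = return_pmf (length P, M)"
      and M: "\<forall>a. 2 \<le> a \<longrightarrow> a < n + 8 \<longrightarrow> M a = algorithm K inp ! (n + 7 - a)"
        "M 0 = algorithm K inp ! (n + 6)" "M 1 = algorithm K inp ! (n + 7)"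
      using P[OF valid] unfolding inp_simps by blast
    have "run P inp (T \<alpha> \<beta> (length ps) n) = return_pmf (length P, M)" unfolding T using t by blast
    moreover have "\<forall>a. 2 \<le> a \<longrightarrow> a < n \<longrightarrow> M a = algorithm K inp ! (n + 7 - a)"
    proof (intro allI impI)
      fix a assume "2 \<le> a" "a < n"
      then show "M a = algorithm K inp ! (n + 7 - a)" using M(1)[rule_format, of a] by linarith
    qed
    ultimately show ?thesis using M(2,3) unfolding inp_def by (intro exI[of _ M] conjI)
  qed
  have halts: "halts_within P (problem_input \<alpha> \<beta> n ps) (T \<alpha> \<beta> r n)"
    if "0 < \<alpha>" "0 < \<beta>" "1 \<le> r" "2 \<le> n" "length ps = r" for \<alpha> \<beta> r n ps
  proof -
    have "ps \<noteq> []" using that by auto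
    from run[OF that(1,2,4) this] that(5) show ?thesis unfolding halts_within_def by (auto simp: halted_def)
  qed
  have error: "error_prob P \<alpha> \<beta> n r center (T \<alpha> \<beta> r n) < real n powr (- \<alpha>)"
    if h: "0 < \<alpha>" "0 < \<beta>" "1 \<le> r" "2 \<le> n" "center permutes {..<n}" for \<alpha> \<beta> r n center
  proof -
    \<comment> \<open>Each run is a point mass, so the joint law of sample and final configuration
      is an image of the law of the sample, and the error probability concerns the sample
      only.\<close>
    define cfg where "cfg ps = (SOME z. run P (problem_input \<alpha> \<beta> n ps) (T \<alpha> \<beta> r n) = return_pmf z)" for ps
    let ?\<nu> = "replicate_pmf r (mallows n \<beta> center)"
    define G where "G ps \<longleftrightarrow> halted P (cfg ps) \<and> is_max_prob_order n \<beta> ps (output_order n (cfg ps))" for ps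
    have cfg: "run P (problem_input \<alpha> \<beta> n ps) (T \<alpha> \<beta> r n) = return_pmf z \<Longrightarrow> cfg ps = z" for ps z
      unfolding cfg_def by (rule some_equality) auto
    have "do {ps \<leftarrow> ?\<nu>; c \<leftarrow> run P (problem_input \<alpha> \<beta> n ps) (T \<alpha> \<beta> r n); return_pmf (ps, c)} =
        do {ps \<leftarrow> ?\<nu>; return_pmf (ps, cfg ps)}"
    proof (rule bind_pmf_cong[OF refl])
      fix ps assume "ps \<in> set_pmf ?\<nu>"
      then have l: "length ps = r" by (simp add: set_replicate_pmf)
      then have "ps \<noteq> []" using h(3) by auto
      from run[OF h(1,2,4) this] obtain z where "run P (problem_input \<alpha> \<beta> n ps) (T \<alpha> \<beta> r n) = return_pmf z"
        unfolding l by blast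
      with cfg[OF this] show "do {c \<leftarrow> run P (problem_input \<alpha> \<beta> n ps) (T \<alpha> \<beta> r n); return_pmf (ps, c)} = return_pmf (ps, cfg ps)"
        by (simp add: bind_return_pmf)
    qed
    also have "\<dots> = map_pmf (\<lambda>ps. (ps, cfg ps)) ?\<nu>" by (simp add: map_pmf_def)
    finally have "error_prob P \<alpha> \<beta> n r center (T \<alpha> \<beta> r n) = measure_pmf.prob ?\<nu> {ps. \<not> G ps}"
      by (simp add: error_prob_def G_def vimage_def)
    also have "\<dots> < real n powr (- \<alpha>)"
    proof (rule failure_prob[OF h(1,2,4,3,5)])
      fix ps
      let ?i = "problem_input \<alpha> \<beta> n ps"
      assume ps: "length ps = r" "\<forall>p \<in> set ps. p permutes {..<n}"
        and fuel: "\<not> ranked_input.shortage ?i n (used_samples ?i) (fuel_of 4200000 ?i)"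
        and maj: "used_samples ?i = r \<or> majority n center (take (used_samples ?i) ps) \<and> majority n center ps"
      have ne: "ps \<noteq> []" using ps h(3) by auto
      interpret m: mallows_input \<alpha> \<beta> n ps by standard (use h ne in auto)
      from run[OF h(1,2,4) ne] obtain M where M: "run P ?i (T \<alpha> \<beta> r n) = return_pmf (length P, M)"
        "\<And>a. 2 \<le> a \<Longrightarrow> a < n \<Longrightarrow> M a = algorithm K m.inp ! (n + 7 - a)"
        "M 0 = algorithm K m.inp ! (n + 6)" "M 1 = algorithm K m.inp ! (n + 7)"
        unfolding ps(1) m.inp_def by blast
      have "is_max_prob_order n \<beta> ps (output_order n (length P, M))"
        by (rule m.correct_output[OF ps(2) _ _ h(5) M(2-4)])
           (use fuel maj ps(1) in \<open>simp_all add: m.inp_def m.R_def m.r_def K_def\<close>)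
      then show "G ps" unfolding G_def cfg[OF M(1)] by (simp add: halted_def)
    qed
    finally show ?thesis .
  qed
  define C where "C = (real KK + 1) * (124 + 8 * real K + 147456 * 2 powr (2 * real K))"
  have "0 < real KK + 1" by linarith
  moreover have "0 < 124 + 8 * real K + 147456 * 2 powr (2 * real K)" by (intro add_pos_nonneg) auto
  ultimately have C: "0 < C" unfolding C_def by (rule mult_pos_pos)
  have time: "real (T \<alpha> \<beta> r n) \<le> C * real n powr (1 + 8 * (\<alpha> / (\<beta> * real r)))
         * 2 powr ((8 * real K + 4) * (\<alpha> / \<beta> + 1 / \<beta>\<^sup>2)) * (log 2 (real n))\<^sup>2"
    if h: "0 < \<alpha>" "0 < \<beta>" "1 \<le> r" "2 \<le> n" for \<alpha> \<beta> r n
  proof -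
    interpret p: mallows_input \<alpha> \<beta> n "replicate r id" by standard (use h in auto)
    have "real (T \<alpha> \<beta> r n) = real KK * real (1 + cost_of K p.inp + n)" unfolding T_def p.inp_def by (rule of_nat_mult)
    also have "\<dots> \<le> (real KK + 1) * real (1 + cost_of K p.inp + n)" by (intro mult_right_mono) auto
    also have "\<dots> \<le> (real KK + 1) * ((124 + 8 * real K + 147456 * 2 powr (2 * real K)) *
        (real n powr (1 + 8 * (\<alpha> / (\<beta> * real r))) * 2 powr ((8 * real K + 4) * (\<alpha> / \<beta> + 1 / \<beta>\<^sup>2)) * (log 2 n)\<^sup>2))"
      using p.cost_bound[of K] unfolding p.r_def length_replicate by (intro mult_left_mono) auto
    finally show ?thesis by (simp only: C_def mult_ac)
  qed
  have almost_linear: "\<exists>R. \<forall>r \<ge> R. (\<lambda>n. real (T \<alpha> \<beta> r n)) \<in> O(\<lambda>n. real n powr (1 + \<epsilon>))"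
    if h: "0 < \<alpha>" "0 < \<beta>" "0 < \<epsilon>" for \<alpha> \<beta> \<epsilon>
  proof -
    \<comment> \<open>From this threshold on \<open>8 * (\<alpha> / (\<beta> * real r))\<close> is
      at most \<epsilon> / 2; the other half of \<epsilon> absorbs the squared logarithm.\<close>
    define R where "R = Suc (nat \<lceil>16 * \<alpha> / (\<beta> * \<epsilon>)\<rceil>)"
    define B where "B = C * 2 powr ((8 * real K + 4) * (\<alpha> / \<beta> + 1 / \<beta>\<^sup>2)) * (4 / (\<epsilon> * ln 2))\<^sup>2"
    have "(\<lambda>n. real (T \<alpha> \<beta> r n)) \<in> O(\<lambda>n. real n powr (1 + \<epsilon>))" if r: "R \<le> r" for r
    proof (rule bigoI)
      have r1: "1 \<le> r" using r by (simp add: R_def)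
      have "16 * \<alpha> / (\<beta> * \<epsilon>) \<le> real r" using real_nat_ceiling_ge[of "16 * \<alpha> / (\<beta> * \<epsilon>)"] r unfolding R_def by linarith
      then have ex: "8 * (\<alpha> / (\<beta> * real r)) \<le> \<epsilon> / 2" using h r1 by (simp add: field_simps)
      show "eventually (\<lambda>n. norm (real (T \<alpha> \<beta> r n)) \<le> B * norm (real n powr (1 + \<epsilon>))) at_top"
        using eventually_ge_at_top[of 2]
      proof eventually_elim
        case (elim n)
        let ?p = "2 powr ((8 * real K + 4) * (\<alpha> / \<beta> + 1 / \<beta>\<^sup>2))"
        have "real (T \<alpha> \<beta> r n) \<le> C * real n powr (1 + 8 * (\<alpha> / (\<beta> * real r))) * ?p * (log 2 (real n))\<^sup>2"
          by (rule time[OF h(1,2) r1 elim])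
        also have "\<dots> \<le> C * real n powr (1 + \<epsilon> / 2) * ?p * ((4 / (\<epsilon> * ln 2))\<^sup>2 * real n powr (\<epsilon> / 2))"
          using C ex elim h log_square_le[OF h(3), of n] by (intro mult_mono powr_mono) auto
        also have "\<dots> = B * (real n powr (1 + \<epsilon> / 2) * real n powr (\<epsilon> / 2))" by (simp only: B_def mult_ac)
        also have "real n powr (1 + \<epsilon> / 2) * real n powr (\<epsilon> / 2) = real n powr (1 + \<epsilon>)"
          by (simp add: powr_add[symmetric] add.commute)
        finally show ?case by simp
      qed
    qed
    then show ?thesis by blast
  qed
  show ?thesis
  proof (rule exI[of _ P], rule exI[of _ T], intro conjI)
    show "\<forall>\<alpha> > 0. \<forall>\<beta> > 0. \<forall>r \<ge> 1. \<forall>n \<ge> 2.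
       (\<forall>ps. length ps = r \<and> (\<forall>p \<in> set ps. p permutes {..<n}) \<longrightarrow>
          halts_within P (problem_input \<alpha> \<beta> n ps) (T \<alpha> \<beta> r n)) \<and>
       (\<forall>center. center permutes {..<n} \<longrightarrow>
          error_prob P \<alpha> \<beta> n r center (T \<alpha> \<beta> r n) < real n powr (- \<alpha>))"
      by (intro allI impI conjI; (elim conjE)?; (rule halts error; assumption))
    have "0 < 8 * real K + 4" by linarith
    moreover have "\<forall>\<alpha> > 0. \<forall>\<beta> > 0. \<forall>r \<ge> 1. \<forall>n \<ge> 2.
       real (T \<alpha> \<beta> r n) \<le> C * real n powr (1 + 8 * (\<alpha> / (\<beta> * real r)))
         * 2 powr ((8 * real K + 4) * (\<alpha> / \<beta> + 1 / \<beta>\<^sup>2)) * (log 2 (real n))\<^sup>2"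
      by (intro allI impI; rule time; assumption)
    ultimately show "\<exists>C > 0. \<exists>C1 > 0. \<exists>C2 > 0. \<forall>\<alpha> > 0. \<forall>\<beta> > 0. \<forall>r \<ge> 1. \<forall>n \<ge> 2.
       real (T \<alpha> \<beta> r n) \<le> C * real n powr (1 + C1 * (\<alpha> / (\<beta> * real r)))
         * 2 powr (C2 * (\<alpha> / \<beta> + 1 / \<beta>\<^sup>2)) * (log 2 (real n))\<^sup>2"
      by - (rule exI[of _ C], rule conjI[OF C], rule exI[of _ 8], rule conjI[OF zero_less_numeral],
          rule exI[of _ "8 * real K + 4"], rule conjI)
    show "\<forall>\<alpha> > 0. \<forall>\<beta> > 0. \<forall>\<epsilon> > 0. \<exists>R. \<forall>r \<ge> R.
       (\<lambda>n. real (T \<alpha> \<beta> r n)) \<in> O(\<lambda>n. real n powr (1 + \<epsilon>))"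
      by (intro allI impI; rule almost_linear; assumption)
  qed
qed

end
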